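(* Let $\Gamma$ be a basic finite-dimensional algebra over a field $\mathbb{K}$ with $\operatorname{domdim}\Gamma=d+1>0$ and maximal projective-injective summand $\Pi$, and let $1\leq k\leq d+1$. Let $T_k$ be the $k$-shifted module of $\Gamma$ and $B_k=\operatorname{End}_\Gamma(T_k)^{\mathrm{op}}$. Write $I_k=D\operatorname{Hom}_\Gamma(\Pi,T_k)$. Then $I_k$ is an injective summand of the $B_k$-module $DT_k$, and the tilting subcategories associated to $T_k$ are $$\mathcal{T}_j(T_k)=\begin{cases}\operatorname{gen}_{k-1}(\Pi),&j=0,\\ \ker\operatorname{Hom}_\Gamma(\Pi,-),&j=k,\\ \{0\},&\text{otherwise},\end{cases}\qquad \mathcal{C}_j(DT_k)=\begin{cases}\operatorname{cogen}^{k-1}(I_k),&j=0,\\ \ker\operatorname{Hom}_{B_k}(-,I_k),&j=k,\\ \{0\},&\text{otherwise}.\end{cases}$$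
   Context: Modules are finitely generated left modules; morphisms are composed right-to-left; $D=\operatorname{Hom}_{\mathbb{K}}(-,\mathbb{K})$. $\operatorname{domdim}\Gamma\geq k$ if ${}_\Gamma\Gamma$ has an injective resolution whose first $k$ terms are projective-injective; $\operatorname{domdim}\Gamma=k$ if moreover not $\geq k+1$. A $\Gamma$-module $T$ is $k$-tilting if $\operatorname{pdim}T\leq k$, $\operatorname{Ext}^i_\Gamma(T,T)=0$ for $i>0$, and there is an exact sequence $0\to\Gamma\to t_0\to\cdots\to t_k\to0$ with all $t_j\in\operatorname{add}T$. It is $P$-special, for $P$ projective, if $P\in\operatorname{add}T$ and there is such a sequence with $t_j\in\operatorname{add}P$ for $0\leq j\leq k-1$. For $0\leq k\leq\operatorname{domdim}\Gamma$, the $k$-shifted module $T_k$ is the basic $\Pi$-special $k$-tilting module (unique up to isomorphism). For $j\geq0$: $\mathcal{T}_j(T)=\bigcap_{i\geq0,\,i\neq j}\ker\operatorname{Ext}^i_\Gamma(T,-)$ and, for $B=\operatorname{End}_\Gamma(T)^{\mathrm{op}}$, $\mathcal{C}_j(DT)=\bigcap_{i\geq0,\,i\neq j}\ker\operatorname{Ext}^i_B(-,DT)$, as full subcategories of the categories of $\Gamma$-modules and $B$-modules respectively ($\operatorname{Ext}^0=\operatorname{Hom}$). For a module $X$ and $m\geq0$, $\operatorname{gen}_m(X)$ is the full subcategory of modules $M$ admitting an exact sequence $X^m\to\cdots\to X^0\to M\to0$ with all $X^i\in\operatorname{add}X$ that stays exact under $\operatorname{Hom}(X,-)$. $\operatorname{cogen}^m(X)$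 is the full subcategory of modules $N$ admitting an exact sequence $0\to N\to X_0\to\cdots\to X_m$ with all $X_i\in\operatorname{add}X$ that stays exact under $\operatorname{Hom}(-,X)$. *)

theory Defs
  imports "HOL-Algebra.Module" "HOL-Algebra.AbelCoset" "HOL-Algebra.Elementary_Groups"
begin

section \<open>Algebras and left modules\<close>

text \<open>
  A \<open>K\<close>-algebra is a record of type \<open>('k, 'a) module\<close>: its ring part is the ring structure and its
  scalar multiplication is the \<open>K\<close>-action.  The locale \<open>algebra\<close> of the library covers only
  commutative algebras and its locale \<open>module\<close> only modules over commutative rings.
\<close>

locale left_module = R?: ring R + M?: abelian_group M
  for R :: "('r, 'z) ring_scheme" (structure) and M :: "('r, 'm) module" (structure) +
  assumes smult_closed:
      "\<lbrakk>a \<in> carrier R; x \<in> carrier M\<rbrakk> \<Longrightarrow> a \<odot>\<^bsub>M\<^esub> x \<in> carrier M"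
    and smult_l_distr:
      "\<lbrakk>a \<in> carrier R; b \<in> carrier R; x \<in> carrier M\<rbrakk> \<Longrightarrow>
        (a \<oplus>\<^bsub>R\<^esub> b) \<odot>\<^bsub>M\<^esub> x = a \<odot>\<^bsub>M\<^esub> x \<oplus>\<^bsub>M\<^esub> b \<odot>\<^bsub>M\<^esub> x"
    and smult_r_distr:
      "\<lbrakk>a \<in> carrier R; x \<in> carrier M; y \<in> carrier M\<rbrakk> \<Longrightarrow>
        a \<odot>\<^bsub>M\<^esub> (x \<oplus>\<^bsub>M\<^esub> y) = a \<odot>\<^bsub>M\<^esub> x \<oplus>\<^bsub>M\<^esub> a \<odot>\<^bsub>M\<^esub> y"
    and smult_assoc1:
      "\<lbrakk>a \<in> carrier R; b \<in> carrier R; x \<in> carrier M\<rbrakk> \<Longrightarrow>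
        (a \<otimes>\<^bsub>R\<^esub> b) \<odot>\<^bsub>M\<^esub> x = a \<odot>\<^bsub>M\<^esub> (b \<odot>\<^bsub>M\<^esub> x)"
    and smult_one:
      "x \<in> carrier M \<Longrightarrow> \<one>\<^bsub>R\<^esub> \<odot>\<^bsub>M\<^esub> x = x"

definition fin_gen :: "('r, 'z) ring_scheme \<Rightarrow> ('r, 'm) module \<Rightarrow> bool" where
  "fin_gen R M \<longleftrightarrow> (\<exists>S. finite S \<and> S \<subseteq> carrier M \<and>
     (\<forall>m\<in>carrier M. \<exists>a\<in>S \<rightarrow> carrier R. m = (\<Oplus>\<^bsub>M\<^esub>s\<in>S. a s \<odot>\<^bsub>M\<^esub> s)))"

definition fg_module :: "('r, 'z) ring_scheme \<Rightarrow> ('r, 'm) module \<Rightarrow> bool" where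
  "fg_module R M \<longleftrightarrow> left_module R M \<and> fin_gen R M"

definition fd_algebra :: "'k ring \<Rightarrow> ('k, 'a) module \<Rightarrow> bool" where
  "fd_algebra K A \<longleftrightarrow> field K \<and> ring A \<and> module K A \<and> fin_gen K A \<and>
     (\<forall>c\<in>carrier K. \<forall>x\<in>carrier A. \<forall>y\<in>carrier A.
        (c \<odot>\<^bsub>A\<^esub> x) \<otimes>\<^bsub>A\<^esub> y = c \<odot>\<^bsub>A\<^esub> (x \<otimes>\<^bsub>A\<^esub> y) \<and>
        x \<otimes>\<^bsub>A\<^esub> (c \<odot>\<^bsub>A\<^esub> y) = c \<odot>\<^bsub>A\<^esub> (x \<otimes>\<^bsub>A\<^esub> y))"

text \<open>
  A record of type \<open>('r, 'm) module\<close> also carries a multiplication and a unit on \<open>'m\<close>; these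
  are never looked at when the record is used as a module.
\<close>

definition regular :: "('r, 'z) ring_scheme \<Rightarrow> ('r, 'r) module" where
  "regular R = \<lparr>carrier = carrier R, monoid.mult = monoid.mult R, one = one R,
     ring.zero = ring.zero R, ring.add = ring.add R, smult = monoid.mult R\<rparr>"

definition opp :: "('k, 'a) module \<Rightarrow> ('k, 'a) module" where
  "opp A = A\<lparr>monoid.mult := (\<lambda>x y. y \<otimes>\<^bsub>A\<^esub> x)\<rparr>"

definition scalar_restriction :: "('k, 'a) module \<Rightarrow> ('a, 'm) module \<Rightarrow> ('k, 'm) module" where
  "scalar_restriction A M = \<lparr>carrier = carrier M, monoid.mult = monoid.mult M, one = one M,
     ring.zero = ring.zero M, ring.add = ring.add M, smult = (\<lambda>c m. (c \<odot>\<^bsub>A\<^esub> \<one>\<^bsub>A\<^esub>) \<odot>\<^bsub>M\<^esub> m)\<rparr>"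

definition zero_module :: "('r, 'm) module \<Rightarrow> bool" where
  "zero_module M \<longleftrightarrow> carrier M = {\<zero>\<^bsub>M\<^esub>}"


section \<open>Homomorphisms\<close>

text \<open>
  Homomorphisms are extensional functions, so that equality in the hom-sets is equality in HOL.
\<close>

definition lhom :: "('r, 'z) ring_scheme \<Rightarrow> ('r, 'm) module \<Rightarrow> ('r, 'n) module \<Rightarrow> ('m \<Rightarrow> 'n) set" where
  "lhom R M N = {f \<in> carrier M \<rightarrow>\<^sub>E carrier N.
     (\<forall>x\<in>carrier M. \<forall>y\<in>carrier M. f (x \<oplus>\<^bsub>M\<^esub> y) = f x \<oplus>\<^bsub>N\<^esub> f y) \<and>
     (\<forall>a\<in>carrier R. \<forall>x\<in>carrier M. f (a \<odot>\<^bsub>M\<^esub> x) = a \<odot>\<^bsub>N\<^esub> f x)}"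

definition isomorphic :: "('r, 'z) ring_scheme \<Rightarrow> ('r, 'm) module \<Rightarrow> ('r, 'n) module \<Rightarrow> bool" where
  "isomorphic R M N \<longleftrightarrow> (\<exists>f\<in>lhom R M N. bij_betw f (carrier M) (carrier N))"

definition Hom :: "('k, 'a) module \<Rightarrow> ('a, 'm) module \<Rightarrow> ('a, 'n) module \<Rightarrow> ('k, 'm \<Rightarrow> 'n) module" where
  "Hom A M N = \<lparr>carrier = lhom A M N, monoid.mult = undefined, one = undefined,
     ring.zero = (\<lambda>x\<in>carrier M. \<zero>\<^bsub>N\<^esub>),
     ring.add = (\<lambda>f g. \<lambda>x\<in>carrier M. f x \<oplus>\<^bsub>N\<^esub> g x),
     smult = (\<lambda>c f. \<lambda>x\<in>carrier M. (c \<odot>\<^bsub>A\<^esub> \<one>\<^bsub>A\<^esub>) \<odot>\<^bsub>N\<^esub> f x)\<rparr>"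

definition End :: "('k, 'a) module \<Rightarrow> ('a, 'm) module \<Rightarrow> ('k, 'm \<Rightarrow> 'm) module" where
  "End A M = (Hom A M M)\<lparr>monoid.mult := (\<lambda>f g. compose (carrier M) f g),
     one := (\<lambda>x\<in>carrier M. x)\<rparr>"

text \<open>
  \<open>T\<close> and \<open>Hom(P, T)\<close> as left \<open>End(T)\<close>-modules, i.e. as right modules over \<open>End(T)\<^sup>o\<^sup>p\<close>.
\<close>

definition End_module :: "('a, 't) module \<Rightarrow> ('t \<Rightarrow> 't, 't) module" where
  "End_module T = \<lparr>carrier = carrier T, monoid.mult = monoid.mult T, one = one T,
     ring.zero = ring.zero T, ring.add = ring.add T, smult = (\<lambda>b t. b t)\<rparr>"

definition Hom_End_module ::
  "('k, 'a) module \<Rightarrow> ('a, 'p) module \<Rightarrow> ('a, 't) module \<Rightarrow> ('t \<Rightarrow> 't, 'p \<Rightarrow> 't) module" where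
  "Hom_End_module A P T = \<lparr>carrier = lhom A P T, monoid.mult = undefined, one = undefined,
     ring.zero = ring.zero (Hom A P T), ring.add = ring.add (Hom A P T),
     smult = (\<lambda>b f. compose (carrier P) b f)\<rparr>"

text \<open>The dual of a left \<open>A\<close>-module; it is a left \<open>opp A\<close>-module.\<close>

definition dual :: "'k ring \<Rightarrow> ('k, 'a) module \<Rightarrow> ('a, 'm) module \<Rightarrow> ('a, 'm \<Rightarrow> 'k) module" where
  "dual K A M = \<lparr>carrier = lhom K (scalar_restriction A M) (regular K),
     monoid.mult = undefined, one = undefined,
     ring.zero = (\<lambda>x\<in>carrier M. \<zero>\<^bsub>K\<^esub>),
     ring.add = (\<lambda>f g. \<lambda>x\<in>carrier M. f x \<oplus>\<^bsub>K\<^esub> g x),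
     smult = (\<lambda>a f. \<lambda>x\<in>carrier M. f (a \<odot>\<^bsub>M\<^esub> x))\<rparr>"


section \<open>Direct sums and summands\<close>

text \<open>
  Auxiliary modules that are quantified inside a definition (complements, test modules, terms of
  resolutions) have the carrier type \<open>nat \<Rightarrow> 'k\<close>.  This is no restriction up to isomorphism: a
  finitely generated module over a finite-dimensional \<open>K\<close>-algebra has a finite \<open>K\<close>-dimension \<open>n\<close>
  and its structure can be transported to \<open>{..<n} \<rightarrow>\<^sub>E carrier K\<close>.
\<close>

definition biproduct :: "('r, 'm) module \<Rightarrow> ('r, 'n) module \<Rightarrow> ('r, 'm \<times> 'n) module" where
  "biproduct M N = \<lparr>carrier = carrier M \<times> carrier N, monoid.mult = undefined, one = undefined,
     ring.zero = (\<zero>\<^bsub>M\<^esub>, \<zero>\<^bsub>N\<^esub>),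
     ring.add = (\<lambda>x y. (fst x \<oplus>\<^bsub>M\<^esub> fst y, snd x \<oplus>\<^bsub>N\<^esub> snd y)),
     smult = (\<lambda>a x. (a \<odot>\<^bsub>M\<^esub> fst x, a \<odot>\<^bsub>N\<^esub> snd x))\<rparr>"

definition direct_sum :: "nat \<Rightarrow> (nat \<Rightarrow> ('r, 'm) module) \<Rightarrow> ('r, nat \<Rightarrow> 'm) module" where
  "direct_sum n X = \<lparr>carrier = (\<Pi>\<^sub>E i\<in>{..<n}. carrier (X i)),
     monoid.mult = undefined, one = undefined,
     ring.zero = (\<lambda>i\<in>{..<n}. \<zero>\<^bsub>X i\<^esub>),
     ring.add = (\<lambda>x y. \<lambda>i\<in>{..<n}. x i \<oplus>\<^bsub>X i\<^esub> y i),
     smult = (\<lambda>a x. \<lambda>i\<in>{..<n}. a \<odot>\<^bsub>X i\<^esub> x i)\<rparr>"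

definition summand :: "('k, 'a) module \<Rightarrow> ('a, 'm) module \<Rightarrow> ('a, 'n) module \<Rightarrow> bool" where
  "summand A X M \<longleftrightarrow> fg_module A X \<and> fg_module A M \<and>
     (\<exists>Y :: ('a, nat \<Rightarrow> 'k) module. fg_module A Y \<and> isomorphic A (biproduct X Y) M)"

definition in_add :: "('k, 'a) module \<Rightarrow> ('a, 'm) module \<Rightarrow> ('a, 'n) module \<Rightarrow> bool" where
  "in_add A X M \<longleftrightarrow> (\<exists>n. summand A M (direct_sum n (\<lambda>_. X)))"

definition indecomposable :: "('k, 'a) module \<Rightarrow> ('a, 'm) module \<Rightarrow> bool" where
  "indecomposable A M \<longleftrightarrow> fg_module A M \<and> \<not> zero_module M \<and>
     (\<forall>(Y :: ('a, nat \<Rightarrow> 'k) module) (Z :: ('a, nat \<Rightarrow> 'k) module).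
        fg_module A Y \<longrightarrow> fg_module A Z \<longrightarrow> isomorphic A (biproduct Y Z) M \<longrightarrow>
        zero_module Y \<or> zero_module Z)"

definition basic_module :: "('k, 'a) module \<Rightarrow> ('a, 'm) module \<Rightarrow> bool" where
  "basic_module A M \<longleftrightarrow> fg_module A M \<and>
     (\<exists>n (X :: nat \<Rightarrow> ('a, nat \<Rightarrow> 'k) module).
        (\<forall>i<n. indecomposable A (X i)) \<and>
        (\<forall>i<n. \<forall>j<n. i \<noteq> j \<longrightarrow> \<not> isomorphic A (X i) (X j)) \<and>
        isomorphic A (direct_sum n X) M)"

definition basic_algebra :: "('k, 'a) module \<Rightarrow> bool" where
  "basic_algebra A \<longleftrightarrow> basic_module A (regular A)"


section \<open>Projective and injective modules\<close>

definition projective :: "('k, 'a) module \<Rightarrow> ('a, 'm) module \<Rightarrow> bool" where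
  "projective A P \<longleftrightarrow> fg_module A P \<and>
     (\<forall>(M :: ('a, nat \<Rightarrow> 'k) module) (N :: ('a, nat \<Rightarrow> 'k) module). \<forall>g\<in>lhom A M N. \<forall>f\<in>lhom A P N.
        fg_module A M \<longrightarrow> fg_module A N \<longrightarrow> g ` carrier M = carrier N \<longrightarrow>
        (\<exists>h\<in>lhom A P M. compose (carrier P) g h = f))"

definition injective :: "('k, 'a) module \<Rightarrow> ('a, 'm) module \<Rightarrow> bool" where
  "injective A I \<longleftrightarrow> fg_module A I \<and>
     (\<forall>(M :: ('a, nat \<Rightarrow> 'k) module) (N :: ('a, nat \<Rightarrow> 'k) module). \<forall>g\<in>lhom A M N. \<forall>f\<in>lhom A M I.
        fg_module A M \<longrightarrow> fg_module A N \<longrightarrow> inj_on g (carrier M) \<longrightarrow>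
        (\<exists>h\<in>lhom A N I. compose (carrier M) h g = f))"

text \<open>\<open>Q\<close> is maximal, for the relation of being a summand, among the projective-injective summands.\<close>

definition maximal_proj_inj_summand :: "('k, 'a) module \<Rightarrow> ('a, 'm) module \<Rightarrow> bool" where
  "maximal_proj_inj_summand A Q \<longleftrightarrow>
     summand A Q (regular A) \<and> projective A Q \<and> injective A Q \<and>
     (\<forall>Q' :: ('a, nat \<Rightarrow> 'k) module.
        summand A Q' (regular A) \<longrightarrow> projective A Q' \<longrightarrow> injective A Q' \<longrightarrow>
        summand A Q Q' \<longrightarrow> isomorphic A Q Q')"


section \<open>Exact sequences and resolutions\<close>

text \<open>
  \<open>exact_to m C d e M\<close>: the sequence \<open>C m \<rightarrow> \<dots> \<rightarrow> C 0 \<rightarrow> M \<rightarrow> 0\<close> with the maps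
  \<open>d i : C (i + 1) \<rightarrow> C i\<close> and \<open>e : C 0 \<rightarrow> M\<close> is exact (except at \<open>C m\<close>).
  \<open>exact_from m M e C d\<close>: the sequence \<open>0 \<rightarrow> M \<rightarrow> C 0 \<rightarrow> \<dots> \<rightarrow> C m\<close> with the maps
  \<open>e : M \<rightarrow> C 0\<close> and \<open>d i : C i \<rightarrow> C (i + 1)\<close> is exact (except at \<open>C m\<close>).
  Only the additive groups matter, so that these also apply to the hom-groups.
\<close>

definition exact_to ::
  "nat \<Rightarrow> (nat \<Rightarrow> ('c, 'y) ring_scheme) \<Rightarrow> (nat \<Rightarrow> 'c \<Rightarrow> 'c) \<Rightarrow> ('c \<Rightarrow> 'm) \<Rightarrow> ('m, 'z) ring_scheme \<Rightarrow> bool"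
where
  "exact_to m C d e M \<longleftrightarrow>
     e ` carrier (C 0) = carrier M \<and>
     (0 < m \<longrightarrow> d 0 ` carrier (C 1) = a_kernel (C 0) M e) \<and>
     (\<forall>i. Suc i < m \<longrightarrow>
        d (Suc i) ` carrier (C (Suc (Suc i))) = a_kernel (C (Suc i)) (C i) (d i))"

definition exact_from ::
  "nat \<Rightarrow> ('m, 'z) ring_scheme \<Rightarrow> ('m \<Rightarrow> 'c) \<Rightarrow> (nat \<Rightarrow> ('c, 'y) ring_scheme) \<Rightarrow> (nat \<Rightarrow> 'c \<Rightarrow> 'c) \<Rightarrow> bool"
where
  "exact_from m M e C d \<longleftrightarrow>
     a_kernel M (C 0) e = {\<zero>\<^bsub>M\<^esub>} \<and>
     (0 < m \<longrightarrow> e ` carrier M = a_kernel (C 0) (C 1) (d 0)) \<and>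
     (\<forall>i. Suc i < m \<longrightarrow>
        d i ` carrier (C i) = a_kernel (C (Suc i)) (C (Suc (Suc i))) (d (Suc i)))"

definition exact_mods_to ::
  "('k, 'a) module \<Rightarrow> nat \<Rightarrow> (nat \<Rightarrow> ('a, 'c) module) \<Rightarrow> (nat \<Rightarrow> 'c \<Rightarrow> 'c) \<Rightarrow> ('c \<Rightarrow> 'm) \<Rightarrow> ('a, 'm) module \<Rightarrow> bool"
where
  "exact_mods_to A m C d e M \<longleftrightarrow> fg_module A M \<and> (\<forall>i\<le>m. fg_module A (C i)) \<and>
     e \<in> lhom A (C 0) M \<and> (\<forall>i<m. d i \<in> lhom A (C (Suc i)) (C i)) \<and> exact_to m C d e M"

definition exact_mods_from ::
  "('k, 'a) module \<Rightarrow> nat \<Rightarrow> ('a, 'm) module \<Rightarrow> ('m \<Rightarrow> 'c) \<Rightarrow> (nat \<Rightarrow> ('a, 'c) module) \<Rightarrow> (nat \<Rightarrow> 'c \<Rightarrow> 'c) \<Rightarrow> bool"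
where
  "exact_mods_from A m M e C d \<longleftrightarrow> fg_module A M \<and> (\<forall>i\<le>m. fg_module A (C i)) \<and>
     e \<in> lhom A M (C 0) \<and> (\<forall>i<m. d i \<in> lhom A (C i) (C (Suc i))) \<and> exact_from m M e C d"

definition projective_resolution ::
  "('k, 'a) module \<Rightarrow> (nat \<Rightarrow> ('a, 'c) module) \<Rightarrow> (nat \<Rightarrow> 'c \<Rightarrow> 'c) \<Rightarrow> ('c \<Rightarrow> 'm) \<Rightarrow> ('a, 'm) module \<Rightarrow> bool"
where
  "projective_resolution A P d e M \<longleftrightarrow>
     (\<forall>i. projective A (P i)) \<and> (\<forall>m. exact_mods_to A m P d e M)"

definition injective_resolution ::
  "('k, 'a) module \<Rightarrow> ('a, 'm) module \<Rightarrow> ('m \<Rightarrow> 'c) \<Rightarrow> (nat \<Rightarrow> ('a, 'c) module) \<Rightarrow> (nat \<Rightarrow> 'c \<Rightarrow> 'c) \<Rightarrow> bool"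
where
  "injective_resolution A M e I d \<longleftrightarrow>
     (\<forall>i. injective A (I i)) \<and> (\<forall>m. exact_mods_from A m M e I d)"

definition pdim_le :: "('k, 'a) module \<Rightarrow> ('a, 'm) module \<Rightarrow> nat \<Rightarrow> bool" where
  "pdim_le A M k \<longleftrightarrow>
     (\<exists>(P :: nat \<Rightarrow> ('a, nat \<Rightarrow> 'k) module) d e.
        projective_resolution A P d e M \<and> (\<forall>i>k. zero_module (P i)))"

definition domdim_ge :: "('k, 'a) module \<Rightarrow> nat \<Rightarrow> bool" where
  "domdim_ge A k \<longleftrightarrow>
     (\<exists>(I :: nat \<Rightarrow> ('a, nat \<Rightarrow> 'k) module) d e.
        injective_resolution A (regular A) e I d \<and> (\<forall>i<k. projective A (I i)))"

definition domdim_eq :: "('k, 'a) module \<Rightarrow> nat \<Rightarrow> bool" where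
  "domdim_eq A k \<longleftrightarrow> domdim_ge A k \<and> \<not> domdim_ge A (Suc k)"


section \<open>Ext\<close>

text \<open>
  \<open>Ext A i M N\<close> is the \<open>i\<close>-th cohomology of \<open>Hom(P, N)\<close> for a chosen projective resolution
  \<open>P\<close> of \<open>M\<close>.
\<close>

definition chosen_resolution ::
  "('k, 'a) module \<Rightarrow> ('a, 'm) module \<Rightarrow>
     (nat \<Rightarrow> ('a, nat \<Rightarrow> 'k) module) \<times> (nat \<Rightarrow> (nat \<Rightarrow> 'k) \<Rightarrow> nat \<Rightarrow> 'k) \<times> ((nat \<Rightarrow> 'k) \<Rightarrow> 'm)"
where
  "chosen_resolution A M = (SOME (P, d, e). projective_resolution A P d e M)"

definition Ext :: "('k, 'a) module \<Rightarrow> nat \<Rightarrow> ('a, 'm) module \<Rightarrow> ('a, 'n) module \<Rightarrow>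
    ((nat \<Rightarrow> 'k) \<Rightarrow> 'n) set monoid" where
  "Ext A i M N =
     (case chosen_resolution A M of (P, d, e) \<Rightarrow>
        (add_monoid (Hom A (P i) N))
          \<lparr>carrier := a_kernel (Hom A (P i) N) (Hom A (P (Suc i)) N)
                       (\<lambda>f. compose (carrier (P (Suc i))) f (d i))\<rparr>
        Mod (if i = 0 then {\<zero>\<^bsub>Hom A (P 0) N\<^esub>}
             else (\<lambda>f. compose (carrier (P i)) f (d (i - 1))) ` carrier (Hom A (P (i - 1)) N)))"

definition Hom_vanishes :: "('k, 'a) module \<Rightarrow> ('a, 'm) module \<Rightarrow> ('a, 'n) module \<Rightarrow> bool" where
  "Hom_vanishes A M N \<longleftrightarrow> trivial_group (add_monoid (Hom A M N))"

definition Ext_vanishes :: "('k, 'a) module \<Rightarrow> nat \<Rightarrow> ('a, 'm) module \<Rightarrow> ('a, 'n) module \<Rightarrow> bool" where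
  "Ext_vanishes A i M N \<longleftrightarrow>
     (if i = 0 then Hom_vanishes A M N else trivial_group (Ext A i M N))"


section \<open>Tilting modules\<close>

text \<open>\<open>0 \<rightarrow> A \<rightarrow> t 0 \<rightarrow> \<dots> \<rightarrow> t k \<rightarrow> 0\<close>; the final zero is \<open>t (k + 1)\<close>.\<close>

definition tilting_coresolution ::
  "('k, 'a) module \<Rightarrow> nat \<Rightarrow> ('a, 'm) module \<Rightarrow> (nat \<Rightarrow> ('a, nat \<Rightarrow> 'k) module) \<Rightarrow> bool" where
  "tilting_coresolution A k T t \<longleftrightarrow>
     (\<forall>j\<le>k. in_add A T (t j)) \<and> zero_module (t (Suc k)) \<and>
     (\<exists>e d. exact_mods_from A (Suc k) (regular A) e t d)"

definition tilting :: "('k, 'a) module \<Rightarrow> nat \<Rightarrow> ('a, 'm) module \<Rightarrow> bool" where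
  "tilting A k T \<longleftrightarrow> fg_module A T \<and> pdim_le A T k \<and>
     (\<forall>i>0. Ext_vanishes A i T T) \<and> (\<exists>t. tilting_coresolution A k T t)"

definition special_tilting ::
  "('k, 'a) module \<Rightarrow> ('a, 'p) module \<Rightarrow> nat \<Rightarrow> ('a, 'm) module \<Rightarrow> bool" where
  "special_tilting A P k T \<longleftrightarrow> tilting A k T \<and> projective A P \<and> in_add A T P \<and>
     (\<exists>t. tilting_coresolution A k T t \<and> (\<forall>j<k. in_add A P (t j)))"

text \<open>\<open>T\<close> is (a representative of the isomorphism class of) the \<open>k\<close>-shifted module.\<close>

definition shifted_module ::
  "('k, 'a) module \<Rightarrow> ('a, 'p) module \<Rightarrow> nat \<Rightarrow> ('a, 'm) module \<Rightarrow> bool" where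
  "shifted_module A Q k T \<longleftrightarrow> domdim_ge A k \<and> basic_module A T \<and> special_tilting A Q k T"


section \<open>Subcategories\<close>

text \<open>
  A full subcategory is given by its set of objects.  The carrier type of the objects is a free
  type variable, so statements about these sets hold for objects over every type.  Since \<open>T\<close> is
  a left \<open>End(T)\<close>-module, \<open>dual K (End A T) (End_module T)\<close> is a left module over
  \<open>opp (End A T)\<close>.
\<close>

definition tilting_T :: "('k, 'a) module \<Rightarrow> ('a, 't) module \<Rightarrow> nat \<Rightarrow> ('a, 'm) module set" where
  "tilting_T A T j = {M. fg_module A M \<and> (\<forall>i. i \<noteq> j \<longrightarrow> Ext_vanishes A i T M)}"

definition tilting_C :: "('k, 'b) module \<Rightarrow> ('b, 'u) module \<Rightarrow> nat \<Rightarrow> ('b, 'n) module set" where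
  "tilting_C B DT j = {N. fg_module B N \<and> (\<forall>i. i \<noteq> j \<longrightarrow> Ext_vanishes B i N DT)}"

definition zero_mods :: "('k, 'a) module \<Rightarrow> ('a, 'm) module set" where
  "zero_mods A = {M. fg_module A M \<and> zero_module M}"

definition ker_Hom_from :: "('k, 'a) module \<Rightarrow> ('a, 'p) module \<Rightarrow> ('a, 'm) module set" where
  "ker_Hom_from A P = {M. fg_module A M \<and> Hom_vanishes A P M}"

definition ker_Hom_into :: "('k, 'b) module \<Rightarrow> ('b, 'i) module \<Rightarrow> ('b, 'n) module set" where
  "ker_Hom_into B I = {N. fg_module B N \<and> Hom_vanishes B N I}"

definition gen :: "('k, 'a) module \<Rightarrow> nat \<Rightarrow> ('a, 'x) module \<Rightarrow> ('a, 'm) module set" where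
  "gen A m X = {M. \<exists>(C :: nat \<Rightarrow> ('a, nat \<Rightarrow> 'k) module) d e.
     (\<forall>i\<le>m. in_add A X (C i)) \<and> exact_mods_to A m C d e M \<and>
     exact_to m (\<lambda>i. Hom A X (C i)) (\<lambda>i h. compose (carrier X) (d i) h)
       (\<lambda>h. compose (carrier X) e h) (Hom A X M)}"

definition cogen :: "('k, 'b) module \<Rightarrow> nat \<Rightarrow> ('b, 'x) module \<Rightarrow> ('b, 'n) module set" where
  "cogen B m X = {N. \<exists>(C :: nat \<Rightarrow> ('b, nat \<Rightarrow> 'k) module) d e.
     (\<forall>i\<le>m. in_add B X (C i)) \<and> exact_mods_from B m N e C d \<and>
     exact_to m (\<lambda>i. Hom B (C i) X) (\<lambda>i h. compose (carrier (C i)) h (d i))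
       (\<lambda>h. compose (carrier N) h e) (Hom B N X)}"

end

(*
  Let 0 -> A -> t_0 -> ... -> t_k -> 0 be the coresolution with t_j in add P for j < k. If Ext^k(T,M) = 0, then
  shifting along it gives Ext^1(t_0/A,M) = 0, so every map A -> M extends to t_0 and M is a quotient of a sum
  of copies of P. The kernel N of such a cover satisfies Ext^(i+1)(T,N) = Ext^i(T,M) for i > 0 because P lies in
  add T, so the argument can be repeated and identifies T_0 with gen_(k-1)(P). In particular T itself has a
  resolution whose first k terms lie in add P. Hence Hom(P,M) = 0 implies Ext^i(T,M) = 0 for i < k, which gives
  T_k; and a module in T_j with 0 < j, j /= k, is a quotient of a sum of copies of P without maps from P.

  The functor Hom(-,T) exchanges the resolution of T and the coresolution of A, so that T is a Hom(P,T)-special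
  tilting module over End(T). Duality over the field turns the description of its subcategories T_j into that of
  the C_j over the opposite algebra.
*)
theory Submission
  imports Defs "HOL-Library.Nat_Bijection"
begin

section \<open>Linear maps and submodules\<close>

text \<open>Only the vanishing of extension groups matters, so \<open>ext_zero\<close> replaces the
  groups defined by a resolution under \<open>SOME\<close>, and the two pieces of the long exact
  sequence in use become extension problems for maps. Independence of the chosen syzygies needs
  enough injectives; these arise from free covers over the opposite algebra by duality over the
  field.

  Modules quantified inside the definitions have carrier type \<open>nat => 'k\<close>, while
  \<open>P\<close>, \<open>T\<close>, their Hom spaces and their duals have other types;
  \<open>copy\<close> moves everything to that type.

  Membership in add X is expressed by \<open>radd\<close>: the identity is a finite sum of
  composites through X. Additive functors preserve this at once, with no decomposition into
  summands.

  The locale \<open>special_tilt\<close> is instantiated over the algebra and again over E = End(T).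
  The second instance rests on the bijectivity of the evaluation C -> Hom_E(Hom(C,T), T) for every
  cokernel C in the coresolution of the algebra; this is what makes T rigid over E.\<close>

lemma left_moduleI:
  assumes "ring R" "abelian_group M"
    and "\<And>a x. \<lbrakk>a \<in> carrier R; x \<in> carrier M\<rbrakk> \<Longrightarrow> a \<odot>\<^bsub>M\<^esub> x \<in> carrier M"
    and "\<And>a b x. \<lbrakk>a \<in> carrier R; b \<in> carrier R; x \<in> carrier M\<rbrakk> \<Longrightarrow> (a \<oplus>\<^bsub>R\<^esub> b) \<odot>\<^bsub>M\<^esub> x = a \<odot>\<^bsub>M\<^esub> x \<oplus>\<^bsub>M\<^esub> b \<odot>\<^bsub>M\<^esub> x"
    and "\<And>a x y. \<lbrakk>a \<in> carrier R; x \<in> carrier M; y \<in> carrier M\<rbrakk> \<Longrightarrow> a \<odot>\<^bsub>M\<^esub> (x \<oplus>\<^bsub>M\<^esub> y) = a \<odot>\<^bsub>M\<^esub> x \<oplus>\<^bsub>M\<^esub> a \<odot>\<^bsub>M\<^esub> y"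
    and "\<And>a b x. \<lbrakk>a \<in> carrier R; b \<in> carrier R; x \<in> carrier M\<rbrakk> \<Longrightarrow> (a \<otimes>\<^bsub>R\<^esub> b) \<odot>\<^bsub>M\<^esub> x = a \<odot>\<^bsub>M\<^esub> (b \<odot>\<^bsub>M\<^esub> x)"
    and "\<And>x. x \<in> carrier M \<Longrightarrow> \<one>\<^bsub>R\<^esub> \<odot>\<^bsub>M\<^esub> x = x"
  shows "left_module R M"
  using assms by (intro left_module.intro left_module_axioms.intro) auto

context left_module
begin

lemma smult_r_null [simp]: "a \<in> carrier R \<Longrightarrow> a \<odot>\<^bsub>M\<^esub> \<zero>\<^bsub>M\<^esub> = \<zero>\<^bsub>M\<^esub>"
  by (metis M.add.r_cancel_one M.r_zero M.zero_closed smult_closed smult_r_distr)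

lemma smult_l_null [simp]: "x \<in> carrier M \<Longrightarrow> \<zero> \<odot>\<^bsub>M\<^esub> x = \<zero>\<^bsub>M\<^esub>"
  by (metis M.add.r_cancel_one R.r_zero R.zero_closed smult_closed smult_l_distr)

lemma smult_r_minus: "a \<in> carrier R \<Longrightarrow> x \<in> carrier M \<Longrightarrow> a \<odot>\<^bsub>M\<^esub> (\<ominus>\<^bsub>M\<^esub> x) = \<ominus>\<^bsub>M\<^esub> (a \<odot>\<^bsub>M\<^esub> x)"
  by (metis M.a_inv_closed M.l_neg M.minus_equality smult_closed smult_r_distr smult_r_null)

lemma smult_l_minus: "a \<in> carrier R \<Longrightarrow> x \<in> carrier M \<Longrightarrow> (\<ominus> a) \<odot>\<^bsub>M\<^esub> x = \<ominus>\<^bsub>M\<^esub> (a \<odot>\<^bsub>M\<^esub> x)"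
  by (metis M.minus_equality R.a_inv_closed R.l_neg smult_closed smult_l_distr smult_l_null)

text \<open>Negation is a scalar multiple, so linear maps and submodules respect it with no clause
  of their own.\<close>

lemma neg_smult: "x \<in> carrier M \<Longrightarrow> \<ominus>\<^bsub>M\<^esub> x = (\<ominus> \<one>) \<odot>\<^bsub>M\<^esub> x"
  by (simp add: smult_l_minus smult_one)

lemma smult_r_diff: "a \<in> carrier R \<Longrightarrow> x \<in> carrier M \<Longrightarrow> y \<in> carrier M \<Longrightarrow>
    a \<odot>\<^bsub>M\<^esub> (x \<ominus>\<^bsub>M\<^esub> y) = a \<odot>\<^bsub>M\<^esub> x \<ominus>\<^bsub>M\<^esub> a \<odot>\<^bsub>M\<^esub> y"
  by (simp add: M.minus_eq smult_r_distr smult_r_minus)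

lemma diff_eq_zero_iff: "x \<in> carrier M \<Longrightarrow> y \<in> carrier M \<Longrightarrow> x \<ominus>\<^bsub>M\<^esub> y = \<zero>\<^bsub>M\<^esub> \<longleftrightarrow> x = y"
  by (metis M.add.inv_closed M.minus_equality M.minus_minus M.minus_eq M.r_neg)

lemma diff_add_cancel: "x \<in> carrier M \<Longrightarrow> y \<in> carrier M \<Longrightarrow> (x \<ominus>\<^bsub>M\<^esub> y) \<oplus>\<^bsub>M\<^esub> y = x"
  by (simp add: M.a_assoc M.l_neg M.minus_eq)

lemma add_diff_cancel: "x \<in> carrier M \<Longrightarrow> y \<in> carrier M \<Longrightarrow> y \<oplus>\<^bsub>M\<^esub> (x \<ominus>\<^bsub>M\<^esub> y) = x"
  using diff_add_cancel[of x y] M.a_comm[of y "x \<ominus>\<^bsub>M\<^esub> y"] by simp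

lemma add_add_swap: "\<lbrakk>x \<in> carrier M; y \<in> carrier M; z \<in> carrier M; w \<in> carrier M\<rbrakk> \<Longrightarrow>
    (x \<oplus>\<^bsub>M\<^esub> y) \<oplus>\<^bsub>M\<^esub> (z \<oplus>\<^bsub>M\<^esub> w) = (x \<oplus>\<^bsub>M\<^esub> z) \<oplus>\<^bsub>M\<^esub> (y \<oplus>\<^bsub>M\<^esub> w)"
  by (simp add: M.a_ac)

lemma add_diff_swap: "\<lbrakk>x \<in> carrier M; y \<in> carrier M; z \<in> carrier M; w \<in> carrier M\<rbrakk> \<Longrightarrow>
    (x \<oplus>\<^bsub>M\<^esub> y) \<ominus>\<^bsub>M\<^esub> (z \<oplus>\<^bsub>M\<^esub> w) = (x \<ominus>\<^bsub>M\<^esub> z) \<oplus>\<^bsub>M\<^esub> (y \<ominus>\<^bsub>M\<^esub> w)"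
  by (simp add: M.minus_eq M.a_ac M.minus_add)

end

text \<open>Dropping the extensionality of \<open>lhom\<close> lets composites and sums of maps be
  written without \<open>restrict\<close>; \<open>restrict_lhom\<close> leads back to
  \<open>lhom\<close> where a definition asks for it.\<close>

definition lin :: "('r, 'z) ring_scheme \<Rightarrow> ('r, 'm) module \<Rightarrow> ('r, 'n) module \<Rightarrow> ('m \<Rightarrow> 'n) \<Rightarrow> bool" where
  "lin R M N f \<longleftrightarrow> (\<forall>x\<in>carrier M. f x \<in> carrier N) \<and>
     (\<forall>x\<in>carrier M. \<forall>y\<in>carrier M. f (x \<oplus>\<^bsub>M\<^esub> y) = f x \<oplus>\<^bsub>N\<^esub> f y) \<and>
     (\<forall>a\<in>carrier R. \<forall>x\<in>carrier M. f (a \<odot>\<^bsub>M\<^esub> x) = a \<odot>\<^bsub>N\<^esub> f x)"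

lemma linI:
  assumes "\<And>x. x \<in> carrier M \<Longrightarrow> f x \<in> carrier N"
    and "\<And>x y. \<lbrakk>x \<in> carrier M; y \<in> carrier M\<rbrakk> \<Longrightarrow> f (x \<oplus>\<^bsub>M\<^esub> y) = f x \<oplus>\<^bsub>N\<^esub> f y"
    and "\<And>a x. \<lbrakk>a \<in> carrier R; x \<in> carrier M\<rbrakk> \<Longrightarrow> f (a \<odot>\<^bsub>M\<^esub> x) = a \<odot>\<^bsub>N\<^esub> f x"
  shows "lin R M N f"
  using assms by (simp add: lin_def)

lemma lin_closed: "lin R M N f \<Longrightarrow> x \<in> carrier M \<Longrightarrow> f x \<in> carrier N"
  and lin_add: "lin R M N f \<Longrightarrow> x \<in> carrier M \<Longrightarrow> y \<in> carrier M \<Longrightarrow> f (x \<oplus>\<^bsub>M\<^esub> y) = f x \<oplus>\<^bsub>N\<^esub> f y"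
  and lin_smult: "lin R M N f \<Longrightarrow> a \<in> carrier R \<Longrightarrow> x \<in> carrier M \<Longrightarrow> f (a \<odot>\<^bsub>M\<^esub> x) = a \<odot>\<^bsub>N\<^esub> f x"
  by (simp_all add: lin_def)

lemma lhom_iff: "f \<in> lhom R M N \<longleftrightarrow> lin R M N f \<and> f \<in> extensional (carrier M)"
  by (auto simp: lhom_def lin_def PiE_def Pi_def)

lemma lhom_lin: "f \<in> lhom R M N \<Longrightarrow> lin R M N f"
  by (simp add: lhom_iff)

lemma lin_cong: "lin R M N f \<Longrightarrow> left_module R M \<Longrightarrow> (\<And>x. x \<in> carrier M \<Longrightarrow> g x = f x) \<Longrightarrow> lin R M N g"
proof -
  assume f: "lin R M N f" and M: "left_module R M" and g: "\<And>x. x \<in> carrier M \<Longrightarrow> g x = f x"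
  interpret M: left_module R M by (rule M)
  show "lin R M N g"
    by (rule linI) (simp_all add: g lin_closed[OF f] lin_add[OF f] lin_smult[OF f] M.smult_closed)
qed

lemma restrict_lhom: "lin R M N f \<Longrightarrow> left_module R M \<Longrightarrow> restrict f (carrier M) \<in> lhom R M N"
  by (auto simp: lhom_iff intro: lin_cong)

lemma lin_zero:
  assumes "lin R M N f" "left_module R M" "left_module R N"
  shows "f \<zero>\<^bsub>M\<^esub> = \<zero>\<^bsub>N\<^esub>"
proof -
  interpret M: left_module R M by fact
  interpret N: left_module R N by fact
  show ?thesis
    by (metis M.M.r_zero M.M.zero_closed N.M.add.r_cancel_one assms(1) lin_add lin_closed)
qed

lemma lin_neg:
  assumes "lin R M N f" "left_module R M" "left_module R N" "x \<in> carrier M"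
  shows "f (\<ominus>\<^bsub>M\<^esub> x) = \<ominus>\<^bsub>N\<^esub> f x"
proof -
  interpret M: left_module R M by fact
  interpret N: left_module R N by fact
  show ?thesis
    using assms by (simp add: M.neg_smult N.neg_smult lin_smult lin_closed)
qed

lemma lin_diff:
  assumes "lin R M N f" "left_module R M" "left_module R N" "x \<in> carrier M" "y \<in> carrier M"
  shows "f (x \<ominus>\<^bsub>M\<^esub> y) = f x \<ominus>\<^bsub>N\<^esub> f y"
proof -
  interpret M: left_module R M by fact
  interpret N: left_module R N by fact
  show ?thesis
    using assms by (simp add: M.M.minus_eq N.M.minus_eq lin_neg lin_add)
qed

lemma lin_id: "lin R M M (\<lambda>x. x)"
  by (simp add: lin_def)

lemma lin_comp: "lin R L M f \<Longrightarrow> lin R M N g \<Longrightarrow> lin R L N (\<lambda>x. g (f x))"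
  by (simp add: lin_def)

lemma lin_plus:
  assumes "lin R M N f" "lin R M N g" "left_module R N"
  shows "lin R M N (\<lambda>x. f x \<oplus>\<^bsub>N\<^esub> g x)"
proof -
  interpret N: left_module R N by fact
  show ?thesis
    using assms(1,2) by (auto simp: lin_def N.smult_r_distr intro: N.add_add_swap)
qed

lemma lin_minus:
  assumes "lin R M N f" "lin R M N g" "left_module R N"
  shows "lin R M N (\<lambda>x. f x \<ominus>\<^bsub>N\<^esub> g x)"
proof -
  interpret N: left_module R N by fact
  show ?thesis
    using assms(1,2) by (auto simp: lin_def N.smult_r_diff intro: N.add_diff_swap)
qed

lemma lin_const_zero: "left_module R N \<Longrightarrow> lin R M N (\<lambda>x. \<zero>\<^bsub>N\<^esub>)"
proof -
  assume "left_module R N"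
  then interpret N: left_module R N .
  show ?thesis by (simp add: lin_def)
qed

lemma lin_inv:
  assumes f: "lin R M N f" and bij: "bij_betw f (carrier M) (carrier N)" and M: "left_module R M"
  shows "lin R N M (inv_into (carrier M) f)"
proof -
  interpret M: left_module R M by fact
  let ?g = "inv_into (carrier M) f"
  have g: "?g y \<in> carrier M" "f (?g y) = y" if "y \<in> carrier N" for y
    using bij that by (auto simp: bij_betw_def inv_into_into f_inv_into_f)
  have gf: "?g (f x) = x" if "x \<in> carrier M" for x
    using bij that by (auto simp: bij_betw_def)
  show ?thesis
  proof (rule linI)
    fix x y assume xy: "x \<in> carrier N" "y \<in> carrier N"
    have "x \<oplus>\<^bsub>N\<^esub> y = f (?g x \<oplus>\<^bsub>M\<^esub> ?g y)" using lin_add[OF f g(1) g(1)] xy g(2) by simp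
    then show "?g (x \<oplus>\<^bsub>N\<^esub> y) = ?g x \<oplus>\<^bsub>M\<^esub> ?g y" using gf[OF M.M.a_closed[OF g(1) g(1)]] xy by simp
  next
    fix a x assume ax: "a \<in> carrier R" "x \<in> carrier N"
    have "a \<odot>\<^bsub>N\<^esub> x = f (a \<odot>\<^bsub>M\<^esub> ?g x)" using lin_smult[OF f ax(1) g(1)] ax g(2) by simp
    then show "?g (a \<odot>\<^bsub>N\<^esub> x) = a \<odot>\<^bsub>M\<^esub> ?g x" using gf[OF M.smult_closed[OF ax(1) g(1)]] ax by simp
  qed (use g in auto)
qed

lemma isomorphic_lin:
  assumes "left_module R M"
  shows "isomorphic R M N \<longleftrightarrow> (\<exists>f. lin R M N f \<and> bij_betw f (carrier M) (carrier N))"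
proof
  assume "\<exists>f. lin R M N f \<and> bij_betw f (carrier M) (carrier N)"
  then obtain f where f: "lin R M N f" "bij_betw f (carrier M) (carrier N)" by blast
  then have "bij_betw (restrict f (carrier M)) (carrier M) (carrier N)"
    by (simp cong: bij_betw_cong)
  with restrict_lhom[OF f(1) assms] show "isomorphic R M N"
    unfolding isomorphic_def by blast
qed (auto simp: isomorphic_def lhom_iff)

lemma lin_inj_iff:
  assumes "lin R M N f" "left_module R M" "left_module R N"
  shows "inj_on f (carrier M) \<longleftrightarrow> (\<forall>x\<in>carrier M. f x = \<zero>\<^bsub>N\<^esub> \<longrightarrow> x = \<zero>\<^bsub>M\<^esub>)"
proof
  interpret M: left_module R M by fact
  assume "inj_on f (carrier M)"
  then show "\<forall>x\<in>carrier M. f x = \<zero>\<^bsub>N\<^esub> \<longrightarrow> x = \<zero>\<^bsub>M\<^esub>"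
    using lin_zero[OF assms] by (metis M.M.zero_closed inj_onD)
next
  interpret M: left_module R M by fact
  interpret N: left_module R N by fact
  assume h: "\<forall>x\<in>carrier M. f x = \<zero>\<^bsub>N\<^esub> \<longrightarrow> x = \<zero>\<^bsub>M\<^esub>"
  show "inj_on f (carrier M)"
  proof (rule inj_onI)
    fix x y assume xy: "x \<in> carrier M" "y \<in> carrier M" "f x = f y"
    then have "f (x \<ominus>\<^bsub>M\<^esub> y) = \<zero>\<^bsub>N\<^esub>"
      using lin_diff[OF assms xy(1,2)] N.diff_eq_zero_iff lin_closed[OF assms(1)] by simp
    then show "x = y" using h xy M.diff_eq_zero_iff by auto
  qed
qed

section \<open>Submodules and generating sets\<close>

definition submod :: "('r, 'z) ring_scheme \<Rightarrow> ('r, 'm) module \<Rightarrow> 'm set \<Rightarrow> bool" where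
  "submod R M W \<longleftrightarrow> W \<subseteq> carrier M \<and> \<zero>\<^bsub>M\<^esub> \<in> W \<and> (\<forall>x\<in>W. \<forall>y\<in>W. x \<oplus>\<^bsub>M\<^esub> y \<in> W) \<and> (\<forall>a\<in>carrier R. \<forall>x\<in>W. a \<odot>\<^bsub>M\<^esub> x \<in> W)"

lemma submodI:
  assumes "W \<subseteq> carrier M" "\<zero>\<^bsub>M\<^esub> \<in> W" "\<And>x y. x \<in> W \<Longrightarrow> y \<in> W \<Longrightarrow> x \<oplus>\<^bsub>M\<^esub> y \<in> W"
    "\<And>a x. a \<in> carrier R \<Longrightarrow> x \<in> W \<Longrightarrow> a \<odot>\<^bsub>M\<^esub> x \<in> W"
  shows "submod R M W"
  using assms by (simp add: submod_def)

lemma submodD: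
  assumes "submod R M W"
  shows "W \<subseteq> carrier M" "\<zero>\<^bsub>M\<^esub> \<in> W" "\<And>x y. x \<in> W \<Longrightarrow> y \<in> W \<Longrightarrow> x \<oplus>\<^bsub>M\<^esub> y \<in> W"
    "\<And>a x. a \<in> carrier R \<Longrightarrow> x \<in> W \<Longrightarrow> a \<odot>\<^bsub>M\<^esub> x \<in> W"
  using assms by (auto simp: submod_def)

abbreviation sub :: "('r, 'm) module \<Rightarrow> 'm set \<Rightarrow> ('r, 'm) module" where
  "sub M W \<equiv> M\<lparr>carrier := W\<rparr>"

lemma submod_neg:
  assumes "submod R M W" "left_module R M" "x \<in> W"
  shows "\<ominus>\<^bsub>M\<^esub> x \<in> W"
proof -
  interpret M: left_module R M by fact
  show ?thesis
    using assms M.neg_smult[of x] submodD[OF assms(1)] by auto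
qed

lemma submod_diff:
  assumes "submod R M W" "left_module R M" "x \<in> W" "y \<in> W"
  shows "x \<ominus>\<^bsub>M\<^esub> y \<in> W"
  using submod_neg[OF assms(1,2,4)] submodD(3)[OF assms(1,3)] by (simp add: a_minus_def)

lemma left_module_sub:
  assumes "submod R M W" "left_module R M"
  shows "left_module R (sub M W)"
proof -
  interpret M: left_module R M by fact
  note W = submodD[OF assms(1)]
  have W': "x \<in> W \<Longrightarrow> x \<in> carrier M" for x using W(1) by auto
  show ?thesis
  proof (rule left_moduleI)
    show "abelian_group (sub M W)"
    proof (rule abelian_groupI)
      fix x assume "x \<in> carrier (sub M W)"
      then show "\<exists>y\<in>carrier (sub M W). y \<oplus>\<^bsub>sub M W\<^esub> x = \<zero>\<^bsub>sub M W\<^esub>"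
        using submod_neg[OF assms] W' by (auto intro!: bexI[of _ "\<ominus>\<^bsub>M\<^esub> x"] simp: M.M.l_neg)
    qed (use W W' in \<open>auto simp: M.M.a_ac\<close>)
  qed (use W W' M.R.ring_axioms in \<open>auto simp: M.smult_l_distr M.smult_r_distr M.smult_assoc1 M.smult_one\<close>)
qed

lemma submod_kernel:
  assumes "lin R M N f" "left_module R M" "left_module R N"
  shows "submod R M {x \<in> carrier M. f x = \<zero>\<^bsub>N\<^esub>}"
proof -
  interpret M: left_module R M by fact
  interpret N: left_module R N by fact
  show ?thesis
    by (rule submodI) (auto simp: lin_zero[OF assms] lin_add[OF assms(1)] lin_smult[OF assms(1)] M.smult_closed)
qed

lemma submod_vimage:
  assumes "lin R M N f" "left_module R M" "left_module R N" "submod R N W"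
  shows "submod R M {x \<in> carrier M. f x \<in> W}"
proof -
  interpret M: left_module R M by fact
  note W = submodD[OF assms(4)]
  show ?thesis
    by (rule submodI)
      (auto simp: lin_zero[OF assms(1-3)] lin_add[OF assms(1)] lin_smult[OF assms(1)] M.smult_closed W)
qed

lemma submod_image:
  assumes "lin R M N f" "left_module R M" "left_module R N" "submod R M W"
  shows "submod R N (f ` W)"
proof -
  interpret M: left_module R M by fact
  note W = submodD[OF assms(4)]
  have W': "x \<in> W \<Longrightarrow> x \<in> carrier M" for x using W(1) by auto
  show ?thesis
  proof (rule submodI)
    show "f ` W \<subseteq> carrier N" using W' lin_closed[OF assms(1)] by auto
    show "\<zero>\<^bsub>N\<^esub> \<in> f ` W" using W(2) lin_zero[OF assms(1-3)] by (metis image_eqI)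
  next
    fix x y assume "x \<in> f ` W" "y \<in> f ` W"
    then obtain u v where "u \<in> W" "v \<in> W" "x = f u" "y = f v" by blast
    then show "x \<oplus>\<^bsub>N\<^esub> y \<in> f ` W"
      using W(3) W' lin_add[OF assms(1)] by (auto intro!: image_eqI[of _ _ "u \<oplus>\<^bsub>M\<^esub> v"])
  next
    fix a x assume "a \<in> carrier R" "x \<in> f ` W"
    then obtain u where "u \<in> W" "x = f u" by blast
    then show "a \<odot>\<^bsub>N\<^esub> x \<in> f ` W"
      using \<open>a \<in> carrier R\<close> W(4) W' lin_smult[OF assms(1)] by (auto intro!: image_eqI[of _ _ "a \<odot>\<^bsub>M\<^esub> u"])
  qed
qed

lemma submod_carrier: "left_module R M \<Longrightarrow> submod R M (carrier M)"
proof -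
  assume "left_module R M"
  then interpret M: left_module R M .
  show ?thesis by (rule submodI) (auto intro: M.smult_closed)
qed

lemma submod_zero: "left_module R M \<Longrightarrow> submod R M {\<zero>\<^bsub>M\<^esub>}"
proof -
  assume "left_module R M"
  then interpret M: left_module R M .
  show ?thesis by (rule submodI) auto
qed

lemma submod_equalizer:
  assumes "lin R M N f" "lin R M N g" "left_module R M" "left_module R N"
  shows "submod R M {x \<in> carrier M. f x = g x}"
proof -
  interpret M: left_module R M by fact
  show ?thesis
    by (rule submodI)
      (auto simp: lin_zero[OF assms(1,3,4)] lin_zero[OF assms(2-4)] lin_add[OF assms(1)] lin_add[OF assms(2)]
        lin_smult[OF assms(1)] lin_smult[OF assms(2)] M.smult_closed)
qed

lemma lin_sub_incl: "W \<subseteq> carrier M \<Longrightarrow> lin R (sub M W) M (\<lambda>x. x)"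
  by (auto simp: lin_def)

lemma lin_sub_into: "lin R M N f \<Longrightarrow> f ` carrier M \<subseteq> W \<Longrightarrow> lin R M (sub N W) f"
  by (auto simp: lin_def)

text \<open>Generation without linear combinations: a property of all elements follows once its
  solutions form a submodule that contains \<open>S\<close>.\<close>

definition gens :: "('r, 'z) ring_scheme \<Rightarrow> ('r, 'm) module \<Rightarrow> 'm set \<Rightarrow> bool" where
  "gens R M S \<longleftrightarrow> S \<subseteq> carrier M \<and> (\<forall>W. submod R M W \<longrightarrow> S \<subseteq> W \<longrightarrow> carrier M \<subseteq> W)"

lemma gensD: "gens R M S \<Longrightarrow> submod R M W \<Longrightarrow> S \<subseteq> W \<Longrightarrow> x \<in> carrier M \<Longrightarrow> x \<in> W"
  by (auto simp: gens_def)

text \<open>The linear combinations of \<open>S\<close> form a submodule containing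
  \<open>S\<close>, and they lie in every submodule that contains \<open>S\<close>.\<close>

lemma fin_gen_iff:
  assumes "left_module R M"
  shows "fin_gen R M \<longleftrightarrow> (\<exists>S. finite S \<and> gens R M S)"
proof -
  interpret M: left_module R M by fact
  have lc: "(\<Oplus>\<^bsub>M\<^esub>s\<in>S. a s \<odot>\<^bsub>M\<^esub> s) \<in> W"
    if "finite S" "submod R M W" "S \<subseteq> W" "a \<in> S \<rightarrow> carrier R" for S W a
    using that(1,3,4)
  proof (induction S rule: finite_induct)
    case empty then show ?case using submodD(2)[OF that(2)] by simp
  next
    case (insert s S)
    have sub: "insert s S \<subseteq> carrier M" using insert.prems submodD(1)[OF that(2)] by auto
    have "(\<Oplus>\<^bsub>M\<^esub>s\<in>insert s S. a s \<odot>\<^bsub>M\<^esub> s) = a s \<odot>\<^bsub>M\<^esub> s \<oplus>\<^bsub>M\<^esub> (\<Oplus>\<^bsub>M\<^esub>s\<in>S. a s \<odot>\<^bsub>M\<^esub> s)"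
      using insert sub by (intro M.M.finsum_insert) (auto intro!: M.smult_closed)
    then show ?case using insert submodD[OF that(2)] by auto
  qed
  show ?thesis
  proof
    assume "fin_gen R M"
    then obtain S where S: "finite S" "S \<subseteq> carrier M"
      "\<forall>m\<in>carrier M. \<exists>a\<in>S \<rightarrow> carrier R. m = (\<Oplus>\<^bsub>M\<^esub>s\<in>S. a s \<odot>\<^bsub>M\<^esub> s)"
      by (auto simp: fin_gen_def)
    then have "gens R M S" by (auto simp: gens_def) (metis lc)
    then show "\<exists>S. finite S \<and> gens R M S" using S by blast
  next
    assume "\<exists>S. finite S \<and> gens R M S"
    then obtain S where S: "finite S" "gens R M S" by blast
    then have SM: "S \<subseteq> carrier M" by (auto simp: gens_def)
    let ?W = "{m. \<exists>a\<in>S \<rightarrow> carrier R. m = (\<Oplus>\<^bsub>M\<^esub>s\<in>S. a s \<odot>\<^bsub>M\<^esub> s)}"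
    have cl: "a \<in> S \<rightarrow> carrier R \<Longrightarrow> (\<lambda>s. a s \<odot>\<^bsub>M\<^esub> s) \<in> S \<rightarrow> carrier M" for a
      using SM by (auto intro!: M.smult_closed)
    have "submod R M ?W"
    proof (rule submodI)
      show "?W \<subseteq> carrier M" using cl by (auto intro!: M.M.finsum_closed)
      have "(\<Oplus>\<^bsub>M\<^esub>s\<in>S. \<zero>\<^bsub>R\<^esub> \<odot>\<^bsub>M\<^esub> s) = \<zero>\<^bsub>M\<^esub>"
        using M.M.finsum_cong'[of S S "\<lambda>_. \<zero>\<^bsub>M\<^esub>" "\<lambda>s. \<zero>\<^bsub>R\<^esub> \<odot>\<^bsub>M\<^esub> s"] SM by (auto simp: M.M.finsum_zero subset_iff)
      then show "\<zero>\<^bsub>M\<^esub> \<in> ?W" by (auto intro!: bexI[of _ "\<lambda>_. \<zero>\<^bsub>R\<^esub>"])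
    next
      fix x y assume "x \<in> ?W" "y \<in> ?W"
      then obtain a b where ab: "a \<in> S \<rightarrow> carrier R" "b \<in> S \<rightarrow> carrier R"
        "x = (\<Oplus>\<^bsub>M\<^esub>s\<in>S. a s \<odot>\<^bsub>M\<^esub> s)" "y = (\<Oplus>\<^bsub>M\<^esub>s\<in>S. b s \<odot>\<^bsub>M\<^esub> s)" by blast
      have "x \<oplus>\<^bsub>M\<^esub> y = (\<Oplus>\<^bsub>M\<^esub>s\<in>S. a s \<odot>\<^bsub>M\<^esub> s \<oplus>\<^bsub>M\<^esub> b s \<odot>\<^bsub>M\<^esub> s)"
        unfolding ab by (rule M.M.finsum_addf[symmetric]) (use cl ab in auto)
      also have "\<dots> = (\<Oplus>\<^bsub>M\<^esub>s\<in>S. (a s \<oplus>\<^bsub>R\<^esub> b s) \<odot>\<^bsub>M\<^esub> s)"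
        using ab SM by (intro M.M.finsum_cong') (auto intro!: M.smult_closed M.smult_l_distr[symmetric])
      finally show "x \<oplus>\<^bsub>M\<^esub> y \<in> ?W" using ab by (auto intro!: bexI[of _ "\<lambda>s. a s \<oplus>\<^bsub>R\<^esub> b s"])
    next
      fix c x assume c: "c \<in> carrier R" and "x \<in> ?W"
      then obtain a where a: "a \<in> S \<rightarrow> carrier R" "x = (\<Oplus>\<^bsub>M\<^esub>s\<in>S. a s \<odot>\<^bsub>M\<^esub> s)" by blast
      have "U \<subseteq> S \<Longrightarrow> c \<odot>\<^bsub>M\<^esub> (\<Oplus>\<^bsub>M\<^esub>s\<in>U. a s \<odot>\<^bsub>M\<^esub> s) = (\<Oplus>\<^bsub>M\<^esub>s\<in>U. (c \<otimes>\<^bsub>R\<^esub> a s) \<odot>\<^bsub>M\<^esub> s)" if "finite U" for U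
        using that
      proof (induction U rule: finite_induct)
        case (insert u U)
        have *: "u \<in> carrier M" "a u \<in> carrier R" "U \<subseteq> carrier M" "\<And>s. s \<in> U \<Longrightarrow> a s \<in> carrier R"
          using insert.prems SM a(1) by auto
        have "(\<Oplus>\<^bsub>M\<^esub>s\<in>U. a s \<odot>\<^bsub>M\<^esub> s) \<in> carrier M"
          by (rule M.M.finsum_closed) (use * in \<open>auto intro!: M.smult_closed\<close>)
        moreover have "(\<Oplus>\<^bsub>M\<^esub>s\<in>insert u U. a s \<odot>\<^bsub>M\<^esub> s) = a u \<odot>\<^bsub>M\<^esub> u \<oplus>\<^bsub>M\<^esub> (\<Oplus>\<^bsub>M\<^esub>s\<in>U. a s \<odot>\<^bsub>M\<^esub> s)"
          by (rule M.M.finsum_insert) (use * insert in \<open>auto intro!: M.smult_closed\<close>)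
        moreover have "(\<Oplus>\<^bsub>M\<^esub>s\<in>insert u U. (c \<otimes>\<^bsub>R\<^esub> a s) \<odot>\<^bsub>M\<^esub> s) = (c \<otimes>\<^bsub>R\<^esub> a u) \<odot>\<^bsub>M\<^esub> u \<oplus>\<^bsub>M\<^esub> (\<Oplus>\<^bsub>M\<^esub>s\<in>U. (c \<otimes>\<^bsub>R\<^esub> a s) \<odot>\<^bsub>M\<^esub> s)"
          by (rule M.M.finsum_insert) (use * insert c in \<open>auto intro!: M.smult_closed\<close>)
        ultimately show ?case
          using insert * c by (simp add: M.smult_r_distr M.smult_closed M.smult_assoc1)
      qed (use c in simp)
      from this[OF S(1)] a show "c \<odot>\<^bsub>M\<^esub> x \<in> ?W"
        using c by (auto intro!: bexI[of _ "\<lambda>s. c \<otimes>\<^bsub>R\<^esub> a s"])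
    qed
    moreover have "S \<subseteq> ?W"
    proof
      fix t assume t: "t \<in> S"
      let ?a = "\<lambda>s. if s = t then \<one>\<^bsub>R\<^esub> else \<zero>\<^bsub>R\<^esub>"
      have "(\<Oplus>\<^bsub>M\<^esub>s\<in>S. ?a s \<odot>\<^bsub>M\<^esub> s) = (\<Oplus>\<^bsub>M\<^esub>s\<in>S. if t = s then s else \<zero>\<^bsub>M\<^esub>)"
        using SM by (intro M.M.finsum_cong') (auto simp: M.smult_one)
      also have "\<dots> = t" using t S SM by (intro M.M.finsum_singleton) auto
      finally show "t \<in> ?W" using t by (auto intro!: bexI[of _ ?a])
    qed
    ultimately have "carrier M \<subseteq> ?W" using S(2) by (auto simp: gens_def)
    then show "fin_gen R M" unfolding fin_gen_def using S SM by blast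
  qed
qed

lemma fg_moduleD: "fg_module R M \<Longrightarrow> left_module R M"
  by (simp add: fg_module_def)

lemma gens_image:
  assumes "lin R M N f" "left_module R M" "left_module R N" "gens R M S" "f ` carrier M = carrier N"
  shows "gens R N (f ` S)"
  unfolding gens_def
proof (intro conjI allI impI subsetI)
  fix x assume "x \<in> f ` S" then show "x \<in> carrier N"
    using assms by (auto simp: gens_def)
next
  fix W y assume W: "submod R N W" "f ` S \<subseteq> W" and y: "y \<in> carrier N"
  then obtain x where x: "x \<in> carrier M" "y = f x" using assms(5) by blast
  have "x \<in> {x \<in> carrier M. f x \<in> W}"
    using assms(4) W x by (intro gensD[OF assms(4) submod_vimage[OF assms(1-3) W(1)]]) (auto simp: gens_def)
  then show "y \<in> W" using x by auto
qed

lemma fg_surj: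
  assumes "lin R M N f" "fg_module R M" "left_module R N" "f ` carrier M = carrier N"
  shows "fg_module R N"
proof -
  have M: "left_module R M" using assms(2) by (rule fg_moduleD)
  obtain S where "finite S" "gens R M S" using assms(2) M by (auto simp: fg_module_def fin_gen_iff)
  then have "finite (f ` S)" "gens R N (f ` S)" using gens_image[OF assms(1) M assms(3) _ assms(4)] by auto
  then show ?thesis using assms(3) by (auto simp: fg_module_def fin_gen_iff)
qed

section \<open>Short exact sequences\<close>

definition ses :: "('r, 'z) ring_scheme \<Rightarrow> ('r, 'l) module \<Rightarrow> ('l \<Rightarrow> 'm) \<Rightarrow> ('r, 'm) module \<Rightarrow> ('m \<Rightarrow> 'n) \<Rightarrow> ('r, 'n) module \<Rightarrow> bool" where
  "ses R L i M p N \<longleftrightarrow> fg_module R L \<and> fg_module R M \<and> fg_module R N \<and> lin R L M i \<and> lin R M N p \<and>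
     inj_on i (carrier L) \<and> p ` carrier M = carrier N \<and> (\<forall>x\<in>carrier M. p x = \<zero>\<^bsub>N\<^esub> \<longleftrightarrow> x \<in> i ` carrier L)"

lemma sesD:
  assumes "ses R L i M p N"
  shows "fg_module R L" "fg_module R M" "fg_module R N" "left_module R L" "left_module R M" "left_module R N"
    "lin R L M i" "lin R M N p" "inj_on i (carrier L)" "p ` carrier M = carrier N"
    "\<And>x. x \<in> carrier M \<Longrightarrow> p x = \<zero>\<^bsub>N\<^esub> \<Longrightarrow> \<exists>y\<in>carrier L. x = i y"
    "\<And>y. y \<in> carrier L \<Longrightarrow> p (i y) = \<zero>\<^bsub>N\<^esub>"
    "\<And>y. y \<in> carrier N \<Longrightarrow> \<exists>x\<in>carrier M. p x = y"
  using assms by (auto simp: ses_def fg_module_def lin_closed) (metis image_iff)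

text \<open>Exactness places the values of \<open>f\<close> in the image of \<open>i\<close>, where
  \<open>i\<close> can be inverted; linearity of the result is checked after applying the injection
  \<open>i\<close>.\<close>

lemma ses_lift:
  assumes "ses R L i M p N" "left_module R X" "lin R X M f" "\<And>x. x \<in> carrier X \<Longrightarrow> p (f x) = \<zero>\<^bsub>N\<^esub>"
  obtains g where "lin R X L g" "\<And>x. x \<in> carrier X \<Longrightarrow> i (g x) = f x"
proof -
  note s = sesD[OF assms(1)]
  interpret L: left_module R L by (rule s)
  interpret X: left_module R X by fact
  let ?g = "\<lambda>x. inv_into (carrier L) i (f x)"
  have fx: "f x \<in> i ` carrier L" if "x \<in> carrier X" for x
    using s(11)[OF lin_closed[OF assms(3) that] assms(4)[OF that]] by auto
  have g: "?g x \<in> carrier L" "i (?g x) = f x" if "x \<in> carrier X" for x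
    using fx[OF that] by (auto intro: inv_into_into f_inv_into_f)
  have eq: "u = v" if "i u = i v" "u \<in> carrier L" "v \<in> carrier L" for u v
    using s(9) that by (auto dest: inj_onD)
  have "lin R X L ?g"
  proof (rule linI)
    fix x y assume xy: "x \<in> carrier X" "y \<in> carrier X"
    have "i (?g (x \<oplus>\<^bsub>X\<^esub> y)) = f x \<oplus>\<^bsub>M\<^esub> f y" using xy g(2)[of "x \<oplus>\<^bsub>X\<^esub> y"] lin_add[OF assms(3)] by simp
    moreover have "i (?g x \<oplus>\<^bsub>L\<^esub> ?g y) = f x \<oplus>\<^bsub>M\<^esub> f y" using lin_add[OF s(7) g(1) g(1)] xy g(2) by simp
    ultimately show "?g (x \<oplus>\<^bsub>X\<^esub> y) = ?g x \<oplus>\<^bsub>L\<^esub> ?g y"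
      by (intro eq g(1) L.M.a_closed X.M.a_closed xy) simp
  next
    fix a x assume ax: "a \<in> carrier R" "x \<in> carrier X"
    have "i (?g (a \<odot>\<^bsub>X\<^esub> x)) = a \<odot>\<^bsub>M\<^esub> f x" using ax g(2)[of "a \<odot>\<^bsub>X\<^esub> x"] lin_smult[OF assms(3)] X.smult_closed by simp
    moreover have "i (a \<odot>\<^bsub>L\<^esub> ?g x) = a \<odot>\<^bsub>M\<^esub> f x" using lin_smult[OF s(7) ax(1) g(1)] ax g(2) by simp
    ultimately show "?g (a \<odot>\<^bsub>X\<^esub> x) = a \<odot>\<^bsub>L\<^esub> ?g x"
      by (intro eq g(1) L.smult_closed X.smult_closed ax) simp
  qed (rule g(1))
  then show thesis using g that by blast
qed

text \<open>Exactness makes \<open>f\<close> constant on the fibres of \<open>p\<close>, so an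
  arbitrary choice of preimages under \<open>p\<close> yields a linear map.\<close>

lemma ses_factor:
  assumes "ses R L i M p N" "left_module R X" "lin R M X f" "\<And>x. x \<in> carrier L \<Longrightarrow> f (i x) = \<zero>\<^bsub>X\<^esub>"
  obtains g where "lin R N X g" "\<And>x. x \<in> carrier M \<Longrightarrow> g (p x) = f x"
proof -
  note s = sesD[OF assms(1)]
  interpret M: left_module R M by (rule s)
  interpret N: left_module R N by (rule s)
  interpret X: left_module R X by fact
  define h where "h y = (SOME x. x \<in> carrier M \<and> p x = y)" for y
  have h: "h y \<in> carrier M" "p (h y) = y" if "y \<in> carrier N" for y
    using someI_ex[of "\<lambda>x. x \<in> carrier M \<and> p x = y"] s(13)[OF that] by (auto simp: h_def)
  have eq: "f u = f v" if uv: "p u = p v" "u \<in> carrier M" "v \<in> carrier M" for u v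
  proof -
    have "p (u \<ominus>\<^bsub>M\<^esub> v) = \<zero>\<^bsub>N\<^esub>"
      using lin_diff[OF s(8) s(5,6) that(2,3)] N.diff_eq_zero_iff[OF lin_closed[OF s(8)] lin_closed[OF s(8)]] that by simp
    then obtain y where "y \<in> carrier L" "u \<ominus>\<^bsub>M\<^esub> v = i y" using s(11)[of "u \<ominus>\<^bsub>M\<^esub> v"] uv by auto
    then have "f (u \<ominus>\<^bsub>M\<^esub> v) = \<zero>\<^bsub>X\<^esub>" using assms(4) by simp
    then show ?thesis
      using lin_diff[OF assms(3) s(5) assms(2) uv(2,3)]
        X.diff_eq_zero_iff[OF lin_closed[OF assms(3) uv(2)] lin_closed[OF assms(3) uv(3)]] by simp
  qed
  have "f (h (p x)) = f x" if "x \<in> carrier M" for x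
    by (rule eq) (use h lin_closed[OF s(8) that] that in auto)
  moreover have "lin R N X (\<lambda>y. f (h y))"
  proof (rule linI)
    fix x y assume xy: "x \<in> carrier N" "y \<in> carrier N"
    have "f (h (x \<oplus>\<^bsub>N\<^esub> y)) = f (h x \<oplus>\<^bsub>M\<^esub> h y)"
      by (intro eq) (simp_all add: xy h lin_add[OF s(8)])
    then show "f (h (x \<oplus>\<^bsub>N\<^esub> y)) = f (h x) \<oplus>\<^bsub>X\<^esub> f (h y)"
      using lin_add[OF assms(3) h(1) h(1)] xy by simp
  next
    fix a x assume ax: "a \<in> carrier R" "x \<in> carrier N"
    have "f (h (a \<odot>\<^bsub>N\<^esub> x)) = f (a \<odot>\<^bsub>M\<^esub> h x)"
      by (intro eq) (simp_all add: ax h N.smult_closed M.smult_closed lin_smult[OF s(8)])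
    then show "f (h (a \<odot>\<^bsub>N\<^esub> x)) = a \<odot>\<^bsub>X\<^esub> f (h x)"
      using lin_smult[OF assms(3) ax(1) h(1)] ax by simp
  qed (simp add: lin_closed[OF assms(3)] h)
  ultimately show thesis using that by blast
qed

lemma ses_kernel:
  assumes "lin R M N p" "fg_module R M" "fg_module R N" "p ` carrier M = carrier N"
    and "fg_module R (sub M {x \<in> carrier M. p x = \<zero>\<^bsub>N\<^esub>})"
  shows "ses R (sub M {x \<in> carrier M. p x = \<zero>\<^bsub>N\<^esub>}) (\<lambda>x. x) M p N"
  using assms by (auto simp: ses_def intro: lin_sub_incl)

text \<open>The isomorphism at the left end points into the old sequence and the other two point out
  of it, which makes both new maps plain composites. Being a left inverse of the bijection
  \<open>b\<close>, \<open>b'\<close> is its inverse.\<close>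

lemma ses_iso:
  assumes "ses R L i M p N" "fg_module R L'" "fg_module R M'" "fg_module R N'"
    and a: "lin R L' L a" "bij_betw a (carrier L') (carrier L)"
    and b: "lin R M M' b" "bij_betw b (carrier M) (carrier M')"
    and b': "lin R M' M b'" "\<And>x. x \<in> carrier M \<Longrightarrow> b' (b x) = x"
    and c: "lin R N N' c" "bij_betw c (carrier N) (carrier N')"
  shows "ses R L' (\<lambda>x. b (i (a x))) M' (\<lambda>x. c (p (b' x))) N'"
proof -
  note s = sesD[OF assms(1)]
  have L': "left_module R L'" "left_module R M'" "left_module R N'" using assms fg_moduleD by auto
  have b'b: "b' ` carrier M' = carrier M"
  proof
    show "b' ` carrier M' \<subseteq> carrier M" using lin_closed[OF b'(1)] by auto
    show "carrier M \<subseteq> b' ` carrier M'"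
    proof
      fix x assume "x \<in> carrier M"
      then show "x \<in> b' ` carrier M'" using b'(2) lin_closed[OF b(1)] by (intro image_eqI[of _ _ "b x"]) auto
    qed
  qed
  have im: "(\<lambda>x. b (i (a x))) ` carrier L' = b ` i ` carrier L"
  proof -
    have "(\<lambda>x. b (i (a x))) ` carrier L' = b ` i ` a ` carrier L'" by (simp only: image_image)
    then show ?thesis using a(2) by (simp only: bij_betw_def)
  qed
  have inj: "inj_on (\<lambda>x. b (i (a x))) (carrier L')"
  proof (rule inj_onI)
    fix x y assume xy: "x \<in> carrier L'" "y \<in> carrier L'" and e: "b (i (a x)) = b (i (a y))"
    note ca = lin_closed[OF a(1) xy(1)] lin_closed[OF a(1) xy(2)]
    have "i (a x) = i (a y)"
      using inj_onD[OF bij_betw_imp_inj_on[OF b(2)] e] ca lin_closed[OF s(7)] by simp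
    then have "a x = a y" by (rule inj_onD[OF s(9)]) (rule ca)+
    then show "x = y" by (rule inj_onD[OF bij_betw_imp_inj_on[OF a(2)]]) (rule xy)+
  qed
  have surj: "(\<lambda>x. c (p (b' x))) ` carrier M' = carrier N'"
  proof -
    have "(\<lambda>x. c (p (b' x))) ` carrier M' = c ` p ` b' ` carrier M'" by (simp only: image_image)
    then show ?thesis using b'b s(10) c(2) by (simp only: bij_betw_def)
  qed
  have ex: "(c (p (b' x)) = \<zero>\<^bsub>N'\<^esub>) = (x \<in> (\<lambda>x. b (i (a x))) ` carrier L')" if x: "x \<in> carrier M'" for x
  proof -
    obtain y where y: "y \<in> carrier M" "x = b y" using x b by (auto simp: bij_betw_def)
    have inj_c: "\<forall>x\<in>carrier N. c x = \<zero>\<^bsub>N'\<^esub> \<longrightarrow> x = \<zero>\<^bsub>N\<^esub>"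
      using c(2) lin_inj_iff[OF c(1) s(6) L'(3)] by (simp add: bij_betw_def)
    have "c (p (b' x)) = \<zero>\<^bsub>N'\<^esub> \<longleftrightarrow> p y = \<zero>\<^bsub>N\<^esub>"
      using y b'(2)[OF y(1)] lin_zero[OF c(1) s(6) L'(3)] inj_c lin_closed[OF s(8) y(1)] by auto
    also have "\<dots> \<longleftrightarrow> y \<in> i ` carrier L" using assms(1) y by (auto simp: ses_def)
    also have "\<dots> \<longleftrightarrow> x \<in> b ` i ` carrier L"
    proof
      assume "x \<in> b ` i ` carrier L"
      then obtain l where l: "l \<in> carrier L" "b y = b (i l)" using y by auto
      then have "y = i l" using inj_onD[OF bij_betw_imp_inj_on[OF b(2)] l(2) y(1)] lin_closed[OF s(7)] by simp
      then show "y \<in> i ` carrier L" using l by auto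
    qed (use y in auto)
    finally show ?thesis unfolding im .
  qed
  have "lin R L' M' (\<lambda>x. b (i (a x)))" "lin R M' N' (\<lambda>x. c (p (b' x)))"
    using lin_comp[OF lin_comp[OF a(1) s(7)] b(1)] lin_comp[OF lin_comp[OF b'(1) s(8)] c(1)] .
  with assms(2-4) inj surj ex show ?thesis
    unfolding ses_def by blast
qed

text \<open>Each module law is checked on elements \<open>f u\<close>, where it is the image of the
  law in \<open>M\<close>. \<open>N\<close> is not yet known to be a group, so that \<open>f\<close>
  preserves zero has to be assumed. This gives the module structure on a transported carrier in
  \<open>copy_exists\<close>.\<close>

lemma left_module_surj:
  assumes "left_module R M" "lin R M N f" "f ` carrier M = carrier N" "f \<zero>\<^bsub>M\<^esub> = \<zero>\<^bsub>N\<^esub>"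
  shows "left_module R N"
proof -
  interpret M: left_module R M by fact
  have cl: "f u \<in> carrier N" if "u \<in> carrier M" for u
    using that by (rule lin_closed[OF assms(2)])
  have ad: "f u \<oplus>\<^bsub>N\<^esub> f v = f (u \<oplus>\<^bsub>M\<^esub> v)" if "u \<in> carrier M" "v \<in> carrier M" for u v
    using that by (rule lin_add[OF assms(2), symmetric])
  have sm: "a \<odot>\<^bsub>N\<^esub> f u = f (a \<odot>\<^bsub>M\<^esub> u)" if "a \<in> carrier R" "u \<in> carrier M" for a u
    using that by (rule lin_smult[OF assms(2), symmetric])
  have im: "\<forall>y\<in>carrier N. P y" if "\<forall>u\<in>carrier M. P (f u)" for P
    using that unfolding assms(3)[symmetric] by simp
  note rules = cl ad sm M.M.a_closed M.smult_closed
  have g: "\<forall>x\<in>carrier N. \<forall>y\<in>carrier N. x \<oplus>\<^bsub>N\<^esub> y \<in> carrier N"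
    "\<forall>x\<in>carrier N. \<forall>y\<in>carrier N. \<forall>z\<in>carrier N. x \<oplus>\<^bsub>N\<^esub> y \<oplus>\<^bsub>N\<^esub> z = x \<oplus>\<^bsub>N\<^esub> (y \<oplus>\<^bsub>N\<^esub> z)"
    "\<forall>x\<in>carrier N. \<zero>\<^bsub>N\<^esub> \<oplus>\<^bsub>N\<^esub> x = x"
    unfolding assms(4)[symmetric]
    by (intro im ballI; simp only: rules M.M.a_assoc M.M.l_zero M.M.zero_closed)+
  have z: "\<zero>\<^bsub>N\<^esub> \<in> carrier N"
    unfolding assms(4)[symmetric] by (rule cl) simp
  have c: "\<forall>x\<in>carrier N. \<forall>y\<in>carrier N. x \<oplus>\<^bsub>N\<^esub> y = y \<oplus>\<^bsub>N\<^esub> x"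
    by (intro im ballI) (simp only: ad M.M.a_comm)
  have i: "\<forall>x\<in>carrier N. \<exists>y\<in>carrier N. y \<oplus>\<^bsub>N\<^esub> x = \<zero>\<^bsub>N\<^esub>"
    unfolding assms(4)[symmetric]
  proof (intro im ballI)
    fix u assume u: "u \<in> carrier M"
    then show "\<exists>y\<in>carrier N. y \<oplus>\<^bsub>N\<^esub> f u = f \<zero>\<^bsub>M\<^esub>"
      by (intro bexI[of _ "f (\<ominus>\<^bsub>M\<^esub> u)"]) (simp_all only: rules M.M.l_neg M.M.a_inv_closed)
  qed
  have s: "\<forall>a\<in>carrier R. \<forall>x\<in>carrier N. a \<odot>\<^bsub>N\<^esub> x \<in> carrier N"
    "\<forall>a\<in>carrier R. \<forall>b\<in>carrier R. \<forall>x\<in>carrier N. (a \<oplus>\<^bsub>R\<^esub> b) \<odot>\<^bsub>N\<^esub> x = a \<odot>\<^bsub>N\<^esub> x \<oplus>\<^bsub>N\<^esub> b \<odot>\<^bsub>N\<^esub> x"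
    "\<forall>a\<in>carrier R. \<forall>b\<in>carrier R. \<forall>x\<in>carrier N. (a \<otimes>\<^bsub>R\<^esub> b) \<odot>\<^bsub>N\<^esub> x = a \<odot>\<^bsub>N\<^esub> (b \<odot>\<^bsub>N\<^esub> x)"
    "\<forall>a\<in>carrier R. \<forall>x\<in>carrier N. \<forall>y\<in>carrier N. a \<odot>\<^bsub>N\<^esub> (x \<oplus>\<^bsub>N\<^esub> y) = a \<odot>\<^bsub>N\<^esub> x \<oplus>\<^bsub>N\<^esub> a \<odot>\<^bsub>N\<^esub> y"
    "\<forall>x\<in>carrier N. \<one>\<^bsub>R\<^esub> \<odot>\<^bsub>N\<^esub> x = x"
    by (intro im ballI; simp only: rules M.smult_l_distr M.smult_r_distr M.smult_assoc1 M.smult_one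
        M.R.a_closed M.R.m_closed M.R.one_closed)+
  show ?thesis
    by (intro left_moduleI abelian_groupI M.R.ring_axioms; ((rule c[rule_format], assumption+) | simp only: g z s i))
qed

section \<open>The regular module, restriction of scalars and the opposite algebra\<close>

lemma left_module_regular: "ring R \<Longrightarrow> left_module R (regular R)"
proof -
  assume "ring R"
  then interpret R: ring R .
  show ?thesis
    by (rule left_moduleI)
      (auto simp: regular_def R.l_distr R.r_distr R.m_assoc R.a_ac R.ring_axioms
        intro!: abelian_groupI R.l_neg bexI[of _ "\<ominus>\<^bsub>R\<^esub> _"])
qed

lemma regular_simps [simp]:
  "carrier (regular R) = carrier R" "monoid.mult (regular R) = monoid.mult R" "one (regular R) = one R"
  "ring.zero (regular R) = ring.zero R" "ring.add (regular R) = ring.add R" "smult (regular R) = monoid.mult R"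
  by (simp_all add: regular_def)

lemma scalar_restriction_simps [simp]:
  "carrier (scalar_restriction A M) = carrier M" "ring.zero (scalar_restriction A M) = ring.zero M"
  "ring.add (scalar_restriction A M) = ring.add M"
  "c \<odot>\<^bsub>scalar_restriction A M\<^esub> m = (c \<odot>\<^bsub>A\<^esub> \<one>\<^bsub>A\<^esub>) \<odot>\<^bsub>M\<^esub> m"
  by (simp_all add: scalar_restriction_def)

lemma opp_simps [simp]:
  "carrier (opp A) = carrier A" "ring.zero (opp A) = ring.zero A" "ring.add (opp A) = ring.add A"
  "one (opp A) = one A" "smult (opp A) = smult A" "x \<otimes>\<^bsub>opp A\<^esub> y = y \<otimes>\<^bsub>A\<^esub> x" "opp (opp A) = A"
  by (simp_all add: opp_def)

text \<open>An element is recovered from a choice of its coefficients with respect to a finite list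
  of generators; the coefficient sequence is continued by zeros.\<close>

lemma fin_gen_embedding:
  fixes M :: "('r, 'm) module"
  assumes "left_module R M" "fin_gen R M"
  obtains j :: "'m \<Rightarrow> nat \<Rightarrow> 'r" where "inj_on j (carrier M)" "\<And>m i. m \<in> carrier M \<Longrightarrow> j m i \<in> carrier R"
proof -
  interpret M: left_module R M by fact
  obtain S where S: "finite S" "S \<subseteq> carrier M"
    and gen: "\<forall>m\<in>carrier M. \<exists>a\<in>S \<rightarrow> carrier R. m = (\<Oplus>\<^bsub>M\<^esub>s\<in>S. a s \<odot>\<^bsub>M\<^esub> s)"
    using assms(2) by (auto simp: fin_gen_def)
  obtain xs where xs: "set xs = S" using S finite_list by blast
  define a where "a m = (SOME a. a \<in> S \<rightarrow> carrier R \<and> m = (\<Oplus>\<^bsub>M\<^esub>s\<in>S. a s \<odot>\<^bsub>M\<^esub> s))" for m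
  have a: "a m \<in> S \<rightarrow> carrier R" "m = (\<Oplus>\<^bsub>M\<^esub>s\<in>S. a m s \<odot>\<^bsub>M\<^esub> s)" if "m \<in> carrier M" for m
    using someI_ex[of "\<lambda>a. a \<in> S \<rightarrow> carrier R \<and> m = (\<Oplus>\<^bsub>M\<^esub>s\<in>S. a s \<odot>\<^bsub>M\<^esub> s)"] gen that
    unfolding a_def by blast+
  define j where "j m i = (if i < length xs then a m (xs ! i) else \<zero>\<^bsub>R\<^esub>)" for m i
  have "inj_on j (carrier M)"
  proof (rule inj_onI)
    fix m n assume mn: "m \<in> carrier M" "n \<in> carrier M" "j m = j n"
    have "a m s = a n s" if "s \<in> S" for s
    proof -
      obtain i where "i < length xs" "xs ! i = s" using \<open>s \<in> S\<close> xs by (metis in_set_conv_nth)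
      then show ?thesis using fun_cong[OF mn(3), of i] by (simp add: j_def)
    qed
    then have "(\<Oplus>\<^bsub>M\<^esub>s\<in>S. a m s \<odot>\<^bsub>M\<^esub> s) = (\<Oplus>\<^bsub>M\<^esub>s\<in>S. a n s \<odot>\<^bsub>M\<^esub> s)"
      using a(1)[OF mn(2)] S by (intro M.M.finsum_cong') (auto intro!: M.smult_closed)
    then show "m = n" using a(2) mn by metis
  qed
  moreover have "j m i \<in> carrier R" if "m \<in> carrier M" for m i
    using a(1)[OF that] xs nth_mem by (fastforce simp: j_def)
  ultimately show thesis using that by blast
qed

section \<open>Linear algebra over a field\<close>

text \<open>Scalars act on the values here, while in \<open>dual\<close> the algebra acts on the
  arguments. For a restriction of scalars the carrier is that of \<open>dual\<close>, which lets
  results of linear algebra be read there.\<close>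

definition kdual :: "'k ring \<Rightarrow> ('k, 'v) module \<Rightarrow> ('k, 'v \<Rightarrow> 'k) module" where
  "kdual K V = \<lparr>carrier = lhom K V (regular K), monoid.mult = undefined, one = undefined,
     ring.zero = (\<lambda>x\<in>carrier V. \<zero>\<^bsub>K\<^esub>), ring.add = (\<lambda>f g. \<lambda>x\<in>carrier V. f x \<oplus>\<^bsub>K\<^esub> g x),
     smult = (\<lambda>c f. \<lambda>x\<in>carrier V. c \<otimes>\<^bsub>K\<^esub> f x)\<rparr>"

lemma kdual_lin: "f \<in> carrier (kdual K V) \<longleftrightarrow> lin K V (regular K) f \<and> f \<in> extensional (carrier V)"
  by (simp add: kdual_def lhom_iff)

lemma kdual_eqI:
  assumes "f \<in> extensional (carrier V)" "g \<in> extensional (carrier V)" "\<And>x. x \<in> carrier V \<Longrightarrow> f x = g x"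
  shows "f = g"
  using assms by (rule extensionalityI)

lemma left_module_kdual:
  assumes "field K" "left_module K V"
  shows "left_module K (kdual K V)"
proof -
  interpret K: field K by fact
  interpret V: left_module K V by fact
  interpret RK: left_module K "regular K" by (rule left_module_regular) (rule K.ring_axioms)
  have cl: "x \<in> carrier V \<Longrightarrow> f x \<in> carrier K" if "f \<in> carrier (kdual K V)" for f x
    using that by (auto simp: kdual_lin dest: lin_closed)
  have ext: "f \<in> carrier (kdual K V) \<Longrightarrow> f \<in> extensional (carrier V)" for f by (simp add: kdual_lin)
  have r: "lin K V (regular K) f \<Longrightarrow> restrict f (carrier V) \<in> carrier (kdual K V)" for f
    using restrict_lhom[OF _ assms(2)] by (simp add: kdual_def)
  have z: "(\<lambda>x\<in>carrier V. \<zero>\<^bsub>K\<^esub>) \<in> carrier (kdual K V)"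
    using r[OF lin_const_zero[OF RK.left_module_axioms]] by simp
  have p: "(\<lambda>x\<in>carrier V. f x \<oplus>\<^bsub>K\<^esub> g x) \<in> carrier (kdual K V)"
    if "f \<in> carrier (kdual K V)" "g \<in> carrier (kdual K V)" for f g
  proof -
    have "lin K V (regular K) (\<lambda>x. f x \<oplus>\<^bsub>regular K\<^esub> g x)"
      using that by (intro lin_plus RK.left_module_axioms) (simp_all add: kdual_lin)
    then show ?thesis using r by simp
  qed
  have m: "(\<lambda>x\<in>carrier V. c \<otimes>\<^bsub>K\<^esub> f x) \<in> carrier (kdual K V)"
    if "f \<in> carrier (kdual K V)" "c \<in> carrier K" for f c
  proof -
    have "lin K V (regular K) f" using that by (simp add: kdual_lin)
    then have "lin K V (regular K) (\<lambda>x. c \<otimes>\<^bsub>K\<^esub> f x)"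
      using that(2) cl[OF that(1)] by (auto simp: lin_def K.r_distr K.m_lcomm)
    then show ?thesis by (rule r)
  qed
  show ?thesis
  proof (rule left_moduleI)
    show "abelian_group (kdual K V)"
    proof (rule abelian_groupI)
      fix f assume f: "f \<in> carrier (kdual K V)"
      show "\<exists>g\<in>carrier (kdual K V). g \<oplus>\<^bsub>kdual K V\<^esub> f = \<zero>\<^bsub>kdual K V\<^esub>"
        using m[OF f, of "\<ominus>\<^bsub>K\<^esub> \<one>\<^bsub>K\<^esub>"] cl[OF f]
        by (intro bexI[of _ "\<lambda>x\<in>carrier V. (\<ominus>\<^bsub>K\<^esub> \<one>\<^bsub>K\<^esub>) \<otimes>\<^bsub>K\<^esub> f x"])
          (auto simp: kdual_def K.l_minus K.l_neg cong: restrict_cong)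
      show "\<zero>\<^bsub>kdual K V\<^esub> \<oplus>\<^bsub>kdual K V\<^esub> f = f"
        using cl[OF f] ext[OF f] by (intro kdual_eqI[of _ V]) (auto simp: kdual_def)
    qed (use z p cl in \<open>auto simp: kdual_def K.a_ac cong: restrict_cong\<close>)
  next
    fix f assume f: "f \<in> carrier (kdual K V)"
    show "\<one>\<^bsub>K\<^esub> \<odot>\<^bsub>kdual K V\<^esub> f = f"
      using cl[OF f] ext[OF f] by (intro kdual_eqI[of _ V]) (auto simp: kdual_def)
  qed (use m cl K.ring_axioms in \<open>auto simp: kdual_def K.r_distr K.l_distr K.m_assoc cong: restrict_cong\<close>)
qed

text \<open>Bases are avoided by induction on a finite set \<open>S\<close> that spans
  \<open>V\<close> together with \<open>W\<close>. All claims use one splitting of a functional f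
  into f o p and a remainder, so they are proved together: p projects onto \<open>W\<close>, the
  remainder lies in every subspace containing the finite set C, and a functional h on the dual
  differs between f and f o p by evaluation at one vector m. Complements come from p; the zero
  subspace \<open>W\<close> gives finiteness and reflexivity of the dual.\<close>

lemma linear_projection_aux:
  assumes "field K" "left_module K V" "finite S"
  shows "S \<subseteq> carrier V \<longrightarrow> (\<forall>W. submod K V W \<longrightarrow> (\<forall>U. submod K V U \<longrightarrow> W \<subseteq> U \<longrightarrow> S \<subseteq> U \<longrightarrow> carrier V \<subseteq> U) \<longrightarrow>
    (\<exists>p C. lin K V V p \<and> p ` carrier V \<subseteq> W \<and> (\<forall>w\<in>W. p w = w) \<and> finite C \<and> C \<subseteq> carrier (kdual K V) \<and>
       (\<forall>G. submod K (kdual K V) G \<longrightarrow> C \<subseteq> G \<longrightarrow>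
          (\<forall>f\<in>carrier (kdual K V). \<exists>g\<in>G. \<forall>x\<in>carrier V. f x = f (p x) \<oplus>\<^bsub>K\<^esub> g x)) \<and>
       (\<forall>h. lin K (kdual K V) (regular K) h \<longrightarrow>
          (\<exists>m\<in>carrier V. \<forall>f\<in>carrier (kdual K V). h f = h (\<lambda>x\<in>carrier V. f (p x)) \<oplus>\<^bsub>K\<^esub> f m))))"
  using assms(3)
proof (induction S rule: finite_induct)
  interpret K: field K by fact
  interpret V: left_module K V by fact
  interpret D: left_module K "kdual K V" by (rule left_module_kdual) fact+
  interpret RK: left_module K "regular K" by (rule left_module_regular) (rule K.ring_axioms)
  {
    case empty
    show ?case
    proof (intro impI allI)
      fix W assume W: "submod K V W" "\<forall>U. submod K V U \<longrightarrow> W \<subseteq> U \<longrightarrow> {} \<subseteq> U \<longrightarrow> carrier V \<subseteq> U"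
      \<comment> \<open>Nothing has to be added to \<open>W\<close>, so the projection is the
        identity, every remainder is zero and m is the zero vector.\<close>
      then have WV: "W = carrier V" by (auto simp: submod_def)
      have e: "(\<lambda>x\<in>carrier V. f x) = f" if "f \<in> carrier (kdual K V)" for f
        using that by (auto simp: kdual_lin extensional_restrict)
      have zero: "(\<lambda>x\<in>carrier V. \<zero>\<^bsub>K\<^esub>) = \<zero>\<^bsub>kdual K V\<^esub>" by (simp add: kdual_def)
      have hcl: "lin K (kdual K V) (regular K) h \<Longrightarrow> f \<in> carrier (kdual K V) \<Longrightarrow> h f \<in> carrier K" for h f
        using lin_closed[of K "kdual K V" "regular K"] by simp
      have fcl: "f \<in> carrier (kdual K V) \<Longrightarrow> x \<in> carrier V \<Longrightarrow> f x \<in> carrier K" for f x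
        using lin_closed[of K V "regular K"] by (simp add: kdual_lin)
      have fz: "f \<in> carrier (kdual K V) \<Longrightarrow> f \<zero>\<^bsub>V\<^esub> = \<zero>\<^bsub>K\<^esub>" for f
        using lin_zero[of K V "regular K" f] V.left_module_axioms RK.left_module_axioms by (simp add: kdual_lin)
      have "\<exists>g\<in>G. \<forall>x\<in>carrier V. f x = f x \<oplus>\<^bsub>K\<^esub> g x"
        if "submod K (kdual K V) G" "f \<in> carrier (kdual K V)" for G f
        using submodD(2)[OF that(1)] fcl[OF that(2)]
        by (intro bexI[of _ "\<lambda>x\<in>carrier V. \<zero>\<^bsub>K\<^esub>"]) (auto simp: zero[symmetric])
      moreover have "\<exists>m\<in>carrier V. \<forall>f\<in>carrier (kdual K V). h f = h (\<lambda>x\<in>carrier V. f x) \<oplus>\<^bsub>K\<^esub> f m"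
        if "lin K (kdual K V) (regular K) h" for h
      proof (intro bexI[of _ "\<zero>\<^bsub>V\<^esub>"] ballI)
        fix f assume f: "f \<in> carrier (kdual K V)"
        show "h f = h (\<lambda>x\<in>carrier V. f x) \<oplus>\<^bsub>K\<^esub> f \<zero>\<^bsub>V\<^esub>"
          using e[OF f] fz[OF f] hcl[OF that f] by simp
      qed simp
      ultimately show "\<exists>p C. lin K V V p \<and> p ` carrier V \<subseteq> W \<and> (\<forall>w\<in>W. p w = w) \<and> finite C \<and> C \<subseteq> carrier (kdual K V) \<and>
       (\<forall>G. submod K (kdual K V) G \<longrightarrow> C \<subseteq> G \<longrightarrow>
          (\<forall>f\<in>carrier (kdual K V). \<exists>g\<in>G. \<forall>x\<in>carrier V. f x = f (p x) \<oplus>\<^bsub>K\<^esub> g x)) \<and>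
       (\<forall>h. lin K (kdual K V) (regular K) h \<longrightarrow>
          (\<exists>m\<in>carrier V. \<forall>f\<in>carrier (kdual K V). h f = h (\<lambda>x\<in>carrier V. f (p x)) \<oplus>\<^bsub>K\<^esub> f m))"
        using lin_id WV by (intro exI[of _ "\<lambda>x. x"] exI[of _ "{}"]) auto
    qed
  next
    case (insert s S)
    show ?case
    proof (intro impI allI)
      fix W assume sS: "insert s S \<subseteq> carrier V" and W: "submod K V W"
        and gen: "\<forall>U. submod K V U \<longrightarrow> W \<subseteq> U \<longrightarrow> insert s S \<subseteq> U \<longrightarrow> carrier V \<subseteq> U"
      note W' = submodD[OF W]
      have s: "s \<in> carrier V" using sS by simp
      let ?goal = "\<lambda>W. \<exists>p C. lin K V V p \<and> p ` carrier V \<subseteq> W \<and> (\<forall>w\<in>W. p w = w) \<and> finite C \<and> C \<subseteq> carrier (kdual K V) \<and>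
       (\<forall>G. submod K (kdual K V) G \<longrightarrow> C \<subseteq> G \<longrightarrow>
          (\<forall>f\<in>carrier (kdual K V). \<exists>g\<in>G. \<forall>x\<in>carrier V. f x = f (p x) \<oplus>\<^bsub>K\<^esub> g x)) \<and>
       (\<forall>h. lin K (kdual K V) (regular K) h \<longrightarrow>
          (\<exists>m\<in>carrier V. \<forall>f\<in>carrier (kdual K V). h f = h (\<lambda>x\<in>carrier V. f (p x)) \<oplus>\<^bsub>K\<^esub> f m))"
      have IH: "?goal W'" if "submod K V W'" "\<forall>U. submod K V U \<longrightarrow> W' \<subseteq> U \<longrightarrow> S \<subseteq> U \<longrightarrow> carrier V \<subseteq> U" for W'
        using insert.IH sS that by blast
      show "?goal W"
      proof (cases "s \<in> W")
        case True
        then have "\<forall>U. submod K V U \<longrightarrow> W \<subseteq> U \<longrightarrow> S \<subseteq> U \<longrightarrow> carrier V \<subseteq> U" using gen by blast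
        with W show ?thesis by (rule IH)
      next
        case False
        have WV: "w \<in> W \<Longrightarrow> w \<in> carrier V" for w using W' by auto
        \<comment> \<open>\<open>W\<close> plus the line through \<open>s\<close>, a direct sum
          because \<open>s\<close> is not in \<open>W\<close>. The induction hypothesis applies to
          it, since it spans \<open>V\<close> together with \<open>S\<close> alone.\<close>
        define W1 where "W1 = {w \<oplus>\<^bsub>V\<^esub> c \<odot>\<^bsub>V\<^esub> s | w c. w \<in> W \<and> c \<in> carrier K}"
        have W1: "submod K V W1"
        proof (rule submodI)
          show "W1 \<subseteq> carrier V" using WV s by (auto simp: W1_def V.smult_closed)
          have "\<zero>\<^bsub>V\<^esub> = \<zero>\<^bsub>V\<^esub> \<oplus>\<^bsub>V\<^esub> \<zero>\<^bsub>K\<^esub> \<odot>\<^bsub>V\<^esub> s" using s by simp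
          then show "\<zero>\<^bsub>V\<^esub> \<in> W1" using W'(2) unfolding W1_def by blast
        next
          fix x y assume "x \<in> W1" "y \<in> W1"
          then obtain w c w' c' where d: "w \<in> W" "c \<in> carrier K" "w' \<in> W" "c' \<in> carrier K"
            "x = w \<oplus>\<^bsub>V\<^esub> c \<odot>\<^bsub>V\<^esub> s" "y = w' \<oplus>\<^bsub>V\<^esub> c' \<odot>\<^bsub>V\<^esub> s" unfolding W1_def by blast
          then have "x \<oplus>\<^bsub>V\<^esub> y = (w \<oplus>\<^bsub>V\<^esub> w') \<oplus>\<^bsub>V\<^esub> (c \<oplus>\<^bsub>K\<^esub> c') \<odot>\<^bsub>V\<^esub> s"
            using WV s by (simp add: V.smult_l_distr V.add_add_swap V.smult_closed)
          then show "x \<oplus>\<^bsub>V\<^esub> y \<in> W1" using d W'(3) K.a_closed unfolding W1_def by blast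
        next
          fix a x assume a: "a \<in> carrier K" and "x \<in> W1"
          then obtain w c where d: "w \<in> W" "c \<in> carrier K" "x = w \<oplus>\<^bsub>V\<^esub> c \<odot>\<^bsub>V\<^esub> s" unfolding W1_def by blast
          then have "a \<odot>\<^bsub>V\<^esub> x = (a \<odot>\<^bsub>V\<^esub> w) \<oplus>\<^bsub>V\<^esub> (a \<otimes>\<^bsub>K\<^esub> c) \<odot>\<^bsub>V\<^esub> s"
            using WV s a by (simp add: V.smult_r_distr V.smult_closed V.smult_assoc1)
          then show "a \<odot>\<^bsub>V\<^esub> x \<in> W1" using d a W'(4) K.m_closed unfolding W1_def by blast
        qed
        have WW1: "W \<subseteq> W1"
        proof
          fix w assume "w \<in> W"
          moreover from this have "w = w \<oplus>\<^bsub>V\<^esub> \<zero>\<^bsub>K\<^esub> \<odot>\<^bsub>V\<^esub> s" using s WV by simp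
          ultimately show "w \<in> W1" unfolding W1_def by blast
        qed
        have sW1: "s \<in> W1"
        proof -
          have "s = \<zero>\<^bsub>V\<^esub> \<oplus>\<^bsub>V\<^esub> \<one>\<^bsub>K\<^esub> \<odot>\<^bsub>V\<^esub> s" using s by (simp add: V.smult_one)
          then show ?thesis using W'(2) unfolding W1_def by blast
        qed
        have uniq: "c = c' \<and> w = w'"
          if d: "w \<in> W" "c \<in> carrier K" "w' \<in> W" "c' \<in> carrier K" "w \<oplus>\<^bsub>V\<^esub> c \<odot>\<^bsub>V\<^esub> s = w' \<oplus>\<^bsub>V\<^esub> c' \<odot>\<^bsub>V\<^esub> s" for w c w' c'
        proof -
          have "(w \<oplus>\<^bsub>V\<^esub> c \<odot>\<^bsub>V\<^esub> s) \<ominus>\<^bsub>V\<^esub> (w' \<oplus>\<^bsub>V\<^esub> c' \<odot>\<^bsub>V\<^esub> s) = \<zero>\<^bsub>V\<^esub>"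
            using d WV s by (subst V.diff_eq_zero_iff) (auto simp: V.smult_closed)
          moreover have "(w \<oplus>\<^bsub>V\<^esub> c \<odot>\<^bsub>V\<^esub> s) \<ominus>\<^bsub>V\<^esub> (w' \<oplus>\<^bsub>V\<^esub> c' \<odot>\<^bsub>V\<^esub> s) = (w \<ominus>\<^bsub>V\<^esub> w') \<oplus>\<^bsub>V\<^esub> (c \<ominus>\<^bsub>K\<^esub> c') \<odot>\<^bsub>V\<^esub> s"
          proof -
            have "(c \<ominus>\<^bsub>K\<^esub> c') \<odot>\<^bsub>V\<^esub> s = c \<odot>\<^bsub>V\<^esub> s \<ominus>\<^bsub>V\<^esub> c' \<odot>\<^bsub>V\<^esub> s"
              using d(2,4) s by (simp add: K.minus_eq V.smult_l_distr V.smult_l_minus V.M.minus_eq)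
            then show ?thesis using d(1-4) WV s by (simp add: V.add_diff_swap V.smult_closed)
          qed
          ultimately have "(w \<ominus>\<^bsub>V\<^esub> w') \<oplus>\<^bsub>V\<^esub> (c \<ominus>\<^bsub>K\<^esub> c') \<odot>\<^bsub>V\<^esub> s = \<zero>\<^bsub>V\<^esub>" by simp
          then have "(c \<ominus>\<^bsub>K\<^esub> c') \<odot>\<^bsub>V\<^esub> s = \<ominus>\<^bsub>V\<^esub> (w \<ominus>\<^bsub>V\<^esub> w')"
            using d WV s V.M.minus_equality[of "(c \<ominus>\<^bsub>K\<^esub> c') \<odot>\<^bsub>V\<^esub> s" "w \<ominus>\<^bsub>V\<^esub> w'"]
            by (simp add: V.smult_closed V.M.a_comm)
          then have inW: "(c \<ominus>\<^bsub>K\<^esub> c') \<odot>\<^bsub>V\<^esub> s \<in> W"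
            using submod_neg[OF W V.left_module_axioms submod_diff[OF W V.left_module_axioms]] d by simp
          \<comment> \<open>A nonzero difference of the coefficients is a unit of the field and
            would put \<open>s\<close> into \<open>W\<close>.\<close>
          have "c = c'"
          proof (rule ccontr)
            assume "c \<noteq> c'"
            moreover have "c = c'" if "c \<ominus>\<^bsub>K\<^esub> c' = \<zero>\<^bsub>K\<^esub>"
              using that d(2,4) by (metis K.add.inv_closed K.minus_eq K.minus_equality K.minus_minus)
            ultimately have u: "c \<ominus>\<^bsub>K\<^esub> c' \<in> Units K" using d(2,4) K.field_Units by auto
            then have "s = inv\<^bsub>K\<^esub> (c \<ominus>\<^bsub>K\<^esub> c') \<odot>\<^bsub>V\<^esub> ((c \<ominus>\<^bsub>K\<^esub> c') \<odot>\<^bsub>V\<^esub> s)"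
              using s d by (simp add: V.smult_one flip: V.smult_assoc1)
            then have "s \<in> W" using W'(4)[OF K.Units_inv_closed[OF u] inW] by simp
            with False show False by simp
          qed
          moreover from this have "w = w'" using d WV s V.smult_closed by simp
          ultimately show ?thesis by simp
        qed
        have "\<exists>w c. w \<in> W \<and> c \<in> carrier K \<and> y = w \<oplus>\<^bsub>V\<^esub> c \<odot>\<^bsub>V\<^esub> s" if "y \<in> W1" for y
          using that unfolding W1_def by blast
        then obtain ww cc where dec: "\<And>y. y \<in> W1 \<Longrightarrow> ww y \<in> W \<and> cc y \<in> carrier K \<and> y = ww y \<oplus>\<^bsub>V\<^esub> cc y \<odot>\<^bsub>V\<^esub> s"
          by metis
        have dec': "cc y = c \<and> ww y = w" if "y \<in> W1" "w \<in> W" "c \<in> carrier K" "y = w \<oplus>\<^bsub>V\<^esub> c \<odot>\<^bsub>V\<^esub> s" for y w c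
          using uniq[of "ww y" "cc y" w c] dec[OF that(1)] that by metis
        have "\<forall>U. submod K V U \<longrightarrow> W1 \<subseteq> U \<longrightarrow> S \<subseteq> U \<longrightarrow> carrier V \<subseteq> U"
        proof (intro allI impI)
          fix U assume "submod K V U" "W1 \<subseteq> U" "S \<subseteq> U"
          then show "carrier V \<subseteq> U" using gen WW1 sW1 by blast
        qed
        then obtain p C where p: "lin K V V p" "p ` carrier V \<subseteq> W1" "\<And>w. w \<in> W1 \<Longrightarrow> p w = w"
          and C: "finite C" "C \<subseteq> carrier (kdual K V)"
          and CG: "\<And>G f. submod K (kdual K V) G \<Longrightarrow> C \<subseteq> G \<Longrightarrow> f \<in> carrier (kdual K V) \<Longrightarrow> \<exists>g\<in>G. \<forall>x\<in>carrier V. f x = f (p x) \<oplus>\<^bsub>K\<^esub> g x"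
          and Ch: "\<And>h. lin K (kdual K V) (regular K) h \<Longrightarrow>
            \<exists>m\<in>carrier V. \<forall>f\<in>carrier (kdual K V). h f = h (\<lambda>x\<in>carrier V. f (p x)) \<oplus>\<^bsub>K\<^esub> f m"
          using IH[OF W1] by metis
        have pW: "x \<in> carrier V \<Longrightarrow> p x \<in> W1" for x using p(2) by auto
        have W1V: "x \<in> W1 \<Longrightarrow> x \<in> carrier V" for x using W1 by (auto simp: submod_def)
        \<comment> \<open>The projection \<open>p\<close> onto \<open>W1\<close> is split further:
          \<open>q\<close> is the coefficient of \<open>s\<close>, and the component
          \<open>r\<close> in \<open>W\<close> is the new projection. The functional
          \<open>q\<close> is the one generator added to \<open>C\<close>.\<close>
        define q where "q = (\<lambda>x\<in>carrier V. cc (p x))"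
        define r where "r x = ww (p x)" for x
        have d: "r x \<in> W" "q x \<in> carrier K" "p x = r x \<oplus>\<^bsub>V\<^esub> q x \<odot>\<^bsub>V\<^esub> s" if "x \<in> carrier V" for x
          using dec[OF pW[OF that]] that by (auto simp: r_def q_def)
        have d': "q x = c \<and> r x = w" if "x \<in> carrier V" "w \<in> W" "c \<in> carrier K" "p x = w \<oplus>\<^bsub>V\<^esub> c \<odot>\<^bsub>V\<^esub> s" for x w c
          using dec'[OF pW[OF that(1)] that(2-4)] that(1) by (auto simp: r_def q_def)
        have add: "q (x \<oplus>\<^bsub>V\<^esub> y) = q x \<oplus>\<^bsub>K\<^esub> q y \<and> r (x \<oplus>\<^bsub>V\<^esub> y) = r x \<oplus>\<^bsub>V\<^esub> r y" if xy: "x \<in> carrier V" "y \<in> carrier V" for x y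
        proof (rule d')
          show "p (x \<oplus>\<^bsub>V\<^esub> y) = r x \<oplus>\<^bsub>V\<^esub> r y \<oplus>\<^bsub>V\<^esub> (q x \<oplus>\<^bsub>K\<^esub> q y) \<odot>\<^bsub>V\<^esub> s"
            unfolding lin_add[OF p(1) xy] d(3)[OF xy(1)] d(3)[OF xy(2)]
            using d(1,2)[OF xy(1)] d(1,2)[OF xy(2)] WV s by (simp add: V.smult_l_distr V.add_add_swap V.smult_closed)
        qed (use xy d W' in auto)
        have smul: "q (a \<odot>\<^bsub>V\<^esub> x) = a \<otimes>\<^bsub>K\<^esub> q x \<and> r (a \<odot>\<^bsub>V\<^esub> x) = a \<odot>\<^bsub>V\<^esub> r x" if ax: "a \<in> carrier K" "x \<in> carrier V" for a x
        proof (rule d')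
          show "p (a \<odot>\<^bsub>V\<^esub> x) = a \<odot>\<^bsub>V\<^esub> r x \<oplus>\<^bsub>V\<^esub> (a \<otimes>\<^bsub>K\<^esub> q x) \<odot>\<^bsub>V\<^esub> s"
            unfolding lin_smult[OF p(1) ax] d(3)[OF ax(2)]
            using d(1,2)[OF ax(2)] WV s ax by (simp add: V.smult_r_distr V.smult_assoc1 V.smult_closed)
        qed (use ax d W' V.smult_closed in auto)
        have r_lin: "lin K V V r" using add smul d(1) WV by (auto intro!: linI)
        have q_in: "q \<in> carrier (kdual K V)"
          unfolding kdual_lin using add smul d(2) by (auto intro!: linI simp: q_def)
        have r_id: "r w = w" if "w \<in> W" for w
        proof -
          have "p w = w \<oplus>\<^bsub>V\<^esub> \<zero>\<^bsub>K\<^esub> \<odot>\<^bsub>V\<^esub> s" using p(3) WW1 that WV s by auto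
          then show ?thesis using d'[of w w "\<zero>\<^bsub>K\<^esub>"] that WV by simp
        qed
        have fcl: "x \<in> carrier V \<Longrightarrow> f x \<in> carrier K" if "f \<in> carrier (kdual K V)" for f x
          using that lin_closed[of K V "regular K"] by (simp add: kdual_lin)
        \<comment> \<open>The splitting that drives both remaining claims: f o p is f o r plus the
          multiple f(s) of \<open>q\<close>, so the new remainder is the old one plus f(s)
          \<open>q\<close>.\<close>
        have fp: "f (p x) = f (r x) \<oplus>\<^bsub>K\<^esub> f s \<otimes>\<^bsub>K\<^esub> q x" if "f \<in> carrier (kdual K V)" "x \<in> carrier V" for f x
        proof -
          have f: "lin K V (regular K) f" using that(1) by (simp add: kdual_lin)
          have "f (p x) = f (r x) \<oplus>\<^bsub>K\<^esub> q x \<otimes>\<^bsub>K\<^esub> f s"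
            unfolding d(3)[OF that(2)]
            using lin_add[OF f WV[OF d(1)[OF that(2)]] V.smult_closed[OF d(2)[OF that(2)] s]] lin_smult[OF f d(2)[OF that(2)] s] by simp
          then show ?thesis using K.m_comm[OF d(2)[OF that(2)] fcl[OF that(1) s]] by simp
        qed
        have "\<exists>g\<in>G. \<forall>x\<in>carrier V. f x = f (r x) \<oplus>\<^bsub>K\<^esub> g x"
          if G: "submod K (kdual K V) G" "insert q C \<subseteq> G" and f: "f \<in> carrier (kdual K V)" for G f
        proof -
          obtain g where g: "g \<in> G" "\<forall>x\<in>carrier V. f x = f (p x) \<oplus>\<^bsub>K\<^esub> g x" using CG[OF G(1) _ f] G(2) by auto
          have gD: "g \<in> carrier (kdual K V)" using submodD(1)[OF G(1)] g(1) by auto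
          let ?g = "(f s \<odot>\<^bsub>kdual K V\<^esub> q) \<oplus>\<^bsub>kdual K V\<^esub> g"
          have "?g \<in> G" using submodD(3,4)[OF G(1)] g G(2) fcl[OF f s] by auto
          moreover have "f x = f (r x) \<oplus>\<^bsub>K\<^esub> ?g x" if x: "x \<in> carrier V" for x
            using g(2) fp[OF f x] x d(2)[OF x] fcl[OF gD x] fcl[OF f s] fcl[OF f WV[OF d(1)[OF x]]]
            by (simp add: kdual_def K.a_assoc)
          ultimately show ?thesis by blast
        qed
        moreover have "\<exists>m\<in>carrier V. \<forall>f\<in>carrier (kdual K V). h f = h (\<lambda>x\<in>carrier V. f (r x)) \<oplus>\<^bsub>K\<^esub> f m"
          if h: "lin K (kdual K V) (regular K) h" for h
        proof -
          obtain m where m: "m \<in> carrier V" "\<And>f. f \<in> carrier (kdual K V) \<Longrightarrow> h f = h (\<lambda>x\<in>carrier V. f (p x)) \<oplus>\<^bsub>K\<^esub> f m"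
            using Ch[OF h] by blast
          have hq: "h q \<in> carrier K" using lin_closed[OF h q_in] by simp
          \<comment> \<open>The added remainder f(s) \<open>q\<close> is sent by h to f(s) h(q),
            which is the value of f at h(q) s.\<close>
          let ?m = "h q \<odot>\<^bsub>V\<^esub> s \<oplus>\<^bsub>V\<^esub> m"
          have "h f = h (\<lambda>x\<in>carrier V. f (r x)) \<oplus>\<^bsub>K\<^esub> f ?m" if f: "f \<in> carrier (kdual K V)" for f
          proof -
            have fl: "lin K V (regular K) f" using f by (simp add: kdual_lin)
            have fr: "(\<lambda>x\<in>carrier V. f (r x)) \<in> carrier (kdual K V)"
              using restrict_lhom[OF lin_comp[OF r_lin fl] V.left_module_axioms] by (simp add: kdual_def)
            have sq: "f s \<odot>\<^bsub>kdual K V\<^esub> q \<in> carrier (kdual K V)"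
              using D.smult_closed[OF fcl[OF f s] q_in] .
            have "(\<lambda>x\<in>carrier V. f (p x)) = (\<lambda>x\<in>carrier V. f (r x)) \<oplus>\<^bsub>kdual K V\<^esub> (f s \<odot>\<^bsub>kdual K V\<^esub> q)"
              using fp[OF f] by (auto simp: kdual_def cong: restrict_cong)
            then have "h (\<lambda>x\<in>carrier V. f (p x)) = h (\<lambda>x\<in>carrier V. f (r x)) \<oplus>\<^bsub>K\<^esub> f s \<otimes>\<^bsub>K\<^esub> h q"
              using lin_add[OF h fr sq] lin_smult[OF h fcl[OF f s] q_in] by simp
            moreover have "f ?m = h q \<otimes>\<^bsub>K\<^esub> f s \<oplus>\<^bsub>K\<^esub> f m"
              using lin_add[OF fl V.smult_closed[OF hq s] m(1)] lin_smult[OF fl hq s] by simp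
            ultimately show ?thesis
              using m(2)[OF f] hq fcl[OF f s] fcl[OF f m(1)] lin_closed[OF h fr] by (simp add: K.m_comm K.a_assoc)
          qed
          then show ?thesis using m(1) hq s by (intro bexI[of _ ?m]) (auto simp: V.smult_closed)
        qed
        ultimately show ?thesis
          using r_lin d(1) r_id C q_in by (intro exI[of _ r] exI[of _ "insert q C"]) auto
      qed
    qed
  }
qed

lemma linear_projection:
  fixes K :: "'k ring"
  assumes "field K" "left_module K V" "fin_gen K V" "submod K V W"
  obtains p where "lin K V V p" "\<And>x. x \<in> carrier V \<Longrightarrow> p x \<in> W" "\<And>w. w \<in> W \<Longrightarrow> p w = w"
proof -
  obtain S where S: "finite S" "gens K V S" using assms(2,3) by (auto simp: fin_gen_iff)
  then have g: "S \<subseteq> carrier V" "\<forall>U. submod K V U \<longrightarrow> W \<subseteq> U \<longrightarrow> S \<subseteq> U \<longrightarrow> carrier V \<subseteq> U" by (auto simp: gens_def)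
  then obtain p where p: "lin K V V p" "p ` carrier V \<subseteq> W" "\<forall>w\<in>W. p w = w"
    using linear_projection_aux[OF assms(1,2) S(1), THEN mp, OF g(1), THEN spec[of _ W], THEN mp, OF assms(4), THEN mp, OF g(2)]
    by (elim exE conjE) (rule that)
  then show thesis by (intro that[of p]) auto
qed

text \<open>The case of the zero subspace: f o p vanishes, so every functional is its own remainder.
  Hence the finite set \<open>C\<close> generates the dual, and h is evaluation at m.\<close>

lemma kdual_fin_gen_and_reflexive:
  fixes K :: "'k ring"
  assumes "field K" "left_module K V" "fin_gen K V"
  shows "fin_gen K (kdual K V)"
    and "lin K (kdual K V) (regular K) h \<Longrightarrow> \<exists>m\<in>carrier V. \<forall>f\<in>carrier (kdual K V). h f = f m"
proof -
  interpret K: field K by fact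
  interpret V: left_module K V by fact
  interpret D: left_module K "kdual K V" by (rule left_module_kdual) fact+
  interpret RK: left_module K "regular K" by (rule left_module_regular) (rule K.ring_axioms)
  obtain S where S: "finite S" "gens K V S" using assms(2,3) by (auto simp: fin_gen_iff)
  have g: "\<forall>U. submod K V U \<longrightarrow> {\<zero>\<^bsub>V\<^esub>} \<subseteq> U \<longrightarrow> S \<subseteq> U \<longrightarrow> carrier V \<subseteq> U" "S \<subseteq> carrier V" using S by (auto simp: gens_def)
  then obtain p C where p: "p ` carrier V \<subseteq> {\<zero>\<^bsub>V\<^esub>}" and C: "finite C" "C \<subseteq> carrier (kdual K V)"
    and G: "\<forall>G. submod K (kdual K V) G \<longrightarrow> C \<subseteq> G \<longrightarrow> (\<forall>f\<in>carrier (kdual K V). \<exists>g\<in>G. \<forall>x\<in>carrier V. f x = f (p x) \<oplus>\<^bsub>K\<^esub> g x)"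
    and h: "\<forall>h. lin K (kdual K V) (regular K) h \<longrightarrow>
            (\<exists>m\<in>carrier V. \<forall>f\<in>carrier (kdual K V). h f = h (\<lambda>x\<in>carrier V. f (p x)) \<oplus>\<^bsub>K\<^esub> f m)"
    using linear_projection_aux[OF assms(1,2) S(1), THEN mp, OF g(2), THEN spec[of _ "{\<zero>\<^bsub>V\<^esub>}"], THEN mp, OF submod_zero[OF assms(2)], THEN mp, OF g(1)]
    by (elim exE conjE) (rule that)
  have p0: "p x = \<zero>\<^bsub>V\<^esub>" if "x \<in> carrier V" for x using p that by auto
  have f0: "f \<zero>\<^bsub>V\<^esub> = \<zero>\<^bsub>K\<^esub>" if "f \<in> carrier (kdual K V)" for f
    using lin_zero[OF _ V.left_module_axioms RK.left_module_axioms, of f] that by (simp add: kdual_lin)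
  have "gens K (kdual K V) C"
    unfolding gens_def
  proof (intro conjI allI impI subsetI)
    fix U f assume U: "submod K (kdual K V) U" "C \<subseteq> U" and f: "f \<in> carrier (kdual K V)"
    obtain g where g: "g \<in> U" "\<forall>x\<in>carrier V. f x = f (p x) \<oplus>\<^bsub>K\<^esub> g x" using G U f by meson
    have gD: "g \<in> carrier (kdual K V)" using submodD(1)[OF U(1)] g(1) by auto
    then have "g x \<in> carrier K" if "x \<in> carrier V" for x using lin_closed[OF _ that, of K "regular K" g] by (simp add: kdual_lin)
    then have "f = g" using f gD g(2) p0 f0[OF f] by (intro kdual_eqI[of _ V]) (auto simp: kdual_lin)
    then show "f \<in> U" using g(1) by simp
  qed (use C in auto)
  then show "fin_gen K (kdual K V)" using C(1) D.left_module_axioms by (auto simp: fin_gen_iff)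
  assume hl: "lin K (kdual K V) (regular K) h"
  obtain m where m: "m \<in> carrier V" "\<And>f. f \<in> carrier (kdual K V) \<Longrightarrow> h f = h (\<lambda>x\<in>carrier V. f (p x)) \<oplus>\<^bsub>K\<^esub> f m"
    using h hl by meson
  have "h f = f m" if f: "f \<in> carrier (kdual K V)" for f
  proof -
    have "(\<lambda>x\<in>carrier V. f (p x)) = \<zero>\<^bsub>kdual K V\<^esub>" using p0 f0[OF f] by (auto simp: kdual_def cong: restrict_cong)
    then have "h (\<lambda>x\<in>carrier V. f (p x)) = \<zero>\<^bsub>K\<^esub>" using lin_zero[OF hl D.left_module_axioms RK.left_module_axioms] by simp
    moreover have "f m \<in> carrier K" using lin_closed[OF _ m(1), of K "regular K" f] f by (simp add: kdual_lin)
    ultimately show ?thesis using m(2)[OF f] by simp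
  qed
  then show "\<exists>m\<in>carrier V. \<forall>f\<in>carrier (kdual K V). h f = f m" using m(1) by blast
qed

text \<open>A projection onto \<open>W\<close> makes \<open>W\<close> a quotient of
  \<open>V\<close>, and generators pass to quotients.\<close>

lemma fin_gen_submod:
  fixes K :: "'k ring"
  assumes "field K" "left_module K V" "fin_gen K V" "submod K V W"
  shows "fin_gen K (sub V W)"
proof -
  obtain p where p: "lin K V V p" "\<And>x. x \<in> carrier V \<Longrightarrow> p x \<in> W" "\<And>w. w \<in> W \<Longrightarrow> p w = w"
    using linear_projection[OF assms] by blast
  have "p ` carrier V = W"
  proof (intro equalityI subsetI)
    fix w assume "w \<in> W"
    then show "w \<in> p ` carrier V" using p(3) submodD(1)[OF assms(4)] by (intro image_eqI[of _ _ w]) auto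
  qed (use p(2) in auto)
  moreover have "lin K V (sub V W) p" using p by (intro lin_sub_into) auto
  ultimately have "fg_module K (sub V W)"
    using assms left_module_sub[OF assms(4,2)] fg_surj[of K V "sub V W" p] by (simp add: fg_module_def)
  then show ?thesis by (simp add: fg_module_def)
qed

lemma fin_gen_inj:
  fixes K :: "'k ring"
  assumes "field K" "lin K V W f" "inj_on f (carrier V)" "left_module K V" "left_module K W" "fin_gen K W"
  shows "fin_gen K V"
proof -
  interpret V: left_module K V by fact
  have sm: "submod K W (f ` carrier V)" by (rule submod_image[OF assms(2,4,5) submod_carrier[OF assms(4)]])
  let ?U = "sub W (f ` carrier V)"
  have U: "left_module K ?U" "fin_gen K ?U"
    using left_module_sub[OF sm assms(5)] fin_gen_submod[OF assms(1,5,6) sm] by auto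
  have l: "lin K V ?U f" by (rule lin_sub_into[OF assms(2)]) simp
  have b: "bij_betw f (carrier V) (carrier ?U)" using assms(3) by (simp add: bij_betw_def)
  have "bij_betw (inv_into (carrier V) f) (carrier ?U) (carrier V)" using b by (rule bij_betw_inv_into)
  then have "fg_module K V"
    using U lin_inv[OF l b assms(4)] assms(4) fg_surj[OF lin_inv[OF l b assms(4)]] by (simp add: fg_module_def bij_betw_def)
  then show ?thesis by (simp add: fg_module_def)
qed

text \<open>Precompose with a projection onto \<open>W\<close>.\<close>

lemma functional_extension:
  fixes K :: "'k ring"
  assumes "field K" "left_module K V" "fin_gen K V" "submod K V W" "lin K (sub V W) (regular K) f"
  obtains g where "lin K V (regular K) g" "\<And>w. w \<in> W \<Longrightarrow> g w = f w"
proof -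
  obtain p where p: "lin K V V p" "\<And>x. x \<in> carrier V \<Longrightarrow> p x \<in> W" "\<And>w. w \<in> W \<Longrightarrow> p w = w"
    using linear_projection[OF assms(1-4)] by blast
  have "lin K V (sub V W) p" using p by (intro lin_sub_into) auto
  then show thesis using that[OF lin_comp[OF _ assms(5)]] p(3) by auto
qed

section \<open>Finite-dimensional algebras\<close>

locale fd_alg =
  fixes K :: "'k ring" and A :: "('k, 'a) module"
  assumes fd: "fd_algebra K A"
begin

lemma field_K: "field K"
  using fd by (simp add: fd_algebra_def)

lemma ring_A: "ring A"
  using fd by (simp add: fd_algebra_def)

lemma module_KA: "module K A"
  using fd by (simp add: fd_algebra_def)

sublocale K: field K by (rule field_K)
sublocale A: ring A by (rule ring_A)
sublocale KA: module K A by (rule module_KA)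

lemma left_module_KA: "left_module K A"
  using KA.smult_closed KA.smult_l_distr KA.smult_r_distr KA.smult_assoc1 KA.smult_one
  by (intro left_moduleI K.ring_axioms A.abelian_group_axioms)

lemma smult_mult: "c \<in> carrier K \<Longrightarrow> x \<in> carrier A \<Longrightarrow> y \<in> carrier A \<Longrightarrow> (c \<odot>\<^bsub>A\<^esub> x) \<otimes>\<^bsub>A\<^esub> y = c \<odot>\<^bsub>A\<^esub> (x \<otimes>\<^bsub>A\<^esub> y)"
  and mult_smult: "c \<in> carrier K \<Longrightarrow> x \<in> carrier A \<Longrightarrow> y \<in> carrier A \<Longrightarrow> x \<otimes>\<^bsub>A\<^esub> (c \<odot>\<^bsub>A\<^esub> y) = c \<odot>\<^bsub>A\<^esub> (x \<otimes>\<^bsub>A\<^esub> y)"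
  using fd unfolding fd_algebra_def by blast+

abbreviation sc where "sc c \<equiv> c \<odot>\<^bsub>A\<^esub> \<one>\<^bsub>A\<^esub>"

lemma sc_closed: "c \<in> carrier K \<Longrightarrow> sc c \<in> carrier A"
  by (rule KA.smult_closed) auto

lemma sc_mult: "c \<in> carrier K \<Longrightarrow> x \<in> carrier A \<Longrightarrow> sc c \<otimes>\<^bsub>A\<^esub> x = c \<odot>\<^bsub>A\<^esub> x"
  and mult_sc: "c \<in> carrier K \<Longrightarrow> x \<in> carrier A \<Longrightarrow> x \<otimes>\<^bsub>A\<^esub> sc c = c \<odot>\<^bsub>A\<^esub> x"
  by (simp_all add: smult_mult mult_smult)

lemma left_module_scalar:
  assumes "left_module A M"
  shows "left_module K (scalar_restriction A M)"
proof -
  interpret M: left_module A M by fact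
  have ab: "abelian_group (scalar_restriction A M)"
  proof (rule abelian_groupI)
    fix x assume "x \<in> carrier (scalar_restriction A M)"
    then show "\<exists>y\<in>carrier (scalar_restriction A M). y \<oplus>\<^bsub>scalar_restriction A M\<^esub> x = \<zero>\<^bsub>scalar_restriction A M\<^esub>"
      by (intro bexI[of _ "\<ominus>\<^bsub>M\<^esub> x"]) (simp_all add: M.M.l_neg)
  qed (simp_all add: M.M.a_ac)
  have 1: "sc (a \<oplus>\<^bsub>K\<^esub> b) = sc a \<oplus>\<^bsub>A\<^esub> sc b" if "a \<in> carrier K" "b \<in> carrier K" for a b
    using that by (simp add: KA.smult_l_distr)
  have 2: "sc (a \<otimes>\<^bsub>K\<^esub> b) = sc a \<otimes>\<^bsub>A\<^esub> sc b" if "a \<in> carrier K" "b \<in> carrier K" for a b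
    using that by (simp add: sc_mult sc_closed KA.smult_assoc1)
  have 3: "sc \<one>\<^bsub>K\<^esub> = \<one>\<^bsub>A\<^esub>" by (rule KA.smult_one) simp
  show ?thesis
    by (rule left_moduleI)
      (simp_all only: scalar_restriction_simps K.ring_axioms ab 1 2 3 sc_closed M.smult_closed M.smult_l_distr
        M.smult_r_distr M.smult_assoc1 M.smult_one)
qed

lemma lin_scalar: "lin A M N f \<Longrightarrow> lin K (scalar_restriction A M) (scalar_restriction A N) f"
  by (rule linI) (simp_all add: lin_closed lin_add lin_smult sc_closed)

lemma submod_scalar: "submod A M W \<Longrightarrow> submod K (scalar_restriction A M) W"
  unfolding submod_def by (simp add: sc_closed)

text \<open>If G generates the algebra over the field and S generates M over the algebra, the
  finitely many products a s with a in G, s in S generate M over the field. Finiteness questions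
  thereby become linear algebra.\<close>

lemma fin_gen_scalar:
  assumes "left_module A M"
  shows "fin_gen A M \<longleftrightarrow> fin_gen K (scalar_restriction A M)"
proof -
  interpret M: left_module A M by fact
  let ?KM = "scalar_restriction A M"
  have KM: "left_module K ?KM" using assms by (rule left_module_scalar)
  show ?thesis
  proof
    assume "fin_gen K ?KM"
    then obtain S where S: "finite S" "gens K ?KM S" using KM by (auto simp: fin_gen_iff)
    have "gens A M S"
      unfolding gens_def
    proof (intro conjI allI impI)
      show "S \<subseteq> carrier M" using S(2) by (simp add: gens_def)
      fix W assume "submod A M W" "S \<subseteq> W"
      then show "carrier M \<subseteq> W" using S(2) submod_scalar[of M W] by (simp add: gens_def)
    qed
    then show "fin_gen A M" using S(1) assms by (auto simp: fin_gen_iff)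
  next
    assume "fin_gen A M"
    then obtain S where S: "finite S" "gens A M S" using assms by (auto simp: fin_gen_iff)
    have "fin_gen K A" using fd by (simp add: fd_algebra_def)
    then obtain G where G: "finite G" "gens K A G" using left_module_KA by (auto simp: fin_gen_iff)
    let ?T = "(\<lambda>(a, s). a \<odot>\<^bsub>M\<^esub> s) ` (G \<times> S)"
    have SM: "S \<subseteq> carrier M" and GA: "G \<subseteq> carrier A" using S G by (auto simp: gens_def)
    have "gens K ?KM ?T"
      unfolding gens_def
    proof (intro conjI allI impI)
      show "?T \<subseteq> carrier ?KM" using SM GA by (auto intro!: M.smult_closed)
      fix W assume W: "submod K ?KM W" "?T \<subseteq> W"
      note W' = submodD[OF W(1), simplified]
      have as: "a \<odot>\<^bsub>M\<^esub> s \<in> W" if s: "s \<in> S" and a: "a \<in> carrier A" for a s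
      proof -
        have "submod K A {a \<in> carrier A. a \<odot>\<^bsub>M\<^esub> s \<in> W}"
        proof (rule submodI)
          fix c x assume c: "c \<in> carrier K" and x: "x \<in> {a \<in> carrier A. a \<odot>\<^bsub>M\<^esub> s \<in> W}"
          have "(c \<odot>\<^bsub>A\<^esub> x) \<odot>\<^bsub>M\<^esub> s = sc c \<odot>\<^bsub>M\<^esub> (x \<odot>\<^bsub>M\<^esub> s)"
            using c x s SM sc_closed by (auto simp: M.smult_assoc1[symmetric] sc_mult)
          then show "c \<odot>\<^bsub>A\<^esub> x \<in> {a \<in> carrier A. a \<odot>\<^bsub>M\<^esub> s \<in> W}"
            using x c W'(4) by (simp add: KA.smult_closed)
        qed (use s SM W' in \<open>auto simp: M.smult_l_distr subset_iff\<close>)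
        moreover have "G \<subseteq> {a \<in> carrier A. a \<odot>\<^bsub>M\<^esub> s \<in> W}" using GA W(2) s by auto
        ultimately show ?thesis using gensD[OF G(2) _ _ a] by blast
      qed
      \<comment> \<open>The largest submodule over \<open>A\<close> inside \<open>W\<close>, which
        itself is only a subspace over \<open>K\<close>. It contains \<open>S\<close>, hence
        everything.\<close>
      have "submod A M {m \<in> carrier M. \<forall>a\<in>carrier A. a \<odot>\<^bsub>M\<^esub> m \<in> W}"
      proof (rule submodI)
        fix b m assume b: "b \<in> carrier A" and "m \<in> {m \<in> carrier M. \<forall>a\<in>carrier A. a \<odot>\<^bsub>M\<^esub> m \<in> W}"
        then have m: "m \<in> carrier M" "\<And>a. a \<in> carrier A \<Longrightarrow> a \<odot>\<^bsub>M\<^esub> m \<in> W" by auto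
        have "a \<odot>\<^bsub>M\<^esub> (b \<odot>\<^bsub>M\<^esub> m) \<in> W" if "a \<in> carrier A" for a
          using m(2)[of "a \<otimes>\<^bsub>A\<^esub> b"] that b m(1) by (simp add: M.smult_assoc1)
        then show "b \<odot>\<^bsub>M\<^esub> m \<in> {m \<in> carrier M. \<forall>a\<in>carrier A. a \<odot>\<^bsub>M\<^esub> m \<in> W}"
          using b m(1) by (simp add: M.smult_closed)
      qed (use W' in \<open>auto simp: M.smult_r_distr\<close>)
      moreover have "S \<subseteq> {m \<in> carrier M. \<forall>a\<in>carrier A. a \<odot>\<^bsub>M\<^esub> m \<in> W}" using SM as by auto
      ultimately have sub: "carrier M \<subseteq> {m \<in> carrier M. \<forall>a\<in>carrier A. a \<odot>\<^bsub>M\<^esub> m \<in> W}" using S(2) by (simp add: gens_def)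
      show "carrier ?KM \<subseteq> W"
      proof
        fix m assume "m \<in> carrier ?KM"
        then have m: "m \<in> carrier M" by simp
        with sub have "\<one>\<^bsub>A\<^esub> \<odot>\<^bsub>M\<^esub> m \<in> W" by blast
        then show "m \<in> W" using m by (simp add: M.smult_one)
      qed
    qed
    moreover have "finite ?T" using S(1) G(1) by simp
    ultimately show "fin_gen K ?KM" unfolding fin_gen_iff[OF KM] by blast
  qed
qed

text \<open>Finite dimension over the field passes to subspaces; this takes the place of a
  noetherian argument.\<close>

lemma fg_sub:
  assumes "fg_module A M" "submod A M W"
  shows "fg_module A (sub M W)"
proof -
  have M: "left_module A M" using assms(1) by (rule fg_moduleD)
  have "fin_gen K (scalar_restriction A M)"
    using assms(1) fin_gen_scalar[OF M] by (simp add: fg_module_def)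
  then have "fin_gen K (sub (scalar_restriction A M) W)"
    by (rule fin_gen_submod[OF field_K left_module_scalar[OF M] _ submod_scalar[OF assms(2)]])
  moreover have "scalar_restriction A (sub M W) = sub (scalar_restriction A M) W"
    by (simp add: scalar_restriction_def)
  ultimately show ?thesis
    using left_module_sub[OF assms(2) M] fin_gen_scalar[OF left_module_sub[OF assms(2) M]] by (simp add: fg_module_def)
qed

lemma fg_kernel:
  assumes "lin A M N f" "fg_module A M" "left_module A N"
  shows "fg_module A (sub M {x \<in> carrier M. f x = \<zero>\<^bsub>N\<^esub>})"
  using assms by (intro fg_sub submod_kernel) (auto dest: fg_moduleD)

lemma kernel_ses:
  assumes "lin A M N p" "fg_module A M" "fg_module A N" "p ` carrier M = carrier N"
  shows "ses A (sub M {x \<in> carrier M. p x = \<zero>\<^bsub>N\<^esub>}) (\<lambda>x. x) M p N"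
  using assms fg_kernel[OF assms(1,2)] fg_moduleD by (intro ses_kernel) auto

end

text \<open>Up to isomorphism every module lives on the carrier type used for auxiliary modules in the definitions.\<close>

definition copy :: "('k, 'a) module \<Rightarrow> ('a, 'm) module \<Rightarrow> ('a, nat \<Rightarrow> 'k) module" where
  "copy A M = (SOME M'. fg_module A M' \<and> isomorphic A M M')"

definition copy_map :: "('k, 'a) module \<Rightarrow> ('a, 'm) module \<Rightarrow> 'm \<Rightarrow> (nat \<Rightarrow> 'k)" where
  "copy_map A M = (SOME f. lin A M (copy A M) f \<and> bij_betw f (carrier M) (carrier (copy A M)))"

definition copy_inv :: "('k, 'a) module \<Rightarrow> ('a, 'm) module \<Rightarrow> (nat \<Rightarrow> 'k) \<Rightarrow> 'm" where
  "copy_inv A M = inv_into (carrier M) (copy_map A M)"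

context fd_alg
begin

text \<open>Coordinates over the algebra, followed by coordinates of these over the field, embed the
  carrier into \<open>nat => 'k\<close>; the structure is carried along to the image.\<close>

lemma copy_exists:
  fixes M :: "('a, 'm) module"
  assumes "fg_module A M"
  shows "\<exists>M' :: ('a, nat \<Rightarrow> 'k) module. fg_module A M' \<and> isomorphic A M M'"
proof -
  have M: "left_module A M" using assms by (rule fg_moduleD)
  interpret M: left_module A M by (rule M)
  obtain jM :: "'m \<Rightarrow> nat \<Rightarrow> 'a" where jM: "inj_on jM (carrier M)" "\<And>m i. m \<in> carrier M \<Longrightarrow> jM m i \<in> carrier A"
    using fin_gen_embedding[OF M] assms by (auto simp: fg_module_def)
  have "fin_gen K A" using fd by (simp add: fd_algebra_def)
  then obtain jA :: "'a \<Rightarrow> nat \<Rightarrow> 'k" where jA: "inj_on jA (carrier A)"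
    using fin_gen_embedding[OF left_module_KA] by metis
  \<comment> \<open>\<open>prod_decode\<close> splits an index into the position of a generator of
    \<open>M\<close> and the position of a coordinate of its coefficient in
    \<open>A\<close>.\<close>
  define j where "j m n = jA (jM m (fst (prod_decode n))) (snd (prod_decode n))" for m n
  have inj: "inj_on j (carrier M)"
  proof (rule inj_onI)
    fix m m' assume m: "m \<in> carrier M" "m' \<in> carrier M" "j m = j m'"
    have "jA (jM m u) v = jA (jM m' u) v" for u v
      using fun_cong[OF m(3), of "prod_encode (u, v)"] by (simp add: j_def prod_encode_inverse)
    then have "jA (jM m u) = jA (jM m' u)" for u by (rule ext)
    then have "jM m u = jM m' u" for u using inj_onD[OF jA] jM(2) m by blast
    then have "jM m = jM m'" by (rule ext)
    then show "m = m'" using inj_onD[OF jM(1)] m by blast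
  qed
  let ?g = "inv_into (carrier M) j"
  have g: "?g (j m) = m" if "m \<in> carrier M" for m using inj that by simp
  define M' :: "('a, nat \<Rightarrow> 'k) module" where "M' = \<lparr>carrier = j ` carrier M, monoid.mult = undefined, one = undefined,
     ring.zero = j \<zero>\<^bsub>M\<^esub>, ring.add = (\<lambda>x y. j (?g x \<oplus>\<^bsub>M\<^esub> ?g y)), smult = (\<lambda>a x. j (a \<odot>\<^bsub>M\<^esub> ?g x))\<rparr>"
  have l: "lin A M M' j" by (rule linI) (simp_all add: M'_def g)
  have c: "j ` carrier M = carrier M'" by (simp add: M'_def)
  have "left_module A M'" by (rule left_module_surj[OF M l c]) (simp add: M'_def)
  then have "fg_module A M'" using fg_surj[OF l assms _ c] by blast
  moreover have "isomorphic A M M'" using isomorphic_lin[OF M] l inj c by (auto simp: bij_betw_def)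
  ultimately show ?thesis by blast
qed

lemma copy:
  assumes "fg_module A M"
  shows fg_copy: "fg_module A (copy A M)" and lin_copy_map: "lin A M (copy A M) (copy_map A M)"
    and bij_copy_map: "bij_betw (copy_map A M) (carrier M) (carrier (copy A M))"
    and lin_copy_inv: "lin A (copy A M) M (copy_inv A M)"
    and bij_copy_inv: "bij_betw (copy_inv A M) (carrier (copy A M)) (carrier M)"
    and copy_inv_copy_map: "\<And>x. x \<in> carrier M \<Longrightarrow> copy_inv A M (copy_map A M x) = x"
    and copy_map_copy_inv: "\<And>y. y \<in> carrier (copy A M) \<Longrightarrow> copy_map A M (copy_inv A M y) = y"
proof -
  have M: "left_module A M" using assms by (rule fg_moduleD)
  have 1: "fg_module A (copy A M) \<and> isomorphic A M (copy A M)"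
    unfolding copy_def by (rule someI_ex[OF copy_exists[OF assms]])
  then have "\<exists>f. lin A M (copy A M) f \<and> bij_betw f (carrier M) (carrier (copy A M))"
    using isomorphic_lin[OF M] by blast
  then have 2: "lin A M (copy A M) (copy_map A M) \<and> bij_betw (copy_map A M) (carrier M) (carrier (copy A M))"
    unfolding copy_map_def by (rule someI_ex)
  show "fg_module A (copy A M)" "lin A M (copy A M) (copy_map A M)" "bij_betw (copy_map A M) (carrier M) (carrier (copy A M))"
    using 1 2 by auto
  show "lin A (copy A M) M (copy_inv A M)" "bij_betw (copy_inv A M) (carrier (copy A M)) (carrier M)"
    unfolding copy_inv_def using 2 lin_inv[OF _ _ M] bij_betw_inv_into by auto
  show "copy_inv A M (copy_map A M x) = x" if "x \<in> carrier M" for x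
    unfolding copy_inv_def using 2 that by (simp add: bij_betw_def)
  show "copy_map A M (copy_inv A M y) = y" if "y \<in> carrier (copy A M)" for y
    unfolding copy_inv_def using 2 that by (simp add: bij_betw_def f_inv_into_f)
qed

lemma copy_map_closed: "fg_module A M \<Longrightarrow> x \<in> carrier M \<Longrightarrow> copy_map A M x \<in> carrier (copy A M)"
  by (rule lin_closed[OF lin_copy_map])

lemma copy_inv_closed: "fg_module A M \<Longrightarrow> x \<in> carrier (copy A M) \<Longrightarrow> copy_inv A M x \<in> carrier M"
  by (rule lin_closed[OF lin_copy_inv])

section \<open>Lifting and extension properties for modules of arbitrary carrier type\<close>

lemma projectiveI:
  assumes "fg_module A P"
    and "\<And>(M :: ('a, nat \<Rightarrow> 'k) module) (N :: ('a, nat \<Rightarrow> 'k) module) g f. \<lbrakk>fg_module A M; fg_module A N; lin A M N g;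
      g ` carrier M = carrier N; lin A P N f\<rbrakk> \<Longrightarrow> \<exists>h. lin A P M h \<and> (\<forall>x\<in>carrier P. g (h x) = f x)"
  shows "projective A P"
  unfolding projective_def
proof (intro conjI allI ballI impI)
  fix M N :: "('a, nat \<Rightarrow> 'k) module" and g f
  assume a: "g \<in> lhom A M N" "f \<in> lhom A P N" "fg_module A M" "fg_module A N" "g ` carrier M = carrier N"
  have P: "left_module A P" using assms(1) by (rule fg_moduleD)
  obtain h where h: "lin A P M h" "\<forall>x\<in>carrier P. g (h x) = f x"
    using assms(2)[OF a(3,4) lhom_lin[OF a(1)] a(5) lhom_lin[OF a(2)]] by blast
  have "compose (carrier P) g (restrict h (carrier P)) = f"
  proof (rule extensionalityI[of _ "carrier P"])
    show "f \<in> extensional (carrier P)" using a(2) by (simp add: lhom_iff)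
  qed (use h(2) in \<open>simp_all add: compose_def\<close>)
  then show "\<exists>h\<in>lhom A P M. compose (carrier P) g h = f" using restrict_lhom[OF h(1) P] by blast
qed (rule assms(1))

text \<open>The definition tests lifting only against modules on \<open>nat => 'k\<close>. The
  problem is solved between the copies of \<open>M\<close> and \<open>N\<close> and the solution is
  composed with \<open>copy_inv\<close>.\<close>

lemma projective_lift:
  assumes "projective A P" "fg_module A M" "fg_module A N" "lin A M N g" "g ` carrier M = carrier N" "lin A P N f"
  obtains h where "lin A P M h" "\<And>x. x \<in> carrier P \<Longrightarrow> g (h x) = f x"
proof -
  have P: "fg_module A P" using assms(1) by (simp add: projective_def)
  note lm = fg_moduleD[OF P] fg_moduleD[OF assms(2)] fg_moduleD[OF fg_copy[OF assms(2)]]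
  let ?M = "copy A M" and ?N = "copy A N"
  let ?g = "restrict (\<lambda>x. copy_map A N (g (copy_inv A M x))) (carrier ?M)"
  let ?f = "restrict (\<lambda>x. copy_map A N (f x)) (carrier P)"
  have 1: "?g \<in> lhom A ?M ?N"
    by (rule restrict_lhom[OF lin_comp[OF lin_comp[OF lin_copy_inv[OF assms(2)] assms(4)] lin_copy_map[OF assms(3)]] lm(3)])
  have 2: "?f \<in> lhom A P ?N" by (rule restrict_lhom[OF lin_comp[OF assms(6) lin_copy_map[OF assms(3)]] lm(1)])
  have "?g ` carrier ?M = copy_map A N ` g ` copy_inv A M ` carrier ?M"
    by (simp add: image_image cong: image_cong)
  then have 3: "?g ` carrier ?M = carrier ?N"
    using bij_copy_inv[OF assms(2)] bij_copy_map[OF assms(3)] assms(5) by (simp add: bij_betw_def)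
  obtain h where h: "h \<in> lhom A P ?M" "compose (carrier P) ?g h = ?f"
    using assms(1)[unfolded projective_def, THEN conjunct2, rule_format, OF 1 2 fg_copy[OF assms(2)] fg_copy[OF assms(3)] 3] by blast
  have hl: "lin A P ?M h" using h(1) by (rule lhom_lin)
  have "g (copy_inv A M (h x)) = f x" if x: "x \<in> carrier P" for x
  proof -
    have "copy_map A N (g (copy_inv A M (h x))) = copy_map A N (f x)"
      using fun_cong[OF h(2), of x] x lin_closed[OF hl x] by (simp add: compose_def)
    from arg_cong[OF this, of "copy_inv A N"] show ?thesis
      by (simp only: copy_inv_copy_map[OF assms(3) lin_closed[OF assms(6) x]]
        copy_inv_copy_map[OF assms(3) lin_closed[OF assms(4) copy_inv_closed[OF assms(2) lin_closed[OF hl x]]]])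
  qed
  then show thesis using that[OF lin_comp[OF hl lin_copy_inv[OF assms(2)]]] by blast
qed

lemma injectiveI:
  assumes "fg_module A I"
    and "\<And>(M :: ('a, nat \<Rightarrow> 'k) module) (N :: ('a, nat \<Rightarrow> 'k) module) g f. \<lbrakk>fg_module A M; fg_module A N; lin A M N g;
      inj_on g (carrier M); lin A M I f\<rbrakk> \<Longrightarrow> \<exists>h. lin A N I h \<and> (\<forall>x\<in>carrier M. h (g x) = f x)"
  shows "injective A I"
  unfolding injective_def
proof (intro conjI allI ballI impI)
  fix M N :: "('a, nat \<Rightarrow> 'k) module" and g f
  assume a: "g \<in> lhom A M N" "f \<in> lhom A M I" "fg_module A M" "fg_module A N" "inj_on g (carrier M)"
  obtain h where h: "lin A N I h" "\<forall>x\<in>carrier M. h (g x) = f x"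
    using assms(2)[OF a(3,4) lhom_lin[OF a(1)] a(5) lhom_lin[OF a(2)]] by blast
  have "compose (carrier M) (restrict h (carrier N)) g = f"
  proof (rule extensionalityI[of _ "carrier M"])
    show "f \<in> extensional (carrier M)" using a(2) by (simp add: lhom_iff)
  qed (use h(2) lin_closed[OF lhom_lin[OF a(1)]] in \<open>simp_all add: compose_def\<close>)
  then show "\<exists>h\<in>lhom A N I. compose (carrier M) h g = f" using restrict_lhom[OF h(1) fg_moduleD[OF a(4)]] by blast
qed (rule assms(1))

text \<open>As for \<open>projective_lift\<close>, conjugation with the copies removes the
  restriction of the test modules to one carrier type.\<close>

lemma injective_extend:
  assumes "injective A I" "fg_module A M" "fg_module A N" "lin A M N g" "inj_on g (carrier M)" "lin A M I f"
  obtains h where "lin A N I h" "\<And>x. x \<in> carrier M \<Longrightarrow> h (g x) = f x"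
proof -
  have I: "fg_module A I" using assms(1) by (simp add: injective_def)
  note lm = fg_moduleD[OF fg_copy[OF assms(2)]]
  let ?M = "copy A M" and ?N = "copy A N"
  let ?g = "restrict (\<lambda>x. copy_map A N (g (copy_inv A M x))) (carrier ?M)"
  let ?f = "restrict (\<lambda>x. f (copy_inv A M x)) (carrier ?M)"
  have 1: "?g \<in> lhom A ?M ?N"
    by (rule restrict_lhom[OF lin_comp[OF lin_comp[OF lin_copy_inv[OF assms(2)] assms(4)] lin_copy_map[OF assms(3)]] lm(1)])
  have 2: "?f \<in> lhom A ?M I" by (rule restrict_lhom[OF lin_comp[OF lin_copy_inv[OF assms(2)] assms(6)] lm(1)])
  have 3: "inj_on ?g (carrier ?M)"
  proof (rule inj_onI)
    fix x y assume xy: "x \<in> carrier ?M" "y \<in> carrier ?M" "?g x = ?g y"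
    note c = copy_inv_closed[OF assms(2) xy(1)] copy_inv_closed[OF assms(2) xy(2)]
    have e: "copy_map A N (g (copy_inv A M x)) = copy_map A N (g (copy_inv A M y))" using xy by simp
    have "g (copy_inv A M x) = g (copy_inv A M y)"
      using arg_cong[OF e, of "copy_inv A N"]
      by (simp only: copy_inv_copy_map[OF assms(3) lin_closed[OF assms(4) c(1)]] copy_inv_copy_map[OF assms(3) lin_closed[OF assms(4) c(2)]])
    then have "copy_inv A M x = copy_inv A M y" by (rule inj_onD[OF assms(5) _ c])
    from arg_cong[OF this, of "copy_map A M"] show "x = y"
      by (simp only: copy_map_copy_inv[OF assms(2) xy(1)] copy_map_copy_inv[OF assms(2) xy(2)])
  qed
  obtain h where h: "h \<in> lhom A ?N I" "compose (carrier ?M) h ?g = ?f"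
    using assms(1)[unfolded injective_def, THEN conjunct2, rule_format, OF 1 2 fg_copy[OF assms(2)] fg_copy[OF assms(3)] 3] by blast
  have hl: "lin A ?N I h" using h(1) by (rule lhom_lin)
  have "h (copy_map A N (g x)) = f x" if x: "x \<in> carrier M" for x
    using fun_cong[OF h(2), of "copy_map A M x"] copy_map_closed[OF assms(2) x] copy_inv_copy_map[OF assms(2) x] by (simp add: compose_def)
  then show thesis using that[OF lin_comp[OF lin_copy_map[OF assms(3)] hl]] by blast
qed

end

section \<open>Maps factoring through sums of copies of a module\<close>

text \<open>Finite sums of composites M -> X -> N, in other words maps through a power of
  \<open>X\<close> (\<open>fac_through_pw\<close>). Adding one composite at a time turns claims on
  add X into inductions with a single factorization per step.\<close>

inductive fac :: "('r, 'z) ring_scheme \<Rightarrow> ('r, 'x) module \<Rightarrow> ('r, 'm) module \<Rightarrow> ('r, 'n) module \<Rightarrow> ('m \<Rightarrow> 'n) \<Rightarrow> bool"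
  for R X M N where
  fac_zero: "(\<And>x. x \<in> carrier M \<Longrightarrow> u x = \<zero>\<^bsub>N\<^esub>) \<Longrightarrow> fac R X M N u"
| fac_step: "fac R X M N v \<Longrightarrow> lin R M X s \<Longrightarrow> lin R X N r \<Longrightarrow>
    (\<And>x. x \<in> carrier M \<Longrightarrow> u x = v x \<oplus>\<^bsub>N\<^esub> r (s x)) \<Longrightarrow> fac R X M N u"

lemma fac_lin:
  assumes "fac R X M N u" "left_module R M" "left_module R N"
  shows "lin R M N u"
  using assms(1)
proof induction
  case (fac_zero u)
  then show ?case by (intro lin_cong[OF lin_const_zero[OF assms(3)] assms(2)])
next
  case (fac_step v s r u)
  then show ?case by (intro lin_cong[OF lin_plus[OF fac_step.IH lin_comp[OF fac_step.hyps(2,3)] assms(3)] assms(2)])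
qed

lemma fac_cong: "fac R X M N u \<Longrightarrow> (\<And>x. x \<in> carrier M \<Longrightarrow> v x = u x) \<Longrightarrow> fac R X M N v"
proof (induction rule: fac.induct)
  case (fac_zero u)
  then show ?case by (intro fac.fac_zero) simp
next
  case (fac_step w s r u)
  then show ?case by (intro fac.fac_step[OF fac_step.hyps(1-3)]) simp
qed

lemma fac_comp_left:
  assumes "fac R X M N u" "lin R N N' g" "left_module R M" "left_module R N" "left_module R N'" "left_module R X"
  shows "fac R X M N' (\<lambda>x. g (u x))"
  using assms(1)
proof induction
  case (fac_zero u)
  then show ?case by (intro fac.fac_zero) (simp add: lin_zero[OF assms(2,4,5)])
next
  case (fac_step v s r u)
  have "g (u x) = g (v x) \<oplus>\<^bsub>N'\<^esub> g (r (s x))" if x: "x \<in> carrier M" for x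
    using lin_add[OF assms(2) lin_closed[OF fac_lin[OF fac_step.hyps(1) assms(3,4)] x]
        lin_closed[OF fac_step.hyps(3) lin_closed[OF fac_step.hyps(2) x]]] fac_step.hyps(4)[OF x] by simp
  then show ?case by (rule fac.fac_step[OF fac_step.IH fac_step.hyps(2) lin_comp[OF fac_step.hyps(3) assms(2)]])
qed

lemma fac_comp_right:
  assumes "fac R X M N u" "lin R M' M g"
  shows "fac R X M' N (\<lambda>x. u (g x))"
  using assms(1)
proof induction
  case (fac_zero u)
  then show ?case by (intro fac.fac_zero) (simp add: lin_closed[OF assms(2)])
next
  case (fac_step v s r u)
  then show ?case
    by (intro fac.fac_step[OF fac_step.IH lin_comp[OF assms(2) fac_step.hyps(2)] fac_step.hyps(3)])
      (simp add: lin_closed[OF assms(2)])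
qed

lemma fac_single:
  assumes "lin R M X s" "lin R X N r" "left_module R N"
  shows "fac R X M N (\<lambda>x. r (s x))"
proof -
  interpret N: left_module R N by fact
  show ?thesis
    by (rule fac_step[OF fac_zero[of M "\<lambda>_. \<zero>\<^bsub>N\<^esub>"] assms(1,2)])
      (simp_all add: lin_closed[OF assms(2)] lin_closed[OF assms(1)])
qed

lemma fac_plus:
  assumes "fac R X M N u" "fac R X M N v" "left_module R M" "left_module R N"
  shows "fac R X M N (\<lambda>x. u x \<oplus>\<^bsub>N\<^esub> v x)"
  using assms(2)
proof induction
  interpret N: left_module R N by fact
  {
    case (fac_zero v)
    then show ?case
      by (intro fac_cong[OF assms(1)]) (simp add: lin_closed[OF fac_lin[OF assms(1,3,4)]])
  next
    case (fac_step v s r w)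
    have "u x \<oplus>\<^bsub>N\<^esub> w x = (u x \<oplus>\<^bsub>N\<^esub> v x) \<oplus>\<^bsub>N\<^esub> r (s x)" if x: "x \<in> carrier M" for x
      using fac_step.hyps(4)[OF x] lin_closed[OF fac_lin[OF fac_step.hyps(1) assms(3,4)] x]
        lin_closed[OF fac_step.hyps(3) lin_closed[OF fac_step.hyps(2) x]] lin_closed[OF fac_lin[OF assms(1,3,4)] x]
      by (simp add: N.M.a_assoc)
    then show ?case by (rule fac.fac_step[OF fac_step.IH fac_step.hyps(2,3)])
  }
qed

text \<open>\<open>M\<close> lies in add X, by \<open>in_add_iff\<close>. No complement and no power
  of \<open>X\<close> is mentioned, so the condition is transitive and is preserved by duality and
  by Hom into \<open>T\<close>.\<close>

definition radd :: "('r, 'z) ring_scheme \<Rightarrow> ('r, 'x) module \<Rightarrow> ('r, 'm) module \<Rightarrow> bool" where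
  "radd R X M \<longleftrightarrow> fg_module R X \<and> fg_module R M \<and> fac R X M M (\<lambda>x. x)"

lemma raddD:
  assumes "radd R X M"
  shows "fg_module R X" "fg_module R M" "left_module R X" "left_module R M" "fac R X M M (\<lambda>x. x)"
  using assms by (auto simp: radd_def fg_module_def)

text \<open>Insert the identity of \<open>X\<close>, a sum of composites through \<open>Y\<close>,
  between the two factors of every composite through \<open>X\<close>.\<close>

lemma fac_trans:
  assumes "fac R X M N u" "radd R Y X" "left_module R M" "left_module R N"
  shows "fac R Y M N u"
  using assms(1)
proof induction
  case (fac_zero u)
  then show ?case by (rule fac.fac_zero)
next
  case (fac_step v s r u)
  note X = raddD[OF assms(2)]
  have f: "fac R Y M N (\<lambda>x. r (s x))"
    using fac_comp_left[OF fac_comp_right[OF X(5) fac_step.hyps(2)] fac_step.hyps(3) assms(3) X(4) assms(4) X(3)] .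
  show ?case
    by (rule fac_cong[OF fac_plus[OF fac_step.IH f assms(3,4)]]) (rule fac_step.hyps(4))
qed

lemma radd_trans: "radd R Y X \<Longrightarrow> radd R X M \<Longrightarrow> radd R Y M"
  using fac_trans[of R X M M "\<lambda>x. x" Y] by (auto simp: radd_def fg_module_def)

lemma radd_retract:
  assumes "radd R X M" "fg_module R N" "lin R N M s" "lin R M N r" "\<And>x. x \<in> carrier N \<Longrightarrow> r (s x) = x"
  shows "radd R X N"
proof -
  note M = raddD[OF assms(1)]
  have "fac R X N N (\<lambda>x. r (s x))"
    using fac_comp_left[OF fac_comp_right[OF M(5) assms(3)] assms(4)] M fg_moduleD[OF assms(2)] by blast
  then have "fac R X N N (\<lambda>x. x)" by (rule fac_cong) (simp add: assms(5))
  then show ?thesis using M assms(2) by (simp add: radd_def)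
qed

lemma radd_of_retract:
  assumes "fg_module R X" "fg_module R N" "lin R N X s" "lin R X N r" "\<And>x. x \<in> carrier N \<Longrightarrow> r (s x) = x"
  shows "radd R X N"
  unfolding radd_def
  using assms(1,2) fac_cong[OF fac_single[OF assms(3,4) fg_moduleD[OF assms(2)]], of "\<lambda>x. x"] assms(5) by simp

lemma radd_refl: "fg_module R X \<Longrightarrow> radd R X X"
  using radd_of_retract[OF _ _ lin_id lin_id] by blast

section \<open>Finite powers of a module\<close>

abbreviation pw :: "nat \<Rightarrow> ('r, 'm) module \<Rightarrow> ('r, nat \<Rightarrow> 'm) module" where
  "pw n X \<equiv> direct_sum n (\<lambda>_. X)"

lemma pw_simps [simp]:
  "carrier (pw n X) = {..<n} \<rightarrow>\<^sub>E carrier X"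
  "\<zero>\<^bsub>pw n X\<^esub> = (\<lambda>i\<in>{..<n}. \<zero>\<^bsub>X\<^esub>)"
  "x \<oplus>\<^bsub>pw n X\<^esub> y = (\<lambda>i\<in>{..<n}. x i \<oplus>\<^bsub>X\<^esub> y i)"
  "a \<odot>\<^bsub>pw n X\<^esub> x = (\<lambda>i\<in>{..<n}. a \<odot>\<^bsub>X\<^esub> x i)"
  by (simp_all add: direct_sum_def)

lemma pw_mem: "x \<in> carrier (pw n X) \<Longrightarrow> i < n \<Longrightarrow> x i \<in> carrier X"
  by (auto dest: PiE_mem)

lemma pw_eqI: "x \<in> carrier (pw n X) \<Longrightarrow> y \<in> carrier (pw n X) \<Longrightarrow> (\<And>i. i < n \<Longrightarrow> x i = y i) \<Longrightarrow> x = y"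
  by (auto intro: PiE_ext)

lemma left_module_pw:
  assumes "left_module R X"
  shows "left_module R (pw n X)"
proof -
  interpret X: left_module R X by fact
  let ?P = "pw n X"
  have cl: "x \<oplus>\<^bsub>?P\<^esub> y \<in> carrier ?P" "a \<odot>\<^bsub>?P\<^esub> x \<in> carrier ?P" "\<zero>\<^bsub>?P\<^esub> \<in> carrier ?P" "(\<lambda>i\<in>{..<n}. \<ominus>\<^bsub>X\<^esub> x i) \<in> carrier ?P"
    if "x \<in> carrier ?P" "y \<in> carrier ?P" "a \<in> carrier R" for x y a
    using pw_mem[OF that(1)] pw_mem[OF that(2)] that(3) X.smult_closed by simp_all
  have 1: "x \<oplus>\<^bsub>?P\<^esub> y \<oplus>\<^bsub>?P\<^esub> z = x \<oplus>\<^bsub>?P\<^esub> (y \<oplus>\<^bsub>?P\<^esub> z)" "x \<oplus>\<^bsub>?P\<^esub> y = y \<oplus>\<^bsub>?P\<^esub> x"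
    if "x \<in> carrier ?P" "y \<in> carrier ?P" "z \<in> carrier ?P" for x y z
    using pw_mem[OF that(1)] pw_mem[OF that(2)] pw_mem[OF that(3)] by (auto simp: fun_eq_iff X.M.a_ac)
  have 2: "\<zero>\<^bsub>?P\<^esub> \<oplus>\<^bsub>?P\<^esub> x = x" "\<one>\<^bsub>R\<^esub> \<odot>\<^bsub>?P\<^esub> x = x" if x: "x \<in> carrier ?P" for x
  proof -
    show "\<zero>\<^bsub>?P\<^esub> \<oplus>\<^bsub>?P\<^esub> x = x"
      by (rule pw_eqI[OF cl(1)[OF cl(3)[OF x x X.R.zero_closed] x X.R.zero_closed] x]) (simp add: pw_mem[OF x])
    show "\<one>\<^bsub>R\<^esub> \<odot>\<^bsub>?P\<^esub> x = x"
      by (rule pw_eqI[OF cl(2)[OF x x X.R.one_closed] x]) (simp add: pw_mem[OF x] X.smult_one)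
  qed
  have 3: "(\<lambda>i\<in>{..<n}. \<ominus>\<^bsub>X\<^esub> x i) \<oplus>\<^bsub>?P\<^esub> x = \<zero>\<^bsub>?P\<^esub>" if x: "x \<in> carrier ?P" for x
    using pw_mem[OF x] by (auto simp: fun_eq_iff X.M.l_neg)
  have 4: "(a \<oplus>\<^bsub>R\<^esub> b) \<odot>\<^bsub>?P\<^esub> x = a \<odot>\<^bsub>?P\<^esub> x \<oplus>\<^bsub>?P\<^esub> b \<odot>\<^bsub>?P\<^esub> x" "a \<odot>\<^bsub>?P\<^esub> (x \<oplus>\<^bsub>?P\<^esub> y) = a \<odot>\<^bsub>?P\<^esub> x \<oplus>\<^bsub>?P\<^esub> a \<odot>\<^bsub>?P\<^esub> y"
    "(a \<otimes>\<^bsub>R\<^esub> b) \<odot>\<^bsub>?P\<^esub> x = a \<odot>\<^bsub>?P\<^esub> (b \<odot>\<^bsub>?P\<^esub> x)"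
    if "a \<in> carrier R" "b \<in> carrier R" "x \<in> carrier ?P" "y \<in> carrier ?P" for a b x y
    using pw_mem[OF that(3)] pw_mem[OF that(4)] that(1,2)
    by (auto simp: fun_eq_iff X.smult_l_distr X.smult_r_distr X.smult_assoc1)
  have ab: "abelian_group ?P"
  proof (rule abelian_groupI)
    fix x assume "x \<in> carrier ?P"
    then show "\<exists>y\<in>carrier ?P. y \<oplus>\<^bsub>?P\<^esub> x = \<zero>\<^bsub>?P\<^esub>" using cl(4)[OF _ _ X.R.zero_closed] 3 by blast
  next
    show "\<zero>\<^bsub>?P\<^esub> \<in> carrier ?P" by simp
  qed (use cl(1)[OF _ _ X.R.zero_closed] 1 2 in \<open>auto simp del: pw_simps\<close>)
  show ?thesis
    by (rule left_moduleI[OF X.R.ring_axioms ab]) (use cl(2) 2 4 in \<open>auto simp del: pw_simps\<close>)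
qed

definition pw_in :: "nat \<Rightarrow> ('r, 'm) module \<Rightarrow> nat \<Rightarrow> 'm \<Rightarrow> nat \<Rightarrow> 'm" where
  "pw_in n X i x = (\<lambda>j\<in>{..<n}. if j = i then x else \<zero>\<^bsub>X\<^esub>)"

lemma lin_pw_in:
  assumes "left_module R X"
  shows "lin R X (pw n X) (pw_in n X i)"
proof -
  interpret X: left_module R X by fact
  show ?thesis by (rule linI) (auto simp: pw_in_def fun_eq_iff)
qed

lemma lin_proj:
  assumes "i < n"
  shows "lin R (pw n X) X (\<lambda>x. x i)"
  using assms by (intro linI) (auto intro: pw_mem)

text \<open>Induction over the truncations of \<open>x\<close> to its first entries, the remaining
  entries being zero: each truncation arises from the previous one by adding one entry.\<close>

lemma trunc_induct:
  assumes "left_module R X" "x \<in> carrier (pw n X)"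
    and "P \<zero>\<^bsub>pw n X\<^esub>" "\<And>y i. y \<in> carrier (pw n X) \<Longrightarrow> i < n \<Longrightarrow> P y \<Longrightarrow> P (y \<oplus>\<^bsub>pw n X\<^esub> pw_in n X i (x i))"
  shows "P x"
proof -
  interpret X: left_module R X by fact
  have xc: "i < n \<Longrightarrow> x i \<in> carrier X" for i using assms(2) by (rule pw_mem)
  have "m \<le> n \<Longrightarrow> P (\<lambda>j\<in>{..<n}. if j < m then x j else \<zero>\<^bsub>X\<^esub>)" for m
  proof (induction m)
    case 0
    have "(\<lambda>j\<in>{..<n}. if j < 0 then x j else \<zero>\<^bsub>X\<^esub>) = \<zero>\<^bsub>pw n X\<^esub>" by (simp add: fun_eq_iff)
    then show ?case using assms(3) by (simp only:)
  next
    case (Suc m)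
    let ?t = "\<lambda>j\<in>{..<n}. if j < m then x j else \<zero>\<^bsub>X\<^esub>"
    have tc: "?t \<in> carrier (pw n X)" using xc by auto
    have "P ?t" by (rule Suc.IH[OF Suc_leD[OF Suc.prems]])
    moreover have "m < n" using Suc.prems by simp
    ultimately have "P (?t \<oplus>\<^bsub>pw n X\<^esub> pw_in n X m (x m))" using assms(4)[OF tc, of m] by blast
    moreover have "?t \<oplus>\<^bsub>pw n X\<^esub> pw_in n X m (x m) = (\<lambda>j\<in>{..<n}. if j < Suc m then x j else \<zero>\<^bsub>X\<^esub>)"
      using Suc.prems xc by (auto simp: pw_in_def less_Suc_eq fun_eq_iff)
    ultimately show ?case by (simp only:)
  qed
  from this[OF le_refl] have "P (\<lambda>j\<in>{..<n}. if j < n then x j else \<zero>\<^bsub>X\<^esub>)" .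
  moreover have "(\<lambda>j\<in>{..<n}. if j < n then x j else \<zero>\<^bsub>X\<^esub>) = x"
    using assms(2) xc by (intro PiE_ext[of _ "{..<n}" "\<lambda>_. carrier X"]) auto
  ultimately show ?thesis by (simp only:)
qed

text \<open>The identity is the sum of the projections followed by the inclusions of the factors;
  the partial sums are the truncation maps \<open>?t\<close>.\<close>

lemma fac_pw:
  assumes "left_module R X"
  shows "fac R X (pw n X) (pw n X) (\<lambda>x. x)"
proof -
  interpret X: left_module R X by fact
  let ?t = "\<lambda>m x. \<lambda>j\<in>{..<n}. if j < m then x j else \<zero>\<^bsub>X\<^esub>"
  have "m \<le> n \<Longrightarrow> fac R X (pw n X) (pw n X) (?t m)" for m
  proof (induction m)
    case 0
    show ?case by (rule fac_zero) (simp add: fun_eq_iff)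
  next
    case (Suc m)
    then have m: "m < n" by simp
    have IH: "fac R X (pw n X) (pw n X) (?t m)" by (rule Suc.IH[OF Suc_leD[OF Suc.prems]])
    show ?case
    proof (rule fac_step[OF IH lin_proj[OF m] lin_pw_in[OF assms, of n m]])
      fix x assume x: "x \<in> carrier (pw n X)"
      show "?t (Suc m) x = ?t m x \<oplus>\<^bsub>pw n X\<^esub> pw_in n X m (x m)"
        using m pw_mem[OF x] by (auto simp: pw_in_def less_Suc_eq fun_eq_iff)
    qed
  qed
  from this[OF le_refl] have "fac R X (pw n X) (pw n X) (?t n)" .
  then show ?thesis
  proof (rule fac_cong)
    fix x assume x: "x \<in> carrier (pw n X)"
    then show "x = ?t n x"
      using pw_mem[OF x] by (intro PiE_ext[of _ "{..<n}" "\<lambda>_. carrier X"]) auto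
  qed
qed

lemma fg_pw:
  assumes "fg_module R X"
  shows "fg_module R (pw n X)"
proof -
  have X: "left_module R X" using assms by (rule fg_moduleD)
  have P: "left_module R (pw n X)" using X by (rule left_module_pw)
  obtain S where S: "finite S" "gens R X S" using assms X by (auto simp: fg_module_def fin_gen_iff)
  let ?T = "(\<lambda>(i, s). pw_in n X i s) ` ({..<n} \<times> S)"
  have "gens R (pw n X) ?T"
    unfolding gens_def
  proof (intro conjI allI impI)
    show "?T \<subseteq> carrier (pw n X)"
    proof
      fix t assume "t \<in> ?T"
      then obtain i s where "s \<in> S" "t = pw_in n X i s" by auto
      then show "t \<in> carrier (pw n X)" using lin_closed[OF lin_pw_in[OF X]] S(2) by (auto simp: gens_def simp del: pw_simps)
    qed
    fix W assume W: "submod R (pw n X) W" "?T \<subseteq> W"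
    have in_W: "pw_in n X i y \<in> W" if "i < n" "y \<in> carrier X" for i y
    proof -
      have "y \<in> {y \<in> carrier X. pw_in n X i y \<in> W}"
        by (rule gensD[OF S(2) submod_vimage[OF lin_pw_in[OF X] X P W(1)] _ that(2)])
          (use W(2) S(2) that(1) in \<open>auto simp: gens_def\<close>)
      then show ?thesis by simp
    qed
    show "carrier (pw n X) \<subseteq> W"
    proof
      fix x assume x: "x \<in> carrier (pw n X)"
      show "x \<in> W"
      proof (rule trunc_induct[OF X x])
        fix y i assume "y \<in> carrier (pw n X)" "i < n" "y \<in> W"
        moreover have "x i \<in> carrier X" using x \<open>i < n\<close> by (rule pw_mem)
        ultimately show "y \<oplus>\<^bsub>pw n X\<^esub> pw_in n X i (x i) \<in> W"
          using submodD(3)[OF W(1)] in_W by blast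
      qed (rule submodD(2)[OF W(1)])
    qed
  qed
  moreover have "finite ?T" using S(1) by simp
  ultimately show ?thesis using P fin_gen_iff[OF P] unfolding fg_module_def by blast
qed

lemma radd_pw: "fg_module R X \<Longrightarrow> radd R X (pw n X)"
  using fac_pw[OF fg_moduleD] fg_pw by (auto simp: radd_def)

text \<open>The identification of the n-th power plus one more copy with the next power. The index
  set is cut off so that the result is an element of \<open>pw (Suc n)\<close> as an extensional
  function.\<close>

definition psnoc :: "nat \<Rightarrow> (nat \<Rightarrow> 'm) \<Rightarrow> 'm \<Rightarrow> nat \<Rightarrow> 'm" where
  "psnoc n x y = (\<lambda>i\<in>{..<Suc n}. if i = n then y else x i)"

lemma pw_extend:
  assumes "left_module R X" "left_module R N" "lin R (pw n X) N g" "lin R X N h"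
  obtains g' where "lin R (pw (Suc n) X) N g'"
    "\<And>x y. x \<in> carrier (pw n X) \<Longrightarrow> y \<in> carrier X \<Longrightarrow> psnoc n x y \<in> carrier (pw (Suc n) X) \<and> g' (psnoc n x y) = g x \<oplus>\<^bsub>N\<^esub> h y"
proof -
  interpret X: left_module R X by fact
  define g' where "g' z = g (restrict z {..<n}) \<oplus>\<^bsub>N\<^esub> h (z n)" for z
  have r: "lin R (pw (Suc n) X) (pw n X) (\<lambda>z. restrict z {..<n})"
  proof (rule linI)
    fix x assume x: "x \<in> carrier (pw (Suc n) X)"
    show "restrict x {..<n} \<in> carrier (pw n X)" using pw_mem[OF x] by simp
  qed (auto simp: fun_eq_iff)
  have "lin R (pw (Suc n) X) N g'"
    unfolding g'_def by (rule lin_plus[OF lin_comp[OF r assms(3)] lin_comp[OF lin_proj assms(4)] assms(2)]) simp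
  moreover have "psnoc n x y \<in> carrier (pw (Suc n) X) \<and> g' (psnoc n x y) = g x \<oplus>\<^bsub>N\<^esub> h y"
    if x: "x \<in> carrier (pw n X)" "y \<in> carrier X" for x y
  proof -
    have "restrict (psnoc n x y) {..<n} = x"
      using x pw_mem[OF x(1)] by (intro PiE_ext[of _ "{..<n}" "\<lambda>_. carrier X"]) (auto simp: psnoc_def)
    moreover have "psnoc n x y \<in> carrier (pw (Suc n) X)" using x(2) pw_mem[OF x(1)] by (auto simp: psnoc_def less_Suc_eq)
    ultimately show ?thesis by (simp add: g'_def psnoc_def)
  qed
  ultimately show thesis using that by blast
qed

lemma psnoc_lin:
  assumes "left_module R X" "lin R M (pw n X) f" "lin R M X h"
  shows "lin R M (pw (Suc n) X) (\<lambda>m. psnoc n (f m) (h m))"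
proof (rule linI)
  fix x assume x: "x \<in> carrier M"
  then show "psnoc n (f x) (h x) \<in> carrier (pw (Suc n) X)"
    using pw_mem[OF lin_closed[OF assms(2) x]] lin_closed[OF assms(3) x] by (auto simp: psnoc_def less_Suc_eq)
next
  fix x y assume "x \<in> carrier M" "y \<in> carrier M"
  then show "psnoc n (f (x \<oplus>\<^bsub>M\<^esub> y)) (h (x \<oplus>\<^bsub>M\<^esub> y)) = psnoc n (f x) (h x) \<oplus>\<^bsub>pw (Suc n) X\<^esub> psnoc n (f y) (h y)"
    by (auto simp: psnoc_def lin_add[OF assms(2)] lin_add[OF assms(3)] less_Suc_eq fun_eq_iff)
next
  fix a x assume "a \<in> carrier R" "x \<in> carrier M"
  then show "psnoc n (f (a \<odot>\<^bsub>M\<^esub> x)) (h (a \<odot>\<^bsub>M\<^esub> x)) = a \<odot>\<^bsub>pw (Suc n) X\<^esub> psnoc n (f x) (h x)"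
    by (auto simp: psnoc_def lin_smult[OF assms(2)] lin_smult[OF assms(3)] less_Suc_eq fun_eq_iff)
qed

text \<open>Every composite in the sum occupies one further coordinate: the maps into
  \<open>X\<close> become the entries of a tuple and the maps out of \<open>X\<close> are added
  up.\<close>

lemma fac_through_pw:
  assumes "fac R X M N u" "left_module R X" "left_module R M" "left_module R N"
  shows "\<exists>n s r. lin R M (pw n X) s \<and> lin R (pw n X) N r \<and> (\<forall>x\<in>carrier M. u x = r (s x))"
  using assms(1)
proof induction
  interpret N: left_module R N by fact
  {
    case (fac_zero u)
    have "lin R M (pw 0 X) (\<lambda>_. \<zero>\<^bsub>pw 0 X\<^esub>)" "lin R (pw 0 X) N (\<lambda>_. \<zero>\<^bsub>N\<^esub>)"
      using lin_const_zero left_module_pw[OF assms(2)] assms(4) by blast+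
    then show ?case using fac_zero by blast
  next
    case (fac_step v s r u)
    then obtain n s0 r0 where h: "lin R M (pw n X) s0" "lin R (pw n X) N r0" "\<forall>x\<in>carrier M. v x = r0 (s0 x)" by blast
    obtain g where g: "lin R (pw (Suc n) X) N g"
      "\<And>x y. x \<in> carrier (pw n X) \<Longrightarrow> y \<in> carrier X \<Longrightarrow> psnoc n x y \<in> carrier (pw (Suc n) X) \<and> g (psnoc n x y) = r0 x \<oplus>\<^bsub>N\<^esub> r y"
      using pw_extend[OF assms(2,4) h(2) fac_step.hyps(3)] by blast
    have "u x = g (psnoc n (s0 x) (s x))" if x: "x \<in> carrier M" for x
      using g(2)[OF lin_closed[OF h(1) x] lin_closed[OF fac_step.hyps(2) x]] h(3) x fac_step.hyps(4)[OF x] by simp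
    then show ?case using psnoc_lin[OF assms(2) h(1) fac_step.hyps(2)] g(1) by blast
  }
qed

text \<open>Enlarging the power by one copy of \<open>X\<close> for each composite in
  \<open>u\<close> keeps the old image and brings in the value \<open>u y\<close>.\<close>

lemma fac_image_pw:
  assumes "fac R X M N u" "left_module R X" "left_module R M" "left_module R N" "lin R (pw n X) N g" "y \<in> carrier M"
  shows "\<exists>m h. lin R (pw m X) N h \<and> g ` carrier (pw n X) \<subseteq> h ` carrier (pw m X) \<and> u y \<in> h ` carrier (pw m X)"
  using assms(1)
proof induction
  case (fac_zero u)
  interpret P: left_module R "pw n X" by (rule left_module_pw) fact
  have "u y \<in> g ` carrier (pw n X)"
    using fac_zero[OF assms(6)] lin_zero[OF assms(5) P.left_module_axioms assms(4)] P.M.zero_closed by (metis image_eqI)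
  then show ?case using assms(5) by blast
next
  case (fac_step v s r u)
  interpret X: left_module R X by fact
  interpret N: left_module R N by fact
  obtain m h where h: "lin R (pw m X) N h" "g ` carrier (pw n X) \<subseteq> h ` carrier (pw m X)" "v y \<in> h ` carrier (pw m X)"
    using fac_step.IH by blast
  obtain h' where h': "lin R (pw (Suc m) X) N h'"
    "\<And>x z. x \<in> carrier (pw m X) \<Longrightarrow> z \<in> carrier X \<Longrightarrow> psnoc m x z \<in> carrier (pw (Suc m) X) \<and> h' (psnoc m x z) = h x \<oplus>\<^bsub>N\<^esub> r z"
    using pw_extend[OF assms(2,4) h(1) fac_step.hyps(3)] by blast
  have im: "h x \<oplus>\<^bsub>N\<^esub> r z \<in> h' ` carrier (pw (Suc m) X)" if "x \<in> carrier (pw m X)" "z \<in> carrier X" for x z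
    using h'(2)[OF that] by (metis image_eqI)
  have "h x \<in> h' ` carrier (pw (Suc m) X)" if x: "x \<in> carrier (pw m X)" for x
    using im[OF x X.M.zero_closed] lin_zero[OF fac_step.hyps(3) assms(2,4)] lin_closed[OF h(1) x] by simp
  then have "g ` carrier (pw n X) \<subseteq> h' ` carrier (pw (Suc m) X)" by (intro order_trans[OF h(2) image_subsetI])
  moreover obtain x where "x \<in> carrier (pw m X)" "v y = h x" using h(3) by auto
  then have "u y \<in> h' ` carrier (pw (Suc m) X)"
    using fac_step.hyps(4)[OF assms(6)] im[OF _ lin_closed[OF fac_step.hyps(2) assms(6)], of x] by simp
  ultimately show ?case using h'(1) by blast
qed

text \<open>It is enough to reach finitely many generators, and \<open>fac_image_pw\<close> reaches
  one more at a time. The module \<open>M\<close> is the algebra itself for free covers and the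
  first term of the coresolution for covers by copies of P.\<close>

lemma pw_onto:
  assumes "left_module R X" "fg_module R N"
    and "\<And>y. y \<in> carrier N \<Longrightarrow> \<exists>M u x. left_module R (M :: ('r, 'm) module) \<and> fac R X M N u \<and> x \<in> carrier M \<and> y = u x"
  shows "\<exists>n h. lin R (pw n X) N h \<and> h ` carrier (pw n X) = carrier N"
proof -
  have N: "left_module R N" using assms(2) by (rule fg_moduleD)
  obtain S where S: "finite S" "gens R N S" using assms(2) N by (auto simp: fg_module_def fin_gen_iff)
  have "S \<subseteq> carrier N" using S by (simp add: gens_def)
  with S(1) have "\<exists>n h. lin R (pw n X) N h \<and> S \<subseteq> h ` carrier (pw n X)"
  proof (induction S rule: finite_induct)
    case empty
    then show ?case using lin_const_zero[OF N, of "pw 0 X"] by blast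
  next
    case (insert y S)
    then obtain n h where h: "lin R (pw n X) N h" "S \<subseteq> h ` carrier (pw n X)" by auto
    obtain M :: "('r, 'm) module" and u x where u: "left_module R M" "fac R X M N u" "x \<in> carrier M" "y = u x"
      using assms(3)[of y] insert.prems by blast
    obtain m h' where "lin R (pw m X) N h'" "h ` carrier (pw n X) \<subseteq> h' ` carrier (pw m X)" "u x \<in> h' ` carrier (pw m X)"
      using fac_image_pw[OF u(2) assms(1) u(1) N h(1) u(3)] by blast
    then show ?case using h(2) u(4) by (intro exI[of _ m] exI[of _ h']) auto
  qed
  then obtain n h where h: "lin R (pw n X) N h" "S \<subseteq> h ` carrier (pw n X)" by blast
  have P: "left_module R (pw n X)" using assms(1) by (rule left_module_pw)
  have "carrier N \<subseteq> h ` carrier (pw n X)"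
    using S(2) submod_image[OF h(1) P N submod_carrier[OF P]] h(2) by (simp add: gens_def del: pw_simps)
  then have "h ` carrier (pw n X) = carrier N" using lin_closed[OF h(1)] by (auto simp del: pw_simps)
  then show ?thesis using h(1) by blast
qed

section \<open>Biproducts, summands and retracts\<close>

lemma biproduct_simps [simp]:
  "carrier (biproduct M N) = carrier M \<times> carrier N" "\<zero>\<^bsub>biproduct M N\<^esub> = (\<zero>\<^bsub>M\<^esub>, \<zero>\<^bsub>N\<^esub>)"
  "x \<oplus>\<^bsub>biproduct M N\<^esub> y = (fst x \<oplus>\<^bsub>M\<^esub> fst y, snd x \<oplus>\<^bsub>N\<^esub> snd y)"
  "a \<odot>\<^bsub>biproduct M N\<^esub> x = (a \<odot>\<^bsub>M\<^esub> fst x, a \<odot>\<^bsub>N\<^esub> snd x)"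
  by (simp_all add: biproduct_def)

lemma left_module_biproduct:
  assumes "left_module R M" "left_module R N"
  shows "left_module R (biproduct M N)"
proof -
  interpret M: left_module R M by fact
  interpret N: left_module R N by fact
  show ?thesis
  proof (rule left_moduleI)
    show "abelian_group (biproduct M N)"
    proof (rule abelian_groupI)
      fix x assume "x \<in> carrier (biproduct M N)"
      then show "\<exists>y\<in>carrier (biproduct M N). y \<oplus>\<^bsub>biproduct M N\<^esub> x = \<zero>\<^bsub>biproduct M N\<^esub>"
        by (intro bexI[of _ "(\<ominus>\<^bsub>M\<^esub> fst x, \<ominus>\<^bsub>N\<^esub> snd x)"]) (auto simp: M.M.l_neg N.M.l_neg)
    qed (auto simp: M.M.a_ac N.M.a_ac)
  qed (auto simp: M.smult_closed N.smult_closed M.smult_l_distr N.smult_l_distr M.smult_r_distr N.smult_r_distr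
      M.smult_assoc1 N.smult_assoc1 M.smult_one N.smult_one M.R.ring_axioms)
qed

lemma summand_retract:
  fixes A :: "('k, 'a) module"
  assumes "summand A X M"
  obtains s r where "lin A X M s" "lin A M X r" "\<And>x. x \<in> carrier X \<Longrightarrow> r (s x) = x"
proof -
  obtain Y :: "('a, nat \<Rightarrow> 'k) module" where Y: "fg_module A Y" "isomorphic A (biproduct X Y) M"
    using assms unfolding summand_def by blast
  have X: "left_module A X" and YM: "left_module A Y" using assms Y(1) by (auto simp: summand_def dest: fg_moduleD)
  interpret Y: left_module A Y by (rule YM)
  have XY: "left_module A (biproduct X Y)" using X YM by (rule left_module_biproduct)
  obtain f where f: "lin A (biproduct X Y) M f" "bij_betw f (carrier (biproduct X Y)) (carrier M)"
    using Y(2) isomorphic_lin[OF XY] by blast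
  let ?g = "inv_into (carrier (biproduct X Y)) f"
  have g: "lin A M (biproduct X Y) ?g" by (rule lin_inv[OF f XY])
  have gf: "?g (f z) = z" if "z \<in> carrier (biproduct X Y)" for z
    using f(2) that by (simp add: bij_betw_def)
  have i: "lin A X (biproduct X Y) (\<lambda>x. (x, \<zero>\<^bsub>Y\<^esub>))" by (rule linI) auto
  have p: "lin A (biproduct X Y) X fst" by (rule linI) auto
  have "fst (?g (f (x, \<zero>\<^bsub>Y\<^esub>))) = x" if "x \<in> carrier X" for x
    using gf[of "(x, \<zero>\<^bsub>Y\<^esub>)"] that by simp
  then show thesis using that[OF lin_comp[OF i f(1)] lin_comp[OF g p]] by blast
qed

context fd_alg
begin

text \<open>The kernel of the retraction is a complement; \<open>copy\<close> gives it the carrier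
  type that \<open>summand\<close> prescribes.\<close>

lemma retract_summand:
  fixes M :: "('a, 'm) module" and X :: "('a, 'n) module"
  assumes "fg_module A X" "fg_module A M" "lin A X M s" "lin A M X r" "\<And>x. x \<in> carrier X \<Longrightarrow> r (s x) = x"
  shows "summand A X M"
proof -
  note X = fg_moduleD[OF assms(1)] and M = fg_moduleD[OF assms(2)]
  interpret X: left_module A X by (rule X)
  interpret M: left_module A M by (rule M)
  let ?W = "{x \<in> carrier M. r x = \<zero>\<^bsub>X\<^esub>}"
  let ?Ker = "sub M ?W"
  have Y0: "fg_module A ?Ker" by (rule fg_kernel[OF assms(4,2) X])
  let ?Y = "copy A ?Ker"
  note co = copy_inv_closed[OF Y0, simplified]
  let ?XY = "biproduct X ?Y"
  have XY: "left_module A ?XY" by (rule left_module_biproduct[OF X fg_moduleD[OF fg_copy[OF Y0]]])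
  have fs: "lin A ?XY X fst" "lin A ?XY ?Y snd" by (rule linI; auto)+
  have incl: "lin A ?Ker M (\<lambda>x. x)" by (rule lin_sub_incl) auto
  note l1 = lin_comp[OF fs(1) assms(3)] and l2 = lin_comp[OF lin_comp[OF fs(2) lin_copy_inv[OF Y0]] incl]
  define f where "f z = s (fst z) \<oplus>\<^bsub>M\<^esub> copy_inv A ?Ker (snd z)" for z
  have f: "lin A ?XY M f" unfolding f_def by (rule lin_plus[OF l1 l2 M])
  have "inj_on f (carrier ?XY)"
    unfolding lin_inj_iff[OF f XY M]
  proof (intro ballI impI)
    fix z assume z: "z \<in> carrier ?XY" "f z = \<zero>\<^bsub>M\<^esub>"
    note c = co[of "snd z"] and sc = lin_closed[OF assms(3), of "fst z"]
    have z': "fst z \<in> carrier X" "snd z \<in> carrier ?Y" using z(1) by auto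
    have "r (f z) = fst z"
      using lin_add[OF assms(4) sc[OF z'(1)], of "copy_inv A ?Ker (snd z)"] c z' assms(5) by (simp add: f_def)
    then have z1: "fst z = \<zero>\<^bsub>X\<^esub>" using z(2) lin_zero[OF assms(4) M X] by simp
    then have "copy_inv A ?Ker (snd z) = \<zero>\<^bsub>M\<^esub>" using z(2) lin_zero[OF assms(3) X M] c z' by (simp add: f_def)
    then have "snd z = copy_map A ?Ker \<zero>\<^bsub>?Ker\<^esub>" using copy_map_copy_inv[OF Y0 z'(2)] by simp
    also have "\<dots> = \<zero>\<^bsub>?Y\<^esub>" by (rule lin_zero[OF lin_copy_map[OF Y0] fg_moduleD[OF Y0] fg_moduleD[OF fg_copy[OF Y0]]])
    finally show "z = \<zero>\<^bsub>?XY\<^esub>" using z1 by (simp add: prod_eq_iff)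
  qed
  moreover have "f ` carrier ?XY = carrier M"
  proof (intro equalityI subsetI)
    fix m assume m: "m \<in> carrier M"
    let ?n = "m \<ominus>\<^bsub>M\<^esub> s (r m)"
    have rm: "r m \<in> carrier X" "s (r m) \<in> carrier M" using lin_closed[OF assms(4) m] lin_closed[OF assms(3)] by auto
    have "r ?n = \<zero>\<^bsub>X\<^esub>"
      using lin_diff[OF assms(4) M X m rm(2)] X.diff_eq_zero_iff[OF rm(1) rm(1)] assms(5)[OF rm(1)] by simp
    then have n: "?n \<in> carrier ?Ker" using m rm by simp
    have "f (r m, copy_map A ?Ker ?n) = m"
      using copy_inv_copy_map[OF Y0 n] M.add_diff_cancel[OF m rm(2)] by (simp add: f_def)
    then show "m \<in> f ` carrier ?XY" using rm copy_map_closed[OF Y0 n] by (intro image_eqI[of _ _ "(r m, copy_map A ?Ker ?n)"]) auto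
  qed (use lin_closed[OF f] in \<open>auto simp del: biproduct_simps\<close>)
  ultimately have "isomorphic A ?XY M" using isomorphic_lin[OF XY] f by (auto simp: bij_betw_def)
  then show ?thesis using assms(1,2) fg_copy[OF Y0] unfolding summand_def by blast
qed

text \<open>A factorization of the identity of \<open>M\<close> through a power of \<open>X\<close>
  is a retraction of that power onto \<open>M\<close>.\<close>

lemma in_add_iff:
  assumes "fg_module A X"
  shows "in_add A X M \<longleftrightarrow> radd A X M"
proof
  assume "in_add A X M"
  then obtain n where n: "summand A M (pw n X)" by (auto simp: in_add_def)
  obtain s r where "lin A M (pw n X) s" "lin A (pw n X) M r" "\<And>x. x \<in> carrier M \<Longrightarrow> r (s x) = x"
    using summand_retract[OF n] by blast
  then show "radd A X M"
    using n by (intro radd_retract[OF radd_pw[OF assms]]) (auto simp: summand_def)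
next
  assume r: "radd A X M"
  note M = raddD[OF r]
  obtain n s r where "lin A M (pw n X) s" "lin A (pw n X) M r" "\<forall>x\<in>carrier M. x = r (s x)"
    using fac_through_pw[OF M(5,3,4,4)] by blast
  then have "summand A M (pw n X)" using M fg_pw[OF assms] by (intro retract_summand[of M "pw n X" s r]) auto
  then show "in_add A X M" by (auto simp: in_add_def)
qed

section \<open>Projective modules as retracts of powers of the algebra\<close>

lemma fg_regular: "fg_module A (regular A)"
proof -
  have R: "left_module A (regular A)" by (rule left_module_regular[OF ring_A])
  have "gens A (regular A) {\<one>\<^bsub>A\<^esub>}"
    unfolding gens_def
  proof (intro conjI allI impI subsetI)
    fix W x assume "submod A (regular A) W" "{\<one>\<^bsub>A\<^esub>} \<subseteq> W" "x \<in> carrier (regular A)"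
    then show "x \<in> W" using submodD(4)[of A "regular A" W x "\<one>\<^bsub>A\<^esub>"] by simp
  qed simp
  then show ?thesis using R fin_gen_iff[OF R] by (auto simp: fg_module_def)
qed

lemma lin_from_regular:
  assumes "left_module A M" "m \<in> carrier M"
  shows "lin A (regular A) M (\<lambda>a. a \<odot>\<^bsub>M\<^esub> m)"
proof -
  interpret M: left_module A M by fact
  show ?thesis using assms(2) by (intro linI) (simp_all add: M.smult_closed M.smult_l_distr M.smult_assoc1)
qed

lemma projective_regular: "projective A (regular A)"
proof (rule projectiveI[OF fg_regular])
  fix M N :: "('a, nat \<Rightarrow> 'k) module" and g f
  assume a: "fg_module A M" "fg_module A N" "lin A M N g" "g ` carrier M = carrier N" "lin A (regular A) N f"
  have M: "left_module A M" using a(1) by (rule fg_moduleD)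
  have "f \<one>\<^bsub>A\<^esub> \<in> carrier N" using lin_closed[OF a(5)] by simp
  then obtain m where m: "m \<in> carrier M" "g m = f \<one>\<^bsub>A\<^esub>" using a(4) by (metis imageE)
  have "g (x \<odot>\<^bsub>M\<^esub> m) = f x" if x: "x \<in> carrier A" for x
    using lin_smult[OF a(3) x m(1)] m(2) lin_smult[OF a(5) x, of "\<one>\<^bsub>A\<^esub>"] x by simp
  then show "\<exists>h. lin A (regular A) M h \<and> (\<forall>x\<in>carrier (regular A). g (h x) = f x)"
    using lin_from_regular[OF M m(1)] by (intro exI[of _ "\<lambda>a. a \<odot>\<^bsub>M\<^esub> m"]) simp
qed

text \<open>For every partial sum u of composites through \<open>X\<close> the map f o u is lifted,
  one composite at a time; the identity is the last partial sum.\<close>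

lemma projective_radd:
  assumes "projective A X" "radd A X M"
  shows "projective A M"
proof (rule projectiveI)
  note M = raddD[OF assms(2)]
  fix U N :: "('a, nat \<Rightarrow> 'k) module" and g f
  assume a: "fg_module A U" "fg_module A N" "lin A U N g" "g ` carrier U = carrier N" "lin A M N f"
  have U: "left_module A U" "left_module A N" using a(1,2) fg_moduleD by auto
  have "\<exists>h. lin A M U h \<and> (\<forall>x\<in>carrier M. g (h x) = f (u x))" if "fac A X M M u" for u
    using that
  proof induction
    case (fac_zero u)
    then show ?case using lin_const_zero[OF U(1), of M] lin_zero[OF a(3) U] lin_zero[OF a(5) M(4) U(2)]
      by (intro exI[of _ "\<lambda>_. \<zero>\<^bsub>U\<^esub>"]) simp
  next
    case (fac_step v s r u)
    then obtain h where h: "lin A M U h" "\<forall>x\<in>carrier M. g (h x) = f (v x)" by blast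
    obtain t where t: "lin A X U t" "\<And>x. x \<in> carrier X \<Longrightarrow> g (t x) = f (r x)"
      using projective_lift[OF assms(1) a(1-4) lin_comp[OF fac_step.hyps(3) a(5)]] by blast
    have "g (h x \<oplus>\<^bsub>U\<^esub> t (s x)) = f (u x)" if x: "x \<in> carrier M" for x
    proof -
      note sx = lin_closed[OF fac_step.hyps(2) x]
      have "g (h x \<oplus>\<^bsub>U\<^esub> t (s x)) = f (v x) \<oplus>\<^bsub>N\<^esub> f (r (s x))"
        using lin_add[OF a(3) lin_closed[OF h(1) x] lin_closed[OF t(1) sx]] h(2) x t(2)[OF sx] by simp
      also have "\<dots> = f (u x)"
        using lin_add[OF a(5) lin_closed[OF fac_lin[OF fac_step.hyps(1) M(4,4)] x] lin_closed[OF fac_step.hyps(3) sx]]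
          fac_step.hyps(4)[OF x] by simp
      finally show ?thesis .
    qed
    then show ?case using lin_plus[OF h(1) lin_comp[OF fac_step.hyps(2) t(1)] U(1)] by (intro exI[of _ "\<lambda>x. h x \<oplus>\<^bsub>U\<^esub> t (s x)"]) simp
  qed
  from this[OF M(5)] show "\<exists>h. lin A M U h \<and> (\<forall>x\<in>carrier M. g (h x) = f x)" .
qed (rule raddD(2)[OF assms(2)])

text \<open>Every y in \<open>M\<close> is the value at one of the map a -> a y from the regular
  module, so a power of the regular module covers \<open>M\<close>.\<close>

lemma free_cover:
  assumes "fg_module A M"
  obtains F :: "('a, nat \<Rightarrow> 'k) module" and p where "radd A (regular A) F" "projective A F" "lin A F M p" "p ` carrier F = carrier M"
proof -
  have M: "left_module A M" using assms by (rule fg_moduleD)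
  interpret M: left_module A M by (rule M)
  have R: "left_module A (regular A)" using fg_regular by (rule fg_moduleD)
  have ex: "\<exists>(N :: ('a, 'a) module) u x. left_module A N \<and> fac A (regular A) N M u \<and> x \<in> carrier N \<and> y = u x" if y: "y \<in> carrier M" for y
    using R fac_single[OF lin_id lin_from_regular[OF M y] M] M.smult_one[OF y] A.one_closed
    by (intro exI[of _ "regular A"] exI[of _ "\<lambda>a. a \<odot>\<^bsub>M\<^esub> y"] exI[of _ "\<one>\<^bsub>A\<^esub>"]) simp
  then obtain n h where h: "lin A (pw n (regular A)) M h" "h ` carrier (pw n (regular A)) = carrier M"
    using pw_onto[OF R assms ex] by blast
  let ?G = "pw n (regular A)"
  have F0: "fg_module A ?G" by (rule fg_pw[OF fg_regular])
  let ?F = "copy A ?G"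
  have r: "radd A (regular A) ?F"
    by (rule radd_retract[OF radd_pw[OF fg_regular] fg_copy[OF F0] lin_copy_inv[OF F0] lin_copy_map[OF F0]]) (rule copy_map_copy_inv[OF F0])
  have "(\<lambda>x. h (copy_inv A ?G x)) ` carrier ?F = h ` copy_inv A ?G ` carrier ?F" by (simp only: image_image)
  then have "(\<lambda>x. h (copy_inv A ?G x)) ` carrier ?F = carrier M" using bij_copy_inv[OF F0] h(2) by (simp only: bij_betw_def)
  then show thesis
    using that[OF r projective_radd[OF projective_regular r] lin_comp[OF lin_copy_inv[OF F0] h(1)]] by blast
qed

text \<open>A free cover of a projective module splits.\<close>

lemma projective_retract_of_free:
  assumes "projective A P"
  shows "radd A (regular A) P"
proof -
  have P: "fg_module A P" using assms by (simp add: projective_def)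
  obtain F :: "('a, nat \<Rightarrow> 'k) module" and p where F: "radd A (regular A) F" "lin A F P p" "p ` carrier F = carrier P"
    by (rule free_cover[OF P]) (rule that)
  obtain s where "lin A P F s" "\<And>x. x \<in> carrier P \<Longrightarrow> p (s x) = x"
    by (rule projective_lift[OF assms raddD(2)[OF F(1)] P F(2,3) lin_id]) (rule that)
  then show ?thesis by (rule radd_retract[OF F(1) P _ F(2)])
qed

end

section \<open>Duality\<close>

lemma dual_simps [simp]:
  "carrier (dual K A M) = lhom K (scalar_restriction A M) (regular K)"
  "\<zero>\<^bsub>dual K A M\<^esub> = (\<lambda>x\<in>carrier M. \<zero>\<^bsub>K\<^esub>)"
  "f \<oplus>\<^bsub>dual K A M\<^esub> g = (\<lambda>x\<in>carrier M. f x \<oplus>\<^bsub>K\<^esub> g x)"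
  "a \<odot>\<^bsub>dual K A M\<^esub> f = (\<lambda>x\<in>carrier M. f (a \<odot>\<^bsub>M\<^esub> x))"
  by (simp_all add: dual_def)

text \<open>Precomposition with \<open>g\<close>. The value type is left open, so it serves for the
  dual map over the field and for Hom(g, T) alike.\<close>

definition dmap :: "('a, 'm) module \<Rightarrow> ('m \<Rightarrow> 'n) \<Rightarrow> ('n \<Rightarrow> 'k) \<Rightarrow> 'm \<Rightarrow> 'k" where
  "dmap M g f = (\<lambda>x\<in>carrier M. f (g x))"

lemma dmap_apply: "x \<in> carrier M \<Longrightarrow> dmap M g f x = f (g x)"
  by (simp add: dmap_def)

context fd_alg
begin

lemma fd_alg_opp: "fd_alg K (opp A)"
proof
  have ab: "abelian_group (opp A)"
  proof (rule abelian_groupI)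
    fix x assume "x \<in> carrier (opp A)"
    then show "\<exists>y\<in>carrier (opp A). y \<oplus>\<^bsub>opp A\<^esub> x = \<zero>\<^bsub>opp A\<^esub>"
      by (intro bexI[of _ "\<ominus>\<^bsub>A\<^esub> x"]) (simp_all add: A.l_neg)
  qed (simp_all add: A.a_ac)
  have ri: "ring (opp A)"
    by (intro ringI ab monoidI) (simp_all add: A.m_assoc A.l_distr A.r_distr)
  have mo: "module K (opp A)"
    by (rule moduleI[OF K.is_cring ab])
      (simp_all add: KA.smult_closed KA.smult_l_distr KA.smult_r_distr KA.smult_assoc1)
  have lm: "left_module K (opp A)"
    using ab by (intro left_moduleI K.ring_axioms)
      (simp_all add: KA.smult_closed KA.smult_l_distr KA.smult_r_distr KA.smult_assoc1)
  have "fin_gen K A" using fd by (simp add: fd_algebra_def)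
  then have fg: "fin_gen K (opp A)"
    unfolding fin_gen_iff[OF left_module_KA] fin_gen_iff[OF lm] gens_def submod_def by simp
  show "fd_algebra K (opp A)"
    unfolding fd_algebra_def using field_K ri mo fg by (simp add: smult_mult mult_smult)
qed

lemma dual_lin: "f \<in> carrier (dual K A M) \<Longrightarrow> lin K (scalar_restriction A M) (regular K) f"
  by (simp add: lhom_iff)

lemma dual_ext: "f \<in> carrier (dual K A M) \<Longrightarrow> f \<in> extensional (carrier M)"
  by (simp add: lhom_iff)

lemma dual_closed: "f \<in> carrier (dual K A M) \<Longrightarrow> x \<in> carrier M \<Longrightarrow> f x \<in> carrier K"
  using lin_closed[OF dual_lin, of f M x] by simp

lemma dual_add: "f \<in> carrier (dual K A M) \<Longrightarrow> x \<in> carrier M \<Longrightarrow> y \<in> carrier M \<Longrightarrow> f (x \<oplus>\<^bsub>M\<^esub> y) = f x \<oplus>\<^bsub>K\<^esub> f y"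
  using lin_add[OF dual_lin, of f M x y] by simp

lemma dual_scal: "f \<in> carrier (dual K A M) \<Longrightarrow> c \<in> carrier K \<Longrightarrow> x \<in> carrier M \<Longrightarrow> f (sc c \<odot>\<^bsub>M\<^esub> x) = c \<otimes>\<^bsub>K\<^esub> f x"
  using lin_smult[OF dual_lin, of f M c x] by simp

lemma dual_zero: "left_module A M \<Longrightarrow> f \<in> carrier (dual K A M) \<Longrightarrow> f \<zero>\<^bsub>M\<^esub> = \<zero>\<^bsub>K\<^esub>"
  using lin_zero[OF dual_lin left_module_scalar left_module_regular[OF K.ring_axioms], of f M] by simp

lemma dual_eqI: "f \<in> carrier (dual K A M) \<Longrightarrow> g \<in> carrier (dual K A M) \<Longrightarrow> (\<And>x. x \<in> carrier M \<Longrightarrow> f x = g x) \<Longrightarrow> f = g"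
  by (rule extensionalityI[OF dual_ext dual_ext])

lemma dual_restrictI:
  assumes "left_module A M" "\<And>x. x \<in> carrier M \<Longrightarrow> f x \<in> carrier K"
    and "\<And>x y. x \<in> carrier M \<Longrightarrow> y \<in> carrier M \<Longrightarrow> f (x \<oplus>\<^bsub>M\<^esub> y) = f x \<oplus>\<^bsub>K\<^esub> f y"
    and "\<And>c x. c \<in> carrier K \<Longrightarrow> x \<in> carrier M \<Longrightarrow> f (sc c \<odot>\<^bsub>M\<^esub> x) = c \<otimes>\<^bsub>K\<^esub> f x"
  shows "(\<lambda>x\<in>carrier M. f x) \<in> carrier (dual K A M)"
proof -
  have "lin K (scalar_restriction A M) (regular K) f" by (rule linI) (simp_all add: assms)
  from restrict_lhom[OF this left_module_scalar[OF assms(1)]] show ?thesis by simp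
qed

lemma left_module_dual:
  assumes "left_module A M"
  shows "left_module (opp A) (dual K A M)"
proof -
  interpret M: left_module A M by fact
  interpret O: fd_alg K "opp A" by (rule fd_alg_opp)
  let ?D = "dual K A M" and ?V = "kdual K (scalar_restriction A M)"
  interpret V: left_module K ?V by (rule left_module_kdual[OF field_K left_module_scalar[OF assms]])
  have eqs: "carrier ?D = carrier ?V" "\<zero>\<^bsub>?D\<^esub> = \<zero>\<^bsub>?V\<^esub>" "\<And>f g. f \<oplus>\<^bsub>?D\<^esub> g = f \<oplus>\<^bsub>?V\<^esub> g"
    by (simp_all add: kdual_def)
  have ab: "abelian_group ?D"
  proof (rule abelian_groupI)
    fix f assume "f \<in> carrier ?D"
    then show "\<exists>y\<in>carrier ?D. y \<oplus>\<^bsub>?D\<^esub> f = \<zero>\<^bsub>?D\<^esub>"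
      unfolding eqs by (intro bexI[of _ "\<ominus>\<^bsub>?V\<^esub> f"]) (simp_all only: V.M.l_neg V.M.a_inv_closed)
  qed (simp_all only: eqs V.M.a_closed V.M.zero_closed V.M.a_ac V.M.l_zero V.M.r_zero)
  have cl: "a \<odot>\<^bsub>?D\<^esub> f \<in> carrier ?D" if a: "a \<in> carrier A" and f: "f \<in> carrier ?D" for a f
  proof -
    have s: "a \<odot>\<^bsub>M\<^esub> (sc c \<odot>\<^bsub>M\<^esub> x) = sc c \<odot>\<^bsub>M\<^esub> (a \<odot>\<^bsub>M\<^esub> x)" if "c \<in> carrier K" "x \<in> carrier M" for c x
      using that a sc_closed[of c] by (simp add: M.smult_assoc1[symmetric] sc_mult mult_sc)
    have "(\<lambda>x\<in>carrier M. f (a \<odot>\<^bsub>M\<^esub> x)) \<in> carrier ?D"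
      by (rule dual_restrictI[OF assms])
        (simp_all only: a M.smult_closed M.smult_r_distr s dual_closed[OF f] dual_add[OF f] dual_scal[OF f])
    then show ?thesis by simp
  qed
  show ?thesis
  proof (rule left_moduleI[OF O.ring_A ab])
    fix a f assume "a \<in> carrier (opp A)" "f \<in> carrier ?D"
    then show "a \<odot>\<^bsub>?D\<^esub> f \<in> carrier ?D" using cl by simp
  next
    fix a b f assume "a \<in> carrier (opp A)" "b \<in> carrier (opp A)" and f: "f \<in> carrier ?D"
    then have a: "a \<in> carrier A" "b \<in> carrier A" by auto
    show "(a \<oplus>\<^bsub>opp A\<^esub> b) \<odot>\<^bsub>?D\<^esub> f = a \<odot>\<^bsub>?D\<^esub> f \<oplus>\<^bsub>?D\<^esub> b \<odot>\<^bsub>?D\<^esub> f"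
      using a by (auto simp: fun_eq_iff M.smult_l_distr dual_add[OF f] M.smult_closed)
    show "(a \<otimes>\<^bsub>opp A\<^esub> b) \<odot>\<^bsub>?D\<^esub> f = a \<odot>\<^bsub>?D\<^esub> (b \<odot>\<^bsub>?D\<^esub> f)"
      using a by (auto simp: fun_eq_iff M.smult_assoc1 M.smult_closed)
  next
    fix a f g assume "a \<in> carrier (opp A)" "f \<in> carrier ?D" "g \<in> carrier ?D"
    then show "a \<odot>\<^bsub>?D\<^esub> (f \<oplus>\<^bsub>?D\<^esub> g) = a \<odot>\<^bsub>?D\<^esub> f \<oplus>\<^bsub>?D\<^esub> a \<odot>\<^bsub>?D\<^esub> g"
      by (auto simp: fun_eq_iff M.smult_closed)
  next
    fix f assume f: "f \<in> carrier ?D"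
    show "\<one>\<^bsub>opp A\<^esub> \<odot>\<^bsub>?D\<^esub> f = f"
      by (rule dual_eqI[OF _ f]) (use cl[OF A.one_closed f] in \<open>auto simp: M.smult_one\<close>)
  qed
qed

text \<open>A scalar acts on the argument of a functional as on its value, so the finite dimension
  of \<open>kdual\<close> passes to the dual, and \<open>fin_gen_scalar\<close> converts it into
  finite generation over the opposite algebra.\<close>

lemma fg_dual:
  assumes "fg_module A M"
  shows "fg_module (opp A) (dual K A M)"
proof -
  have M: "left_module A M" using assms by (rule fg_moduleD)
  interpret O: fd_alg K "opp A" by (rule fd_alg_opp)
  let ?D = "dual K A M" and ?V = "kdual K (scalar_restriction A M)"
  note D = left_module_dual[OF M]
  have "fin_gen K (scalar_restriction A M)" using assms fin_gen_scalar[OF M] by (simp add: fg_module_def)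
  from kdual_fin_gen_and_reflexive(1)[OF field_K left_module_scalar[OF M] this]
  have V: "fg_module K ?V" using left_module_kdual[OF field_K left_module_scalar[OF M]] by (simp add: fg_module_def)
  have cV: "carrier ?V = carrier ?D" by (simp add: kdual_def)
  have "lin K ?V (scalar_restriction (opp A) ?D) (\<lambda>f. f)"
  proof (rule linI)
    fix c f assume c: "c \<in> carrier K" and "f \<in> carrier ?V"
    then have f: "f \<in> carrier ?D" by (simp only: cV)
    show "c \<odot>\<^bsub>?V\<^esub> f = c \<odot>\<^bsub>scalar_restriction (opp A) ?D\<^esub> f"
      using dual_scal[OF f c] by (auto simp: kdual_def fun_eq_iff)
  qed (auto simp: kdual_def)
  then have "fg_module K (scalar_restriction (opp A) ?D)"
    by (rule fg_surj[OF _ V O.left_module_scalar[OF D]]) (simp add: cV)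
  then show ?thesis using D O.fin_gen_scalar[OF D] by (simp add: fg_module_def)
qed

lemma dmap_closed:
  assumes "lin A M N g" "left_module A M" "f \<in> carrier (dual K A N)"
  shows "dmap M g f \<in> carrier (dual K A M)"
  unfolding dmap_def
  by (rule dual_restrictI[OF assms(2)])
    (simp_all only: lin_closed[OF assms(1)] lin_add[OF assms(1)] lin_smult[OF assms(1)] sc_closed
      dual_closed[OF assms(3)] dual_add[OF assms(3)] dual_scal[OF assms(3)])

lemma lin_dmap:
  assumes "lin A M N g" "left_module A M"
  shows "lin (opp A) (dual K A N) (dual K A M) (dmap M g)"
proof (rule linI)
  interpret M: left_module A M by fact
  fix f assume "f \<in> carrier (dual K A N)"
  then show "dmap M g f \<in> carrier (dual K A M)" by (rule dmap_closed[OF assms])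
next
  fix f f' assume "f \<in> carrier (dual K A N)" "f' \<in> carrier (dual K A N)"
  show "dmap M g (f \<oplus>\<^bsub>dual K A N\<^esub> f') = dmap M g f \<oplus>\<^bsub>dual K A M\<^esub> dmap M g f'"
    by (auto simp: dmap_def fun_eq_iff lin_closed[OF assms(1)])
next
  interpret M: left_module A M by fact
  fix a f assume "a \<in> carrier (opp A)" "f \<in> carrier (dual K A N)"
  then show "dmap M g (a \<odot>\<^bsub>dual K A N\<^esub> f) = a \<odot>\<^bsub>dual K A M\<^esub> dmap M g f"
    by (auto simp: dmap_def fun_eq_iff lin_closed[OF assms(1)] lin_smult[OF assms(1)] M.smult_closed)
qed

lemma dmap_surj:
  assumes "lin A M N g" "inj_on g (carrier M)" "left_module A M" "fg_module A N"
  shows "dmap M g ` carrier (dual K A N) = carrier (dual K A M)"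
proof (intro equalityI subsetI)
  fix f assume f: "f \<in> carrier (dual K A M)"
  have N: "left_module A N" using assms(4) by (rule fg_moduleD)
  let ?N = "scalar_restriction A N" and ?M = "scalar_restriction A M"
  note NM = left_module_scalar[OF N] left_module_scalar[OF assms(3)]
  let ?W = "g ` carrier M"
  have W: "submod K ?N ?W"
    using submod_image[OF lin_scalar[OF assms(1)] NM(2,1) submod_carrier[OF NM(2)]] by simp
  have fN: "fin_gen K ?N" using assms(4) fin_gen_scalar[OF N] by (simp add: fg_module_def)
  have "lin K ?M (sub ?N ?W) g" by (rule lin_sub_into[OF lin_scalar[OF assms(1)]]) simp
  moreover have "bij_betw g (carrier ?M) (carrier (sub ?N ?W))" using assms(2) by (simp add: bij_betw_def)
  ultimately have i: "lin K (sub ?N ?W) ?M (inv_into (carrier M) g)"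
    using lin_inv[of K ?M "sub ?N ?W" g] NM(2) by simp
  obtain h where h: "lin K ?N (regular K) h" "\<And>w. w \<in> ?W \<Longrightarrow> h w = f (inv_into (carrier M) g w)"
    by (rule functional_extension[OF field_K NM(1) fN W lin_comp[OF i dual_lin[OF f]]]) (rule that)
  have hD: "restrict h (carrier N) \<in> carrier (dual K A N)" using restrict_lhom[OF h(1) NM(1)] by simp
  have "dmap M g (restrict h (carrier N)) = f"
  proof (rule dual_eqI[OF dmap_closed[OF assms(1,3) hD] f])
    fix x assume x: "x \<in> carrier M"
    then show "dmap M g (restrict h (carrier N)) x = f x"
      using h(2)[of "g x"] lin_closed[OF assms(1) x] assms(2) by (simp add: dmap_def)
  qed
  then show "f \<in> dmap M g ` carrier (dual K A N)" using hD by (metis image_eqI)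
next
  fix f assume "f \<in> dmap M g ` carrier (dual K A N)"
  then obtain h where h: "h \<in> carrier (dual K A N)" "f = dmap M g h" by (rule imageE)
  show "f \<in> carrier (dual K A M)" unfolding h(2) by (rule dmap_closed[OF assms(1,3) h(1)])
qed

lemma fg_scalar: "fg_module A M \<Longrightarrow> fg_module K (scalar_restriction A M)"
  using fin_gen_scalar[OF fg_moduleD] left_module_scalar[OF fg_moduleD] by (auto simp: fg_module_def)

lemma ses_scalar:
  "ses A L i M p N \<Longrightarrow> ses K (scalar_restriction A L) i (scalar_restriction A M) p (scalar_restriction A N)"
  unfolding ses_def by (simp add: fg_scalar lin_scalar)

text \<open>Surjectivity of p makes precomposition injective, \<open>dmap_surj\<close> gives
  surjectivity at the other end, and a functional that vanishes on the image of i factors over p by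
  \<open>ses_factor\<close> over the field.\<close>

lemma dual_ses:
  assumes "ses A L i M p N"
  shows "ses (opp A) (dual K A N) (dmap M p) (dual K A M) (dmap L i) (dual K A L)"
proof -
  note s = sesD[OF assms]
  have "inj_on (dmap M p) (carrier (dual K A N))"
  proof (rule inj_onI)
    fix f f' assume f: "f \<in> carrier (dual K A N)" "f' \<in> carrier (dual K A N)" "dmap M p f = dmap M p f'"
    show "f = f'"
    proof (rule dual_eqI[OF f(1,2)])
      fix y assume "y \<in> carrier N"
      then obtain x where x: "x \<in> carrier M" "p x = y" using s(13) by blast
      then show "f y = f' y" using fun_cong[OF f(3), of x] by (simp add: dmap_def)
    qed
  qed
  moreover have "dmap L i f = \<zero>\<^bsub>dual K A L\<^esub> \<longleftrightarrow> f \<in> dmap M p ` carrier (dual K A N)" if f: "f \<in> carrier (dual K A M)" for f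
  proof
    assume z: "dmap L i f = \<zero>\<^bsub>dual K A L\<^esub>"
    have "f (i x) = \<zero>\<^bsub>K\<^esub>" if "x \<in> carrier L" for x
      using fun_cong[OF z, of x] that by (simp add: dmap_def)
    then obtain g where g: "lin K (scalar_restriction A N) (regular K) g" "\<And>x. x \<in> carrier M \<Longrightarrow> g (p x) = f x"
      using ses_factor[OF ses_scalar[OF assms] left_module_regular[OF K.ring_axioms] dual_lin[OF f]]
      by (metis regular_simps(4) scalar_restriction_simps(1))
    have gD: "restrict g (carrier N) \<in> carrier (dual K A N)"
      using restrict_lhom[OF g(1) left_module_scalar[OF s(6)]] by simp
    have "f = dmap M p (restrict g (carrier N))"
      by (rule dual_eqI[OF f dmap_closed[OF s(8,5) gD]]) (simp add: dmap_def g(2) lin_closed[OF s(8)])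
    then show "f \<in> dmap M p ` carrier (dual K A N)" using gD by (rule image_eqI)
  next
    assume "f \<in> dmap M p ` carrier (dual K A N)"
    then obtain g where g: "g \<in> carrier (dual K A N)" "f = dmap M p g" by (rule imageE)
    have "f (i x) = \<zero>\<^bsub>K\<^esub>" if x: "x \<in> carrier L" for x
      unfolding g(2) using dmap_apply[OF lin_closed[OF s(7) x], of p g] s(12)[OF x] dual_zero[OF s(6) g(1)] by simp
    then show "dmap L i f = \<zero>\<^bsub>dual K A L\<^esub>" by (auto simp: dmap_def fun_eq_iff)
  qed
  ultimately show ?thesis
    unfolding ses_def
    using fg_dual[OF s(1)] fg_dual[OF s(2)] fg_dual[OF s(3)] lin_dmap[OF s(8,5)] lin_dmap[OF s(7,4)] dmap_surj[OF s(7,9,4,2)]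
    by (intro conjI ballI) simp_all
qed

section \<open>Double duals and the existence of injective embeddings\<close>

definition bidual :: "('a, 'm) module \<Rightarrow> 'm \<Rightarrow> ('m \<Rightarrow> 'k) \<Rightarrow> 'k" where
  "bidual M m = (\<lambda>f\<in>carrier (dual K A M). f m)"

text \<open>Functionals separate points, which gives injectivity; surjectivity is the reflexivity of
  a finite-dimensional space from \<open>kdual_fin_gen_and_reflexive\<close>.\<close>

lemma double_dual:
  assumes "fg_module A M"
  shows "lin A M (dual K (opp A) (dual K A M)) (bidual M)"
    and "bij_betw (bidual M) (carrier M) (carrier (dual K (opp A) (dual K A M)))"
proof -
  have M: "left_module A M" using assms by (rule fg_moduleD)
  interpret M: left_module A M by (rule M)
  interpret O: fd_alg K "opp A" by (rule fd_alg_opp)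
  let ?D = "dual K A M" let ?DD = "dual K (opp A) ?D"
  note D = left_module_dual[OF M]
  interpret D: left_module "opp A" ?D by (rule D)
  have sD: "c \<odot>\<^bsub>opp A\<^esub> \<one>\<^bsub>opp A\<^esub> \<odot>\<^bsub>?D\<^esub> f = (\<lambda>x\<in>carrier M. c \<otimes>\<^bsub>K\<^esub> f x)" if "c \<in> carrier K" "f \<in> carrier ?D" for c f
    using dual_scal[OF that(2,1)] by (auto simp: fun_eq_iff)
  have cl: "bidual M m \<in> carrier ?DD" if m: "m \<in> carrier M" for m
    unfolding bidual_def
  proof (rule O.dual_restrictI[OF D])
    fix c f assume "c \<in> carrier K" "f \<in> carrier ?D"
    then show "(c \<odot>\<^bsub>opp A\<^esub> \<one>\<^bsub>opp A\<^esub> \<odot>\<^bsub>?D\<^esub> f) m = c \<otimes>\<^bsub>K\<^esub> f m" unfolding sD[OF \<open>c \<in> carrier K\<close> \<open>f \<in> carrier ?D\<close>] using m by simp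
  qed (use m dual_closed in \<open>simp_all del: dual_simps(1)\<close>)
  show l: "lin A M ?DD (bidual M)"
  proof (rule linI)
    fix x y assume xy: "x \<in> carrier M" "y \<in> carrier M"
    show "bidual M (x \<oplus>\<^bsub>M\<^esub> y) = bidual M x \<oplus>\<^bsub>?DD\<^esub> bidual M y"
      unfolding bidual_def using dual_add[OF _ xy] by (simp add: fun_eq_iff del: dual_simps(1))
  next
    fix a x assume ax: "a \<in> carrier A" "x \<in> carrier M"
    show "bidual M (a \<odot>\<^bsub>M\<^esub> x) = a \<odot>\<^bsub>?DD\<^esub> bidual M x"
    proof
      fix f
      show "bidual M (a \<odot>\<^bsub>M\<^esub> x) f = (a \<odot>\<^bsub>?DD\<^esub> bidual M x) f"
      proof (cases "f \<in> carrier ?D")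
        case True
        then have "a \<odot>\<^bsub>?D\<^esub> f \<in> carrier ?D" using D.smult_closed ax(1) by (simp del: dual_simps)
        then show ?thesis using True ax unfolding bidual_def by (simp del: dual_simps(1))
      next
        case False
        then show ?thesis unfolding bidual_def by (simp del: dual_simps(1))
      qed
    qed
  qed (rule cl)
  \<comment> \<open>On the line spanned by \<open>m\<close> the coefficient is a functional with
    value one at \<open>m\<close>; it is extended to the whole space.\<close>
  have kf: "\<exists>f\<in>carrier ?D. f m \<noteq> \<zero>\<^bsub>K\<^esub>" if m: "m \<in> carrier M" "m \<noteq> \<zero>\<^bsub>M\<^esub>" for m
  proof -
    let ?V = "scalar_restriction A M"
    interpret V: left_module K ?V by (rule left_module_scalar[OF M])
    let ?W = "(\<lambda>c. sc c \<odot>\<^bsub>M\<^esub> m) ` carrier K"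
    interpret RK: left_module K "regular K" by (rule left_module_regular[OF K.ring_axioms])
    have g: "lin K (regular K) ?V (\<lambda>c. sc c \<odot>\<^bsub>M\<^esub> m)"
      using V.smult_closed V.smult_l_distr V.smult_assoc1 m(1) by (intro linI) simp_all
    have W: "submod K ?V ?W"
      using submod_image[OF g RK.left_module_axioms V.left_module_axioms submod_carrier[OF RK.left_module_axioms]] by simp
    have "inj_on (\<lambda>c. sc c \<odot>\<^bsub>M\<^esub> m) (carrier (regular K))"
      unfolding lin_inj_iff[OF g RK.left_module_axioms V.left_module_axioms]
    proof (intro ballI impI)
      fix c assume c: "c \<in> carrier (regular K)" "sc c \<odot>\<^bsub>M\<^esub> m = \<zero>\<^bsub>?V\<^esub>"
      show "c = \<zero>\<^bsub>regular K\<^esub>"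
      proof (rule ccontr)
        assume "c \<noteq> \<zero>\<^bsub>regular K\<^esub>"
        then have u: "c \<in> Units K" using c(1) K.field_Units by simp
        have "m = \<one>\<^bsub>K\<^esub> \<odot>\<^bsub>?V\<^esub> m" using V.smult_one[of m] m(1) by simp
        also have "\<one>\<^bsub>K\<^esub> = inv\<^bsub>K\<^esub> c \<otimes>\<^bsub>K\<^esub> c" using u by simp
        also have "(inv\<^bsub>K\<^esub> c \<otimes>\<^bsub>K\<^esub> c) \<odot>\<^bsub>?V\<^esub> m = inv\<^bsub>K\<^esub> c \<odot>\<^bsub>?V\<^esub> (c \<odot>\<^bsub>?V\<^esub> m)"
          using u m(1) c(1) by (intro V.smult_assoc1) simp_all
        also have "c \<odot>\<^bsub>?V\<^esub> m = \<zero>\<^bsub>?V\<^esub>" using c(2) by simp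
        also have "inv\<^bsub>K\<^esub> c \<odot>\<^bsub>?V\<^esub> \<zero>\<^bsub>?V\<^esub> = \<zero>\<^bsub>?V\<^esub>" using u by (intro V.smult_r_null) simp
        finally show False using m(2) by simp
      qed
    qed
    then have b: "bij_betw (\<lambda>c. sc c \<odot>\<^bsub>M\<^esub> m) (carrier (regular K)) (carrier (sub ?V ?W))" by (simp add: bij_betw_def)
    have g': "lin K (regular K) (sub ?V ?W) (\<lambda>c. sc c \<odot>\<^bsub>M\<^esub> m)" by (rule lin_sub_into[OF g]) simp
    let ?h = "inv_into (carrier (regular K)) (\<lambda>c. sc c \<odot>\<^bsub>M\<^esub> m)"
    have h: "lin K (sub ?V ?W) (regular K) ?h" by (rule lin_inv[OF g' b RK.left_module_axioms])
    have fg: "fin_gen K ?V" using assms fin_gen_scalar[OF M] by (simp add: fg_module_def)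
    obtain f where f: "lin K ?V (regular K) f" "\<And>w. w \<in> ?W \<Longrightarrow> f w = ?h w"
      by (rule functional_extension[OF field_K V.left_module_axioms fg W h]) (rule that)
    have m1: "m = sc \<one>\<^bsub>K\<^esub> \<odot>\<^bsub>M\<^esub> m" using V.smult_one[of m] m(1) by simp
    have "?h (sc \<one>\<^bsub>K\<^esub> \<odot>\<^bsub>M\<^esub> m) = \<one>\<^bsub>K\<^esub>"
      using b by (intro inv_into_f_f) (auto simp: bij_betw_def)
    moreover have "sc \<one>\<^bsub>K\<^esub> \<odot>\<^bsub>M\<^esub> m \<in> ?W" by (rule imageI) simp
    ultimately have "f (sc \<one>\<^bsub>K\<^esub> \<odot>\<^bsub>M\<^esub> m) = \<one>\<^bsub>K\<^esub>" by (simp only: f(2))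
    then have "f m = \<one>\<^bsub>K\<^esub>" by (simp only: m1[symmetric])
    then have "(restrict f (carrier M)) m \<noteq> \<zero>\<^bsub>K\<^esub>" using m(1) by simp
    moreover have "restrict f (carrier M) \<in> carrier ?D" using restrict_lhom[OF f(1) V.left_module_axioms] by simp
    ultimately show ?thesis by blast
  qed
  have "inj_on (bidual M) (carrier M)"
    unfolding lin_inj_iff[OF l M O.left_module_dual[OF D, unfolded opp_simps]]
  proof (intro ballI impI)
    fix m assume m: "m \<in> carrier M" "bidual M m = \<zero>\<^bsub>?DD\<^esub>"
    show "m = \<zero>\<^bsub>M\<^esub>"
    proof (rule ccontr)
      assume "m \<noteq> \<zero>\<^bsub>M\<^esub>"
      then obtain f where f: "f \<in> carrier ?D" "f m \<noteq> \<zero>\<^bsub>K\<^esub>" using kf m(1) by blast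
      have "bidual M m f = \<zero>\<^bsub>K\<^esub>" unfolding m(2) using f(1) by simp
      then show False using f unfolding bidual_def by (simp del: dual_simps)
    qed
  qed
  moreover have "bidual M ` carrier M = carrier ?DD"
  proof (intro equalityI subsetI)
    fix h assume h: "h \<in> carrier ?DD"
    let ?V = "scalar_restriction A M"
    have cV: "carrier (kdual K ?V) = carrier ?D" by (simp add: kdual_def)
    have "lin K (kdual K ?V) (regular K) h"
    proof (rule linI)
      fix f assume "f \<in> carrier (kdual K ?V)"
      then show "h f \<in> carrier (regular K)" using O.dual_closed[OF h] by (simp add: cV del: dual_simps)
    next
      fix f g assume "f \<in> carrier (kdual K ?V)" "g \<in> carrier (kdual K ?V)"
      then show "h (f \<oplus>\<^bsub>kdual K ?V\<^esub> g) = h f \<oplus>\<^bsub>regular K\<^esub> h g"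
        unfolding cV using O.dual_add[OF h, of f g] by (simp add: kdual_def)
    next
      fix c f assume c: "c \<in> carrier K" and f: "f \<in> carrier (kdual K ?V)"
      have "c \<odot>\<^bsub>kdual K ?V\<^esub> f = c \<odot>\<^bsub>opp A\<^esub> \<one>\<^bsub>opp A\<^esub> \<odot>\<^bsub>?D\<^esub> f"
        unfolding sD[OF c f[unfolded cV]] by (simp add: kdual_def)
      then show "h (c \<odot>\<^bsub>kdual K ?V\<^esub> f) = c \<odot>\<^bsub>regular K\<^esub> h f"
        using O.dual_scal[OF h c f[unfolded cV]] by (simp del: dual_simps)
    qed
    then obtain m where m: "m \<in> carrier M" "\<forall>f\<in>carrier ?D. h f = f m"
      using kdual_fin_gen_and_reflexive(2)[OF field_K left_module_scalar[OF M]] assms fin_gen_scalar[OF M]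
      unfolding cV fg_module_def scalar_restriction_simps by blast
    have "h = bidual M m" by (rule O.dual_eqI[OF h cl[OF m(1)]]) (use m(2) in \<open>simp add: bidual_def del: dual_simps\<close>)
    then show "h \<in> bidual M ` carrier M" using m(1) by (rule image_eqI)
  qed (use cl in blast)
  ultimately show "bij_betw (bidual M) (carrier M) (carrier ?DD)" by (simp add: bij_betw_def)
qed

text \<open>A map N -> D M and a map M -> D N are both pairings of N with M; \<open>flip\<close>
  exchanges the two arguments. This adjunction turns extension problems into lifting
  problems.\<close>

definition flip :: "('a, 'n) module \<Rightarrow> ('n \<Rightarrow> 'm \<Rightarrow> 'k) \<Rightarrow> 'm \<Rightarrow> 'n \<Rightarrow> 'k" where
  "flip N f m = (\<lambda>n\<in>carrier N. f n m)"

lemma lin_flip: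
  assumes "left_module (opp A) N" "left_module A M" "lin (opp A) N (dual K A M) f"
  shows "lin A M (dual K (opp A) N) (flip N f)"
proof -
  interpret N: left_module "opp A" N by fact
  interpret M: left_module A M by fact
  interpret O: fd_alg K "opp A" by (rule fd_alg_opp)
  note fD = lin_closed[OF assms(3)]
  have ns: "f (a \<odot>\<^bsub>N\<^esub> n) m = f n (a \<odot>\<^bsub>M\<^esub> m)" if "a \<in> carrier A" "n \<in> carrier N" "m \<in> carrier M" for a n m
    using lin_smult[OF assms(3), of a n] that by simp
  show ?thesis
  proof (rule linI)
    fix m assume m: "m \<in> carrier M"
    show "flip N f m \<in> carrier (dual K (opp A) N)"
      unfolding flip_def
    proof (rule O.dual_restrictI[OF assms(1)])
      fix n assume "n \<in> carrier N" then show "f n m \<in> carrier K" using dual_closed[OF fD m] by blast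
    next
      fix n n' assume "n \<in> carrier N" "n' \<in> carrier N"
      then show "f (n \<oplus>\<^bsub>N\<^esub> n') m = f n m \<oplus>\<^bsub>K\<^esub> f n' m" using lin_add[OF assms(3), of n n'] m by simp
    next
      fix c n assume "c \<in> carrier K" "n \<in> carrier N"
      then show "f (c \<odot>\<^bsub>opp A\<^esub> \<one>\<^bsub>opp A\<^esub> \<odot>\<^bsub>N\<^esub> n) m = c \<otimes>\<^bsub>K\<^esub> f n m"
        using ns[OF sc_closed] m dual_scal[OF fD] by simp
    qed
  next
    fix x y assume "x \<in> carrier M" "y \<in> carrier M"
    then show "flip N f (x \<oplus>\<^bsub>M\<^esub> y) = flip N f x \<oplus>\<^bsub>dual K (opp A) N\<^esub> flip N f y"
      using dual_add[OF fD] by (auto simp: flip_def fun_eq_iff)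
  next
    fix a x assume "a \<in> carrier A" "x \<in> carrier M"
    then show "flip N f (a \<odot>\<^bsub>M\<^esub> x) = a \<odot>\<^bsub>dual K (opp A) N\<^esub> flip N f x"
      using ns N.smult_closed by (auto simp: flip_def fun_eq_iff)
  qed
qed

lemma injective_retract:
  assumes "injective A J" "fg_module A I" "lin A I J s" "lin A J I r" "\<And>x. x \<in> carrier I \<Longrightarrow> r (s x) = x"
  shows "injective A I"
proof (rule injectiveI[OF assms(2)])
  fix M N :: "('a, nat \<Rightarrow> 'k) module" and g f
  assume a: "fg_module A M" "fg_module A N" "lin A M N g" "inj_on g (carrier M)" "lin A M I f"
  obtain h where h: "lin A N J h" "\<And>x. x \<in> carrier M \<Longrightarrow> h (g x) = s (f x)"
    by (rule injective_extend[OF assms(1) a(1-4) lin_comp[OF a(5) assms(3)]]) (rule that)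
  have "\<forall>x\<in>carrier M. r (h (g x)) = f x" using h(2) assms(5) lin_closed[OF a(5)] by simp
  then show "\<exists>h. lin A N I h \<and> (\<forall>x\<in>carrier M. h (g x) = f x)" using lin_comp[OF h(1) assms(4)] by blast
qed

text \<open>Extending U -> D Q along an injection U -> V becomes, after \<open>flip\<close>, lifting
  Q -> D U along the surjection D V -> D U.\<close>

lemma dual_projective:
  assumes "projective A Q"
  shows "injective (opp A) (dual K A Q)"
proof -
  interpret O: fd_alg K "opp A" by (rule fd_alg_opp)
  have Q: "fg_module A Q" using assms by (simp add: projective_def)
  note QM = fg_moduleD[OF Q]
  show ?thesis
  proof (rule O.injectiveI[OF fg_dual[OF Q]])
    fix U V :: "('a, nat \<Rightarrow> 'k) module" and g f
    assume a: "fg_module (opp A) U" "fg_module (opp A) V" "lin (opp A) U V g" "inj_on g (carrier U)"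
      "lin (opp A) U (dual K A Q) f"
    note U = fg_moduleD[OF a(1)] and V = fg_moduleD[OF a(2)]
    note f' = lin_flip[OF U QM a(5)]
    have lg: "lin A (dual K (opp A) V) (dual K (opp A) U) (dmap U g)" using O.lin_dmap[OF a(3) U] by simp
    have fgU: "fg_module A (dual K (opp A) U)" "fg_module A (dual K (opp A) V)"
      using O.fg_dual[OF a(1)] O.fg_dual[OF a(2)] by simp_all
    obtain h where h: "lin A Q (dual K (opp A) V) h" "\<And>x. x \<in> carrier Q \<Longrightarrow> dmap U g (h x) = flip U f x"
      by (rule projective_lift[OF assms fgU(2,1) lg O.dmap_surj[OF a(3,4) U a(2)] f']) (rule that)
    have h': "lin (opp A) V (dual K A Q) (O.flip Q h)"
      using O.lin_flip[of Q V h] QM V h(1) by simp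
    have "O.flip Q h (g u) = f u" if u: "u \<in> carrier U" for u
    proof (rule dual_eqI[OF lin_closed[OF h' lin_closed[OF a(3) u]] lin_closed[OF a(5) u]])
      fix q assume q: "q \<in> carrier Q"
      show "O.flip Q h (g u) q = f u q"
        using fun_cong[OF h(2)[OF q], of u] u q by (simp add: dmap_def flip_def O.flip_def)
    qed
    then show "\<exists>h. lin (opp A) V (dual K A Q) h \<and> (\<forall>x\<in>carrier U. h (g x) = f x)" using h' by blast
  qed
qed

text \<open>Dualize a free cover of D M over the opposite algebra and identify \<open>M\<close> with
  its double dual. Minimality of the embedding is not claimed; only a cosyzygy \<open>Y\<close> is
  wanted.\<close>

lemma injective_hull_exists:
  assumes "fg_module A M"
  obtains J Y :: "('a, nat \<Rightarrow> 'k) module" and i p where "injective A J" "ses A M i J p Y"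
proof -
  interpret O: fd_alg K "opp A" by (rule fd_alg_opp)
  have D: "fg_module (opp A) (dual K A M)" by (rule fg_dual[OF assms])
  obtain F :: "('a, nat \<Rightarrow> 'k) module" and q where F: "projective (opp A) F" "lin (opp A) F (dual K A M) q"
      "q ` carrier F = carrier (dual K A M)"
    by (rule O.free_cover[OF D]) (rule that)
  have fF: "fg_module (opp A) F" using F(1) by (simp add: projective_def)
  let ?L = "sub F {x \<in> carrier F. q x = \<zero>\<^bsub>dual K A M\<^esub>}"
  have s: "ses (opp A) ?L (\<lambda>x. x) F q (dual K A M)" by (rule O.kernel_ses[OF F(2) fF D F(3)])
  let ?J = "dual K (opp A) F" and ?Y = "dual K (opp A) ?L"
  have s2: "ses A (dual K (opp A) (dual K A M)) (dmap F q) ?J (dmap ?L (\<lambda>x. x)) ?Y"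
    using O.dual_ses[OF s] unfolding opp_simps .
  note t = sesD[OF s2]
  have s3: "ses A M (\<lambda>x. copy_map A ?J (dmap F q (bidual M x))) (copy A ?J) (\<lambda>x. copy_map A ?Y (dmap ?L (\<lambda>x. x) (copy_inv A ?J x))) (copy A ?Y)"
    by (rule ses_iso[OF s2 assms fg_copy[OF t(2)] fg_copy[OF t(3)] double_dual(1)[OF assms] double_dual(2)[OF assms]
        lin_copy_map[OF t(2)] bij_copy_map[OF t(2)] lin_copy_inv[OF t(2)] _ lin_copy_map[OF t(3)] bij_copy_map[OF t(3)]])
      (rule copy_inv_copy_map[OF t(2)])
  have "injective A ?J" using O.dual_projective[OF F(1)] unfolding opp_simps .
  then have "injective A (copy A ?J)"
    by (rule injective_retract[OF _ fg_copy[OF t(2)] lin_copy_inv[OF t(2)] lin_copy_map[OF t(2)]]) (rule copy_map_copy_inv[OF t(2)])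
  then show thesis using s3 by (rule that)
qed

lemma fac_dual:
  assumes "fac A X M N u" "left_module A M" "left_module A N" "left_module A X"
  shows "fac (opp A) (dual K A X) (dual K A N) (dual K A M) (dmap M u)"
  using assms(1)
proof induction
  case (fac_zero u)
  show ?case
  proof (rule fac.fac_zero)
    fix f assume f: "f \<in> carrier (dual K A N)"
    show "dmap M u f = \<zero>\<^bsub>dual K A M\<^esub>"
      using fac_zero dual_zero[OF assms(3) f] by (auto simp: dmap_def fun_eq_iff)
  qed
next
  case (fac_step v s r u)
  show ?case
  proof (rule fac.fac_step[OF fac_step.IH lin_dmap[OF fac_step.hyps(3) assms(4)] lin_dmap[OF fac_step.hyps(2) assms(2)]])
    fix f assume f: "f \<in> carrier (dual K A N)"
    have "f (u x) = f (v x) \<oplus>\<^bsub>K\<^esub> f (r (s x))" if x: "x \<in> carrier M" for x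
      using dual_add[OF f lin_closed[OF fac_lin[OF fac_step.hyps(1) assms(2,3)] x]
          lin_closed[OF fac_step.hyps(3) lin_closed[OF fac_step.hyps(2) x]]] fac_step.hyps(4)[OF x] by simp
    then show "dmap M u f = dmap M v f \<oplus>\<^bsub>dual K A M\<^esub> dmap M s (dmap X r f)"
      using lin_closed[OF fac_step.hyps(2)] by (auto simp: dmap_def fun_eq_iff)
  qed
qed

lemma radd_dual:
  assumes "radd A X M"
  shows "radd (opp A) (dual K A X) (dual K A M)"
proof -
  note r = raddD[OF assms]
  have "fac (opp A) (dual K A X) (dual K A M) (dual K A M) (\<lambda>f. f)"
  proof (rule fac_cong[OF fac_dual[OF r(5,4,4,3)]])
    fix f assume f: "f \<in> carrier (dual K A M)"
    show "f = dmap M (\<lambda>x. x) f"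
      unfolding dmap_def using extensional_restrict[OF dual_ext[OF f]] by simp
  qed
  then show ?thesis using fg_dual[OF r(1)] fg_dual[OF r(2)] by (simp add: radd_def)
qed

end

section \<open>Vanishing of Ext\<close>

text \<open>For an exact sequence 0 -> Z -> Q -> M -> 0 with Q projective this says Ext^1(M,N) =
  0.\<close>

definition ext_on :: "('r, 'z) ring_scheme \<Rightarrow> ('r, 'l) module \<Rightarrow> ('l \<Rightarrow> 'q) \<Rightarrow> ('r, 'q) module \<Rightarrow> ('r, 'n) module \<Rightarrow> bool" where
  "ext_on R Z i Q N \<longleftrightarrow> (\<forall>f. lin R Z N f \<longrightarrow> (\<exists>g. lin R Q N g \<and> (\<forall>x\<in>carrier Z. g (i x) = f x)))"

text \<open>For an exact sequence 0 -> N -> J -> Y -> 0 with J injective this says Ext^1(M,N) = 0,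
  computed in the second argument.\<close>

definition lift_on :: "('r, 'z) ring_scheme \<Rightarrow> ('r, 'm) module \<Rightarrow> ('r, 'j) module \<Rightarrow> ('j \<Rightarrow> 'y) \<Rightarrow> ('r, 'y) module \<Rightarrow> bool" where
  "lift_on R M J q Y \<longleftrightarrow> (\<forall>f. lin R M Y f \<longrightarrow> (\<exists>g. lin R M J g \<and> (\<forall>x\<in>carrier M. q (g x) = f x)))"

lemma ext_onD:
  assumes "ext_on R Z i Q N" "lin R Z N f"
  obtains g where "lin R Q N g" "\<And>x. x \<in> carrier Z \<Longrightarrow> g (i x) = f x"
  using assms unfolding ext_on_def by blast

lemma lift_onD:
  assumes "lift_on R M J q Y" "lin R M Y f"
  obtains g where "lin R M J g" "\<And>x. x \<in> carrier M \<Longrightarrow> q (g x) = f x"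
  using assms unfolding lift_on_def by blast

text \<open>\<open>ext_zero A n M N\<close> says that the group of extensions of degree \<open>n + 1\<close> vanishes; it is computed by shifting along
  syzygies, and does not depend on their choice because it can also be computed with cosyzygies of \<open>N\<close>.\<close>

primrec ext_zero :: "('k, 'a) module \<Rightarrow> nat \<Rightarrow> ('a, nat \<Rightarrow> 'k) module \<Rightarrow> ('a, nat \<Rightarrow> 'k) module \<Rightarrow> bool" where
  "ext_zero A 0 M N \<longleftrightarrow> (\<exists>(Z :: ('a, nat \<Rightarrow> 'k) module) (Q :: ('a, nat \<Rightarrow> 'k) module) i p.
     projective A Q \<and> ses A Z i Q p M \<and> ext_on A Z i Q N)"
| "ext_zero A (Suc n) M N \<longleftrightarrow> (\<exists>(Z :: ('a, nat \<Rightarrow> 'k) module) (Q :: ('a, nat \<Rightarrow> 'k) module) i p.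
     projective A Q \<and> ses A Z i Q p M \<and> ext_zero A n Z N)"

lemma diff_zero_eq: "left_module R N \<Longrightarrow> x \<in> carrier N \<Longrightarrow> x \<ominus>\<^bsub>N\<^esub> \<zero>\<^bsub>N\<^esub> = x"
proof -
  assume "left_module R N" and x: "x \<in> carrier N"
  then interpret N: left_module R N by blast
  show ?thesis using x by (simp add: N.M.minus_eq)
qed

lemma diff_self: "left_module R N \<Longrightarrow> x \<in> carrier N \<Longrightarrow> x \<ominus>\<^bsub>N\<^esub> x = \<zero>\<^bsub>N\<^esub>"
proof -
  assume "left_module R N" and x: "x \<in> carrier N"
  then interpret N: left_module R N by blast
  show ?thesis using N.diff_eq_zero_iff[OF x x] by simp
qed

lemma zero_in: "left_module R N \<Longrightarrow> \<zero>\<^bsub>N\<^esub> \<in> carrier N"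
proof -
  assume "left_module R N"
  then interpret N: left_module R N .
  show ?thesis by simp
qed

context fd_alg
begin

section \<open>Dimension shifting in both arguments\<close>

lemma syzygy_exists:
  assumes "fg_module A M"
  obtains Z Q :: "('a, nat \<Rightarrow> 'k) module" and i p where "projective A Q" "ses A Z i Q p M"
proof -
  obtain Q :: "('a, nat \<Rightarrow> 'k) module" and p where Q: "projective A Q" "lin A Q M p" "p ` carrier Q = carrier M"
    by (rule free_cover[OF assms]) (rule that)
  have "fg_module A Q" using Q(1) by (simp add: projective_def)
  from kernel_ses[OF Q(2) this assms Q(3)] Q(1) show thesis by (rule that[rotated])
qed

lemma ext_zero_0I: "projective A Q \<Longrightarrow> ses A (Z :: ('a, nat \<Rightarrow> 'k) module) i (Q :: ('a, nat \<Rightarrow> 'k) module) p M \<Longrightarrow> ext_on A Z i Q N \<Longrightarrow> ext_zero A 0 M N"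
  unfolding ext_zero.simps by (intro exI conjI)

lemma ext_zero_SucI: "projective A Q \<Longrightarrow> ses A (Z :: ('a, nat \<Rightarrow> 'k) module) i (Q :: ('a, nat \<Rightarrow> 'k) module) p M \<Longrightarrow> ext_zero A n Z N \<Longrightarrow> ext_zero A (Suc n) M N"
  unfolding ext_zero.simps by (intro exI conjI)

lemma ext_zero_0E:
  assumes "ext_zero A 0 M N"
  obtains Z Q :: "('a, nat \<Rightarrow> 'k) module" and i p where "projective A Q" "ses A Z i Q p M" "ext_on A Z i Q N"
  using assms unfolding ext_zero.simps by (elim exE conjE) (rule that)

lemma ext_zero_SucE:
  assumes "ext_zero A (Suc n) M N"
  obtains Z Q :: "('a, nat \<Rightarrow> 'k) module" and i p where "projective A Q" "ses A Z i Q p M" "ext_zero A n Z N"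
  using assms unfolding ext_zero.simps by (elim exE conjE) (rule that)

text \<open>Balance of Ext^1: both sides are compared through maps Q -> J. A map between the
  sequences restricts to Z -> N and induces M -> Y, and solving the problem at one end corrects it
  to a solution at the other.\<close>

lemma ext_on_iff_lift_on:
  assumes Q: "projective A Q" and s: "ses A Z i Q p M" and J: "injective A J" and t: "ses A N j J q Y"
  shows "ext_on A Z i Q N \<longleftrightarrow> lift_on A M J q Y"
proof
  note S = sesD[OF s] and T = sesD[OF t]
  assume E: "ext_on A Z i Q N"
  show "lift_on A M J q Y"
    unfolding lift_on_def
  proof (intro allI impI)
    fix f assume f: "lin A M Y f"
    obtain g where g: "lin A Q J g" "\<And>x. x \<in> carrier Q \<Longrightarrow> q (g x) = f (p x)"
      by (rule projective_lift[OF Q T(2,3,8,10) lin_comp[OF S(8) f]]) (rule that)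
    have "q (g (i x)) = \<zero>\<^bsub>Y\<^esub>" if "x \<in> carrier Z" for x
      using g(2)[OF lin_closed[OF S(7) that]] S(12)[OF that] lin_zero[OF f S(6) T(6)] by simp
    then obtain u where u: "lin A Z N u" "\<And>x. x \<in> carrier Z \<Longrightarrow> j (u x) = g (i x)"
      using ses_lift[OF t S(4) lin_comp[OF S(7) g(1)]] by metis
    obtain h where h: "lin A Q N h" "\<And>x. x \<in> carrier Z \<Longrightarrow> h (i x) = u x"
      by (rule ext_onD[OF E u(1)]) (rule that)
    \<comment> \<open>The extension \<open>h\<close> agrees on \<open>Z\<close> with the restriction
      of \<open>g\<close>, so the difference drops to \<open>M\<close>; as j o h is killed by q, it
      still lifts \<open>f\<close>.\<close>
    let ?d = "\<lambda>x. g x \<ominus>\<^bsub>J\<^esub> j (h x)"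
    have d: "lin A Q J ?d" by (rule lin_minus[OF g(1) lin_comp[OF h(1) T(7)] T(5)])
    have "?d (i x) = \<zero>\<^bsub>J\<^esub>" if "x \<in> carrier Z" for x
      using h(2)[OF that] u(2)[OF that] diff_self[OF T(5) lin_closed[OF g(1) lin_closed[OF S(7) that]]] by simp
    then obtain v where v: "lin A M J v" "\<And>x. x \<in> carrier Q \<Longrightarrow> v (p x) = ?d x"
      using ses_factor[OF s T(5) d] by metis
    have "q (v m) = f m" if m: "m \<in> carrier M" for m
    proof -
      obtain x where x: "x \<in> carrier Q" "p x = m" using S(13)[OF m] by auto
      have "q (v (p x)) = q (g x) \<ominus>\<^bsub>Y\<^esub> q (j (h x))"
        using v(2)[OF x(1)] lin_diff[OF T(8,5,6) lin_closed[OF g(1) x(1)] lin_closed[OF T(7) lin_closed[OF h(1) x(1)]]] by simp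
      also have "\<dots> = f (p x)"
        using T(12)[OF lin_closed[OF h(1) x(1)]] g(2)[OF x(1)] diff_zero_eq[OF T(6) lin_closed[OF lin_comp[OF S(8) f] x(1)]] by simp
      finally show ?thesis using x by simp
    qed
    then show "\<exists>g. lin A M J g \<and> (\<forall>x\<in>carrier M. q (g x) = f x)" using v(1) by auto
  qed
next
  note S = sesD[OF s] and T = sesD[OF t]
  assume L: "lift_on A M J q Y"
  show "ext_on A Z i Q N"
    unfolding ext_on_def
  proof (intro allI impI)
    fix f assume f: "lin A Z N f"
    obtain g where g: "lin A Q J g" "\<And>x. x \<in> carrier Z \<Longrightarrow> g (i x) = j (f x)"
      by (rule injective_extend[OF J S(1,2,7,9) lin_comp[OF f T(7)]]) (rule that)
    have "q (g (i x)) = \<zero>\<^bsub>Y\<^esub>" if "x \<in> carrier Z" for x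
      using g(2)[OF that] T(12)[OF lin_closed[OF f that]] by simp
    then obtain u where u: "lin A M Y u" "\<And>x. x \<in> carrier Q \<Longrightarrow> u (p x) = q (g x)"
      using ses_factor[OF s T(6) lin_comp[OF g(1) T(8)]] by metis
    obtain v where v: "lin A M J v" "\<And>x. x \<in> carrier M \<Longrightarrow> q (v x) = u x"
      by (rule lift_onD[OF L u(1)]) (rule that)
    \<comment> \<open>Subtracting \<open>v o p\<close> moves the values of \<open>g\<close> into
      \<open>N\<close> and changes nothing on \<open>Z\<close>, where p vanishes.\<close>
    let ?d = "\<lambda>x. g x \<ominus>\<^bsub>J\<^esub> v (p x)"
    have d: "lin A Q J ?d" by (rule lin_minus[OF g(1) lin_comp[OF S(8) v(1)] T(5)])
    have "q (?d x) = \<zero>\<^bsub>Y\<^esub>" if x: "x \<in> carrier Q" for x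
      using lin_diff[OF T(8,5,6) lin_closed[OF g(1) x] lin_closed[OF v(1) lin_closed[OF S(8) x]]] u(2)[OF x]
        v(2)[OF lin_closed[OF S(8) x]] diff_self[OF T(6) lin_closed[OF T(8) lin_closed[OF g(1) x]]] by simp
    then obtain h where h: "lin A Q N h" "\<And>x. x \<in> carrier Q \<Longrightarrow> j (h x) = ?d x"
      using ses_lift[OF t S(5) d] by metis
    have "h (i x) = f x" if x: "x \<in> carrier Z" for x
    proof -
      have "j (h (i x)) = j (f x)"
        using h(2)[OF lin_closed[OF S(7) x]] g(2)[OF x] S(12)[OF x] lin_zero[OF v(1) S(6) T(5)]
          diff_zero_eq[OF T(5) lin_closed[OF T(7) lin_closed[OF f x]]] by simp
      then show ?thesis
        by (rule inj_onD[OF T(9) _ lin_closed[OF h(1) lin_closed[OF S(7) x]] lin_closed[OF f x]])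
    qed
    then show "\<exists>g. lin A Q N g \<and> (\<forall>x\<in>carrier Z. g (i x) = f x)" using h(1) by auto
  qed
qed

text \<open>Any two syzygy sequences of \<open>M\<close> are compared with one embedding of
  \<open>N\<close> into an injective module, so the existential choice in \<open>ext_zero\<close> is
  immaterial.\<close>

lemma ext_zero_0_iff_ext_on:
  assumes "projective A Q" "ses A Z i Q p M" "fg_module A N"
  shows "ext_zero A 0 M N \<longleftrightarrow> ext_on A Z i Q N"
proof -
  obtain J Y :: "('a, nat \<Rightarrow> 'k) module" and j q where J: "injective A J" "ses A N j J q Y"
    by (rule injective_hull_exists[OF assms(3)]) (rule that)
  show ?thesis
  proof
    assume "ext_zero A 0 M N"
    then obtain Z' Q' :: "('a, nat \<Rightarrow> 'k) module" and i' p' where x: "projective A Q'" "ses A Z' i' Q' p' M" "ext_on A Z' i' Q' N"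
      by (rule ext_zero_0E) (rule that)
    then show "ext_on A Z i Q N" using ext_on_iff_lift_on[OF assms(1,2) J] ext_on_iff_lift_on[OF x(1,2) J] by simp
  next
    assume e: "ext_on A Z i Q N"
    obtain Z' Q' :: "('a, nat \<Rightarrow> 'k) module" and i' p' where x: "projective A Q'" "ses A Z' i' Q' p' M"
      by (rule syzygy_exists[OF sesD(3)[OF assms(2)]]) (rule that)
    show "ext_zero A 0 M N"
      by (rule ext_zero_0I[OF x]) (use e ext_on_iff_lift_on[OF assms(1,2) J] ext_on_iff_lift_on[OF x(1,2) J] in simp)
  qed
qed

lemma ext_zero_0_iff_lift_on:
  assumes "injective A J" "ses A N j J q Y" "fg_module A M"
  shows "ext_zero A 0 M N \<longleftrightarrow> lift_on A M J q Y"
proof -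
  obtain Z Q :: "('a, nat \<Rightarrow> 'k) module" and i p where Q: "projective A Q" "ses A Z i Q p M"
    by (rule syzygy_exists[OF assms(3)]) (rule that)
  show ?thesis
    using ext_zero_0_iff_ext_on[OF Q sesD(1)[OF assms(2)]] ext_on_iff_lift_on[OF Q assms(1,2)] by simp
qed

text \<open>Either condition says that every map Z -> Y is induced by a map Q -> J: a lift to J
  extends to Q by injectivity, and an extension to Q lifts to J by projectivity. This is the base
  case of the shift.\<close>

lemma lift_on_iff_ext_on_middle:
  assumes Q: "projective A Q" and s: "ses A Z i Q p M" and J: "injective A J" and t: "ses A N j J q Y"
  shows "lift_on A Z J q Y \<longleftrightarrow> ext_on A Z i Q Y"
proof
  note S = sesD[OF s] and T = sesD[OF t]
  assume L: "lift_on A Z J q Y"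
  show "ext_on A Z i Q Y"
    unfolding ext_on_def
  proof (intro allI impI)
    fix f assume f: "lin A Z Y f"
    obtain g where g: "lin A Z J g" "\<And>x. x \<in> carrier Z \<Longrightarrow> q (g x) = f x"
      by (rule lift_onD[OF L f]) (rule that)
    obtain h where h: "lin A Q J h" "\<And>x. x \<in> carrier Z \<Longrightarrow> h (i x) = g x"
      by (rule injective_extend[OF J S(1,2,7,9) g(1)]) (rule that)
    show "\<exists>g. lin A Q Y g \<and> (\<forall>x\<in>carrier Z. g (i x) = f x)"
      using lin_comp[OF h(1) T(8)] h(2) g(2) by (intro exI[of _ "\<lambda>x. q (h x)"]) simp
  qed
next
  note S = sesD[OF s] and T = sesD[OF t]
  assume E: "ext_on A Z i Q Y"
  show "lift_on A Z J q Y"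
    unfolding lift_on_def
  proof (intro allI impI)
    fix f assume f: "lin A Z Y f"
    obtain g where g: "lin A Q Y g" "\<And>x. x \<in> carrier Z \<Longrightarrow> g (i x) = f x"
      by (rule ext_onD[OF E f]) (rule that)
    obtain h where h: "lin A Q J h" "\<And>x. x \<in> carrier Q \<Longrightarrow> q (h x) = g x"
      by (rule projective_lift[OF Q T(2,3,8,10) g(1)]) (rule that)
    show "\<exists>g. lin A Z J g \<and> (\<forall>x\<in>carrier Z. q (g x) = f x)"
      using lin_comp[OF S(7) h(1)] h(2) g(2) lin_closed[OF S(7)] by (intro exI[of _ "\<lambda>x. h (i x)"]) simp
  qed
qed

text \<open>Both sides express Ext^(n+2)(M,N) = 0, shifted once in the first or once in the second
  argument. The induction hypothesis is also what compares different syzygies, so all sequences must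
  be arbitrary in it.\<close>

lemma ext_zero_shift:
  fixes Q J :: "('a, nat \<Rightarrow> 'k) module"
  assumes "projective A Q" "ses A Z i Q p M" "injective A J" "ses A N j J q Y"
  shows "ext_zero A n Z N \<longleftrightarrow> ext_zero A n M Y"
  using assms
proof (induction n arbitrary: Z Q i p M N j J q Y)
  case 0
  then show ?case
    using ext_zero_0_iff_lift_on[OF 0(3,4) sesD(1)[OF 0(2)]] ext_zero_0_iff_ext_on[OF 0(1,2) sesD(3)[OF 0(4)]]
      lift_on_iff_ext_on_middle[OF 0] by simp
next
  case (Suc n)
  obtain J' Y' :: "('a, nat \<Rightarrow> 'k) module" and j' q' where J': "injective A J'" "ses A Y j' J' q' Y'"
    by (rule injective_hull_exists[OF sesD(3)[OF Suc.prems(4)]]) (rule that)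
  obtain Z' Q' :: "('a, nat \<Rightarrow> 'k) module" and i' p' where Q': "projective A Q'" "ses A Z' i' Q' p' Z"
    by (rule syzygy_exists[OF sesD(1)[OF Suc.prems(2)]]) (rule that)
  have "ext_zero A (Suc n) Z N \<longleftrightarrow> ext_zero A n Z Y"
  proof
    assume "ext_zero A (Suc n) Z N"
    then obtain Z' Q' :: "('a, nat \<Rightarrow> 'k) module" and i' p' where x: "projective A Q'" "ses A Z' i' Q' p' Z" "ext_zero A n Z' N"
      by (rule ext_zero_SucE) (rule that)
    then show "ext_zero A n Z Y" using Suc.IH[OF x(1,2) Suc.prems(3,4)] by simp
  next
    assume "ext_zero A n Z Y"
    then show "ext_zero A (Suc n) Z N" using Suc.IH[OF Q' Suc.prems(3,4)] by (intro ext_zero_SucI[OF Q']) simp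
  qed
  \<comment> \<open>Two syzygies of \<open>M\<close> are compared by shifting both to the cosyzygy
    \<open>Y'\<close> of \<open>Y\<close>.\<close>
  moreover have "ext_zero A (Suc n) M Y \<longleftrightarrow> ext_zero A n Z Y"
  proof
    assume "ext_zero A (Suc n) M Y"
    then obtain Z' Q' :: "('a, nat \<Rightarrow> 'k) module" and i' p' where x: "projective A Q'" "ses A Z' i' Q' p' M" "ext_zero A n Z' Y"
      by (rule ext_zero_SucE) (rule that)
    then show "ext_zero A n Z Y" using Suc.IH[OF Suc.prems(1,2) J'] Suc.IH[OF x(1,2) J'] by simp
  next
    assume z: "ext_zero A n Z Y"
    obtain Z' Q' :: "('a, nat \<Rightarrow> 'k) module" and i' p' where x: "projective A Q'" "ses A Z' i' Q' p' M"
      by (rule syzygy_exists[OF sesD(3)[OF Suc.prems(2)]]) (rule that)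
    show "ext_zero A (Suc n) M Y"
      by (rule ext_zero_SucI[OF x]) (use z Suc.IH[OF Suc.prems(1,2) J'] Suc.IH[OF x(1,2) J'] in simp)
  qed
  ultimately show ?case by simp
qed

text \<open>By \<open>ext_zero_shift\<close> every syzygy of \<open>M\<close> gives the same answer
  as a cosyzygy of \<open>N\<close>, so the existential in \<open>ext_zero\<close> may be replaced
  by the sequence at hand.\<close>

lemma ext_zero_Suc_proj:
  fixes Q :: "('a, nat \<Rightarrow> 'k) module"
  assumes "projective A Q" "ses A Z i Q p M" "fg_module A N"
  shows "ext_zero A (Suc n) M N \<longleftrightarrow> ext_zero A n Z N"
proof -
  obtain J Y :: "('a, nat \<Rightarrow> 'k) module" and j q where J: "injective A J" "ses A N j J q Y"
    by (rule injective_hull_exists[OF assms(3)]) (rule that)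
  show ?thesis
  proof
    assume "ext_zero A (Suc n) M N"
    then obtain Z' Q' :: "('a, nat \<Rightarrow> 'k) module" and i' p' where x: "projective A Q'" "ses A Z' i' Q' p' M" "ext_zero A n Z' N"
      by (rule ext_zero_SucE) (rule that)
    then show "ext_zero A n Z N" using ext_zero_shift[OF assms(1,2) J] ext_zero_shift[OF x(1,2) J] by simp
  next
    assume z: "ext_zero A n Z N"
    obtain Z' Q' :: "('a, nat \<Rightarrow> 'k) module" and i' p' where x: "projective A Q'" "ses A Z' i' Q' p' M"
      by (rule syzygy_exists[OF sesD(3)[OF assms(2)]]) (rule that)
    show "ext_zero A (Suc n) M N"
      by (rule ext_zero_SucI[OF x]) (use z ext_zero_shift[OF assms(1,2) J] ext_zero_shift[OF x(1,2) J] in simp)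
  qed
qed

lemma ext_zero_Suc_inj:
  fixes J :: "('a, nat \<Rightarrow> 'k) module"
  assumes "injective A J" "ses A N j J q Y" "fg_module A M"
  shows "ext_zero A (Suc n) M N \<longleftrightarrow> ext_zero A n M Y"
proof -
  obtain Z Q :: "('a, nat \<Rightarrow> 'k) module" and i p where Q: "projective A Q" "ses A Z i Q p M"
    by (rule syzygy_exists[OF assms(3)]) (rule that)
  show ?thesis
    using ext_zero_Suc_proj[OF Q sesD(1)[OF assms(2)]] ext_zero_shift[OF Q assms(1,2)] by simp
qed

text \<open>Exactness of Ext^(n+1)(M,N2) -> Ext^(n+2)(M,N1) -> Ext^(n+2)(M,X) in the middle, without
  a connecting map: passing to syzygies reduces to n = 0, where it is a chase with the second syzygy
  \<open>Z'\<close>.\<close>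

lemma ext_zero_les_left:
  assumes "fg_module A M" "ses A N1 a X b N2" "ext_zero A n M N2" "ext_zero A (Suc n) M X"
  shows "ext_zero A (Suc n) M N1"
  using assms
proof (induction n arbitrary: M)
  case (Suc n)
  obtain Z Q :: "('a, nat \<Rightarrow> 'k) module" and i p where Q: "projective A Q" "ses A Z i Q p M"
    by (rule syzygy_exists[OF Suc.prems(1)]) (rule that)
  note N = sesD(1-3)[OF Suc.prems(2)]
  show ?case
    using Suc.IH[OF sesD(1)[OF Q(2)] Suc.prems(2)] Suc.prems(3,4)
    unfolding ext_zero_Suc_proj[OF Q N(1)] ext_zero_Suc_proj[OF Q N(2)] ext_zero_Suc_proj[OF Q N(3)] by blast
next
  case 0
  obtain Z Q :: "('a, nat \<Rightarrow> 'k) module" and i p where Q: "projective A Q" "ses A Z i Q p M"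
    by (rule syzygy_exists[OF 0(1)]) (rule that)
  obtain Z' Q' :: "('a, nat \<Rightarrow> 'k) module" and i' p' where Q': "projective A Q'" "ses A Z' i' Q' p' Z"
    by (rule syzygy_exists[OF sesD(1)[OF Q(2)]]) (rule that)
  note S = sesD[OF Q(2)] and S' = sesD[OF Q'(2)] and N = sesD[OF 0(2)]
  have E2: "ext_on A Z i Q N2" using 0(3) ext_zero_0_iff_ext_on[OF Q N(3)] by blast
  have EX: "ext_on A Z' i' Q' X" using 0(4) ext_zero_Suc_proj[OF Q N(2)] ext_zero_0_iff_ext_on[OF Q' N(2)] by blast
  have "ext_on A Z' i' Q' N1"
    unfolding ext_on_def
  proof (intro allI impI)
    fix f assume f: "lin A Z' N1 f"
    obtain g where g: "lin A Q' X g" "\<And>x. x \<in> carrier Z' \<Longrightarrow> g (i' x) = a (f x)"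
      by (rule ext_onD[OF EX lin_comp[OF f N(7)]]) (rule that)
    have "b (g (i' x)) = \<zero>\<^bsub>N2\<^esub>" if "x \<in> carrier Z'" for x
      using g(2)[OF that] N(12)[OF lin_closed[OF f that]] by simp
    then obtain c where c: "lin A Z N2 c" "\<And>x. x \<in> carrier Q' \<Longrightarrow> c (p' x) = b (g x)"
      using ses_factor[OF Q'(2) N(6) lin_comp[OF g(1) N(8)]] by metis
    obtain c' where c': "lin A Q N2 c'" "\<And>x. x \<in> carrier Z \<Longrightarrow> c' (i x) = c x"
      by (rule ext_onD[OF E2 c(1)]) (rule that)
    obtain w where w: "lin A Q X w" "\<And>x. x \<in> carrier Q \<Longrightarrow> b (w x) = c' x"
      by (rule projective_lift[OF Q(1) N(2,3,8,10) c'(1)]) (rule that)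
    \<comment> \<open>\<open>g\<close> extends \<open>f\<close> only into \<open>X\<close>. Its
      image under b drops to \<open>Z\<close>, extends to \<open>Q\<close> and lifts to
      \<open>w\<close>; subtracting this moves \<open>g\<close> into \<open>N1\<close>, and on
      \<open>Z'\<close> nothing changes because p' vanishes there.\<close>
    let ?d = "\<lambda>x. g x \<ominus>\<^bsub>X\<^esub> w (i (p' x))"
    have wip: "lin A Q' X (\<lambda>x. w (i (p' x)))" by (rule lin_comp[OF lin_comp[OF S'(8) S(7)] w(1)])
    have d: "lin A Q' X ?d" by (rule lin_minus[OF g(1) wip N(5)])
    have "b (?d x) = \<zero>\<^bsub>N2\<^esub>" if x: "x \<in> carrier Q'" for x
    proof -
      have "b (w (i (p' x))) = b (g x)"
        using w(2)[OF lin_closed[OF S(7) lin_closed[OF S'(8) x]]] c'(2)[OF lin_closed[OF S'(8) x]] c(2)[OF x] by simp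
      then show ?thesis
        using lin_diff[OF N(8,5,6) lin_closed[OF g(1) x] lin_closed[OF wip x]]
          diff_self[OF N(6) lin_closed[OF N(8) lin_closed[OF g(1) x]]] by simp
    qed
    then obtain h where h: "lin A Q' N1 h" "\<And>x. x \<in> carrier Q' \<Longrightarrow> a (h x) = ?d x"
      using ses_lift[OF 0(2) S'(5) d] by metis
    have "h (i' x) = f x" if x: "x \<in> carrier Z'" for x
    proof -
      have "w (i (p' (i' x))) = \<zero>\<^bsub>X\<^esub>"
        using S'(12)[OF x] lin_zero[OF S(7,4,5)] lin_zero[OF w(1) S(5) N(5)] by simp
      then have "a (h (i' x)) = a (f x)"
        using h(2)[OF lin_closed[OF S'(7) x]] g(2)[OF x] diff_zero_eq[OF N(5) lin_closed[OF N(7) lin_closed[OF f x]]] by simp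
      then show ?thesis
        by (rule inj_onD[OF N(9) _ lin_closed[OF h(1) lin_closed[OF S'(7) x]] lin_closed[OF f x]])
    qed
    then show "\<exists>g. lin A Q' N1 g \<and> (\<forall>x\<in>carrier Z'. g (i' x) = f x)" using h(1) by auto
  qed
  then show ?case using ext_zero_Suc_proj[OF Q N(1)] ext_zero_0_iff_ext_on[OF Q' N(1)] by blast
qed

text \<open>Exactness of Ext^(n+1)(M,X) -> Ext^(n+1)(M,N2) -> Ext^(n+2)(M,N1) in the middle, again
  reduced to n = 0 by syzygies.\<close>

lemma ext_zero_les_right:
  assumes "fg_module A M" "ses A N1 a X b N2" "ext_zero A n M X" "ext_zero A (Suc n) M N1"
  shows "ext_zero A n M N2"
  using assms
proof (induction n arbitrary: M)
  case (Suc n)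
  obtain Z Q :: "('a, nat \<Rightarrow> 'k) module" and i p where Q: "projective A Q" "ses A Z i Q p M"
    by (rule syzygy_exists[OF Suc.prems(1)]) (rule that)
  note N = sesD(1-3)[OF Suc.prems(2)]
  show ?case
    using Suc.IH[OF sesD(1)[OF Q(2)] Suc.prems(2)] Suc.prems(3,4)
    unfolding ext_zero_Suc_proj[OF Q N(1)] ext_zero_Suc_proj[OF Q N(2)] ext_zero_Suc_proj[OF Q N(3)] by blast
next
  case 0
  obtain Z Q :: "('a, nat \<Rightarrow> 'k) module" and i p where Q: "projective A Q" "ses A Z i Q p M"
    by (rule syzygy_exists[OF 0(1)]) (rule that)
  obtain Z' Q' :: "('a, nat \<Rightarrow> 'k) module" and i' p' where Q': "projective A Q'" "ses A Z' i' Q' p' Z"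
    by (rule syzygy_exists[OF sesD(1)[OF Q(2)]]) (rule that)
  note S = sesD[OF Q(2)] and S' = sesD[OF Q'(2)] and N = sesD[OF 0(2)]
  have EX: "ext_on A Z i Q X" using 0(3) ext_zero_0_iff_ext_on[OF Q N(2)] by blast
  have E1: "ext_on A Z' i' Q' N1" using 0(4) ext_zero_Suc_proj[OF Q N(1)] ext_zero_0_iff_ext_on[OF Q' N(1)] by blast
  have "ext_on A Z i Q N2"
    unfolding ext_on_def
  proof (intro allI impI)
    fix f assume f: "lin A Z N2 f"
    obtain g where g: "lin A Q' X g" "\<And>x. x \<in> carrier Q' \<Longrightarrow> b (g x) = f (p' x)"
      by (rule projective_lift[OF Q'(1) N(2,3,8,10) lin_comp[OF S'(8) f]]) (rule that)
    have "b (g (i' x)) = \<zero>\<^bsub>N2\<^esub>" if "x \<in> carrier Z'" for x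
      using g(2)[OF lin_closed[OF S'(7) that]] S'(12)[OF that] lin_zero[OF f S(4) N(6)] by simp
    then obtain c where c: "lin A Z' N1 c" "\<And>x. x \<in> carrier Z' \<Longrightarrow> a (c x) = g (i' x)"
      using ses_lift[OF 0(2) S'(4) lin_comp[OF S'(7) g(1)]] by metis
    obtain h where h: "lin A Q' N1 h" "\<And>x. x \<in> carrier Z' \<Longrightarrow> h (i' x) = c x"
      by (rule ext_onD[OF E1 c(1)]) (rule that)
    \<comment> \<open>The lift \<open>g\<close> of \<open>f o p'\<close> to \<open>X\<close>
      restricts on \<open>Z'\<close> to a map into \<open>N1\<close>; its extension \<open>h\<close>
      is subtracted, so the lift drops to \<open>Z\<close>, from where it extends to
      \<open>Q\<close>.\<close>
    let ?d = "\<lambda>x. g x \<ominus>\<^bsub>X\<^esub> a (h x)"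
    have d: "lin A Q' X ?d" by (rule lin_minus[OF g(1) lin_comp[OF h(1) N(7)] N(5)])
    have "?d (i' x) = \<zero>\<^bsub>X\<^esub>" if "x \<in> carrier Z'" for x
      using h(2)[OF that] c(2)[OF that] diff_self[OF N(5) lin_closed[OF g(1) lin_closed[OF S'(7) that]]] by simp
    then obtain u where u: "lin A Z X u" "\<And>x. x \<in> carrier Q' \<Longrightarrow> u (p' x) = ?d x"
      using ses_factor[OF Q'(2) N(5) d] by metis
    have bu: "b (u z) = f z" if z: "z \<in> carrier Z" for z
    proof -
      obtain x where x: "x \<in> carrier Q'" "p' x = z" using S'(13)[OF z] by auto
      have "b (u (p' x)) = b (g x) \<ominus>\<^bsub>N2\<^esub> b (a (h x))"
        using u(2)[OF x(1)] lin_diff[OF N(8,5,6) lin_closed[OF g(1) x(1)] lin_closed[OF N(7) lin_closed[OF h(1) x(1)]]] by simp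
      also have "\<dots> = f (p' x)"
        using N(12)[OF lin_closed[OF h(1) x(1)]] g(2)[OF x(1)] diff_zero_eq[OF N(6) lin_closed[OF lin_comp[OF S'(8) f] x(1)]] by simp
      finally show ?thesis using x by simp
    qed
    obtain v where v: "lin A Q X v" "\<And>x. x \<in> carrier Z \<Longrightarrow> v (i x) = u x"
      by (rule ext_onD[OF EX u(1)]) (rule that)
    show "\<exists>g. lin A Q N2 g \<and> (\<forall>x\<in>carrier Z. g (i x) = f x)"
      using lin_comp[OF v(1) N(8)] v(2) bu by (intro exI[of _ "\<lambda>x. b (v x)"]) simp
  qed
  then show ?case using ext_zero_0_iff_ext_on[OF Q N(3)] by blast
qed

section \<open>Vanishing on additive closures and for projective modules\<close>

lemma ext_on_radd:
  assumes "radd A X N" "ext_on A Z i Q X" "left_module A Z" "left_module A Q" "lin A Z Q i"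
  shows "ext_on A Z i Q N"
  unfolding ext_on_def
proof (intro allI impI)
  note N = raddD[OF assms(1)]
  fix f assume f: "lin A Z N f"
  have "\<exists>g. lin A Q N g \<and> (\<forall>x\<in>carrier Z. g (i x) = u (f x))" if "fac A X N N u" for u
    using that
  proof induction
    case (fac_zero u)
    then show ?case using lin_const_zero[OF N(4)] lin_closed[OF f] by (intro exI[of _ "\<lambda>_. \<zero>\<^bsub>N\<^esub>"]) simp
  next
    case (fac_step v s r u)
    obtain g where g: "lin A Q N g" "\<And>x. x \<in> carrier Z \<Longrightarrow> g (i x) = v (f x)" using fac_step.IH by blast
    obtain h where h: "lin A Q X h" "\<And>x. x \<in> carrier Z \<Longrightarrow> h (i x) = s (f x)"
      by (rule ext_onD[OF assms(2) lin_comp[OF f fac_step.hyps(2)]]) (rule that)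
    show ?case
      using lin_plus[OF g(1) lin_comp[OF h(1) fac_step.hyps(3)] N(4)] g(2) h(2) fac_step.hyps(4) lin_closed[OF f]
      by (intro exI[of _ "\<lambda>x. g x \<oplus>\<^bsub>N\<^esub> r (h x)"]) simp
  qed
  from this[OF N(5)] show "\<exists>g. lin A Q N g \<and> (\<forall>x\<in>carrier Z. g (i x) = f x)" .
qed

lemma lift_on_radd:
  assumes "radd A X M" "lift_on A X J q Y" "left_module A J" "left_module A Y" "lin A J Y q"
  shows "lift_on A M J q Y"
  unfolding lift_on_def
proof (intro allI impI)
  note M = raddD[OF assms(1)]
  fix f assume f: "lin A M Y f"
  have "\<exists>g. lin A M J g \<and> (\<forall>x\<in>carrier M. q (g x) = f (u x))" if "fac A X M M u" for u
    using that
  proof induction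
    case (fac_zero u)
    then show ?case using lin_const_zero[OF assms(3)] lin_zero[OF f M(4) assms(4)] lin_zero[OF assms(5,3,4)]
      by (intro exI[of _ "\<lambda>_. \<zero>\<^bsub>J\<^esub>"]) simp
  next
    case (fac_step v s r u)
    obtain g where g: "lin A M J g" "\<And>x. x \<in> carrier M \<Longrightarrow> q (g x) = f (v x)" using fac_step.IH by blast
    obtain h where h: "lin A X J h" "\<And>x. x \<in> carrier X \<Longrightarrow> q (h x) = f (r x)"
      by (rule lift_onD[OF assms(2) lin_comp[OF fac_step.hyps(3) f]]) (rule that)
    have "q (g x \<oplus>\<^bsub>J\<^esub> h (s x)) = f (u x)" if x: "x \<in> carrier M" for x
    proof -
      note sx = lin_closed[OF fac_step.hyps(2) x]
      have "q (g x \<oplus>\<^bsub>J\<^esub> h (s x)) = f (v x) \<oplus>\<^bsub>Y\<^esub> f (r (s x))"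
        using lin_add[OF assms(5) lin_closed[OF g(1) x] lin_closed[OF h(1) sx]] g(2)[OF x] h(2)[OF sx] by simp
      also have "\<dots> = f (u x)"
        using lin_add[OF f lin_closed[OF fac_lin[OF fac_step.hyps(1) M(4,4)] x] lin_closed[OF fac_step.hyps(3) sx]]
          fac_step.hyps(4)[OF x] by simp
      finally show ?thesis .
    qed
    then show ?case using lin_plus[OF g(1) lin_comp[OF fac_step.hyps(2) h(1)] assms(3)]
      by (intro exI[of _ "\<lambda>x. g x \<oplus>\<^bsub>J\<^esub> h (s x)"]) simp
  qed
  from this[OF M(5)] show "\<exists>g. lin A M J g \<and> (\<forall>x\<in>carrier M. q (g x) = f x)" .
qed

lemma ext_zero_radd_right:
  assumes "radd A X N" "fg_module A M" "ext_zero A n M X"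
  shows "ext_zero A n M N"
  using assms(2,3)
proof (induction n arbitrary: M)
  note N = raddD[OF assms(1)]
  {
    case 0
    obtain Z Q :: "('a, nat \<Rightarrow> 'k) module" and i p where Q: "projective A Q" "ses A Z i Q p M"
      by (rule syzygy_exists[OF 0(1)]) (rule that)
    note S = sesD[OF Q(2)]
    show ?case
      using ext_on_radd[OF assms(1) _ S(4,5,7)] 0(2) unfolding ext_zero_0_iff_ext_on[OF Q N(1)] ext_zero_0_iff_ext_on[OF Q N(2)] by blast
  next
    case (Suc n)
    obtain Z Q :: "('a, nat \<Rightarrow> 'k) module" and i p where Q: "projective A Q" "ses A Z i Q p M"
      by (rule syzygy_exists[OF Suc.prems(1)]) (rule that)
    show ?case
      using Suc.IH[OF sesD(1)[OF Q(2)]] Suc.prems(2) unfolding ext_zero_Suc_proj[OF Q N(1)] ext_zero_Suc_proj[OF Q N(2)] by blast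
  }
qed

lemma ext_zero_radd_left:
  assumes "radd A X M" "fg_module A N" "ext_zero A n X N"
  shows "ext_zero A n M N"
  using assms(2,3)
proof (induction n arbitrary: N)
  note M = raddD[OF assms(1)]
  {
    case 0
    obtain J Y :: "('a, nat \<Rightarrow> 'k) module" and j q where J: "injective A J" "ses A N j J q Y"
      by (rule injective_hull_exists[OF 0(1)]) (rule that)
    note S = sesD[OF J(2)]
    show ?case
      using lift_on_radd[OF assms(1) _ S(5,6,8)] 0(2) unfolding ext_zero_0_iff_lift_on[OF J M(1)] ext_zero_0_iff_lift_on[OF J M(2)] by blast
  next
    case (Suc n)
    obtain J Y :: "('a, nat \<Rightarrow> 'k) module" and j q where J: "injective A J" "ses A N j J q Y"
      by (rule injective_hull_exists[OF Suc.prems(1)]) (rule that)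
    show ?case
      using Suc.IH[OF sesD(3)[OF J(2)]] Suc.prems(2) unfolding ext_zero_Suc_inj[OF J M(1)] ext_zero_Suc_inj[OF J M(2)] by blast
  }
qed

lemma ext_zero_projective:
  assumes "projective A M" "fg_module A N"
  shows "ext_zero A n M N"
  using assms(2)
proof (induction n arbitrary: N)
  have M: "fg_module A M" using assms(1) by (simp add: projective_def)
  {
    case 0
    obtain J Y :: "('a, nat \<Rightarrow> 'k) module" and j q where J: "injective A J" "ses A N j J q Y"
      by (rule injective_hull_exists[OF 0(1)]) (rule that)
    note S = sesD[OF J(2)]
    have "lift_on A M J q Y"
      unfolding lift_on_def
    proof (intro allI impI)
      fix f assume f: "lin A M Y f"
      obtain g where "lin A M J g" "\<And>x. x \<in> carrier M \<Longrightarrow> q (g x) = f x"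
        by (rule projective_lift[OF assms(1) S(2,3,8,10) f]) (rule that)
      then show "\<exists>g. lin A M J g \<and> (\<forall>x\<in>carrier M. q (g x) = f x)" by auto
    qed
    then show ?case using ext_zero_0_iff_lift_on[OF J M] by blast
  next
    case (Suc n)
    obtain J Y :: "('a, nat \<Rightarrow> 'k) module" and j q where J: "injective A J" "ses A N j J q Y"
      by (rule injective_hull_exists[OF Suc.prems(1)]) (rule that)
    show ?case using Suc.IH[OF sesD(3)[OF J(2)]] ext_zero_Suc_inj[OF J M] by blast
  }
qed

text \<open>Vanishing against the syzygy \<open>Z\<close> itself extends the identity of
  \<open>Z\<close> to a retraction of \<open>Q\<close>, so the sequence splits and \<open>M\<close>
  is a retract of a projective module.\<close>

lemma ext_zero_projectiveI:
  assumes "fg_module A M" "\<And>N. fg_module A N \<Longrightarrow> ext_zero A 0 M N"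
  shows "projective A M"
proof -
  obtain Z Q :: "('a, nat \<Rightarrow> 'k) module" and i p where Q: "projective A Q" "ses A Z i Q p M"
    by (rule syzygy_exists[OF assms(1)]) (rule that)
  note S = sesD[OF Q(2)]
  have E: "ext_on A Z i Q Z" using assms(2)[OF S(1)] ext_zero_0_iff_ext_on[OF Q S(1)] by blast
  obtain r where r: "lin A Q Z r" "\<And>x. x \<in> carrier Z \<Longrightarrow> r (i x) = x"
    by (rule ext_onD[OF E lin_id]) (rule that)
  let ?d = "\<lambda>x. x \<ominus>\<^bsub>Q\<^esub> i (r x)"
  have d: "lin A Q Q ?d" by (rule lin_minus[OF lin_id lin_comp[OF r(1) S(7)] S(5)])
  have "?d (i x) = \<zero>\<^bsub>Q\<^esub>" if "x \<in> carrier Z" for x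
    using r(2)[OF that] diff_self[OF S(5) lin_closed[OF S(7) that]] by simp
  then obtain s where s: "lin A M Q s" "\<And>x. x \<in> carrier Q \<Longrightarrow> s (p x) = ?d x"
    using ses_factor[OF Q(2) S(5) d] by metis
  have "p (s m) = m" if m: "m \<in> carrier M" for m
  proof -
    obtain x where x: "x \<in> carrier Q" "p x = m" using S(13)[OF m] by auto
    have "p (s (p x)) = p x \<ominus>\<^bsub>M\<^esub> p (i (r x))"
      using s(2)[OF x(1)] lin_diff[OF S(8,5,6) x(1) lin_closed[OF S(7) lin_closed[OF r(1) x(1)]]] by simp
    also have "\<dots> = p x"
      using S(12)[OF lin_closed[OF r(1) x(1)]] diff_zero_eq[OF S(6) lin_closed[OF S(8) x(1)]] by simp
    finally show ?thesis using x by simp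
  qed
  then have "radd A Q M" by (rule radd_of_retract[OF S(2,3) s(1) S(8)])
  with Q(1) show ?thesis by (rule projective_radd)
qed

lemma radd_copy:
  assumes "fg_module A M"
  shows "radd A M (copy A M)" "radd A (copy A M) M"
proof -
  show "radd A M (copy A M)"
    by (rule radd_of_retract[OF assms fg_copy[OF assms] lin_copy_inv[OF assms] lin_copy_map[OF assms]]) (rule copy_map_copy_inv[OF assms])
  show "radd A (copy A M) M"
    by (rule radd_of_retract[OF fg_copy[OF assms] assms lin_copy_map[OF assms] lin_copy_inv[OF assms]]) (rule copy_inv_copy_map[OF assms])
qed

lemma ext_on_copy:
  assumes "fg_module A N" "left_module A Z" "left_module A Q" "lin A Z Q i"
  shows "ext_on A Z i Q (copy A N) \<longleftrightarrow> ext_on A Z i Q N"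
  using ext_on_radd[OF radd_copy(1)[OF assms(1)] _ assms(2-4)] ext_on_radd[OF radd_copy(2)[OF assms(1)] _ assms(2-4)] by blast

end

section \<open>Special tilting modules\<close>

definition hom_zero :: "('r, 'z) ring_scheme \<Rightarrow> ('r, 'm) module \<Rightarrow> ('r, 'n) module \<Rightarrow> bool" where
  "hom_zero R M N \<longleftrightarrow> (\<forall>f. lin R M N f \<longrightarrow> (\<forall>x\<in>carrier M. f x = \<zero>\<^bsub>N\<^esub>))"

lemma hzD: "hom_zero R M N \<Longrightarrow> lin R M N f \<Longrightarrow> x \<in> carrier M \<Longrightarrow> f x = \<zero>\<^bsub>N\<^esub>"
  by (simp add: hom_zero_def)

lemma hom_zero_radd:
  assumes "radd R X M" "hom_zero R X N" "left_module R N"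
  shows "hom_zero R M N"
  unfolding hom_zero_def
proof (intro allI impI ballI)
  note M = raddD[OF assms(1)]
  interpret N: left_module R N by fact
  fix f x assume f: "lin R M N f" and x: "x \<in> carrier M"
  have "f (u x) = \<zero>\<^bsub>N\<^esub>" if "fac R X M M u" for u
    using that
  proof induction
    case (fac_zero u)
    then show ?case using x lin_zero[OF f M(4) assms(3)] by simp
  next
    case (fac_step v s r u)
    note sx = lin_closed[OF fac_step.hyps(2) x]
    have "f (r (s x)) = \<zero>\<^bsub>N\<^esub>" by (rule hzD[OF assms(2) lin_comp[OF fac_step.hyps(3) f] sx])
    then show ?case
      using lin_add[OF f lin_closed[OF fac_lin[OF fac_step.hyps(1) M(4,4)] x] lin_closed[OF fac_step.hyps(3) sx]]
        fac_step.IH fac_step.hyps(4)[OF x] by simp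
  qed
  from this[OF M(5)] show "f x = \<zero>\<^bsub>N\<^esub>" .
qed

text \<open>A coresolution with terms t_0, ..., t_(k-1) in add P and t_k in add T, cut into short
  exact sequences; for the regular module it is the sequence in the definition of a P-special
  tilting module.\<close>

primrec cores :: "('k, 'a) module \<Rightarrow> ('a, 'p) module \<Rightarrow> ('a, 't) module \<Rightarrow> nat \<Rightarrow> ('a, nat \<Rightarrow> 'k) module \<Rightarrow> bool" where
  "cores A P T 0 C \<longleftrightarrow> radd A T C"
| "cores A P T (Suc k) C \<longleftrightarrow> (\<exists>(t :: ('a, nat \<Rightarrow> 'k) module) (L :: ('a, nat \<Rightarrow> 'k) module) i q.
     radd A P t \<and> ses A C i t q L \<and> cores A P T k L)"

text \<open>The number counts terms in add P, so \<open>Suc m\<close> corresponds to index m in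
  \<open>gen\<close>; the kernel left at the end is arbitrary. Exactness under Hom(P,-) is automatic
  once P is projective (\<open>gen_iff\<close>).\<close>

primrec gen_res :: "('k, 'a) module \<Rightarrow> ('a, 'p) module \<Rightarrow> nat \<Rightarrow> ('a, nat \<Rightarrow> 'k) module \<Rightarrow> bool" where
  "gen_res A P 0 M \<longleftrightarrow> True"
| "gen_res A P (Suc m) M \<longleftrightarrow> (\<exists>(N :: ('a, nat \<Rightarrow> 'k) module) (F :: ('a, nat \<Rightarrow> 'k) module) i p.
     radd A P F \<and> ses A N i F p M \<and> gen_res A P m N)"

lemma cores_SucE:
  assumes "cores A P T (Suc k) C"
  obtains t L :: "('a, nat \<Rightarrow> 'k) module" and i q where "radd A P t" "ses (A :: ('k, 'a) module) C i t q L" "cores A P T k L"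
  using assms unfolding cores.simps by (elim exE conjE) (rule that)

lemma cores_SucI:
  "radd A P t \<Longrightarrow> ses (A :: ('k, 'a) module) C i (t :: ('a, nat \<Rightarrow> 'k) module) q L \<Longrightarrow> cores A P T k L \<Longrightarrow> cores A P T (Suc k) C"
  unfolding cores.simps by (intro exI conjI)

lemma gen_res_SucE:
  assumes "gen_res A P (Suc m) M"
  obtains N F :: "('a, nat \<Rightarrow> 'k) module" and i p where "radd A P F" "ses (A :: ('k, 'a) module) N i F p M" "gen_res A P m N"
  using assms unfolding gen_res.simps by (elim exE conjE) (rule that)

lemma gen_res_SucI:
  "radd A P F \<Longrightarrow> ses (A :: ('k, 'a) module) N i (F :: ('a, nat \<Rightarrow> 'k) module) p M \<Longrightarrow> gen_res A P m N \<Longrightarrow> gen_res A P (Suc m) M"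
  unfolding gen_res.simps by (intro exI conjI)

text \<open>Special tilting in terms of \<open>ext_zero\<close>, whose index n stands for degree n +
  1; hence \<open>pd_T\<close> says that T has projective dimension at most k. All modules have the
  carrier type of \<open>copy\<close>, so that the same locale fits the algebra and the endomorphism
  algebra.\<close>

locale special_tilt = fd_alg K A for K :: "'k ring" and A :: "('k, 'a) module" +
  fixes P T :: "('a, nat \<Rightarrow> 'k) module" and k :: nat
  assumes proj_P: "projective A P"
    and P_in_T: "radd A T P"
    and pd_T: "\<And>n N. k \<le> n \<Longrightarrow> fg_module A N \<Longrightarrow> ext_zero A n T N"
    and ext_T: "\<And>n. ext_zero A n T T"
    and cores_A: "cores A P T k (copy A (regular A))"
begin

lemma fg_T: "fg_module A T" and fg_P: "fg_module A P"
  using raddD(1,2)[OF P_in_T] .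

lemma radd_P_projective: "radd A P M \<Longrightarrow> projective A M"
  by (rule projective_radd[OF proj_P])

lemma ext_zero_T_radd_P: "radd A P F \<Longrightarrow> ext_zero A n T F"
  using ext_zero_radd_right[OF radd_trans[OF P_in_T] fg_T ext_T] .

text \<open>A term in add P is projective, so each module of the coresolution is a syzygy of the
  next cokernel; every step raises the degree by one until add T is reached.\<close>

lemma cores_ext_zero:
  assumes "cores A P T j L" "fg_module A M" "ext_zero A (j + n) T M"
  shows "ext_zero A n L M"
  using assms(1,3)
proof (induction j arbitrary: n L)
  case 0
  then show ?case using ext_zero_radd_left[of T L M n] assms(2) by simp
next
  case (Suc j)
  obtain t L' :: "('a, nat \<Rightarrow> 'k) module" and i q where t: "radd A P t" "ses A L i t q L'" "cores A P T j L'"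
    using Suc.prems(1) by (rule cores_SucE) (rule that)
  have "ext_zero A (Suc n) L' M" by (rule Suc.IH[OF t(3)]) (use Suc.prems(2) in simp)
  then show ?case using ext_zero_Suc_proj[OF radd_P_projective[OF t(1)] t(2) assms(2)] by simp
qed

lemma cover:
  assumes "fg_module A M" "0 < k" "ext_zero A (k - 1) T M"
  obtains N F :: "('a, nat \<Rightarrow> 'k) module" and i p where "radd A P F" "ses A N i F p M"
proof -
  note M = fg_moduleD[OF assms(1)]
  interpret M: left_module A M by (rule M)
  let ?R = "regular A" let ?C = "copy A ?R"
  obtain k' where k': "k = Suc k'" using assms(2) by (cases k) auto
  obtain t L :: "('a, nat \<Rightarrow> 'k) module" and i q where t: "radd A P t" "ses A ?C i t q L" "cores A P T k' L"
    using cores_A unfolding k' by (rule cores_SucE) (rule that)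
  note S = sesD[OF t(2)]
  \<comment> \<open>The remaining coresolution of \<open>L\<close> has length k - 1, so Ext^1(L,M)
    is controlled by degree k of T, which is index k - 1.\<close>
  have "ext_zero A 0 L M" by (rule cores_ext_zero[OF t(3) assms(1)]) (use assms(3) k' in simp)
  then have E: "ext_on A ?C i t M" using ext_zero_0_iff_ext_on[OF radd_P_projective[OF t(1)] t(2) assms(1)] by simp
  have ex: "\<exists>(X :: ('a, nat \<Rightarrow> 'k) module) u x. left_module A X \<and> fac A P X M u \<and> x \<in> carrier X \<and> y = u x"
    if y: "y \<in> carrier M" for y
  proof -
    \<comment> \<open>The map sending one to \<open>y\<close> is extended from the algebra to
      \<open>t\<close>. As \<open>t\<close> lies in add P, the extension factors through copies of
      P, which is what \<open>pw_onto\<close> asks for.\<close>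
    obtain g where g: "lin A t M g" "\<And>x. x \<in> carrier ?C \<Longrightarrow> g (i x) = copy_inv A ?R x \<odot>\<^bsub>M\<^esub> y"
      by (rule ext_onD[OF E lin_comp[OF lin_copy_inv[OF fg_regular] lin_from_regular[OF M y]]]) (rule that)
    let ?e = "copy_map A ?R \<one>\<^bsub>A\<^esub>"
    have e: "?e \<in> carrier ?C" using copy_map_closed[OF fg_regular, of "\<one>\<^bsub>A\<^esub>"] by simp
    have "g (i ?e) = y" using g(2)[OF e] copy_inv_copy_map[OF fg_regular, of "\<one>\<^bsub>A\<^esub>"] M.smult_one[OF y] by simp
    moreover have "fac A P t M g"
      using fac_comp_left[OF raddD(5)[OF t(1)] g(1) S(5,5) M raddD(3)[OF t(1)]] .
    ultimately show ?thesis using S(5) lin_closed[OF S(7) e] by (intro exI[of _ t] exI[of _ g] exI[of _ "i ?e"]) simp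
  qed
  obtain n h where h: "lin A (pw n P) M h" "h ` carrier (pw n P) = carrier M"
    using pw_onto[OF raddD(4)[OF P_in_T] assms(1) ex] by blast
  let ?G = "pw n P" let ?F = "copy A ?G"
  have G: "fg_module A ?G" by (rule fg_pw[OF fg_P])
  have r: "radd A P ?F" by (rule radd_trans[OF radd_pw[OF fg_P] radd_copy(1)[OF G]])
  have "(\<lambda>x. h (copy_inv A ?G x)) ` carrier ?F = h ` copy_inv A ?G ` carrier ?F" by (simp only: image_image)
  then have c: "(\<lambda>x. h (copy_inv A ?G x)) ` carrier ?F = carrier M" using bij_copy_inv[OF G] h(2) by (simp only: bij_betw_def)
  show thesis
    by (rule that[OF r kernel_ses[OF lin_comp[OF lin_copy_inv[OF G] h(1)] fg_copy[OF G] assms(1) c]])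
qed

text \<open>Covering by add P raises the degrees of vanishing by one for the kernel, so the
  induction runs with vanishing above degree k - m only. For m = k these are all positive
  degrees.\<close>

lemma ext_zero_gen_res:
  assumes "fg_module A M" "m \<le> k" "\<And>n. k - m \<le> n \<Longrightarrow> ext_zero A n T M"
  shows "gen_res A P m M"
  using assms
proof (induction m arbitrary: M)
  case (Suc m)
  obtain N F :: "('a, nat \<Rightarrow> 'k) module" and i p where F: "radd A P F" "ses A N i F p M"
    by (rule cover[OF Suc.prems(1) _ Suc.prems(3)]) (use Suc.prems(2) that in auto)
  note S = sesD[OF F(2)]
  \<comment> \<open>The index \<open>n\<close> is positive because \<open>Suc m\<close> is at most
    k, so it can be lowered by one to use the hypothesis on \<open>M\<close>.\<close>
  have "ext_zero A n T N" if "k - m \<le> n" for n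
  proof (cases n)
    case (Suc n')
    have "ext_zero A (Suc n') T N"
      by (rule ext_zero_les_left[OF fg_T F(2) Suc.prems(3) ext_zero_T_radd_P[OF F(1)]]) (use that Suc Suc.prems(2) in simp)
    then show ?thesis using Suc by simp
  qed (use that Suc.prems(2) in simp)
  then have "gen_res A P m N" using Suc.IH[OF S(1)] Suc.prems(2) by simp
  then show ?case by (rule gen_res_SucI[OF F])
qed simp

text \<open>As F has no higher extensions by T, vanishing of Ext^(i+1)(T,N) gives vanishing of
  Ext^i(T,M). After m steps the degree exceeds k and \<open>pd_T\<close> applies.\<close>

lemma gen_res_ext_zero:
  assumes "gen_res A P m M" "fg_module A M" "m \<le> k" "k - m \<le> n"
  shows "ext_zero A n T M"
  using assms
proof (induction m arbitrary: M n)
  case 0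
  then show ?case using pd_T by simp
next
  case (Suc m)
  obtain N F :: "('a, nat \<Rightarrow> 'k) module" and i p where F: "radd A P F" "ses A N i F p M" "gen_res A P m N"
    using Suc.prems(1) by (rule gen_res_SucE) (rule that)
  have "ext_zero A (Suc n) T N" by (rule Suc.IH[OF F(3) sesD(1)[OF F(2)]]) (use Suc.prems in auto)
  then show ?case by (rule ext_zero_les_right[OF fg_T F(2) ext_zero_T_radd_P[OF F(1)]])
qed

text \<open>The m terms of the resolution of \<open>X\<close> are projective and admit no nonzero
  map to \<open>M\<close>, so degrees zero to m - 1 of Ext(X,M) vanish.\<close>

lemma gen_res_hom_zero_ext_zero:
  assumes "gen_res A P m X" "fg_module A X" "hom_zero A P M" "fg_module A M"
  shows "(0 < m \<longrightarrow> hom_zero A X M) \<and> (\<forall>n. Suc n < m \<longrightarrow> ext_zero A n X M)"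
  using assms(1,2)
proof (induction m arbitrary: X)
  case (Suc m)
  obtain N F :: "('a, nat \<Rightarrow> 'k) module" and i p where F: "radd A P F" "ses A N i F p X" "gen_res A P m N"
    using Suc.prems(1) by (rule gen_res_SucE) (rule that)
  note S = sesD[OF F(2)] and M = fg_moduleD[OF assms(4)]
  have IH: "0 < m \<longrightarrow> hom_zero A N M" "\<forall>n. Suc n < m \<longrightarrow> ext_zero A n N M" using Suc.IH[OF F(3) S(1)] by auto
  have hF: "hom_zero A F M" by (rule hom_zero_radd[OF F(1) assms(3) M])
  have "hom_zero A X M"
    unfolding hom_zero_def
  proof (intro allI impI ballI)
    fix f x assume f: "lin A X M f" and "x \<in> carrier X"
    then obtain y where y: "y \<in> carrier F" "p y = x" using S(13) by auto
    then show "f x = \<zero>\<^bsub>M\<^esub>" using hzD[OF hF lin_comp[OF S(8) f] y(1)] by simp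
  qed
  moreover have "ext_zero A n X M" if n: "Suc n < Suc m" for n
  proof (cases n)
    case 0
    have hN: "hom_zero A N M" using IH(1) n 0 by simp
    have "ext_on A N i F M"
      unfolding ext_on_def
    proof (intro allI impI)
      fix f assume "lin A N M f"
      then show "\<exists>g. lin A F M g \<and> (\<forall>x\<in>carrier N. g (i x) = f x)"
        using hzD[OF hN] lin_const_zero[OF M] by (intro exI[of _ "\<lambda>_. \<zero>\<^bsub>M\<^esub>"]) simp
    qed
    then show ?thesis using ext_zero_0_iff_ext_on[OF radd_P_projective[OF F(1)] F(2) assms(4)] 0 by simp
  next
    case (Suc n')
    then show ?thesis using ext_zero_Suc_proj[OF radd_P_projective[OF F(1)] F(2) assms(4)] IH(2) n by simp
  qed
  ultimately show ?case by simp
qed simp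

lemma gen_res_T: "gen_res A P k T"
  by (rule ext_zero_gen_res[OF fg_T le_refl ext_T])

lemma tilting_class_zero:
  assumes "fg_module A M"
  shows "(\<forall>n. ext_zero A n T M) \<longleftrightarrow> gen_res A P k M"
proof
  assume "\<forall>n. ext_zero A n T M"
  then show "gen_res A P k M" by (intro ext_zero_gen_res[OF assms le_refl]) simp
next
  assume "gen_res A P k M"
  then show "\<forall>n. ext_zero A n T M" using gen_res_ext_zero[OF _ assms le_refl] by simp
qed

lemma tilting_class_k:
  assumes "fg_module A M" "0 < k"
  shows "hom_zero A T M \<and> (\<forall>n. Suc n \<noteq> k \<longrightarrow> ext_zero A n T M) \<longleftrightarrow> hom_zero A P M"
proof
  assume "hom_zero A T M \<and> (\<forall>n. Suc n \<noteq> k \<longrightarrow> ext_zero A n T M)"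
  then show "hom_zero A P M" using hom_zero_radd[OF P_in_T _ fg_moduleD[OF assms(1)]] by simp
next
  assume h: "hom_zero A P M"
  note g = gen_res_hom_zero_ext_zero[OF gen_res_T fg_T h assms(1)]
  \<comment> \<open>Degree n + 1 differs from k: below k the resolution of T by add P decides, above
    k the projective dimension.\<close>
  have "ext_zero A n T M" if "Suc n \<noteq> k" for n
  proof (cases "Suc n < k")
    case False
    then show ?thesis using that by (intro pd_T assms(1)) simp
  qed (use g in simp)
  then show "hom_zero A T M \<and> (\<forall>n. Suc n \<noteq> k \<longrightarrow> ext_zero A n T M)" using g assms(2) by simp
qed

lemma tilting_class_other:
  assumes "fg_module A M" "0 < k" "j \<noteq> 0" "j \<noteq> k"
  shows "hom_zero A T M \<and> (\<forall>n. Suc n \<noteq> j \<longrightarrow> ext_zero A n T M) \<longleftrightarrow> carrier M = {\<zero>\<^bsub>M\<^esub>}"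
proof
  assume h: "hom_zero A T M \<and> (\<forall>n. Suc n \<noteq> j \<longrightarrow> ext_zero A n T M)"
  have M: "left_module A M" using assms(1) by (rule fg_moduleD)
  have hP: "hom_zero A P M" using hom_zero_radd[OF P_in_T _ M] h by simp
  have x: "ext_zero A (k - 1) T M" using h assms(2,4) by simp
  obtain N F :: "('a, nat \<Rightarrow> 'k) module" and i p where F: "radd A P F" "ses A N i F p M"
    by (rule cover[OF assms(1,2) x]) (rule that)
  note S = sesD[OF F(2)]
  show "carrier M = {\<zero>\<^bsub>M\<^esub>}"
  proof (intro equalityI subsetI)
    fix m assume "m \<in> carrier M"
    then obtain y where "y \<in> carrier F" "p y = m" using S(13) by blast
    then show "m \<in> {\<zero>\<^bsub>M\<^esub>}" using hzD[OF hom_zero_radd[OF F(1) hP M] S(8)] by simp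
  qed (simp add: zero_in[OF M])
next
  assume z: "carrier M = {\<zero>\<^bsub>M\<^esub>}"
  have "hom_zero A T M"
    unfolding hom_zero_def
  proof (intro allI impI ballI)
    fix f x assume "lin A T M f" "x \<in> carrier T"
    then have "f x \<in> carrier M" by (rule lin_closed)
    then show "f x = \<zero>\<^bsub>M\<^esub>" unfolding z by simp
  qed
  \<comment> \<open>The identity of a zero module is the empty sum of composites, so it lies in add
    T and \<open>ext_T\<close> gives all vanishing at once.\<close>
  moreover have "radd A T M"
    unfolding radd_def
  proof (intro conjI fg_T assms(1) fac_zero)
    fix x assume "x \<in> carrier M"
    then show "x = \<zero>\<^bsub>M\<^esub>" unfolding z by simp
  qed
  then have "ext_zero A n T M" for n by (rule ext_zero_radd_right[OF _ fg_T ext_T])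
  ultimately show "hom_zero A T M \<and> (\<forall>n. Suc n \<noteq> j \<longrightarrow> ext_zero A n T M)" by simp
qed

end

context fd_alg
begin

section \<open>Invariance of resolutions and coresolutions under isomorphism\<close>

lemma gen_res_iso:
  assumes "gen_res A P m M" "fg_module A M'" "lin A M M' c" "bij_betw c (carrier M) (carrier M')"
  shows "gen_res A P m M'"
proof (cases m)
  case (Suc n)
  obtain N F :: "('a, nat \<Rightarrow> 'k) module" and i p where F: "radd A P F" "ses A N i F p M" "gen_res A P n N"
    using assms(1) unfolding Suc by (rule gen_res_SucE) (rule that)
  note S = sesD[OF F(2)]
  have "ses A N (\<lambda>x. i x) F (\<lambda>x. c (p x)) M'"
    by (rule ses_iso[OF F(2) S(1,2) assms(2) lin_id _ lin_id _ lin_id _ assms(3,4)]) (simp_all add: bij_betw_def)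
  then show ?thesis unfolding Suc by (rule gen_res_SucI[OF F(1) _ F(3)])
qed simp

lemma cores_iso:
  assumes "cores A P T j C" "fg_module A C'" "lin A C' C a" "bij_betw a (carrier C') (carrier C)"
  shows "cores A P T j C'"
proof (cases j)
  case 0
  have C': "left_module A C'" using assms(2) by (rule fg_moduleD)
  have "radd A T C" using assms(1) unfolding 0 by simp
  then have "radd A T C'"
    by (rule radd_retract[OF _ assms(2,3) lin_inv[OF assms(3,4) C']]) (use assms(4) in \<open>simp add: bij_betw_def\<close>)
  then show ?thesis unfolding 0 by simp
next
  case (Suc n)
  obtain t L :: "('a, nat \<Rightarrow> 'k) module" and i q where t: "radd A P t" "ses A C i t q L" "cores A P T n L"
    using assms(1) unfolding Suc by (rule cores_SucE) (rule that)
  note S = sesD[OF t(2)]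
  have "ses A C' (\<lambda>x. i (a x)) t (\<lambda>x. q x) L"
    by (rule ses_iso[OF t(2) assms(2) S(2,3) assms(3,4) lin_id _ lin_id _ lin_id]) (simp_all add: bij_betw_def)
  then show ?thesis unfolding Suc by (rule cores_SucI[OF t(1) _ t(3)])
qed

end

section \<open>The endomorphism algebra\<close>

lemma Hom_simps [simp]:
  "carrier (Hom A M N) = lhom A M N" "\<zero>\<^bsub>Hom A M N\<^esub> = (\<lambda>x\<in>carrier M. \<zero>\<^bsub>N\<^esub>)"
  "f \<oplus>\<^bsub>Hom A M N\<^esub> g = (\<lambda>x\<in>carrier M. f x \<oplus>\<^bsub>N\<^esub> g x)"
  "c \<odot>\<^bsub>Hom A M N\<^esub> f = (\<lambda>x\<in>carrier M. (c \<odot>\<^bsub>A\<^esub> \<one>\<^bsub>A\<^esub>) \<odot>\<^bsub>N\<^esub> f x)"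
  by (simp_all add: Hom_def)

lemma End_simps [simp]:
  "carrier (End A T) = lhom A T T" "\<zero>\<^bsub>End A T\<^esub> = (\<lambda>x\<in>carrier T. \<zero>\<^bsub>T\<^esub>)"
  "f \<oplus>\<^bsub>End A T\<^esub> g = (\<lambda>x\<in>carrier T. f x \<oplus>\<^bsub>T\<^esub> g x)"
  "c \<odot>\<^bsub>End A T\<^esub> f = (\<lambda>x\<in>carrier T. (c \<odot>\<^bsub>A\<^esub> \<one>\<^bsub>A\<^esub>) \<odot>\<^bsub>T\<^esub> f x)"
  "f \<otimes>\<^bsub>End A T\<^esub> g = compose (carrier T) f g" "\<one>\<^bsub>End A T\<^esub> = (\<lambda>x\<in>carrier T. x)"
  by (simp_all add: End_def Hom_def)

lemma End_module_simps [simp]: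
  "carrier (End_module T) = carrier T" "\<zero>\<^bsub>End_module T\<^esub> = \<zero>\<^bsub>T\<^esub>" "x \<oplus>\<^bsub>End_module T\<^esub> y = x \<oplus>\<^bsub>T\<^esub> y"
  "b \<odot>\<^bsub>End_module T\<^esub> x = b x"
  by (simp_all add: End_module_def)

lemma Hom_End_module_simps [simp]:
  "carrier (Hom_End_module A M T) = lhom A M T" "\<zero>\<^bsub>Hom_End_module A M T\<^esub> = (\<lambda>x\<in>carrier M. \<zero>\<^bsub>T\<^esub>)"
  "f \<oplus>\<^bsub>Hom_End_module A M T\<^esub> g = (\<lambda>x\<in>carrier M. f x \<oplus>\<^bsub>T\<^esub> g x)"
  "b \<odot>\<^bsub>Hom_End_module A M T\<^esub> f = compose (carrier M) b f"
  by (simp_all add: Hom_End_module_def)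

lemma lhom_closed: "f \<in> lhom R M N \<Longrightarrow> x \<in> carrier M \<Longrightarrow> f x \<in> carrier N"
  by (rule lin_closed[OF lhom_lin])

lemma lhom_eqI: "f \<in> lhom R M N \<Longrightarrow> g \<in> lhom R M N \<Longrightarrow> (\<And>x. x \<in> carrier M \<Longrightarrow> f x = g x) \<Longrightarrow> f = g"
  by (rule extensionalityI[of _ "carrier M"]) (simp_all add: lhom_iff)

lemma compose_lhom: "f \<in> lhom R M N \<Longrightarrow> g \<in> lhom R L M \<Longrightarrow> left_module R L \<Longrightarrow> compose (carrier L) f g \<in> lhom R L N"
  unfolding compose_def by (rule restrict_lhom[OF lin_comp[OF lhom_lin lhom_lin]])

context fd_alg
begin

lemma left_module_Hom:
  assumes "left_module A M" "left_module A N"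
  shows "left_module K (Hom A M N)"
proof -
  interpret M: left_module A M by fact
  interpret N: left_module A N by fact
  interpret KN: left_module K "scalar_restriction A N" by (rule left_module_scalar[OF assms(2)])
  let ?H = "Hom A M N"
  have cl: "f x \<in> carrier N" if "f \<in> carrier ?H" "x \<in> carrier M" for f x
    using lhom_closed[of f A M N x] that by simp
  have sN: "sc c \<odot>\<^bsub>N\<^esub> x \<in> carrier N" if "c \<in> carrier K" "x \<in> carrier N" for c x
    using that by (intro N.smult_closed sc_closed)
  have add: "f \<oplus>\<^bsub>?H\<^esub> g \<in> carrier ?H" if "f \<in> carrier ?H" "g \<in> carrier ?H" for f g
    using restrict_lhom[OF lin_plus[OF lhom_lin lhom_lin assms(2)] assms(1), of f g] that by simp
  have smu: "c \<odot>\<^bsub>?H\<^esub> f \<in> carrier ?H" if c: "c \<in> carrier K" and f: "f \<in> carrier ?H" for c f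
  proof -
    have f': "lin A M N f" using f by (intro lhom_lin) simp
    \<comment> \<open>Scalars of the field are central in the algebra, so a scalar multiple of a
      linear map is linear.\<close>
    have "lin A M N (\<lambda>x. sc c \<odot>\<^bsub>N\<^esub> f x)"
    proof (rule linI)
      fix a x assume a: "a \<in> carrier A" "x \<in> carrier M"
      have "sc c \<odot>\<^bsub>N\<^esub> (a \<odot>\<^bsub>N\<^esub> f x) = a \<odot>\<^bsub>N\<^esub> (sc c \<odot>\<^bsub>N\<^esub> f x)"
        using a c cl[OF f a(2)] by (simp add: N.smult_assoc1[symmetric] sc_closed sc_mult mult_sc)
      then show "sc c \<odot>\<^bsub>N\<^esub> f (a \<odot>\<^bsub>M\<^esub> x) = a \<odot>\<^bsub>N\<^esub> (sc c \<odot>\<^bsub>N\<^esub> f x)" using lin_smult[OF f' a] by simp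
    qed (simp_all add: c cl[OF f] sN lin_add[OF f'] N.smult_r_distr sc_closed)
    then show ?thesis using restrict_lhom[OF _ assms(1)] by simp
  qed
  have z: "\<zero>\<^bsub>?H\<^esub> \<in> carrier ?H" using restrict_lhom[OF lin_const_zero[OF assms(2)] assms(1)] by simp
  have ng: "(\<lambda>x\<in>carrier M. \<ominus>\<^bsub>N\<^esub> f x) \<in> carrier ?H" if f: "f \<in> carrier ?H" for f
  proof -
    have f': "lin A M N f" using f by (intro lhom_lin) simp
    have "lin A M N (\<lambda>x. \<ominus>\<^bsub>N\<^esub> f x)"
      by (rule linI) (simp_all add: cl[OF f] lin_add[OF f'] lin_smult[OF f'] N.M.minus_add N.smult_r_minus)
    then show ?thesis using restrict_lhom[OF _ assms(1)] by simp
  qed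
  have ab: "abelian_group ?H"
  proof (rule abelian_groupI)
    fix f assume f: "f \<in> carrier ?H"
    show "\<exists>g\<in>carrier ?H. g \<oplus>\<^bsub>?H\<^esub> f = \<zero>\<^bsub>?H\<^esub>"
      using ng[OF f] cl[OF f] by (intro bexI[of _ "\<lambda>x\<in>carrier M. \<ominus>\<^bsub>N\<^esub> f x"]) (auto simp: fun_eq_iff N.M.l_neg)
    show "\<zero>\<^bsub>?H\<^esub> \<oplus>\<^bsub>?H\<^esub> f = f"
      by (rule lhom_eqI[of _ A M N]) (use add[OF z f] f cl[OF f] in auto)
  next
    fix f g h assume h: "f \<in> carrier ?H" "g \<in> carrier ?H" "h \<in> carrier ?H"
    show "f \<oplus>\<^bsub>?H\<^esub> g \<oplus>\<^bsub>?H\<^esub> h = f \<oplus>\<^bsub>?H\<^esub> (g \<oplus>\<^bsub>?H\<^esub> h)"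
      using cl[OF h(1)] cl[OF h(2)] cl[OF h(3)] by (auto simp: fun_eq_iff N.M.a_assoc)
  next
    fix f g assume h: "f \<in> carrier ?H" "g \<in> carrier ?H"
    show "f \<oplus>\<^bsub>?H\<^esub> g = g \<oplus>\<^bsub>?H\<^esub> f"
      using cl[OF h(1)] cl[OF h(2)] by (auto simp: fun_eq_iff N.M.a_comm)
  qed (rule add z; assumption)+
  have k: "sc (c \<oplus>\<^bsub>K\<^esub> c') \<odot>\<^bsub>N\<^esub> x = sc c \<odot>\<^bsub>N\<^esub> x \<oplus>\<^bsub>N\<^esub> sc c' \<odot>\<^bsub>N\<^esub> x"
    "sc (c \<otimes>\<^bsub>K\<^esub> c') \<odot>\<^bsub>N\<^esub> x = sc c \<odot>\<^bsub>N\<^esub> (sc c' \<odot>\<^bsub>N\<^esub> x)" "sc \<one>\<^bsub>K\<^esub> \<odot>\<^bsub>N\<^esub> x = x"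
    if "c \<in> carrier K" "c' \<in> carrier K" "x \<in> carrier N" for c c' x
    using KN.smult_l_distr[of c c' x] KN.smult_assoc1[of c c' x] KN.smult_one[of x] that by simp_all
  show ?thesis
  proof (rule left_moduleI[OF K.ring_axioms ab smu])
    fix c c' f assume c: "c \<in> carrier K" "c' \<in> carrier K" and f: "f \<in> carrier ?H"
    show "(c \<oplus>\<^bsub>K\<^esub> c') \<odot>\<^bsub>?H\<^esub> f = c \<odot>\<^bsub>?H\<^esub> f \<oplus>\<^bsub>?H\<^esub> c' \<odot>\<^bsub>?H\<^esub> f" "(c \<otimes>\<^bsub>K\<^esub> c') \<odot>\<^bsub>?H\<^esub> f = c \<odot>\<^bsub>?H\<^esub> (c' \<odot>\<^bsub>?H\<^esub> f)"
      using k(1,2)[OF c cl[OF f]] by (auto simp: fun_eq_iff)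
  next
    fix c f g assume c: "c \<in> carrier K" and f: "f \<in> carrier ?H" "g \<in> carrier ?H"
    show "c \<odot>\<^bsub>?H\<^esub> (f \<oplus>\<^bsub>?H\<^esub> g) = c \<odot>\<^bsub>?H\<^esub> f \<oplus>\<^bsub>?H\<^esub> c \<odot>\<^bsub>?H\<^esub> g"
      using N.smult_r_distr[OF sc_closed[OF c] cl[OF f(1)] cl[OF f(2)]] by (auto simp: fun_eq_iff)
  next
    fix f assume f: "f \<in> carrier ?H"
    show "\<one>\<^bsub>K\<^esub> \<odot>\<^bsub>?H\<^esub> f = f"
      by (rule lhom_eqI[of _ A M N])
        (use smu[OF K.one_closed f] f k(3)[OF K.one_closed K.one_closed cl[OF f]] in auto)
  qed
qed

text \<open>A map is determined by its values on finitely many generators of \<open>M\<close>, which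
  embeds Hom into a power of \<open>N\<close> over the field.\<close>

lemma fg_Hom:
  assumes "fg_module A M" "fg_module A N"
  shows "fg_module K (Hom A M N)"
proof -
  note M = fg_moduleD[OF assms(1)] and N = fg_moduleD[OF assms(2)]
  note H = left_module_Hom[OF M N] and KN = left_module_scalar[OF N]
  obtain S where S: "finite S" "gens A M S" using assms(1) M by (auto simp: fg_module_def fin_gen_iff)
  obtain xs where xs: "set xs = S" using S(1) finite_list by blast
  have SM: "S \<subseteq> carrier M" using S(2) by (simp add: gens_def)
  have xM: "xs ! i \<in> carrier M" if "i < length xs" for i using that xs SM nth_mem by blast
  let ?W = "pw (length xs) (scalar_restriction A N)"
  let ?r = "\<lambda>f. \<lambda>i\<in>{..<length xs}. f (xs ! i)"
  have r: "lin K (Hom A M N) ?W ?r"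
  proof (rule linI)
    fix f assume "f \<in> carrier (Hom A M N)"
    then have "f \<in> lhom A M N" by simp
    then show "?r f \<in> carrier ?W" using lhom_closed xM by fastforce
  qed (auto simp: fun_eq_iff xM)
  have i: "inj_on ?r (carrier (Hom A M N))"
  proof (rule inj_onI)
    fix f g assume fg: "f \<in> carrier (Hom A M N)" "g \<in> carrier (Hom A M N)" "?r f = ?r g"
    then have fg': "f \<in> lhom A M N" "g \<in> lhom A M N" by auto
    have "S \<subseteq> {x \<in> carrier M. f x = g x}"
    proof
      fix x assume x: "x \<in> S"
      then obtain i where "i < length xs" "xs ! i = x" using xs by (metis in_set_conv_nth)
      then show "x \<in> {x \<in> carrier M. f x = g x}" using fun_cong[OF fg(3), of i] x SM by auto
    qed
    then have "x \<in> {x \<in> carrier M. f x = g x}" if "x \<in> carrier M" for x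
      using gensD[OF S(2) submod_equalizer[OF lhom_lin[OF fg'(1)] lhom_lin[OF fg'(2)] M N] _ that] by blast
    then show "f = g" by (intro lhom_eqI[OF fg']) simp
  qed
  have "fin_gen K ?W" using fg_pw[OF fg_scalar[OF assms(2)]] by (simp add: fg_module_def)
  then have "fin_gen K (Hom A M N)" by (rule fin_gen_inj[OF field_K r i H left_module_pw[OF KN]])
  then show ?thesis using H by (simp add: fg_module_def)
qed

end

text \<open>Composition from right to left makes \<open>T\<close> and the spaces Hom(M,T) left
  modules over \<open>E\<close>; the algebra B of the theorem is \<open>opp E\<close>, and its
  modules are reached from \<open>E\<close> by duality. \<open>G\<close> is the contravariant
  functor Hom(-,T).\<close>

locale end_algebra = fd_alg K A for K :: "'k ring" and A :: "('k, 'a) module" +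
  fixes T :: "('a, 't) module"
  assumes fgT: "fg_module A T"
begin

abbreviation "E \<equiv> End A T"
abbreviation "ET \<equiv> End_module T"
abbreviation G where "G M \<equiv> Hom_End_module A M T"

lemma lmT: "left_module A T"
  by (rule fg_moduleD[OF fgT])

sublocale T: left_module A T by (rule lmT)

lemma fd_alg_E: "fd_alg K E"
proof
  interpret H: left_module K "Hom A T T" by (rule left_module_Hom[OF lmT lmT])
  have eqs: "carrier E = carrier (Hom A T T)" "\<zero>\<^bsub>E\<^esub> = \<zero>\<^bsub>Hom A T T\<^esub>" "\<And>f g. f \<oplus>\<^bsub>E\<^esub> g = f \<oplus>\<^bsub>Hom A T T\<^esub> g"
    "\<And>c f. c \<odot>\<^bsub>E\<^esub> f = c \<odot>\<^bsub>Hom A T T\<^esub> f" by simp_all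
  have cl: "f x \<in> carrier T" if "f \<in> carrier E" "x \<in> carrier T" for f x
    using lhom_closed[of f A T T x] that by simp
  have ab: "abelian_group E"
  proof (rule abelian_groupI)
    fix f assume "f \<in> carrier E"
    then show "\<exists>y\<in>carrier E. y \<oplus>\<^bsub>E\<^esub> f = \<zero>\<^bsub>E\<^esub>"
      unfolding eqs by (intro bexI[of _ "\<ominus>\<^bsub>Hom A T T\<^esub> f"]) (simp_all only: H.M.l_neg H.M.a_inv_closed)
  qed (simp_all only: eqs H.M.a_closed H.M.zero_closed H.M.a_ac H.M.l_zero H.M.r_zero)
  have one: "\<one>\<^bsub>E\<^esub> \<in> carrier E" using restrict_lhom[OF lin_id lmT] by simp
  have mcl: "f \<otimes>\<^bsub>E\<^esub> g \<in> carrier E" if "f \<in> carrier E" "g \<in> carrier E" for f g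
    using compose_lhom[of f A T T g T] that lmT by simp
  have mon: "Group.monoid E"
  proof (rule monoidI)
    fix f g h assume "f \<in> carrier E" "g \<in> carrier E" and h: "h \<in> carrier E"
    then show "f \<otimes>\<^bsub>E\<^esub> g \<otimes>\<^bsub>E\<^esub> h = f \<otimes>\<^bsub>E\<^esub> (g \<otimes>\<^bsub>E\<^esub> h)"
      using cl[OF h] by (auto simp: compose_def fun_eq_iff)
  next
    fix f assume f: "f \<in> carrier E"
    show "\<one>\<^bsub>E\<^esub> \<otimes>\<^bsub>E\<^esub> f = f"
      by (rule lhom_eqI[of _ A T T]) (use mcl[OF one f] f cl[OF f] in \<open>auto simp: compose_def\<close>)
    show "f \<otimes>\<^bsub>E\<^esub> \<one>\<^bsub>E\<^esub> = f"
      by (rule lhom_eqI[of _ A T T]) (use mcl[OF f one] f cl[OF f] in \<open>auto simp: compose_def\<close>)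
  qed (rule mcl one; assumption)+
  have ri: "ring E"
  proof (rule ringI[OF ab mon])
    fix f g h assume f: "f \<in> carrier E" "g \<in> carrier E" "h \<in> carrier E"
    show "(f \<oplus>\<^bsub>E\<^esub> g) \<otimes>\<^bsub>E\<^esub> h = f \<otimes>\<^bsub>E\<^esub> h \<oplus>\<^bsub>E\<^esub> g \<otimes>\<^bsub>E\<^esub> h"
      using cl[OF f(3)] by (auto simp: compose_def fun_eq_iff)
    show "h \<otimes>\<^bsub>E\<^esub> (f \<oplus>\<^bsub>E\<^esub> g) = h \<otimes>\<^bsub>E\<^esub> f \<oplus>\<^bsub>E\<^esub> h \<otimes>\<^bsub>E\<^esub> g"
      using cl[OF f(1)] cl[OF f(2)] lin_add[OF lhom_lin, of h A T T] f(3) by (auto simp: compose_def fun_eq_iff)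
  qed
  have mo: "module K E"
    by (rule moduleI[OF K.is_cring ab])
      (simp_all only: eqs H.smult_closed H.smult_l_distr H.smult_r_distr H.smult_assoc1 H.smult_one)
  have lm: "left_module K E"
    by (rule left_moduleI[OF K.ring_axioms ab])
      (simp_all only: eqs H.smult_closed H.smult_l_distr H.smult_r_distr H.smult_assoc1 H.smult_one)
  have "fin_gen K (Hom A T T)" using fg_Hom[OF fgT fgT] by (simp add: fg_module_def)
  then have fg: "fin_gen K E"
    unfolding fin_gen_iff[OF H.left_module_axioms] fin_gen_iff[OF lm] gens_def submod_def eqs .
  have "(c \<odot>\<^bsub>E\<^esub> f) \<otimes>\<^bsub>E\<^esub> g = c \<odot>\<^bsub>E\<^esub> (f \<otimes>\<^bsub>E\<^esub> g) \<and> f \<otimes>\<^bsub>E\<^esub> (c \<odot>\<^bsub>E\<^esub> g) = c \<odot>\<^bsub>E\<^esub> (f \<otimes>\<^bsub>E\<^esub> g)"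
    if c: "c \<in> carrier K" and f: "f \<in> carrier E" "g \<in> carrier E" for c f g
    using cl[OF f(2)] lin_smult[OF lhom_lin, of f A T T] f(1) sc_closed[OF c] by (auto simp: compose_def fun_eq_iff)
  then show "fd_algebra K E"
    unfolding fd_algebra_def using field_K ri mo fg by blast
qed

sublocale E: fd_alg K E by (rule fd_alg_E)

lemma fg_ET: "fg_module E ET"
proof -
  have lm: "left_module E ET"
  proof (rule left_moduleI[OF E.ring_A])
    show "abelian_group ET"
    proof (rule abelian_groupI)
      fix x assume "x \<in> carrier ET"
      then show "\<exists>y\<in>carrier ET. y \<oplus>\<^bsub>ET\<^esub> x = \<zero>\<^bsub>ET\<^esub>" by (intro bexI[of _ "\<ominus>\<^bsub>T\<^esub> x"]) (simp_all add: T.M.l_neg)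
    qed (simp_all add: T.M.a_ac)
  qed (simp_all add: lhom_closed lin_add[OF lhom_lin] compose_def)
  have KT: "fg_module K (scalar_restriction A T)" by (rule fg_scalar[OF fgT])
  have "lin K (scalar_restriction A T) (scalar_restriction E ET) (\<lambda>x. x)"
    by (rule linI) simp_all
  then have "fg_module K (scalar_restriction E ET)"
    by (rule fg_surj[OF _ KT E.left_module_scalar[OF lm]]) simp
  then show ?thesis using lm E.fin_gen_scalar[OF lm] by (simp add: fg_module_def)
qed

lemma fg_G:
  assumes "fg_module A M"
  shows "fg_module E (G M)"
proof -
  note M = fg_moduleD[OF assms]
  interpret H: left_module K "Hom A M T" by (rule left_module_Hom[OF M lmT])
  have eqs: "carrier (G M) = carrier (Hom A M T)" "\<zero>\<^bsub>G M\<^esub> = \<zero>\<^bsub>Hom A M T\<^esub>" "\<And>f g. f \<oplus>\<^bsub>G M\<^esub> g = f \<oplus>\<^bsub>Hom A M T\<^esub> g" by simp_all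
  have ab: "abelian_group (G M)"
  proof (rule abelian_groupI)
    fix f assume "f \<in> carrier (G M)"
    then show "\<exists>y\<in>carrier (G M). y \<oplus>\<^bsub>G M\<^esub> f = \<zero>\<^bsub>G M\<^esub>"
      unfolding eqs by (intro bexI[of _ "\<ominus>\<^bsub>Hom A M T\<^esub> f"]) (simp_all only: H.M.l_neg H.M.a_inv_closed)
  qed (simp_all only: eqs H.M.a_closed H.M.zero_closed H.M.a_ac H.M.l_zero H.M.r_zero)
  have cl: "f x \<in> carrier T" if "f \<in> carrier (G M)" "x \<in> carrier M" for f x
    using lhom_closed[of f A M T x] that by simp
  have scl: "b \<odot>\<^bsub>G M\<^esub> f \<in> carrier (G M)" if "b \<in> carrier E" "f \<in> carrier (G M)" for b f
    using compose_lhom[of b A T T f M] that M by simp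
  have lm: "left_module E (G M)"
  proof (rule left_moduleI[OF E.ring_A ab scl])
    fix a b f assume "a \<in> carrier E" "b \<in> carrier E" and f: "f \<in> carrier (G M)"
    show "(a \<oplus>\<^bsub>E\<^esub> b) \<odot>\<^bsub>G M\<^esub> f = a \<odot>\<^bsub>G M\<^esub> f \<oplus>\<^bsub>G M\<^esub> b \<odot>\<^bsub>G M\<^esub> f" "(a \<otimes>\<^bsub>E\<^esub> b) \<odot>\<^bsub>G M\<^esub> f = a \<odot>\<^bsub>G M\<^esub> (b \<odot>\<^bsub>G M\<^esub> f)"
      using cl[OF f] by (auto simp: compose_def fun_eq_iff)
  next
    fix a f g assume a: "a \<in> carrier E" and f: "f \<in> carrier (G M)" "g \<in> carrier (G M)"
    show "a \<odot>\<^bsub>G M\<^esub> (f \<oplus>\<^bsub>G M\<^esub> g) = a \<odot>\<^bsub>G M\<^esub> f \<oplus>\<^bsub>G M\<^esub> a \<odot>\<^bsub>G M\<^esub> g"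
      using cl[OF f(1)] cl[OF f(2)] lin_add[OF lhom_lin, of a A T T] a by (auto simp: compose_def fun_eq_iff)
  next
    fix f assume f: "f \<in> carrier (G M)"
    show "\<one>\<^bsub>E\<^esub> \<odot>\<^bsub>G M\<^esub> f = f"
      by (rule lhom_eqI[of _ A M T]) (use scl[OF E.A.one_closed f] f cl[OF f] in \<open>auto simp: compose_def\<close>)
  qed
  have KT: "fg_module K (Hom A M T)" by (rule fg_Hom[OF assms fgT])
  have "lin K (Hom A M T) (scalar_restriction E (G M)) (\<lambda>x. x)"
  proof (rule linI)
    fix c f assume c: "c \<in> carrier K" and f: "f \<in> carrier (Hom A M T)"
    then show "c \<odot>\<^bsub>Hom A M T\<^esub> f = c \<odot>\<^bsub>scalar_restriction E (G M)\<^esub> f"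
      using lhom_closed[of f A M T] by (auto simp: compose_def fun_eq_iff)
  qed simp_all
  then have "fg_module K (scalar_restriction E (G M))"
    by (rule fg_surj[OF _ KT E.left_module_scalar[OF lm]]) simp
  then show ?thesis using lm E.fin_gen_scalar[OF lm] by (simp add: fg_module_def)
qed

lemma dmap_lhom:
  assumes "lin A M N g" "left_module A M" "f \<in> lhom A N T"
  shows "dmap M g f \<in> lhom A M T"
  unfolding dmap_def by (rule restrict_lhom[OF lin_comp[OF assms(1) lhom_lin[OF assms(3)]] assms(2)])

lemma lin_G:
  assumes "lin A M N g" "left_module A M"
  shows "lin E (G N) (G M) (dmap M g)"
proof (rule linI)
  fix f assume "f \<in> carrier (G N)"
  then show "dmap M g f \<in> carrier (G M)" using dmap_lhom[OF assms] by simp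
qed (auto simp: dmap_def fun_eq_iff compose_def lin_closed[OF assms(1)])

lemma fac_G:
  assumes "fac A X M N u" "left_module A M" "left_module A N" "left_module A X"
  shows "fac E (G X) (G N) (G M) (dmap M u)"
  using assms(1)
proof induction
  case (fac_zero u)
  show ?case
  proof (rule fac.fac_zero)
    fix f assume "f \<in> carrier (G N)"
    then have f: "lin A N T f" by (intro lhom_lin) simp
    show "dmap M u f = \<zero>\<^bsub>G M\<^esub>"
      using fac_zero lin_zero[OF f assms(3) lmT] by (auto simp: dmap_def fun_eq_iff)
  qed
next
  case (fac_step v s r u)
  show ?case
  proof (rule fac.fac_step[OF fac_step.IH lin_G[OF fac_step.hyps(3) assms(4)] lin_G[OF fac_step.hyps(2) assms(2)]])
    fix f assume "f \<in> carrier (G N)"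
    then have f: "lin A N T f" by (intro lhom_lin) simp
    have "f (u x) = f (v x) \<oplus>\<^bsub>T\<^esub> f (r (s x))" if x: "x \<in> carrier M" for x
      using lin_add[OF f lin_closed[OF fac_lin[OF fac_step.hyps(1) assms(2,3)] x]
          lin_closed[OF fac_step.hyps(3) lin_closed[OF fac_step.hyps(2) x]]] fac_step.hyps(4)[OF x] by simp
    then show "dmap M u f = dmap M v f \<oplus>\<^bsub>G M\<^esub> dmap M s (dmap X r f)"
      using lin_closed[OF fac_step.hyps(2)] by (auto simp: dmap_def fun_eq_iff)
  qed
qed

lemma radd_G:
  assumes "radd A X M"
  shows "radd E (G X) (G M)"
proof -
  note r = raddD[OF assms]
  have "fac E (G X) (G M) (G M) (\<lambda>f. f)"
  proof (rule fac_cong[OF fac_G[OF r(5,4,4,3)]])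
    fix f assume "f \<in> carrier (G M)"
    then have "f \<in> extensional (carrier M)" by (simp add: lhom_iff)
    then show "f = dmap M (\<lambda>x. x) f" unfolding dmap_def using extensional_restrict by metis
  qed
  then show ?thesis using fg_G[OF r(1)] fg_G[OF r(2)] by (simp add: radd_def)
qed

text \<open>Hom(-,T) is left exact, and the assumption \<open>ext_on\<close> is exactly the missing
  surjectivity of Hom(M,T) -> Hom(L,T).\<close>

lemma ses_G:
  assumes "ses A L i M p N" "ext_on A L i M T"
  shows "ses E (G N) (dmap M p) (G M) (dmap L i) (G L)"
proof -
  note s = sesD[OF assms(1)]
  have inj: "inj_on (dmap M p) (carrier (G N))"
  proof (rule inj_onI)
    fix f f' assume f: "f \<in> carrier (G N)" "f' \<in> carrier (G N)" "dmap M p f = dmap M p f'"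
    then have f': "f \<in> lhom A N T" "f' \<in> lhom A N T" by auto
    show "f = f'"
    proof (rule lhom_eqI[OF f'])
      fix y assume "y \<in> carrier N"
      then obtain x where x: "x \<in> carrier M" "p x = y" using s(13) by blast
      then show "f y = f' y" using fun_cong[OF f(3), of x] by (simp add: dmap_def)
    qed
  qed
  have surj: "dmap L i ` carrier (G M) = carrier (G L)"
  proof (intro equalityI subsetI)
    fix f assume "f \<in> carrier (G L)"
    then have f: "f \<in> lhom A L T" by simp
    obtain g where g: "lin A M T g" "\<And>x. x \<in> carrier L \<Longrightarrow> g (i x) = f x"
      by (rule ext_onD[OF assms(2) lhom_lin[OF f]]) (rule that)
    have gr: "restrict g (carrier M) \<in> lhom A M T" by (rule restrict_lhom[OF g(1) s(5)])
    have "f = dmap L i (restrict g (carrier M))"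
      by (rule lhom_eqI[OF f dmap_lhom[OF s(7,4) gr]]) (simp add: dmap_def g(2) lin_closed[OF s(7)])
    then show "f \<in> dmap L i ` carrier (G M)" using gr by (intro image_eqI) auto
  next
    fix f assume "f \<in> dmap L i ` carrier (G M)"
    then obtain g where g: "g \<in> carrier (G M)" "f = dmap L i g" by (rule imageE)
    show "f \<in> carrier (G L)" unfolding g(2) by (rule lin_closed[OF lin_G[OF s(7,4)] g(1)])
  qed
  have ex: "dmap L i f = \<zero>\<^bsub>G L\<^esub> \<longleftrightarrow> f \<in> dmap M p ` carrier (G N)" if fG: "f \<in> carrier (G M)" for f
  proof
    have f: "f \<in> lhom A M T" using fG by simp
    assume z: "dmap L i f = \<zero>\<^bsub>G L\<^esub>"
    have z': "f (i x) = \<zero>\<^bsub>T\<^esub>" if "x \<in> carrier L" for x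
      using fun_cong[OF z, of x] that by (simp add: dmap_def)
    obtain g where g: "lin A N T g" "\<And>x. x \<in> carrier M \<Longrightarrow> g (p x) = f x"
      by (rule ses_factor[OF assms(1) lmT lhom_lin[OF f] z']) (auto intro: that)
    have gD: "restrict g (carrier N) \<in> lhom A N T" by (rule restrict_lhom[OF g(1) s(6)])
    have "f = dmap M p (restrict g (carrier N))"
      by (rule lhom_eqI[OF f dmap_lhom[OF s(8,5) gD]]) (simp add: dmap_def g(2) lin_closed[OF s(8)])
    then show "f \<in> dmap M p ` carrier (G N)" using gD by (intro image_eqI) auto
  next
    assume "f \<in> dmap M p ` carrier (G N)"
    then obtain g where g: "g \<in> carrier (G N)" "f = dmap M p g" by (rule imageE)
    have gl: "lin A N T g" using g(1) by (intro lhom_lin) simp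
    have "f (i x) = \<zero>\<^bsub>T\<^esub>" if x: "x \<in> carrier L" for x
      unfolding g(2) using dmap_apply[OF lin_closed[OF s(7) x], of p g] s(12)[OF x] lin_zero[OF gl s(6) lmT] by simp
    then show "dmap L i f = \<zero>\<^bsub>G L\<^esub>" by (auto simp: dmap_def fun_eq_iff)
  qed
  show ?thesis
    unfolding ses_def
    using fg_G[OF s(1)] fg_G[OF s(2)] fg_G[OF s(3)] lin_G[OF s(8,5)] lin_G[OF s(7,4)] inj surj ex
    by (intro conjI ballI) simp_all
qed

lemma G_T_regular:
  shows "lin E (G T) (regular E) (\<lambda>x. x)" "lin E (regular E) (G T) (\<lambda>x. x)"
  by (rule linI; simp)+

text \<open>Evaluation at one identifies Hom(A,T) with T over \<open>E\<close>; the inverse sends t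
  to multiplication of t by elements of the algebra.\<close>

lemma G_regular:
  shows "lin E (G (regular A)) ET (\<lambda>f. f \<one>\<^bsub>A\<^esub>)" "lin E ET (G (regular A)) (\<lambda>t. \<lambda>a\<in>carrier A. a \<odot>\<^bsub>T\<^esub> t)"
    "\<And>t. t \<in> carrier ET \<Longrightarrow> (\<lambda>a\<in>carrier A. a \<odot>\<^bsub>T\<^esub> t) \<one>\<^bsub>A\<^esub> = t"
    "\<And>f. f \<in> carrier (G (regular A)) \<Longrightarrow> (\<lambda>a\<in>carrier A. a \<odot>\<^bsub>T\<^esub> f \<one>\<^bsub>A\<^esub>) = f"
proof -
  note R = fg_moduleD[OF fg_regular]
  show "lin E (G (regular A)) ET (\<lambda>f. f \<one>\<^bsub>A\<^esub>)"
  proof (rule linI)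
    fix f assume "f \<in> carrier (G (regular A))"
    then show "f \<one>\<^bsub>A\<^esub> \<in> carrier ET" using lhom_closed[of f A "regular A" T "\<one>\<^bsub>A\<^esub>"] by simp
  qed (simp_all add: compose_def)
  have r: "(\<lambda>a\<in>carrier A. a \<odot>\<^bsub>T\<^esub> t) \<in> lhom A (regular A) T" if "t \<in> carrier T" for t
    using restrict_lhom[OF lin_from_regular[OF lmT that] R] by simp
  show "lin E ET (G (regular A)) (\<lambda>t. \<lambda>a\<in>carrier A. a \<odot>\<^bsub>T\<^esub> t)"
  proof (rule linI)
    fix t assume "t \<in> carrier ET"
    then show "(\<lambda>a\<in>carrier A. a \<odot>\<^bsub>T\<^esub> t) \<in> carrier (G (regular A))" using r by simp
  next
    fix x y assume "x \<in> carrier ET" "y \<in> carrier ET"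
    then show "(\<lambda>a\<in>carrier A. a \<odot>\<^bsub>T\<^esub> (x \<oplus>\<^bsub>ET\<^esub> y)) = (\<lambda>a\<in>carrier A. a \<odot>\<^bsub>T\<^esub> x) \<oplus>\<^bsub>G (regular A)\<^esub> (\<lambda>a\<in>carrier A. a \<odot>\<^bsub>T\<^esub> y)"
      by (auto simp: fun_eq_iff T.smult_r_distr)
  next
    fix b x assume "b \<in> carrier E" "x \<in> carrier ET"
    then show "(\<lambda>a\<in>carrier A. a \<odot>\<^bsub>T\<^esub> (b \<odot>\<^bsub>ET\<^esub> x)) = b \<odot>\<^bsub>G (regular A)\<^esub> (\<lambda>a\<in>carrier A. a \<odot>\<^bsub>T\<^esub> x)"
      using lin_smult[OF lhom_lin, of b A T T] by (auto simp: fun_eq_iff compose_def)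
  qed
  show "(\<lambda>a\<in>carrier A. a \<odot>\<^bsub>T\<^esub> t) \<one>\<^bsub>A\<^esub> = t" if "t \<in> carrier ET" for t
    using that T.smult_one by simp
  show "(\<lambda>a\<in>carrier A. a \<odot>\<^bsub>T\<^esub> f \<one>\<^bsub>A\<^esub>) = f" if "f \<in> carrier (G (regular A))" for f
  proof -
    have f: "f \<in> lhom A (regular A) T" using that by simp
    have f1: "f \<one>\<^bsub>A\<^esub> \<in> carrier T" using lhom_closed[OF f, of "\<one>\<^bsub>A\<^esub>"] by simp
    show ?thesis
    proof (rule lhom_eqI[OF r[OF f1] f])
      fix x assume "x \<in> carrier (regular A)"
      then show "(\<lambda>a\<in>carrier A. a \<odot>\<^bsub>T\<^esub> f \<one>\<^bsub>A\<^esub>) x = f x"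
        using lin_smult[OF lhom_lin[OF f], of x "\<one>\<^bsub>A\<^esub>"] by simp
    qed
  qed
qed

end

section \<open>Transfer to the endomorphism algebra\<close>

context fd_alg
begin

lemma ses_copy:
  assumes "ses A X i Y p Z"
  shows "ses A (copy A X) (\<lambda>x. copy_map A Y (i (copy_inv A X x))) (copy A Y) (\<lambda>x. copy_map A Z (p (copy_inv A Y x))) (copy A Z)"
proof -
  note s = sesD(1-3)[OF assms]
  show ?thesis
    by (rule ses_iso[OF assms fg_copy[OF s(1)] fg_copy[OF s(2)] fg_copy[OF s(3)] lin_copy_inv[OF s(1)] bij_copy_inv[OF s(1)]
        lin_copy_map[OF s(2)] bij_copy_map[OF s(2)] lin_copy_inv[OF s(2)] _ lin_copy_map[OF s(3)] bij_copy_map[OF s(3)]])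
      (rule copy_inv_copy_map[OF s(2)])
qed

lemma ses_copy_right:
  assumes "ses A X i Y p Z"
  shows "ses A X (\<lambda>x. i x) Y (\<lambda>x. copy_map A Z (p x)) (copy A Z)"
proof -
  note s = sesD(1-3)[OF assms]
  show ?thesis
    by (rule ses_iso[OF assms s(1,2) fg_copy[OF s(3)] lin_id _ lin_id _ lin_id _ lin_copy_map[OF s(3)] bij_copy_map[OF s(3)]])
      (simp_all add: bij_betw_def)
qed

lemma radd_copy_right: "radd A X M \<Longrightarrow> radd A X (copy A M)"
  by (rule radd_trans[OF _ radd_copy(1)[OF raddD(2)]])

lemma radd_copy_left: "radd A X M \<Longrightarrow> radd A (copy A X) M"
  by (rule radd_trans[OF radd_copy(2)[OF raddD(1)]])

end

text \<open>\<open>T\<close> keeps its own carrier type, because \<open>End A T\<close> consists of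
  functions on it, while \<open>special_tilt\<close> is assumed for copies. Over \<open>E\<close>
  the abbreviations \<open>P'\<close>, \<open>T'\<close> and \<open>H\<close> return to the type of
  copies.\<close>

locale end_tilt = end_algebra K A T for K :: "'k ring" and A :: "('k, 'a) module" and T :: "('a, 't) module" +
  fixes P :: "('a, 'p) module" and k :: nat
  assumes fgP: "fg_module A P"
    and sp: "special_tilt K A (copy A P) (copy A T) k"
begin

sublocale S: special_tilt K A "copy A P" "copy A T" k by (rule sp)

abbreviation P' where "P' \<equiv> copy E (G P)"
abbreviation T' where "T' \<equiv> copy E ET"
abbreviation H where "H M \<equiv> copy E (G M)"

lemma radd_P_H: "radd A (copy A P) M \<Longrightarrow> radd E P' (H M)"
  by (rule E.radd_copy_left[OF E.radd_copy_right[OF radd_G[OF radd_trans[OF radd_copy(1)[OF fgP]]]]])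

text \<open>\<open>G\<close> sends \<open>T\<close> to the regular module of \<open>E\<close>, hence
  add T to projective modules.\<close>

lemma projective_G: "radd A T M \<Longrightarrow> projective E (G M)"
proof -
  assume "radd A T M"
  then have "radd E (G T) (G M)" by (rule radd_G)
  moreover have "radd E (regular E) (G T)"
    by (rule radd_of_retract[OF E.fg_regular fg_G[OF fgT] G_T_regular]) simp
  ultimately show ?thesis using E.projective_radd[OF E.projective_regular radd_trans] by blast
qed

lemma radd_T: "radd A (copy A T) M \<Longrightarrow> radd A T M"
  by (rule radd_trans[OF radd_copy(1)[OF fgT]])

lemma radd_P_T: "radd A (copy A P) M \<Longrightarrow> radd A T M"
  by (rule radd_T[OF radd_trans[OF S.P_in_T]])

text \<open>Since Hom(A,T) is \<open>T\<close> over \<open>E\<close>, projective modules over the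
  algebra are sent into the additive closure of \<open>T\<close>.\<close>

lemma radd_regular_H: "radd A (regular A) M \<Longrightarrow> radd E T' (H M)"
proof -
  assume "radd A (regular A) M"
  then have "radd E (G (regular A)) (G M)" by (rule radd_G)
  moreover have "radd E ET (G (regular A))"
    by (rule radd_of_retract[OF fg_ET fg_G[OF fg_regular] G_regular(1,2)]) (rule G_regular(4))
  ultimately show ?thesis using E.radd_copy_left[OF E.radd_copy_right[OF radd_trans]] by blast
qed

text \<open>Surjectivity of the evaluation C -> Hom_E(Hom(C,T), T); \<open>cogenerated\<close> is
  its injectivity. For the regular module the two say that the algebra is the endomorphism ring of
  \<open>T\<close> over \<open>E\<close>.\<close>

definition eval_onto :: "('a, 'm) module \<Rightarrow> bool" where
  "eval_onto C \<longleftrightarrow> (\<forall>h. lin E (G C) ET h \<longrightarrow> (\<exists>x\<in>carrier C. \<forall>f\<in>lhom A C T. h f = f x))"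

definition cogenerated :: "('a, 'm) module \<Rightarrow> bool" where
  "cogenerated C \<longleftrightarrow> (\<forall>x\<in>carrier C. (\<forall>f\<in>lhom A C T. f x = \<zero>\<^bsub>T\<^esub>) \<longrightarrow> x = \<zero>\<^bsub>C\<^esub>)"

lemma cogenerated_radd:
  assumes "radd A T C"
  shows "cogenerated C"
  unfolding cogenerated_def
proof (intro ballI impI)
  note C = raddD[OF assms]
  interpret C: left_module A C by (rule C(4))
  fix x assume x: "x \<in> carrier C" and z: "\<forall>f\<in>lhom A C T. f x = \<zero>\<^bsub>T\<^esub>"
  have "u x = \<zero>\<^bsub>C\<^esub>" if "fac A T C C u" for u
    using that
  proof induction
    case (fac_step v s r u)
    have "s x = \<zero>\<^bsub>T\<^esub>" using restrict_lhom[OF fac_step.hyps(2) C(4)] z x by fastforce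
    then show ?case using fac_step.IH fac_step.hyps(4)[OF x] lin_zero[OF fac_step.hyps(3) lmT C(4)] by simp
  qed (use x in simp)
  from this[OF C(5)] show "x = \<zero>\<^bsub>C\<^esub>" .
qed

text \<open>For every partial sum u of composites through \<open>T\<close>, the assignment sending f
  to h(f o u) is evaluation at a point; each composite adds one summand to the point.\<close>

lemma eval_onto_radd:
  assumes "radd A T C"
  shows "eval_onto C"
  unfolding eval_onto_def
proof (intro allI impI)
  note C = raddD[OF assms]
  interpret C: left_module A C by (rule C(4))
  interpret GC: left_module E "G C" by (rule fg_moduleD[OF fg_G[OF C(2)]])
  fix h assume h: "lin E (G C) ET h"
  have "\<exists>x\<in>carrier C. \<forall>f\<in>lhom A C T. h (dmap C u f) = f x" if "fac A T C C u" for u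
    using that
  proof induction
    case (fac_zero u)
    have "h (dmap C u f) = f \<zero>\<^bsub>C\<^esub>" if f: "f \<in> lhom A C T" for f
    proof -
      have "dmap C u f = \<zero>\<^bsub>G C\<^esub>"
        using fac_zero lin_zero[OF lhom_lin[OF f] C(4) lmT] by (auto simp: dmap_def fun_eq_iff)
      then show ?thesis
        using lin_zero[OF h GC.left_module_axioms fg_moduleD[OF fg_ET]] lin_zero[OF lhom_lin[OF f] C(4) lmT] by simp
    qed
    then show ?case by (intro bexI[of _ "\<zero>\<^bsub>C\<^esub>"]) simp_all
  next
    case (fac_step v s r u)
    then obtain x where x: "x \<in> carrier C" "\<forall>f\<in>lhom A C T. h (dmap C v f) = f x" by blast
    \<comment> \<open>As \<open>s\<close> is itself an element of Hom(C,T), the map f o r o s is its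
      multiple by the endomorphism f o r. Linearity of \<open>h\<close> over \<open>E\<close> sends
      it to f(r(h s)), the value of f at r(h s).\<close>
    let ?s = "restrict s (carrier C)"
    have s: "?s \<in> lhom A C T" by (rule restrict_lhom[OF fac_step.hyps(2) C(4)])
    have hs: "h ?s \<in> carrier T" using lin_closed[OF h, of ?s] s by simp
    have "h (dmap C u f) = f (x \<oplus>\<^bsub>C\<^esub> r (h ?s))" if f: "f \<in> lhom A C T" for f
    proof -
      note f' = lhom_lin[OF f]
      let ?b = "dmap T r f"
      have b: "?b \<in> lhom A T T" by (rule dmap_lhom[OF fac_step.hyps(3) lmT f])
      have v: "dmap C v f \<in> lhom A C T" by (rule dmap_lhom[OF fac_lin[OF fac_step.hyps(1) C(4,4)] C(4) f])
      have bs: "?b \<odot>\<^bsub>G C\<^esub> ?s \<in> lhom A C T" using compose_lhom[OF b s C(4)] by simp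
      have "f (u y) = f (v y) \<oplus>\<^bsub>T\<^esub> f (r (s y))" if y: "y \<in> carrier C" for y
        using lin_add[OF f' lin_closed[OF fac_lin[OF fac_step.hyps(1) C(4,4)] y]
            lin_closed[OF fac_step.hyps(3) lin_closed[OF fac_step.hyps(2) y]]] fac_step.hyps(4)[OF y] by simp
      then have "dmap C u f = dmap C v f \<oplus>\<^bsub>G C\<^esub> (?b \<odot>\<^bsub>G C\<^esub> ?s)"
        using lin_closed[OF fac_step.hyps(2)] by (auto simp: dmap_def fun_eq_iff compose_def)
      then have "h (dmap C u f) = h (dmap C v f) \<oplus>\<^bsub>T\<^esub> h (?b \<odot>\<^bsub>G C\<^esub> ?s)"
        using lin_add[OF h, of "dmap C v f" "?b \<odot>\<^bsub>G C\<^esub> ?s"] v bs by simp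
      also have "h (?b \<odot>\<^bsub>G C\<^esub> ?s) = ?b (h ?s)"
        using lin_smult[OF h, of ?b ?s] b s by simp
      also have "?b (h ?s) = f (r (h ?s))" using hs by (simp add: dmap_def)
      also have "h (dmap C v f) = f x" using x(2) f by blast
      finally show ?thesis by (simp only: lin_add[OF f' x(1) lin_closed[OF fac_step.hyps(3) hs]])
    qed
    then show ?case using x(1) lin_closed[OF fac_step.hyps(3) hs] by (intro bexI[of _ "x \<oplus>\<^bsub>C\<^esub> r (h ?s)"]) simp_all
  qed
  from this[OF C(5)] obtain x where x: "x \<in> carrier C" "\<forall>f\<in>lhom A C T. h (dmap C (\<lambda>x. x) f) = f x" by blast
  have "dmap C (\<lambda>x. x) f = f" if "f \<in> lhom A C T" for f
    using that by (simp add: dmap_def lhom_iff extensional_restrict)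
  with x show "\<exists>x\<in>carrier C. \<forall>f\<in>lhom A C T. h f = f x" by auto
qed

lemma ext_on_T:
  assumes "projective A Q" "ses A Z i (Q :: ('a, nat \<Rightarrow> 'k) module) p M" "ext_zero A 0 M (copy A T)"
  shows "ext_on A Z i Q T"
proof -
  note s = sesD[OF assms(2)]
  have "ext_on A Z i Q (copy A T)" using ext_zero_0_iff_ext_on[OF assms(1,2) fg_copy[OF fgT]] assms(3) by simp
  then show ?thesis using ext_on_copy[OF fgT s(4,5,7)] by simp
qed

lemma lin_eval: "lin E (G C) ET (\<lambda>f. f x)" if "x \<in> carrier C"
  using that lhom_closed[of _ A C T x] by (intro linI) (simp_all add: compose_def)

text \<open>The claims cannot be proved one after the other: rigidity in degree one for
  \<open>C\<close> uses that evaluation is onto for the next cokernel \<open>L\<close>, and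
  evaluation for \<open>C\<close> is onto because it is injective for \<open>L\<close>. For the
  regular module they yield the projective dimension and the rigidity of \<open>T\<close> over
  \<open>E\<close>.\<close>

lemma cores_E:
  assumes "cores A (copy A P) (copy A T) j C"
  shows "(\<forall>n N. j \<le> n \<longrightarrow> fg_module E N \<longrightarrow> ext_zero E n (H C) N) \<and> (\<forall>n. ext_zero E n (H C) T') \<and> eval_onto C \<and> cogenerated C"
  using assms
proof (induction j arbitrary: C)
  case 0
  then have C: "radd A T C" by (intro radd_T) simp
  have H: "projective E (H C)"
    by (rule E.projective_radd[OF projective_G[OF C] E.radd_copy(1)[OF fg_G[OF raddD(2)[OF C]]]])
  show ?case
    using E.ext_zero_projective[OF H] E.fg_copy[OF fg_ET] eval_onto_radd[OF C] cogenerated_radd[OF C] by simp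
next
  case (Suc j)
  obtain t L :: "('a, nat \<Rightarrow> 'k) module" and i q where t: "radd A (copy A P) t" "ses A C i t q L" "cores A (copy A P) (copy A T) j L"
    using Suc.prems by (rule cores_SucE) (rule that)
  note s = sesD[OF t(2)]
  note IH = Suc.IH[OF t(3)]
  have tT: "radd A T t" by (rule radd_P_T[OF t(1)])
  have "ext_zero A 0 L (copy A T)" by (rule S.cores_ext_zero[OF t(3) S.fg_T S.ext_T])
  then have "ext_on A C i t T" by (rule ext_on_T[OF S.radd_P_projective[OF t(1)] t(2)])
  \<comment> \<open>The arrows are reversed: Hom(L,T) is a syzygy of Hom(C,T) over \<open>E\<close>,
    with projective middle term Hom(t,T).\<close>
  note sG = ses_G[OF t(2) this]
  note g = sesD[OF sG]
  have Ht: "projective E (H t)"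
    by (rule E.projective_radd[OF projective_G[OF tT] E.radd_copy(1)[OF g(2)]])
  note sH = E.ses_copy[OF sG]
  have pd: "ext_zero E n (H C) N" if n: "Suc j \<le> n" "fg_module E N" for n N
  proof -
    obtain n' where n': "n = Suc n'" "j \<le> n'" using n(1) by (cases n) auto
    show ?thesis using E.ext_zero_Suc_proj[OF Ht sH n(2)] IH n(2) n' by simp
  qed
  have ext: "ext_zero E n (H C) T'" for n
  proof (cases n)
    case 0
    \<comment> \<open>A map Hom(L,T) -> T is evaluation at some point of \<open>L\<close>;
      evaluation at a preimage of this point in \<open>t\<close> extends it to Hom(t,T).\<close>
    have "ext_on E (G L) (dmap t q) (G t) ET"
      unfolding ext_on_def
    proof (intro allI impI)
      fix h assume "lin E (G L) ET h"
      then obtain y where y: "y \<in> carrier L" "\<forall>f\<in>lhom A L T. h f = f y" using IH unfolding eval_onto_def by blast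
      obtain x where x: "x \<in> carrier t" "q x = y" using s(13)[OF y(1)] by blast
      have "dmap t q f x = h f" if "f \<in> carrier (G L)" for f
        using that x y(2) by (simp add: dmap_def)
      then show "\<exists>g. lin E (G t) ET g \<and> (\<forall>f\<in>carrier (G L). g (dmap t q f) = h f)"
        using lin_eval[OF x(1)] by (intro exI[of _ "\<lambda>f. f x"]) simp
    qed
    then have "ext_on E (G L) (dmap t q) (G t) T'" using E.ext_on_copy[OF fg_ET g(4,5,7)] by simp
    then show ?thesis
      using E.ext_zero_0_iff_ext_on[OF projective_G[OF tT] E.ses_copy_right[OF sG] E.fg_copy[OF fg_ET]] 0 by simp
  next
    case (Suc n')
    then show ?thesis using E.ext_zero_Suc_proj[OF Ht sH E.fg_copy[OF fg_ET]] IH by simp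
  qed
  \<comment> \<open>Pulled back to Hom(t,T), \<open>h\<close> is evaluation at a point x of
    \<open>t\<close>. All maps L -> T vanish at its image in \<open>L\<close>, which is therefore
    zero, so x comes from \<open>C\<close>.\<close>
  have ev: "eval_onto C"
    unfolding eval_onto_def
  proof (intro allI impI)
    fix h assume h: "lin E (G C) ET h"
    obtain x where x: "x \<in> carrier t" "\<And>f. f \<in> lhom A t T \<Longrightarrow> h (dmap C i f) = f x"
      using eval_onto_radd[OF tT] lin_comp[OF g(8) h] unfolding eval_onto_def by blast
    have "f (q x) = \<zero>\<^bsub>T\<^esub>" if f: "f \<in> lhom A L T" for f
    proof -
      have fG: "f \<in> carrier (G L)" using f by simp
      have "f (q x) = dmap t q f x" using x(1) by (simp add: dmap_def)
      also have "\<dots> = h (dmap C i (dmap t q f))" using x(2)[OF dmap_lhom[OF s(8,5) f]] by simp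
      also have "dmap C i (dmap t q f) = \<zero>\<^bsub>G C\<^esub>" by (rule g(12)[OF fG])
      also have "h \<zero>\<^bsub>G C\<^esub> = \<zero>\<^bsub>T\<^esub>" using lin_zero[OF h g(6) fg_moduleD[OF fg_ET]] by simp
      finally show ?thesis .
    qed
    then have "q x = \<zero>\<^bsub>L\<^esub>" using IH lin_closed[OF s(8) x(1)] unfolding cogenerated_def by blast
    then obtain c where c: "c \<in> carrier C" "x = i c" using s(11)[OF x(1)] by blast
    have "h f = f c" if f: "f \<in> lhom A C T" for f
    proof -
      have "f \<in> carrier (G C)" using f by simp
      from g(13)[OF this] obtain f' where f': "f' \<in> carrier (G t)" "dmap C i f' = f" by blast
      then have "h f = f' (i c)" using x(2)[of f'] c(2) by simp
      then show ?thesis using f'(2) c(1) by (auto simp: dmap_def)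
    qed
    then show "\<exists>x\<in>carrier C. \<forall>f\<in>lhom A C T. h f = f x" using c(1) by blast
  qed
  have "cogenerated C"
    unfolding cogenerated_def
  proof (intro ballI impI)
    fix x assume x: "x \<in> carrier C" and z: "\<forall>f\<in>lhom A C T. f x = \<zero>\<^bsub>T\<^esub>"
    have "f (i x) = \<zero>\<^bsub>T\<^esub>" if f: "f \<in> lhom A t T" for f
    proof -
      have "dmap C i f x = \<zero>\<^bsub>T\<^esub>" using z dmap_lhom[OF s(7,4) f] by blast
      then show ?thesis using x by (simp add: dmap_def)
    qed
    then have "i x = \<zero>\<^bsub>t\<^esub>" using cogenerated_radd[OF tT] lin_closed[OF s(7) x] unfolding cogenerated_def by blast
    then show "x = \<zero>\<^bsub>C\<^esub>" using lin_inj_iff[OF s(7,4,5)] s(9) x by simp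
  qed
  then show ?case using pd ext ev by simp
qed

text \<open>Vanishing of Ext(X,T) keeps the reversed sequences exact, with terms Hom(F,T) in add P'.
  After m steps the bound on the projective dimension makes the kernel projective, so that its image
  under \<open>H\<close> lies in add T'.\<close>

lemma gen_res_cores_E:
  assumes "gen_res A (copy A P) m X" "fg_module A X" "\<And>n N. m \<le> n \<Longrightarrow> fg_module A N \<Longrightarrow> ext_zero A n X N" "\<And>n. ext_zero A n X (copy A T)"
  shows "cores E P' T' m (H X)"
  using assms
proof (induction m arbitrary: X)
  case 0
  have "projective A X" by (rule ext_zero_projectiveI[OF 0(2) 0(3)]) simp_all
  then show ?case using radd_regular_H[OF projective_retract_of_free] by simp
next
  case (Suc m)
  obtain N F :: "('a, nat \<Rightarrow> 'k) module" and i p where F: "radd A (copy A P) F" "ses A N i F p X" "gen_res A (copy A P) m N"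
    using Suc.prems(1) by (rule gen_res_SucE) (rule that)
  note s = sesD[OF F(2)]
  have pF: "projective A F" by (rule S.radd_P_projective[OF F(1)])
  have sG: "ses E (G X) (dmap F p) (G F) (dmap N i) (G N)"
    by (rule ses_G[OF F(2) ext_on_T[OF pF F(2) Suc.prems(4)]])
  have sh: "ext_zero A n N M" if "ext_zero A (Suc n) X M" "fg_module A M" for n M
    using ext_zero_Suc_proj[OF pF F(2) that(2)] that(1) by simp
  have "cores E P' T' m (H N)"
    by (rule Suc.IH[OF F(3) s(1)]) (rule sh, rule Suc.prems; (simp add: S.fg_T)?)+
  then show ?case by (rule cores_SucI[OF radd_P_H[OF F(1)] E.ses_copy[OF sG]])
qed

text \<open>\<open>cores_E\<close> for the regular module treats T = Hom(A,T), and
  \<open>gen_res_cores_E\<close> for T produces the coresolution of Hom(T,T) = E.\<close>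

lemma special_tilt_E: "special_tilt K E P' T' k"
proof (unfold_locales)
  let ?C = "copy A (regular A)"
  note R = fg_regular and cT = fg_copy[OF fgT]
  note cA = cores_E[OF S.cores_A]
  have PT: "radd A T P" by (rule radd_trans[OF radd_P_T[OF radd_refl[OF S.fg_P]] radd_copy(2)[OF fgP]])
  show "projective E P'"
    by (rule E.projective_radd[OF projective_G[OF PT] E.radd_copy(1)[OF fg_G[OF fgP]]])
  have "projective A P" by (rule projective_radd[OF S.proj_P radd_copy(2)[OF fgP]])
  then show "radd E T' P'" by (rule radd_regular_H[OF projective_retract_of_free])
  have "radd E (G (regular A)) ET"
    by (rule radd_of_retract[OF fg_G[OF R] fg_ET G_regular(2,1)]) (rule G_regular(3))
  then have HT: "radd E (H ?C) T'"
    using E.radd_copy_left[OF E.radd_copy_right[OF radd_trans[OF radd_G[OF radd_copy(2)[OF R]]]]] by blast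
  show "ext_zero E n T' N" if "k \<le> n" "fg_module E N" for n N
    by (rule E.ext_zero_radd_left[OF HT that(2)]) (use cA that in blast)
  show "ext_zero E n T' T'" for n
    by (rule E.ext_zero_radd_left[OF HT E.fg_copy[OF fg_ET]]) (use cA in blast)
  have c: "cores E P' T' k (H (copy A T))"
    by (rule gen_res_cores_E[OF S.gen_res_T S.fg_T S.pd_T S.ext_T])
  \<comment> \<open>The coresolution found so far belongs to Hom(copy of T, T). Composition with the
    copy maps identifies this module with the regular module, and \<open>?a\<close>,
    \<open>?b\<close> are that isomorphism and its inverse between copies.\<close>
  let ?R = "regular E" and ?GT = "G (copy A T)"
  let ?a = "\<lambda>x. copy_map E ?GT (dmap (copy A T) (copy_inv A T) (copy_inv E ?R x))"
  let ?b = "\<lambda>y. copy_map E ?R (dmap T (copy_map A T) (copy_inv E ?GT y))"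
  note RE = E.fg_regular and GT = fg_G[OF cT]
  have d1: "lin E ?R ?GT (dmap (copy A T) (copy_inv A T))"
    by (rule lin_comp[OF G_T_regular(2) lin_G[OF lin_copy_inv[OF fgT] fg_moduleD[OF cT]]])
  have d2: "lin E ?GT ?R (dmap T (copy_map A T))"
    by (rule lin_comp[OF lin_G[OF lin_copy_map[OF fgT] lmT] G_T_regular(1)])
  have a: "lin E (copy E ?R) (H (copy A T)) ?a"
    by (rule lin_comp[OF lin_comp[OF E.lin_copy_inv[OF RE] d1] E.lin_copy_map[OF GT]])
  have b: "lin E (H (copy A T)) (copy E ?R) ?b"
    by (rule lin_comp[OF lin_comp[OF E.lin_copy_inv[OF GT] d2] E.lin_copy_map[OF RE]])
  have i1: "dmap T (copy_map A T) (dmap (copy A T) (copy_inv A T) f) = f" if f: "f \<in> carrier ?R" for f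
  proof -
    have f': "f \<in> lhom A T T" using f by simp
    show ?thesis
      by (rule lhom_eqI[OF dmap_lhom[OF lin_copy_map[OF fgT] lmT dmap_lhom[OF lin_copy_inv[OF fgT] fg_moduleD[OF cT] f']] f'])
        (simp add: dmap_def copy_map_closed[OF fgT] copy_inv_copy_map[OF fgT])
  qed
  have i2: "dmap (copy A T) (copy_inv A T) (dmap T (copy_map A T) f) = f" if f: "f \<in> carrier ?GT" for f
  proof -
    have f': "f \<in> lhom A (copy A T) T" using f by simp
    show ?thesis
      by (rule lhom_eqI[OF dmap_lhom[OF lin_copy_inv[OF fgT] fg_moduleD[OF cT] dmap_lhom[OF lin_copy_map[OF fgT] lmT f']] f'])
        (simp add: dmap_def copy_inv_closed[OF fgT] copy_map_copy_inv[OF fgT])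
  qed
  have "bij_betw ?a (carrier (copy E ?R)) (carrier (H (copy A T)))"
  proof (rule bij_betw_byWitness[where f' = ?b])
    show "\<forall>x\<in>carrier (copy E ?R). ?b (?a x) = x"
    proof
      fix x assume x: "x \<in> carrier (copy E ?R)"
      note y = E.copy_inv_closed[OF RE x]
      show "?b (?a x) = x"
        by (simp only: E.copy_inv_copy_map[OF GT lin_closed[OF d1 y]] i1[OF y] E.copy_map_copy_inv[OF RE x])
    qed
    show "\<forall>x\<in>carrier (H (copy A T)). ?a (?b x) = x"
    proof
      fix x assume x: "x \<in> carrier (H (copy A T))"
      note y = E.copy_inv_closed[OF GT x]
      show "?a (?b x) = x"
        by (simp only: E.copy_inv_copy_map[OF RE lin_closed[OF d2 y]] i2[OF y] E.copy_map_copy_inv[OF GT x])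
    qed
    show "?a ` carrier (copy E ?R) \<subseteq> carrier (H (copy A T))"
      by (rule image_subsetI) (rule lin_closed[OF a])
    show "?b ` carrier (H (copy A T)) \<subseteq> carrier (copy E ?R)"
      by (rule image_subsetI) (rule lin_closed[OF b])
  qed
  from E.cores_iso[OF c E.fg_copy[OF RE] a this] show "cores E P' T' k (copy E ?R)" .
qed

end

section \<open>Resolutions and the defining Ext groups\<close>

lemma trivial_quotient:
  assumes "left_module R U" "submod R U W"
  shows "trivial_group (add_monoid U Mod W) \<longleftrightarrow> W = carrier U"
proof -
  interpret U: left_module R U by fact
  have cg: "comm_group (add_monoid U)" and gr: "group (add_monoid U)" by (rule U.M.a_comm_group, rule U.M.a_group)
  note W = submodD[OF assms(2)]
  have sg: "subgroup W (add_monoid U)"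
  proof (rule group.subgroupI[OF gr])
    fix a assume "a \<in> W"
    then show "inv\<^bsub>add_monoid U\<^esub> a \<in> W" using submod_neg[OF assms(2,1)] by (simp add: a_inv_def)
  qed (use W in auto)
  note nW = comm_group.subgroup_imp_normal[OF cg sg]
  show ?thesis
  proof
    assume t: "trivial_group (add_monoid U Mod W)"
    show "W = carrier U"
    proof (intro equalityI subsetI)
      fix x assume x: "x \<in> carrier U"
      then have "W #>\<^bsub>add_monoid U\<^esub> x \<in> carrier (add_monoid U Mod W)"
        by (auto simp: FactGroup_def RCOSETS_def)
      then have "W #>\<^bsub>add_monoid U\<^esub> x = W" using t by (simp add: trivial_group_def FactGroup_def)
      then show "x \<in> W" using group.rcos_self[OF gr, of x W] x sg by simp
    qed (use W in auto)
  next
    assume e: "W = carrier U"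
    have "W #>\<^bsub>add_monoid U\<^esub> x = W" if "x \<in> carrier U" for x
      using group.coset_join2[OF gr, of x W] sg that e by simp
    then have "carrier (add_monoid U Mod W) = {W}"
      using U.M.zero_closed by (auto simp: FactGroup_def RCOSETS_def)
    then show "trivial_group (add_monoid U Mod W)"
      unfolding trivial_group_def using normal.factorgroup_is_group[OF nW] by (simp add: FactGroup_def)
  qed
qed

lemma a_kernel_iff: "x \<in> a_kernel X Y f \<longleftrightarrow> x \<in> carrier X \<and> f x = \<zero>\<^bsub>Y\<^esub>"
  by (simp add: a_kernel_def')

lemma exact_mods_toD:
  assumes "exact_mods_to A m C d e M"
  shows "fg_module A M" "\<And>i. i \<le> m \<Longrightarrow> fg_module A (C i)" "lin A (C 0) M e" "e ` carrier (C 0) = carrier M"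
    "\<And>i. i < m \<Longrightarrow> lin A (C (Suc i)) (C i) (d i)"
    "0 < m \<Longrightarrow> d 0 ` carrier (C (Suc 0)) = {x \<in> carrier (C 0). e x = \<zero>\<^bsub>M\<^esub>}"
    "\<And>i. Suc i < m \<Longrightarrow> d (Suc i) ` carrier (C (Suc (Suc i))) = {x \<in> carrier (C (Suc i)). d i x = \<zero>\<^bsub>C i\<^esub>}"
  using assms unfolding exact_mods_to_def exact_to_def by (auto simp: a_kernel_def' lhom_lin)

lemma exact_mods_fromD:
  assumes "exact_mods_from A m M e C d"
  shows "fg_module A M" "\<And>i. i \<le> m \<Longrightarrow> fg_module A (C i)" "lin A M (C 0) e" "{x \<in> carrier M. e x = \<zero>\<^bsub>C 0\<^esub>} = {\<zero>\<^bsub>M\<^esub>}"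
    "\<And>i. i < m \<Longrightarrow> lin A (C i) (C (Suc i)) (d i)"
    "0 < m \<Longrightarrow> e ` carrier M = {x \<in> carrier (C 0). d 0 x = \<zero>\<^bsub>C (Suc 0)\<^esub>}"
    "\<And>i. Suc i < m \<Longrightarrow> d i ` carrier (C i) = {x \<in> carrier (C (Suc i)). d (Suc i) x = \<zero>\<^bsub>C (Suc (Suc i))\<^esub>}"
  using assms unfolding exact_mods_from_def exact_from_def by (auto simp: a_kernel_def' lhom_lin)

context fd_alg
begin

section \<open>Hom and Ext as defined by groups, in terms of maps\<close>

lemma Hom_vanishes_iff:
  assumes "left_module A M" "left_module A N"
  shows "Hom_vanishes A M N \<longleftrightarrow> hom_zero A M N"
proof -
  interpret H: left_module K "Hom A M N" by (rule left_module_Hom[OF assms])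
  have z: "(\<lambda>x\<in>carrier M. \<zero>\<^bsub>N\<^esub>) \<in> lhom A M N" using H.M.zero_closed by simp
  have "Hom_vanishes A M N \<longleftrightarrow> lhom A M N = {\<lambda>x\<in>carrier M. \<zero>\<^bsub>N\<^esub>}"
    unfolding Hom_vanishes_def trivial_group_def using H.M.a_group by simp
  also have "\<dots> \<longleftrightarrow> hom_zero A M N"
  proof
    assume s: "lhom A M N = {\<lambda>x\<in>carrier M. \<zero>\<^bsub>N\<^esub>}"
    show "hom_zero A M N"
      unfolding hom_zero_def
    proof (intro allI impI ballI)
      fix f x assume f: "lin A M N f" and x: "x \<in> carrier M"
      have "restrict f (carrier M) = (\<lambda>x\<in>carrier M. \<zero>\<^bsub>N\<^esub>)" using restrict_lhom[OF f assms(1)] unfolding s by simp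
      from fun_cong[OF this, of x] show "f x = \<zero>\<^bsub>N\<^esub>" using x by simp
    qed
  next
    assume h: "hom_zero A M N"
    have "f = (\<lambda>x\<in>carrier M. \<zero>\<^bsub>N\<^esub>)" if f: "f \<in> lhom A M N" for f
      by (rule lhom_eqI[OF f z]) (simp add: hzD[OF h lhom_lin[OF f]])
    then show "lhom A M N = {\<lambda>x\<in>carrier M. \<zero>\<^bsub>N\<^esub>}" using z by blast
  qed
  finally show ?thesis .
qed

lemma lin_precompose:
  assumes "lin A X Y d" "left_module A X"
  shows "lin K (Hom A Y N) (Hom A X N) (\<lambda>f. compose (carrier X) f d)"
proof (rule linI)
  fix f assume "f \<in> carrier (Hom A Y N)"
  then have f: "f \<in> lhom A Y N" by simp
  show "compose (carrier X) f d \<in> carrier (Hom A X N)"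
    unfolding compose_def using restrict_lhom[OF lin_comp[OF assms(1) lhom_lin[OF f]] assms(2)] by simp
qed (auto simp: compose_def fun_eq_iff lin_closed[OF assms(1)])

lemma exact_step_ses:
  assumes "lin A X Y d" "lin A Y Z e" "d ` carrier X = {y \<in> carrier Y. e y = \<zero>\<^bsub>Z\<^esub>}" "fg_module A X" "fg_module A Y" "left_module A Z"
  shows "ses A (sub X {x \<in> carrier X. d x = \<zero>\<^bsub>Y\<^esub>}) (\<lambda>x. x) X d (sub Y {y \<in> carrier Y. e y = \<zero>\<^bsub>Z\<^esub>})"
proof -
  have k: "fg_module A (sub Y {y \<in> carrier Y. e y = \<zero>\<^bsub>Z\<^esub>})" by (rule fg_kernel[OF assms(2,5,6)])
  have l: "lin A X (sub Y {y \<in> carrier Y. e y = \<zero>\<^bsub>Z\<^esub>}) d" by (rule lin_sub_into[OF assms(1)]) (simp add: assms(3))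
  have "ses A (sub X {x \<in> carrier X. d x = \<zero>\<^bsub>sub Y {y \<in> carrier Y. e y = \<zero>\<^bsub>Z\<^esub>}\<^esub>}) (\<lambda>x. x) X d (sub Y {y \<in> carrier Y. e y = \<zero>\<^bsub>Z\<^esub>})"
    by (rule kernel_ses[OF l assms(4) k]) (simp add: assms(3))
  then show ?thesis by simp
qed

text \<open>The (n+1)-st syzygy of \<open>M\<close>, realized as the kernel of the map out of the
  n-th term; the first map goes to \<open>M\<close>, which has its own type, hence the separate
  case.\<close>

definition syz :: "('a, 'm) module \<Rightarrow> (nat \<Rightarrow> ('a, nat \<Rightarrow> 'k) module) \<Rightarrow> (nat \<Rightarrow> (nat \<Rightarrow> 'k) \<Rightarrow> nat \<Rightarrow> 'k) \<Rightarrow>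
    ((nat \<Rightarrow> 'k) \<Rightarrow> 'm) \<Rightarrow> nat \<Rightarrow> ('a, nat \<Rightarrow> 'k) module" where
  "syz M P d e n = (case n of 0 \<Rightarrow> sub (P 0) {x \<in> carrier (P 0). e x = \<zero>\<^bsub>M\<^esub>}
     | Suc m \<Rightarrow> sub (P (Suc m)) {x \<in> carrier (P (Suc m)). d m x = \<zero>\<^bsub>P m\<^esub>})"

context
  fixes M :: "('a, 'm) module" and P :: "nat \<Rightarrow> ('a, nat \<Rightarrow> 'k) module" and d e
  assumes res: "projective_resolution A P d e M"
begin

lemma res_proj: "projective A (P i)" and res_exact: "exact_mods_to A m P d e M"
  using res by (auto simp: projective_resolution_def)

lemma res_fg: "fg_module A (P i)" and res_lin: "lin A (P (Suc i)) (P i) (d i)"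
  using exact_mods_toD(2)[OF res_exact[of i], of i] exact_mods_toD(5)[OF res_exact[of "Suc i"], of i] by auto

lemma res_ses: "ses A (syz M P d e (Suc n)) (\<lambda>x. x) (P (Suc n)) (d n) (syz M P d e n)"
proof (cases n)
  case 0
  note x = exact_mods_toD[OF res_exact[of "Suc 0"]]
  show ?thesis unfolding 0 syz_def
    using exact_step_ses[OF res_lin x(3) x(6) res_fg res_fg fg_moduleD[OF x(1)]] by simp
next
  case (Suc m)
  note x = exact_mods_toD[OF res_exact[of "Suc (Suc m)"]]
  show ?thesis unfolding Suc syz_def
    using exact_step_ses[OF res_lin res_lin x(7) res_fg res_fg fg_moduleD[OF res_fg]] by simp
qed

lemma res_ses0: "ses A (syz M P d e 0) (\<lambda>x. x) (P 0) e M"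
proof -
  note x = exact_mods_toD[OF res_exact[of 0]]
  show ?thesis unfolding syz_def using kernel_ses[OF x(3) res_fg x(1) x(4)] by simp
qed

lemma res_ext_zero_aux: "fg_module A N \<Longrightarrow> ext_zero A n (syz M P d e a) N \<longleftrightarrow> ext_on A (syz M P d e (Suc a + n)) (\<lambda>x. x) (P (Suc a + n)) N"
proof (induction n arbitrary: a)
  case 0
  then show ?case using ext_zero_0_iff_ext_on[OF res_proj res_ses] by simp
next
  case (Suc n)
  then show ?case using ext_zero_Suc_proj[OF res_proj res_ses Suc.prems] by simp
qed

lemma res_ext_zero:
  assumes "fg_module A N"
  shows "ext_zero A n (copy A M) N \<longleftrightarrow> ext_on A (syz M P d e n) (\<lambda>x. x) (P n) N"
proof (cases n)
  case 0
  then show ?thesis using ext_zero_0_iff_ext_on[OF res_proj ses_copy_right[OF res_ses0] assms] by simp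
next
  case (Suc m)
  then show ?thesis
    using ext_zero_Suc_proj[OF res_proj ses_copy_right[OF res_ses0] assms] res_ext_zero_aux[OF assms, of m 0] by simp
qed

text \<open>Cocycles on the term n + 1 are the maps that factor through \<open>syz n\<close>, and
  coboundaries are those whose factor extends to the term n. Hence the cohomology vanishes if and
  only if every map on \<open>syz n\<close> extends.\<close>

lemma res_cohomology:
  assumes "fg_module A N"
  shows "trivial_group ((add_monoid (Hom A (P (Suc n)) N))
          \<lparr>carrier := a_kernel (Hom A (P (Suc n)) N) (Hom A (P (Suc (Suc n))) N)
                       (\<lambda>f. compose (carrier (P (Suc (Suc n)))) f (d (Suc n)))\<rparr>
        Mod ((\<lambda>f. compose (carrier (P (Suc n))) f (d n)) ` carrier (Hom A (P n) N)))
      \<longleftrightarrow> ext_on A (syz M P d e n) (\<lambda>x. x) (P n) N"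
proof -
  note N = fg_moduleD[OF assms] and lm = fg_moduleD[OF res_fg]
  note s = res_ses[of n] and s' = res_ses[of "Suc n"]
  note S = sesD[OF s] and S' = sesD[OF s']
  let ?H = "Hom A (P (Suc n)) N"
  let ?D = "\<lambda>f. compose (carrier (P (Suc (Suc n)))) f (d (Suc n))"
  let ?D' = "\<lambda>f. compose (carrier (P (Suc n))) f (d n)"
  let ?Ker = "a_kernel ?H (Hom A (P (Suc (Suc n))) N) ?D"
  let ?Im = "?D' ` carrier (Hom A (P n) N)"
  note H = left_module_Hom[OF lm N]
  have D: "lin K ?H (Hom A (P (Suc (Suc n))) N) ?D" by (rule lin_precompose[OF res_lin lm])
  have D': "lin K (Hom A (P n) N) ?H ?D'" by (rule lin_precompose[OF res_lin lm])
  have Ker: "submod K ?H ?Ker" unfolding a_kernel_def' by (rule submod_kernel[OF D H H])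
  have Im: "submod K ?H ?Im" by (rule submod_image[OF D' H H submod_carrier[OF H]])
  have zkn: "d (Suc n) x \<in> carrier (syz M P d e (Suc n))" if "x \<in> carrier (P (Suc (Suc n)))" for x
    by (rule lin_closed[OF S'(8) that])
  have sub: "?Im \<subseteq> ?Ker"
  proof
    fix f assume fI: "f \<in> ?Im"
    then obtain g where g: "g \<in> lhom A (P n) N" "f = ?D' g" by auto
    have fH: "f \<in> carrier ?H" using submodD(1)[OF Im] fI by auto
    have "?D f = \<zero>\<^bsub>Hom A (P (Suc (Suc n))) N\<^esub>"
    proof
      fix x
      show "?D f x = \<zero>\<^bsub>Hom A (P (Suc (Suc n))) N\<^esub> x"
      proof (cases "x \<in> carrier (P (Suc (Suc n)))")
        case True
        have "d n (d (Suc n) x) = \<zero>\<^bsub>syz M P d e n\<^esub>" by (rule S(12)[OF zkn[OF True]])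
        also have "\<dots> = \<zero>\<^bsub>P n\<^esub>" by (simp add: syz_def split: nat.splits)
        finally show ?thesis
          using True lin_closed[OF res_lin True] lin_zero[OF lhom_lin[OF g(1)] lm N] by (simp add: g(2) compose_def)
      qed (simp add: compose_def)
    qed
    then show "f \<in> ?Ker" using fH unfolding a_kernel_iff by simp
  qed
  have U: "left_module K (sub ?H ?Ker)" by (rule left_module_sub[OF Ker H])
  have ImU: "submod K (sub ?H ?Ker) ?Im" using Im sub unfolding submod_def by simp
  have "?Im = ?Ker \<longleftrightarrow> ext_on A (syz M P d e n) (\<lambda>x. x) (P n) N"
  proof
    assume e: "?Im = ?Ker"
    show "ext_on A (syz M P d e n) (\<lambda>x. x) (P n) N"
      unfolding ext_on_def
    proof (intro allI impI)
      fix f assume f: "lin A (syz M P d e n) N f"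
      \<comment> \<open>The cocycle attached to \<open>f\<close>: it kills the image of the next
        differential, which is the kernel of \<open>d n\<close>.\<close>
      let ?g = "restrict (\<lambda>x. f (d n x)) (carrier (P (Suc n)))"
      have g: "?g \<in> lhom A (P (Suc n)) N" by (rule restrict_lhom[OF lin_comp[OF S(8) f] lm])
      have "?D ?g = \<zero>\<^bsub>Hom A (P (Suc (Suc n))) N\<^esub>"
      proof
        fix x
        show "?D ?g x = \<zero>\<^bsub>Hom A (P (Suc (Suc n))) N\<^esub> x"
        proof (cases "x \<in> carrier (P (Suc (Suc n)))")
          case True
          then show ?thesis
            using lin_closed[OF res_lin True] S(12)[OF zkn[OF True]] lin_zero[OF f S(6) N] by (simp add: compose_def)
        qed (simp add: compose_def)
      qed
      then have "?g \<in> ?Im" using g unfolding e a_kernel_iff by simp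
      then obtain h where h: "h \<in> lhom A (P n) N" "?g = ?D' h" by auto
      have "h x = f x" if x: "x \<in> carrier (syz M P d e n)" for x
      proof -
        obtain y where y: "y \<in> carrier (P (Suc n))" "d n y = x" using S(13)[OF x] by blast
        then show ?thesis using fun_cong[OF h(2), of y] by (simp add: compose_def)
      qed
      then show "\<exists>g. lin A (P n) N g \<and> (\<forall>x\<in>carrier (syz M P d e n). g x = f x)" using lhom_lin[OF h(1)] by blast
    qed
  next
    assume E: "ext_on A (syz M P d e n) (\<lambda>x. x) (P n) N"
    have "f \<in> ?Im" if fK: "f \<in> ?Ker" for f
    proof -
      have f: "f \<in> lhom A (P (Suc n)) N" and z: "?D f = \<zero>\<^bsub>Hom A (P (Suc (Suc n))) N\<^esub>"
        using fK unfolding a_kernel_iff by auto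
      have z': "f x = \<zero>\<^bsub>N\<^esub>" if x: "x \<in> carrier (syz M P d e (Suc n))" for x
      proof -
        obtain y where "y \<in> carrier (P (Suc (Suc n)))" "d (Suc n) y = x" using S'(13)[OF x] by blast
        then show ?thesis using fun_cong[OF z, of y] by (simp add: compose_def)
      qed
      obtain g where g: "lin A (syz M P d e n) N g" "\<And>x. x \<in> carrier (P (Suc n)) \<Longrightarrow> g (d n x) = f x"
        by (rule ses_factor[OF s N lhom_lin[OF f] z'], assumption) (rule that)
      obtain h where h: "lin A (P n) N h" "\<And>x. x \<in> carrier (syz M P d e n) \<Longrightarrow> h x = g x"
        by (rule ext_onD[OF E g(1)]) (rule that)
      have hr: "restrict h (carrier (P n)) \<in> lhom A (P n) N" by (rule restrict_lhom[OF h(1) lm])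
      have "f = ?D' (restrict h (carrier (P n)))"
      proof (rule lhom_eqI[OF f])
        show "?D' (restrict h (carrier (P n))) \<in> lhom A (P (Suc n)) N"
          using lin_closed[OF D', of "restrict h (carrier (P n))"] hr by simp
        fix x assume x: "x \<in> carrier (P (Suc n))"
        then show "f x = ?D' (restrict h (carrier (P n))) x"
          using lin_closed[OF res_lin x] h(2)[OF lin_closed[OF S(8) x]] g(2)[OF x] by (simp add: compose_def)
      qed
      then show "f \<in> ?Im" using hr by (intro image_eqI) auto
    qed
    then show "?Im = ?Ker" using sub by blast
  qed
  then show ?thesis using trivial_quotient[OF U ImU] by simp
qed

end

text \<open>Syzygy sequences are chosen for all modules at once, iterated, and spliced. This shows
  that the \<open>SOME\<close> in \<open>chosen_resolution\<close> picks a resolution.\<close>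

lemma projective_resolution_exists:
  assumes "fg_module A M"
  shows "\<exists>(P :: nat \<Rightarrow> ('a, nat \<Rightarrow> 'k) module) d e. projective_resolution A P d e M"
proof -
  let ?S = "\<lambda>(X :: ('a, nat \<Rightarrow> 'k) module) w. projective A (fst (snd w) :: ('a, nat \<Rightarrow> 'k) module) \<and>
    ses A (fst w :: ('a, nat \<Rightarrow> 'k) module) (fst (snd (snd w))) (fst (snd w)) (snd (snd (snd w))) X"
  have "\<forall>X. \<exists>w. fg_module A X \<longrightarrow> ?S X w"
  proof
    fix X :: "('a, nat \<Rightarrow> 'k) module"
    show "\<exists>w. fg_module A X \<longrightarrow> ?S X w"
    proof (cases "fg_module A X")
      case True
      obtain Z Q :: "('a, nat \<Rightarrow> 'k) module" and i p where "projective A Q" "ses A Z i Q p X"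
        by (rule syzygy_exists[OF True]) (rule that)
      then show ?thesis by (intro exI[of _ "(Z, Q, i, p)"]) simp
    qed simp
  qed
  \<comment> \<open>The choice is made for every record; finite generation stays a premise of the
    chosen property and is supplied along the iteration.\<close>
  from choice[OF this] obtain w where w: "\<And>X. fg_module A X \<Longrightarrow> ?S X (w X)" by blast
  define z where "z X = fst (w X)" for X
  define q where "q X = fst (snd (w X))" for X
  define i where "i X = fst (snd (snd (w X)))" for X
  define p where "p X = snd (snd (snd (w X)))" for X
  have s: "projective A (q X) \<and> ses A (z X) (i X) (q X) (p X) X" if "fg_module A X" for X
    unfolding z_def q_def i_def p_def by (rule w[OF that])
  \<comment> \<open>The iteration needs one carrier type, so it starts at the copy of
    \<open>M\<close>; \<open>copy_inv\<close> enters the augmentation \<open>e\<close> to return to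
    \<open>M\<close>.\<close>
  define Z where "Z n = (z ^^ n) (copy A M)" for n
  have Zfg: "fg_module A (Z n)" for n
  proof (induction n)
    case 0
    then show ?case using fg_copy[OF assms] by (simp add: Z_def)
  next
    case (Suc n)
    then show ?case using s[OF Suc] sesD(1) by (auto simp: Z_def)
  qed
  define Q where "Q n = q (Z n)" for n
  have Q: "projective A (Q n)" and S: "ses A (Z (Suc n)) (i (Z n)) (Q n) (p (Z n)) (Z n)" for n
    using s[OF Zfg[of n]] by (simp_all add: Q_def Z_def)
  note x = sesD[OF S]
  define d where "d n = restrict (\<lambda>x. i (Z n) (p (Z (Suc n)) x)) (carrier (Q (Suc n)))" for n
  define e where "e = restrict (\<lambda>x. copy_inv A M (p (Z 0) x)) (carrier (Q 0))"
  have Z0: "Z 0 = copy A M" by (simp add: Z_def)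
  have p0: "lin A (Q 0) (copy A M) (p (Z 0))" using x(8)[of 0] Z0 by simp
  have e: "e \<in> lhom A (Q 0) M"
    unfolding e_def by (rule restrict_lhom[OF lin_comp[OF p0 lin_copy_inv[OF assms]] x(5)])
  have d: "d n \<in> lhom A (Q (Suc n)) (Q n)" for n
    unfolding d_def by (rule restrict_lhom[OF lin_comp[OF x(8) x(7)] x(5)])
  have dim: "d n ` carrier (Q (Suc n)) = i (Z n) ` carrier (Z (Suc n))" for n
  proof -
    have "d n ` carrier (Q (Suc n)) = i (Z n) ` p (Z (Suc n)) ` carrier (Q (Suc n))"
      unfolding image_image by (rule image_cong) (simp_all add: d_def)
    then show ?thesis using x(10) by simp
  qed
  have pker: "i (Z n) ` carrier (Z (Suc n)) = {y \<in> carrier (Q n). p (Z n) y = \<zero>\<^bsub>Z n\<^esub>}" for n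
    using S[of n] lin_closed[OF x(7)[of n]] unfolding ses_def by auto
  have M: "left_module A M" by (rule fg_moduleD[OF assms])
  have e0: "e y = \<zero>\<^bsub>M\<^esub> \<longleftrightarrow> p (Z 0) y = \<zero>\<^bsub>Z 0\<^esub>" if y: "y \<in> carrier (Q 0)" for y
    using lin_inj_iff[OF lin_copy_inv[OF assms] fg_moduleD[OF fg_copy[OF assms]] M] bij_copy_inv[OF assms] lin_closed[OF p0 y] y
      lin_zero[OF lin_copy_inv[OF assms] fg_moduleD[OF fg_copy[OF assms]] M]
    by (auto simp: e_def Z0 bij_betw_def)
  have d0: "d n y = \<zero>\<^bsub>Q n\<^esub> \<longleftrightarrow> p (Z (Suc n)) y = \<zero>\<^bsub>Z (Suc n)\<^esub>" if y: "y \<in> carrier (Q (Suc n))" for n y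
    using lin_inj_iff[OF x(7) x(4) x(5), of n] x(9)[of n] lin_closed[OF x(8) y] y lin_zero[OF x(7) x(4) x(5), of n]
    by (auto simp: d_def)
  have es: "e ` carrier (Q 0) = carrier M"
  proof -
    have "e ` carrier (Q 0) = copy_inv A M ` p (Z 0) ` carrier (Q 0)"
      unfolding image_image by (rule image_cong) (simp_all add: e_def)
    then show ?thesis using x(10)[of 0] Z0 bij_copy_inv[OF assms] by (simp add: bij_betw_def)
  qed
  have k0: "d 0 ` carrier (Q (Suc 0)) = {y \<in> carrier (Q 0). e y = \<zero>\<^bsub>M\<^esub>}"
    unfolding dim pker using e0 by auto
  have k1: "d (Suc n) ` carrier (Q (Suc (Suc n))) = {y \<in> carrier (Q (Suc n)). d n y = \<zero>\<^bsub>Q n\<^esub>}" for n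
    unfolding dim pker using d0 by auto
  have "projective_resolution A Q d e M"
    unfolding projective_resolution_def exact_mods_to_def exact_to_def a_kernel_def'
    using Q assms x(2) e d es k0 k1 by simp
  then show ?thesis by blast
qed

lemma chosen_resolution:
  assumes "fg_module A M" "chosen_resolution A M = (P, d, e)"
  shows "projective_resolution A P d e M"
proof -
  have "\<exists>x. (case x of (P, d, e) \<Rightarrow> projective_resolution A (P :: nat \<Rightarrow> ('a, nat \<Rightarrow> 'k) module) d e M)"
    using projective_resolution_exists[OF assms(1)] by auto
  from someI_ex[OF this] show ?thesis using assms(2) unfolding chosen_resolution_def by simp
qed

text \<open>The chosen resolution computes \<open>ext_zero\<close> like any other one, which removes
  the choice. Degree \<open>Suc n\<close> corresponds to index n.\<close>

lemma Ext_vanishes_iff: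
  assumes "fg_module A M" "fg_module A N"
  shows "Ext_vanishes A (Suc n) M N \<longleftrightarrow> ext_zero A n (copy A M) (copy A N)"
proof -
  obtain P d e where c: "chosen_resolution A M = (P, d, e)" by (cases "chosen_resolution A M") auto
  note r = chosen_resolution[OF assms(1) c]
  have lm: "left_module A (syz M P d e n)" "left_module A (P n)"
    using sesD(6)[OF res_ses[OF r, of n]] fg_moduleD[OF res_fg[OF r]] by auto
  have "Ext_vanishes A (Suc n) M N \<longleftrightarrow> ext_on A (syz M P d e n) (\<lambda>x. x) (P n) N"
    unfolding Ext_vanishes_def Ext_def c using res_cohomology[OF r assms(2), of n] by simp
  also have "\<dots> \<longleftrightarrow> ext_on A (syz M P d e n) (\<lambda>x. x) (P n) (copy A N)"
  proof -
    have "lin A (syz M P d e n) (P n) (\<lambda>x. x)"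
      unfolding syz_def by (cases n) (auto intro: lin_sub_incl)
    then show ?thesis using ext_on_copy[OF assms(2) lm] by simp
  qed
  also have "\<dots> \<longleftrightarrow> ext_zero A n (copy A M) (copy A N)" using res_ext_zero[OF r fg_copy[OF assms(2)]] by simp
  finally show ?thesis .
qed

text \<open>For n at least k the module \<open>syz n\<close> is an image of the zero term n + 1, so
  every map on it extends by zero.\<close>

lemma pdim_ext_zero:
  assumes "pdim_le A M k" "k \<le> n" "fg_module A N"
  shows "ext_zero A n (copy A M) N"
proof -
  obtain P :: "nat \<Rightarrow> ('a, nat \<Rightarrow> 'k) module" and d e where r: "projective_resolution A P d e M" and z: "\<forall>i>k. zero_module (P i)"
    using assms(1) unfolding pdim_le_def by blast
  note N = fg_moduleD[OF assms(3)]
  note S = sesD[OF res_ses[OF r, of n]]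
  have "carrier (P (Suc n)) = {\<zero>\<^bsub>P (Suc n)\<^esub>}" using z assms(2) by (simp add: zero_module_def)
  then have x0: "x = \<zero>\<^bsub>syz M P d e n\<^esub>" if "x \<in> carrier (syz M P d e n)" for x
    using S(13)[OF that] lin_zero[OF S(8,5,6)] by auto
  have "ext_on A (syz M P d e n) (\<lambda>x. x) (P n) N"
    unfolding ext_on_def
  proof (intro allI impI)
    fix f assume f: "lin A (syz M P d e n) N f"
    have "f x = \<zero>\<^bsub>N\<^esub>" if "x \<in> carrier (syz M P d e n)" for x
      using x0[OF that] lin_zero[OF f S(6) N] by simp
    then show "\<exists>g. lin A (P n) N g \<and> (\<forall>x\<in>carrier (syz M P d e n). g x = f x)"
      using lin_const_zero[OF N] by (intro exI[of _ "\<lambda>_. \<zero>\<^bsub>N\<^esub>"]) simp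
  qed
  then show ?thesis using res_ext_zero[OF r assms(3)] by simp
qed

text \<open>Cutting at the image of the first map, which is the next kernel, gives a short exact
  sequence and a shorter long one. The inclusion is restricted because
  \<open>exact_mods_from\<close> asks for maps in \<open>lhom\<close>.\<close>

lemma exact_mods_from_shift:
  assumes "exact_mods_from A (Suc m) C e t d"
  defines "L \<equiv> sub (t (Suc 0)) (d 0 ` carrier (t 0))"
  shows "ses A C e (t 0) (d 0) L"
    and "exact_mods_from A m L (restrict (\<lambda>x. x) (carrier L)) (\<lambda>i. t (Suc i)) (\<lambda>i. d (Suc i))"
proof -
  note x = exact_mods_fromD[OF assms(1)]
  have t0: "left_module A (t 0)" "left_module A (t (Suc 0))" "left_module A C" using x(2)[of 0] x(2)[of "Suc 0"] x(1) by (auto intro: fg_moduleD)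
  have sm: "submod A (t (Suc 0)) (d 0 ` carrier (t 0))"
    by (rule submod_image[OF x(5) t0(1,2) submod_carrier[OF t0(1)]]) simp
  have L: "fg_module A L" unfolding L_def by (rule fg_sub[OF x(2) sm]) simp
  have "inj_on e (carrier C)"
    unfolding lin_inj_iff[OF x(3) t0(3,1)] using x(4) by blast
  moreover have "lin A (t 0) L (d 0)" unfolding L_def by (rule lin_sub_into[OF x(5)]) auto
  ultimately show "ses A C e (t 0) (d 0) L"
    unfolding ses_def using x(1) x(2)[of 0] L x(3) x(6) by (simp add: L_def)
  have cL: "carrier L = d 0 ` carrier (t 0)" by (simp add: L_def)
  have incl: "lin A L (t (Suc 0)) (\<lambda>x. x)"
    unfolding L_def by (rule lin_sub_incl) (rule submodD(1)[OF sm])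
  have z: "\<zero>\<^bsub>L\<^esub> = \<zero>\<^bsub>t (Suc 0)\<^esub>" by (simp add: L_def)
  have "{y \<in> carrier L. restrict (\<lambda>x. x) (carrier L) y = \<zero>\<^bsub>t (Suc 0)\<^esub>} = {\<zero>\<^bsub>L\<^esub>}"
    using zero_in[OF fg_moduleD[OF L]] z by auto
  moreover have "restrict (\<lambda>x. x) (carrier L) ` carrier L = carrier L" by simp
  moreover have d: "d i \<in> lhom A (t i) (t (Suc i))" if "i < Suc m" for i
    using assms(1) that by (simp add: exact_mods_from_def)
  ultimately show "exact_mods_from A m L (restrict (\<lambda>x. x) (carrier L)) (\<lambda>i. t (Suc i)) (\<lambda>i. d (Suc i))"
    unfolding exact_mods_from_def exact_from_def a_kernel_def'
    using L x(2) restrict_lhom[OF incl fg_moduleD[OF L]] x(7)[of 0] x(7) cL by simp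
qed

text \<open>The sequence includes the zero term of index k + 1, which makes the last map onto; at
  the end \<open>C\<close> is isomorphic to its only term, taken in add T.\<close>

lemma coresolution_cores:
  fixes t :: "nat \<Rightarrow> ('a, nat \<Rightarrow> 'k) module"
  assumes "exact_mods_from A (Suc k) C e t d" "\<And>j. j < k \<Longrightarrow> radd A P (t j)" "radd A T (t k)" "zero_module (t (Suc k))"
  shows "cores A P T k C"
  using assms
proof (induction k arbitrary: C e t d)
  case 0
  note x = exact_mods_fromD[OF 0(1)]
  have t0: "fg_module A (t 0)" using x(2)[of 0] by simp
  have "{y \<in> carrier (t 0). d 0 y = \<zero>\<^bsub>t (Suc 0)\<^esub>} = carrier (t 0)"
    using lin_closed[OF x(5), of 0] 0(4) by (auto simp: zero_module_def)
  then have "e ` carrier C = carrier (t 0)" using x(6) by simp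
  moreover have "inj_on e (carrier C)"
    unfolding lin_inj_iff[OF x(3) fg_moduleD[OF x(1)] fg_moduleD[OF t0]] using x(4) by blast
  ultimately have b: "bij_betw e (carrier C) (carrier (t 0))" by (simp add: bij_betw_def)
  have "radd A T C"
    by (rule radd_retract[OF 0(3) x(1,3) lin_inv[OF x(3) b fg_moduleD[OF x(1)]]]) (use b in \<open>simp add: bij_betw_def\<close>)
  then show ?case by simp
next
  case (Suc k)
  note sh = exact_mods_from_shift[OF Suc.prems(1)]
  have "cores A P T k (sub (t (Suc 0)) (d 0 ` carrier (t 0)))"
    by (rule Suc.IH[OF sh(2)]) (use Suc.prems(2-4) in auto)
  then show ?case by (rule cores_SucI[OF Suc.prems(2)[OF zero_less_Suc] sh(1)])
qed

section \<open>Long exact sequences as iterated short ones, and generation by a projective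
  module\<close>

lemma exact_mods_from_iso:
  assumes "exact_mods_from A m M e C d" "fg_module A M'" "lin A M' M a" "bij_betw a (carrier M') (carrier M)"
  shows "exact_mods_from A m M' (restrict (\<lambda>x. e (a x)) (carrier M')) C d"
proof -
  note x = exact_mods_fromD[OF assms(1)]
  note M = fg_moduleD[OF x(1)] and M' = fg_moduleD[OF assms(2)]
  have C0: "left_module A (C 0)" by (rule fg_moduleD[OF x(2)]) simp
  have "e (a y) = \<zero>\<^bsub>C 0\<^esub> \<longleftrightarrow> y = \<zero>\<^bsub>M'\<^esub>" if y: "y \<in> carrier M'" for y
  proof -
    have "e (a y) = \<zero>\<^bsub>C 0\<^esub> \<longleftrightarrow> a y = \<zero>\<^bsub>M\<^esub>" using x(4) lin_closed[OF assms(3) y] by blast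
    also have "\<dots> \<longleftrightarrow> y = \<zero>\<^bsub>M'\<^esub>"
      using lin_inj_iff[OF assms(3) M' M] assms(4) y lin_zero[OF assms(3) M' M] by (auto simp: bij_betw_def)
    finally show ?thesis .
  qed
  then have 1: "{y \<in> carrier M'. restrict (\<lambda>x. e (a x)) (carrier M') y = \<zero>\<^bsub>C 0\<^esub>} = {\<zero>\<^bsub>M'\<^esub>}"
    using zero_in[OF M'] by auto
  have "restrict (\<lambda>x. e (a x)) (carrier M') ` carrier M' = e ` a ` carrier M'"
    unfolding image_image by (rule image_cong) simp_all
  then have 2: "restrict (\<lambda>x. e (a x)) (carrier M') ` carrier M' = e ` carrier M" using assms(4) by (simp add: bij_betw_def)
  show ?thesis
    using assms(1) 1 2 assms(2) restrict_lhom[OF lin_comp[OF assms(3) x(3)] M']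
    unfolding exact_mods_from_def exact_from_def a_kernel_def' by simp
qed

lemma exact_mods_to_iso:
  assumes "exact_mods_to A m C d e M" "fg_module A M'" "lin A M M' a" "bij_betw a (carrier M) (carrier M')"
  shows "exact_mods_to A m C d (restrict (\<lambda>x. a (e x)) (carrier (C 0))) M'"
proof -
  note x = exact_mods_toD[OF assms(1)]
  note M = fg_moduleD[OF x(1)] and M' = fg_moduleD[OF assms(2)]
  have C0: "left_module A (C 0)" by (rule fg_moduleD[OF x(2)]) simp
  have "restrict (\<lambda>x. a (e x)) (carrier (C 0)) y = \<zero>\<^bsub>M'\<^esub> \<longleftrightarrow> e y = \<zero>\<^bsub>M\<^esub>" if y: "y \<in> carrier (C 0)" for y
    using lin_inj_iff[OF assms(3) M M'] assms(4) y lin_zero[OF assms(3) M M'] lin_closed[OF x(3) y] by (auto simp: bij_betw_def)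
  then have 1: "{y \<in> carrier (C 0). restrict (\<lambda>x. a (e x)) (carrier (C 0)) y = \<zero>\<^bsub>M'\<^esub>} = {y \<in> carrier (C 0). e y = \<zero>\<^bsub>M\<^esub>}"
    by auto
  have "restrict (\<lambda>x. a (e x)) (carrier (C 0)) ` carrier (C 0) = a ` e ` carrier (C 0)"
    unfolding image_image by (rule image_cong) simp_all
  then have 2: "restrict (\<lambda>x. a (e x)) (carrier (C 0)) ` carrier (C 0) = carrier M'" using assms(4) x(4) by (simp add: bij_betw_def)
  show ?thesis
    using assms(1) 1 2 assms(2) restrict_lhom[OF lin_comp[OF x(3) assms(3)] C0]
    unfolding exact_mods_to_def exact_to_def a_kernel_def' by simp
qed

lemma exact_to_gen_res:
  fixes C :: "nat \<Rightarrow> ('a, nat \<Rightarrow> 'k) module"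
  assumes "exact_mods_to A m C d e M" "\<And>i. i \<le> m \<Longrightarrow> radd A P (C i)"
  shows "gen_res A P (Suc m) M"
  using assms
proof (induction m arbitrary: C d e M)
  case 0
  note x = exact_mods_toD[OF 0(1)]
  show ?case
    by (rule gen_res_SucI[OF 0(2)[OF le_refl] kernel_ses[OF x(3) x(2)[OF le_refl] x(1,4)]]) simp
next
  case (Suc m)
  note x = exact_mods_toD[OF Suc.prems(1)]
  have C0: "fg_module A (C 0)" by (rule x(2)) simp
  let ?N = "sub (C 0) {x \<in> carrier (C 0). e x = \<zero>\<^bsub>M\<^esub>}"
  have s: "ses A ?N (\<lambda>x. x) (C 0) e M" by (rule kernel_ses[OF x(3) C0 x(1,4)])
  have k: "d 0 ` carrier (C (Suc 0)) = carrier ?N" using x(6) by simp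
  have "lin A (C (Suc 0)) ?N (d 0)" by (rule lin_sub_into[OF x(5)]) (use k in simp_all)
  moreover have "d 0 \<in> extensional (carrier (C (Suc 0)))"
    using Suc.prems(1) by (simp add: exact_mods_to_def lhom_iff)
  ultimately have "d 0 \<in> lhom A (C (Suc 0)) ?N" by (simp add: lhom_iff)
  then have "exact_mods_to A m (\<lambda>i. C (Suc i)) (\<lambda>i. d (Suc i)) (d 0) ?N"
    using Suc.prems(1) k x(2) sesD(1)[OF s] x(7)[of 0] x(7)
    unfolding exact_mods_to_def exact_to_def a_kernel_def' by simp
  then have "gen_res A P (Suc m) ?N" by (rule Suc.IH) (rule Suc.prems(2), simp)
  then show ?case by (rule gen_res_SucI[OF Suc.prems(2)[OF le0] s])
qed

lemma gen_res_exact_to: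
  assumes "gen_res A P (Suc m) M"
  shows "\<exists>(C :: nat \<Rightarrow> ('a, nat \<Rightarrow> 'k) module) d e. (\<forall>i\<le>m. radd A P (C i)) \<and> exact_mods_to A m C d e M"
  using assms
proof (induction m arbitrary: M)
  case 0
  obtain N F :: "('a, nat \<Rightarrow> 'k) module" and i p where F: "radd A P F" "ses A N i F p M"
    using 0 by (rule gen_res_SucE) (rule that)
  note s = sesD[OF F(2)]
  have "restrict p (carrier F) ` carrier F = carrier M" using s(10) by simp
  \<comment> \<open>For a single term no differential is constrained, so a constant
    \<open>undefined\<close> is admissible.\<close>
  then have x: "exact_mods_to A 0 (\<lambda>_. F) (\<lambda>_ _. undefined) (restrict p (carrier F)) M"
    using s(2,3) restrict_lhom[OF s(8,5)] unfolding exact_mods_to_def exact_to_def by simp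
  show ?case
    by (rule exI[of _ "\<lambda>_. F"], rule exI[of _ "\<lambda>_ _. undefined"], rule exI[of _ "restrict p (carrier F)"])
      (intro conjI allI impI x F(1))
next
  case (Suc m)
  obtain N F :: "('a, nat \<Rightarrow> 'k) module" and i p where F: "radd A P F" "ses A N i F p M" "gen_res A P (Suc m) N"
    using Suc.prems by (rule gen_res_SucE) (rule that)
  note s = sesD[OF F(2)]
  obtain C :: "nat \<Rightarrow> ('a, nat \<Rightarrow> 'k) module" and d e where C: "\<forall>i\<le>m. radd A P (C i)" "exact_mods_to A m C d e N"
    using Suc.IH[OF F(3)] by blast
  note x = exact_mods_toD[OF C(2)]
  have C0: "left_module A (C 0)" by (rule fg_moduleD[OF x(2)]) simp
  \<comment> \<open>The new term is placed in front, and the augmentation of the resolution of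
    \<open>N\<close> followed by the inclusion becomes the first differential.\<close>
  let ?C = "case_nat F C" and ?f = "restrict (\<lambda>x. i (e x)) (carrier (C 0))"
  let ?d = "case_nat ?f d" and ?p = "restrict p (carrier F)"
  have f: "?f \<in> lhom A (C 0) F" by (rule restrict_lhom[OF lin_comp[OF x(3) s(7)] C0])
  have fi: "?f ` carrier (C 0) = i ` carrier N"
  proof -
    have "?f ` carrier (C 0) = i ` e ` carrier (C 0)" unfolding image_image by (rule image_cong) simp_all
    then show ?thesis using x(4) by simp
  qed
  have k0: "i ` carrier N = {y \<in> carrier F. ?p y = \<zero>\<^bsub>M\<^esub>}"
    using F(2) lin_closed[OF s(7)] unfolding ses_def by auto
  have fz: "?f y = \<zero>\<^bsub>F\<^esub> \<longleftrightarrow> e y = \<zero>\<^bsub>N\<^esub>" if y: "y \<in> carrier (C 0)" for y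
    using lin_inj_iff[OF s(7,4,5)] s(9) lin_closed[OF x(3) y] lin_zero[OF s(7,4,5)] y by auto
  have "d j ` carrier (C (Suc j)) = {x \<in> carrier (C j). ?d j x = \<zero>\<^bsub>?C j\<^esub>}" if j: "j < m" for j
  proof (cases j)
    case 0
    then show ?thesis using x(6) fz j by auto
  next
    case (Suc j')
    then show ?thesis using x(7)[of j'] j by simp
  qed
  moreover have "\<forall>j\<le>Suc m. fg_module A (?C j)" using x(2) s(2) by (simp split: nat.splits)
  moreover have "\<forall>j<Suc m. ?d j \<in> lhom A (?C (Suc j)) (?C j)"
    using f C(2) unfolding exact_mods_to_def by (simp split: nat.splits)
  moreover have "?p ` carrier F = carrier M" using s(10) by simp
  ultimately have "exact_mods_to A (Suc m) ?C ?d ?p M"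
    using s(3) restrict_lhom[OF s(8,5)] fi k0 unfolding exact_mods_to_def exact_to_def a_kernel_def' by simp
  moreover have "\<forall>i\<le>Suc m. radd A P (?C i)" using C(1) F(1) by (simp split: nat.splits)
  ultimately show ?case by blast
qed

lemma Hom_exact_projective:
  assumes "projective A P" "lin A X Y d" "lin A Y Z e" "d ` carrier X = {y \<in> carrier Y. e y = \<zero>\<^bsub>Z\<^esub>}"
    and "fg_module A X" "fg_module A Y" "left_module A Z"
  shows "(\<lambda>h. compose (carrier P) d h) ` carrier (Hom A P X) = a_kernel (Hom A P Y) (Hom A P Z) (\<lambda>h. compose (carrier P) e h)"
proof (intro equalityI subsetI)
  have P: "left_module A P" using assms(1) by (auto simp: projective_def intro: fg_moduleD)
  fix f assume "f \<in> (\<lambda>h. compose (carrier P) d h) ` carrier (Hom A P X)"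
  then obtain h where h: "h \<in> lhom A P X" "f = compose (carrier P) d h" by auto
  have f: "f \<in> lhom A P Y"
    unfolding h(2) compose_def by (rule restrict_lhom[OF lin_comp[OF lhom_lin[OF h(1)] assms(2)] P])
  have "e (d x) = \<zero>\<^bsub>Z\<^esub>" if "x \<in> carrier X" for x using assms(4) that by blast
  then have "compose (carrier P) e f = \<zero>\<^bsub>Hom A P Z\<^esub>"
    using lhom_closed[OF h(1)] by (auto simp: h(2) compose_def fun_eq_iff)
  then show "f \<in> a_kernel (Hom A P Y) (Hom A P Z) (\<lambda>h. compose (carrier P) e h)" using f unfolding a_kernel_iff by simp
next
  have P: "left_module A P" using assms(1) by (auto simp: projective_def intro: fg_moduleD)
  fix f assume "f \<in> a_kernel (Hom A P Y) (Hom A P Z) (\<lambda>h. compose (carrier P) e h)"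
  then have f: "f \<in> lhom A P Y" and z: "compose (carrier P) e f = \<zero>\<^bsub>Hom A P Z\<^esub>" unfolding a_kernel_iff by auto
  note s = exact_step_ses[OF assms(2-7)]
  have "f ` carrier P \<subseteq> {y \<in> carrier Y. e y = \<zero>\<^bsub>Z\<^esub>}"
  proof (rule image_subsetI)
    fix x assume "x \<in> carrier P"
    then show "f x \<in> {y \<in> carrier Y. e y = \<zero>\<^bsub>Z\<^esub>}" using fun_cong[OF z, of x] lhom_closed[OF f] by (simp add: compose_def)
  qed
  then have f': "lin A P (sub Y {y \<in> carrier Y. e y = \<zero>\<^bsub>Z\<^esub>}) f" by (rule lin_sub_into[OF lhom_lin[OF f]])
  obtain h where h: "lin A P X h" "\<And>x. x \<in> carrier P \<Longrightarrow> d (h x) = f x"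
    by (rule projective_lift[OF assms(1) sesD(2,3)[OF s] sesD(8)[OF s] sesD(10)[OF s] f']) (rule that)
  have hr: "restrict h (carrier P) \<in> lhom A P X" by (rule restrict_lhom[OF h(1) P])
  have "compose (carrier P) d (restrict h (carrier P)) = f"
    by (rule extensionalityI[of _ "carrier P"]) (use f h(2) in \<open>simp_all add: compose_def lhom_iff\<close>)
  then show "f \<in> (\<lambda>h. compose (carrier P) d h) ` carrier (Hom A P X)" using hr by (intro image_eqI[of _ _ "restrict h (carrier P)"]) auto
qed

lemma Hom_onto_projective:
  assumes "projective A P" "lin A X Y d" "d ` carrier X = carrier Y" "fg_module A X" "fg_module A Y"
  shows "(\<lambda>h. compose (carrier P) d h) ` carrier (Hom A P X) = carrier (Hom A P Y)"
proof (intro equalityI subsetI)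
  have P: "left_module A P" using assms(1) by (auto simp: projective_def intro: fg_moduleD)
  fix f assume "f \<in> (\<lambda>h. compose (carrier P) d h) ` carrier (Hom A P X)"
  then obtain h where h: "h \<in> lhom A P X" "f = compose (carrier P) d h" by auto
  show "f \<in> carrier (Hom A P Y)"
    unfolding h(2) compose_def using restrict_lhom[OF lin_comp[OF lhom_lin[OF h(1)] assms(2)] P] by simp
next
  have P: "left_module A P" using assms(1) by (auto simp: projective_def intro: fg_moduleD)
  fix f assume "f \<in> carrier (Hom A P Y)"
  then have f: "f \<in> lhom A P Y" by simp
  obtain h where h: "lin A P X h" "\<And>x. x \<in> carrier P \<Longrightarrow> d (h x) = f x"
    by (rule projective_lift[OF assms(1,4,5,2,3) lhom_lin[OF f]]) (rule that)
  have hr: "restrict h (carrier P) \<in> lhom A P X" by (rule restrict_lhom[OF h(1) P])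
  have "compose (carrier P) d (restrict h (carrier P)) = f"
    by (rule extensionalityI[of _ "carrier P"]) (use f h(2) in \<open>simp_all add: compose_def lhom_iff\<close>)
  then show "f \<in> (\<lambda>h. compose (carrier P) d h) ` carrier (Hom A P X)" using hr by (intro image_eqI[of _ _ "restrict h (carrier P)"]) auto
qed

text \<open>Hom(P,-) is exact for projective P, so the relative exactness in \<open>gen\<close>
  comes for free; the index m there means m + 1 terms.\<close>

lemma gen_iff:
  assumes "projective A P"
  shows "M \<in> gen A m P \<longleftrightarrow> fg_module A M \<and> gen_res A P (Suc m) (copy A M)"
proof
  have P: "fg_module A P" using assms by (simp add: projective_def)
  assume "M \<in> gen A m P"
  then obtain C :: "nat \<Rightarrow> ('a, nat \<Rightarrow> 'k) module" and d e where C: "\<forall>i\<le>m. in_add A P (C i)" "exact_mods_to A m C d e M"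
    unfolding gen_def by blast
  have M: "fg_module A M" by (rule exact_mods_toD(1)[OF C(2)])
  have "gen_res A P (Suc m) (copy A M)"
    by (rule exact_to_gen_res[OF exact_mods_to_iso[OF C(2) fg_copy[OF M] lin_copy_map[OF M] bij_copy_map[OF M]]])
      (use C(1) in_add_iff[OF P] in blast)
  then show "fg_module A M \<and> gen_res A P (Suc m) (copy A M)" using M by simp
next
  have P: "fg_module A P" using assms by (simp add: projective_def)
  assume h: "fg_module A M \<and> gen_res A P (Suc m) (copy A M)"
  then have M: "fg_module A M" by simp
  obtain C :: "nat \<Rightarrow> ('a, nat \<Rightarrow> 'k) module" and d e0 where C: "\<forall>i\<le>m. radd A P (C i)" "exact_mods_to A m C d e0 (copy A M)"
    using gen_res_exact_to h by blast
  let ?e = "restrict (\<lambda>x. copy_inv A M (e0 x)) (carrier (C 0))"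
  have ex: "exact_mods_to A m C d ?e M"
    by (rule exact_mods_to_iso[OF C(2) M lin_copy_inv[OF M] bij_copy_inv[OF M]])
  define e where "e = ?e"
  have ex: "exact_mods_to A m C d e M" using ex by (simp only: e_def)
  note x = exact_mods_toD[OF ex]
  have "exact_to m (\<lambda>i. Hom A P (C i)) (\<lambda>i h. compose (carrier P) (d i) h) (\<lambda>h. compose (carrier P) e h) (Hom A P M)"
    unfolding exact_to_def
  proof (intro conjI allI impI)
    show "(\<lambda>h. compose (carrier P) e h) ` carrier (Hom A P (C 0)) = carrier (Hom A P M)"
      by (rule Hom_onto_projective[OF assms x(3,4) x(2)[OF le0] x(1)])
  next
    assume m: "0 < m"
    show "(\<lambda>h. compose (carrier P) (d 0) h) ` carrier (Hom A P (C 1)) = a_kernel (Hom A P (C 0)) (Hom A P M) (\<lambda>h. compose (carrier P) e h)"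
      unfolding One_nat_def
      by (rule Hom_exact_projective[OF assms x(5)[OF m] x(3) x(6)[OF m] x(2) x(2)[OF le0] fg_moduleD[OF x(1)]]) (use m in simp)
  next
    fix i assume i: "Suc i < m"
    then show "(\<lambda>h. compose (carrier P) (d (Suc i)) h) ` carrier (Hom A P (C (Suc (Suc i)))) =
        a_kernel (Hom A P (C (Suc i))) (Hom A P (C i)) (\<lambda>h. compose (carrier P) (d i) h)"
      by (intro Hom_exact_projective[OF assms x(5) x(5) x(7)] x(2) fg_moduleD[OF x(2)]) simp_all
  qed
  then show "M \<in> gen A m P"
    unfolding gen_def using C(1) in_add_iff[OF P] ex by blast
qed

end

section \<open>Duality for the tilting subcategories\<close>

context fd_alg
begin

section \<open>Hom and Ext under duality\<close>

lemma hom_zero_copy: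
  assumes "fg_module A M" "fg_module A N"
  shows "hom_zero A (copy A M) (copy A N) \<longleftrightarrow> hom_zero A M N"
proof
  note cM = fg_moduleD[OF fg_copy[OF assms(1)]] and cN = fg_moduleD[OF fg_copy[OF assms(2)]] and N = fg_moduleD[OF assms(2)]
  assume "hom_zero A (copy A M) (copy A N)"
  then have h: "hom_zero A M (copy A N)" by (rule hom_zero_radd[OF radd_copy(2)[OF assms(1)] _ cN])
  show "hom_zero A M N"
    unfolding hom_zero_def
  proof (intro allI impI ballI)
    fix f x assume f: "lin A M N f" and x: "x \<in> carrier M"
    have "copy_map A N (f x) = \<zero>\<^bsub>copy A N\<^esub>" by (rule hzD[OF h lin_comp[OF f lin_copy_map[OF assms(2)]] x])
    then show "f x = \<zero>\<^bsub>N\<^esub>"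
      using copy_inv_copy_map[OF assms(2) lin_closed[OF f x]] lin_zero[OF lin_copy_inv[OF assms(2)] cN N] by simp
  qed
next
  note cN = fg_moduleD[OF fg_copy[OF assms(2)]] and N = fg_moduleD[OF assms(2)]
  assume "hom_zero A M N"
  then have h: "hom_zero A (copy A M) N" by (rule hom_zero_radd[OF radd_copy(1)[OF assms(1)] _ N])
  show "hom_zero A (copy A M) (copy A N)"
    unfolding hom_zero_def
  proof (intro allI impI ballI)
    fix f x assume f: "lin A (copy A M) (copy A N) f" and x: "x \<in> carrier (copy A M)"
    have "copy_inv A N (f x) = \<zero>\<^bsub>N\<^esub>" by (rule hzD[OF h lin_comp[OF f lin_copy_inv[OF assms(2)]] x])
    then show "f x = \<zero>\<^bsub>copy A N\<^esub>"
      using copy_map_copy_inv[OF assms(2) lin_closed[OF f x]] lin_zero[OF lin_copy_map[OF assms(2)] N cN] by simp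
  qed
qed

lemma hom_zero_dual_imp:
  assumes "left_module A Q" "left_module (opp A) N" "hom_zero (opp A) N (dual K A Q)"
  shows "hom_zero A Q (dual K (opp A) N)"
  unfolding hom_zero_def
proof (intro allI impI ballI)
  interpret O: fd_alg K "opp A" by (rule fd_alg_opp)
  fix f x assume f: "lin A Q (dual K (opp A) N) f" and x: "x \<in> carrier Q"
  have l: "lin (opp A) N (dual K A Q) (O.flip Q f)"
    using O.lin_flip[of Q N f] assms(1,2) f by simp
  have "f x n = \<zero>\<^bsub>K\<^esub>" if n: "n \<in> carrier N" for n
    using fun_cong[OF hzD[OF assms(3) l n], of x] x by (simp add: O.flip_def)
  then show "f x = \<zero>\<^bsub>dual K (opp A) N\<^esub>"
    by (intro O.dual_eqI[OF lin_closed[OF f x] zero_in[OF O.left_module_dual[OF assms(2)]]]) simp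
qed

text \<open>Both directions are the same statement, since the opposite of the opposite algebra is
  the algebra itself.\<close>

lemma hom_zero_dual:
  assumes "left_module A Q" "left_module (opp A) N"
  shows "hom_zero (opp A) N (dual K A Q) \<longleftrightarrow> hom_zero A Q (dual K (opp A) N)"
proof
  interpret O: fd_alg K "opp A" by (rule fd_alg_opp)
  assume "hom_zero A Q (dual K (opp A) N)"
  then show "hom_zero (opp A) N (dual K A Q)" using O.hom_zero_dual_imp[of N Q] assms by simp
qed (rule hom_zero_dual_imp[OF assms])

text \<open>Under \<open>flip\<close>, a lift of N -> D Z along D i is an extension of Z -> D N
  along i.\<close>

lemma lift_on_dual:
  assumes "ses A Z i Q p T" "left_module (opp A) N"
  shows "lift_on (opp A) N (dual K A Q) (dmap Z i) (dual K A Z) \<longleftrightarrow> ext_on A Z i Q (dual K (opp A) N)"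
proof
  interpret O: fd_alg K "opp A" by (rule fd_alg_opp)
  note s = sesD[OF assms(1)]
  assume L: "lift_on (opp A) N (dual K A Q) (dmap Z i) (dual K A Z)"
  show "ext_on A Z i Q (dual K (opp A) N)"
    unfolding ext_on_def
  proof (intro allI impI)
    fix f assume f: "lin A Z (dual K (opp A) N) f"
    have l: "lin (opp A) N (dual K A Z) (O.flip Z f)" using O.lin_flip[of Z N f] s(4) assms(2) f by simp
    obtain g where g: "lin (opp A) N (dual K A Q) g" "\<And>n. n \<in> carrier N \<Longrightarrow> dmap Z i (g n) = O.flip Z f n"
      by (rule lift_onD[OF L l]) (rule that)
    have g': "lin A Q (dual K (opp A) N) (flip N g)" by (rule lin_flip[OF assms(2) s(5) g(1)])
    have "flip N g (i z) = f z" if z: "z \<in> carrier Z" for z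
    proof (rule O.dual_eqI[OF lin_closed[OF g' lin_closed[OF s(7) z]] lin_closed[OF f z]])
      fix n assume n: "n \<in> carrier N"
      show "flip N g (i z) n = f z n"
        using fun_cong[OF g(2)[OF n], of z] n z by (simp add: dmap_def flip_def O.flip_def)
    qed
    then show "\<exists>g. lin A Q (dual K (opp A) N) g \<and> (\<forall>x\<in>carrier Z. g (i x) = f x)" using g' by blast
  qed
next
  interpret O: fd_alg K "opp A" by (rule fd_alg_opp)
  note s = sesD[OF assms(1)]
  assume E: "ext_on A Z i Q (dual K (opp A) N)"
  show "lift_on (opp A) N (dual K A Q) (dmap Z i) (dual K A Z)"
    unfolding lift_on_def
  proof (intro allI impI)
    fix f assume f: "lin (opp A) N (dual K A Z) f"
    obtain g where g: "lin A Q (dual K (opp A) N) g" "\<And>z. z \<in> carrier Z \<Longrightarrow> g (i z) = flip N f z"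
      by (rule ext_onD[OF E lin_flip[OF assms(2) s(4) f]]) (rule that)
    have g': "lin (opp A) N (dual K A Q) (O.flip Q g)" using O.lin_flip[of Q N g] s(5) assms(2) g(1) by simp
    have "dmap Z i (O.flip Q g n) = f n" if n: "n \<in> carrier N" for n
    proof (rule dual_eqI[OF dmap_closed[OF s(7,4) lin_closed[OF g' n]] lin_closed[OF f n]])
      fix z assume z: "z \<in> carrier Z"
      show "dmap Z i (O.flip Q g n) z = f n z"
        using fun_cong[OF g(2)[OF z], of n] n z lin_closed[OF s(7) z] by (simp add: dmap_def flip_def O.flip_def)
    qed
    then show "\<exists>g. lin (opp A) N (dual K A Q) g \<and> (\<forall>x\<in>carrier N. dmap Z i (g x) = f x)" using g' by blast
  qed
qed

lemma radd_dd:
  assumes "fg_module A M"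
  shows "radd A M (dual K (opp A) (dual K A M))"
proof -
  interpret O: fd_alg K "opp A" by (rule fd_alg_opp)
  note D = double_dual[OF assms] and M = fg_moduleD[OF assms]
  have DD: "fg_module A (dual K (opp A) (dual K A M))" using O.fg_dual[OF fg_dual[OF assms]] by simp
  show ?thesis
    by (rule radd_of_retract[OF assms DD lin_inv[OF D M] D(1)]) (use D(2) in \<open>simp add: bij_betw_def f_inv_into_f del: dual_simps\<close>)
qed

text \<open>The dual of a syzygy sequence of \<open>T\<close> is a cosyzygy sequence of D T, so the
  left side can be computed by cosyzygies and the right side by syzygies in step, down to
  \<open>lift_on_dual\<close>.\<close>

lemma ext_zero_dual:
  assumes "fg_module (opp A) N" "fg_module A T"
  shows "ext_zero (opp A) n N (copy (opp A) (dual K A T)) \<longleftrightarrow> ext_zero A n T (copy A (dual K (opp A) N))"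
  using assms(2)
proof (induction n arbitrary: T)
  interpret O: fd_alg K "opp A" by (rule fd_alg_opp)
  note N = fg_moduleD[OF assms(1)]
  have DN: "fg_module A (dual K (opp A) N)" using O.fg_dual[OF assms(1)] by simp
  {
    case 0
    obtain Z Q :: "('a, nat \<Rightarrow> 'k) module" and i p where Q: "projective A Q" "ses A Z i Q p T"
      by (rule syzygy_exists[OF 0]) (rule that)
    note s = sesD[OF Q(2)]
    note t = dual_ses[OF Q(2)]
    note u = sesD[OF t]
    have "ses (opp A) (copy (opp A) (dual K A T)) (\<lambda>x. dmap Q p (copy_inv (opp A) (dual K A T) x)) (dual K A Q) (\<lambda>x. dmap Z i x) (dual K A Z)"
      by (rule ses_iso[OF t O.fg_copy[OF u(1)] u(2,3) O.lin_copy_inv[OF u(1)] O.bij_copy_inv[OF u(1)] lin_id _ lin_id _ lin_id])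
        (simp_all add: bij_betw_def del: dual_simps)
    then have "ext_zero (opp A) 0 N (copy (opp A) (dual K A T)) \<longleftrightarrow> lift_on (opp A) N (dual K A Q) (\<lambda>x. dmap Z i x) (dual K A Z)"
      by (rule O.ext_zero_0_iff_lift_on[OF dual_projective[OF Q(1)] _ assms(1)])
    also have "\<dots> \<longleftrightarrow> ext_on A Z i Q (dual K (opp A) N)" by (rule lift_on_dual[OF Q(2) N])
    also have "\<dots> \<longleftrightarrow> ext_on A Z i Q (copy A (dual K (opp A) N))" using ext_on_copy[OF DN s(4,5,7)] by simp
    also have "\<dots> \<longleftrightarrow> ext_zero A 0 T (copy A (dual K (opp A) N))" using ext_zero_0_iff_ext_on[OF Q fg_copy[OF DN]] by simp
    finally show ?case .
  next
    case (Suc n)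
    obtain Z Q :: "('a, nat \<Rightarrow> 'k) module" and i p where Q: "projective A Q" "ses A Z i Q p T"
      by (rule syzygy_exists[OF Suc.prems]) (rule that)
    note s = sesD[OF Q(2)]
    note t = O.ses_copy[OF dual_ses[OF Q(2)]]
    note u = sesD(2)[OF dual_ses[OF Q(2)]]
    have J: "injective (opp A) (copy (opp A) (dual K A Q))"
      by (rule O.injective_retract[OF dual_projective[OF Q(1)] O.fg_copy[OF u] O.lin_copy_inv[OF u] O.lin_copy_map[OF u]]) (rule O.copy_map_copy_inv[OF u])
    show ?case
      using O.ext_zero_Suc_inj[OF J t assms(1), of n] Suc.IH[OF s(1)] ext_zero_Suc_proj[OF Q fg_copy[OF DN], of n] by simp
  }
qed

section \<open>Coresolutions over the opposite algebra and resolutions over the algebra\<close>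

lemma bij_dmap:
  assumes "lin A M N f" "bij_betw f (carrier M) (carrier N)" "left_module A M" "fg_module A N"
  shows "bij_betw (dmap M f) (carrier (dual K A N)) (carrier (dual K A M))"
proof -
  have "inj_on (dmap M f) (carrier (dual K A N))"
  proof (rule inj_onI)
    fix g g' assume g: "g \<in> carrier (dual K A N)" "g' \<in> carrier (dual K A N)" "dmap M f g = dmap M f g'"
    show "g = g'"
    proof (rule dual_eqI[OF g(1,2)])
      fix y assume "y \<in> carrier N"
      then obtain x where x: "x \<in> carrier M" "y = f x" using assms(2) by (auto simp: bij_betw_def)
      then show "g y = g' y" using fun_cong[OF g(3), of x] by (simp add: dmap_def)
    qed
  qed
  moreover have "dmap M f ` carrier (dual K A N) = carrier (dual K A M)"
    by (rule dmap_surj[OF assms(1) _ assms(3,4)]) (use assms(2) in \<open>simp add: bij_betw_def\<close>)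
  ultimately show ?thesis by (simp add: bij_betw_def del: dual_simps)
qed

lemma bij_betw_comp: "bij_betw f X Y \<Longrightarrow> bij_betw g Y Z \<Longrightarrow> bij_betw (\<lambda>x. g (f x)) X Z"
  using bij_betw_trans[of f X Y g Z] by (simp add: comp_def)

text \<open>Duality reverses the sequence, and its terms land in the additive closure of the double
  dual of \<open>Q\<close>, that is, of \<open>Q\<close>. The terms of index 0 to m are counted as m
  + 1.\<close>

lemma dual_exact_from_gen_res:
  fixes C :: "nat \<Rightarrow> ('a, nat \<Rightarrow> 'k) module" and N :: "('a, nat \<Rightarrow> 'k) module"
  assumes "fg_module A Q" "exact_mods_from (opp A) m N e C d" "\<And>i. i \<le> m \<Longrightarrow> radd (opp A) (dual K A Q) (C i)"
  shows "gen_res A (copy A Q) (Suc m) (copy A (dual K (opp A) N))"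
  using assms(2,3)
proof (induction m arbitrary: N e C d)
  interpret O: fd_alg K "opp A" by (rule fd_alg_opp)
  \<comment> \<open>The dual of a summand of a power of D Q belongs to the additive closure of the
    double dual, which is brought back to \<open>Q\<close> by \<open>radd_dd\<close>.\<close>
  have r: "radd A (copy A Q) (copy A (dual K (opp A) X))" if "radd (opp A) (dual K A Q) X" for X :: "('a, nat \<Rightarrow> 'k) module"
    using O.radd_dual[OF that] radd_dd[OF assms(1)] by (intro radd_copy_left radd_copy_right) (auto intro: radd_trans simp del: dual_simps)
  {
    case 0
    note x = exact_mods_fromD[OF 0(1)]
    have C0: "fg_module (opp A) (C 0)" by (rule x(2)) simp
    note lN = fg_moduleD[OF x(1)]
    let ?X = "dual K (opp A) (C 0)" and ?Y = "dual K (opp A) N"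
    have X: "fg_module A ?X" and Y: "fg_module A ?Y" using O.fg_dual[OF C0] O.fg_dual[OF x(1)] by simp_all
    have "inj_on e (carrier N)" unfolding lin_inj_iff[OF x(3) lN fg_moduleD[OF C0]] using x(4) by blast
    then have sj: "dmap N e ` carrier ?X = carrier ?Y" by (rule O.dmap_surj[OF x(3) _ lN C0])
    have l: "lin A ?X ?Y (dmap N e)" using O.lin_dmap[OF x(3) lN] by simp
    let ?p = "\<lambda>x. copy_map A ?Y (dmap N e (copy_inv A ?X x))"
    have "?p ` carrier (copy A ?X) = copy_map A ?Y ` dmap N e ` copy_inv A ?X ` carrier (copy A ?X)" by (simp only: image_image)
    then have c: "?p ` carrier (copy A ?X) = carrier (copy A ?Y)"
      using bij_copy_inv[OF X] bij_copy_map[OF Y] sj by (simp only: bij_betw_def)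
    show ?case
      by (rule gen_res_SucI[OF r[OF 0(2)[OF le_refl]]
          kernel_ses[OF lin_comp[OF lin_comp[OF lin_copy_inv[OF X] l] lin_copy_map[OF Y]] fg_copy[OF X] fg_copy[OF Y] c]]) simp
  next
    case (Suc m)
    note sh = O.exact_mods_from_shift[OF Suc.prems(1)]
    let ?L = "sub (C (Suc 0)) (d 0 ` carrier (C 0))"
    have g: "gen_res A (copy A Q) (Suc m) (copy A (dual K (opp A) ?L))"
      by (rule Suc.IH[OF sh(2)]) (rule Suc.prems(2), simp)
    have sD: "ses A (dual K (opp A) ?L) (dmap (C 0) (d 0)) (dual K (opp A) (C 0)) (dmap N e) (dual K (opp A) N)"
      using O.dual_ses[OF sh(1)] unfolding opp_simps .
    show ?case
      by (rule gen_res_SucI[OF r[OF Suc.prems(2)[OF le0]] ses_copy[OF sD] g])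
  }
qed

lemma kernel_restrict_inj:
  assumes "lin R M N f" "inj_on f (carrier M)" "left_module R M" "left_module R N"
  shows "{y \<in> carrier M. restrict f (carrier M) y = \<zero>\<^bsub>N\<^esub>} = {\<zero>\<^bsub>M\<^esub>}"
proof (intro equalityI subsetI)
  fix y assume "y \<in> {y \<in> carrier M. restrict f (carrier M) y = \<zero>\<^bsub>N\<^esub>}"
  then have "y \<in> carrier M" "f y = \<zero>\<^bsub>N\<^esub>" by auto
  then show "y \<in> {\<zero>\<^bsub>M\<^esub>}" using assms(2) unfolding lin_inj_iff[OF assms(1,3,4)] by blast
qed (use zero_in[OF assms(3)] lin_zero[OF assms(1,3,4)] in simp)

text \<open>The reverse passage to \<open>dual_exact_from_gen_res\<close>: the short exact sequences
  of the resolution are dualized and spliced into a coresolution of D M.\<close>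

lemma gen_res_dual_exact_from:
  assumes "fg_module A Q" "gen_res A (copy A Q) (Suc m) M"
  shows "\<exists>(C :: nat \<Rightarrow> ('a, nat \<Rightarrow> 'k) module) d e. (\<forall>i\<le>m. radd (opp A) (dual K A Q) (C i)) \<and>
    exact_mods_from (opp A) m (copy (opp A) (dual K A M)) e C d"
  using assms(2)
proof (induction m arbitrary: M)
  interpret O: fd_alg K "opp A" by (rule fd_alg_opp)
  have r: "radd (opp A) (dual K A Q) (copy (opp A) (dual K A F))" if "radd A (copy A Q) F" for F :: "('a, nat \<Rightarrow> 'k) module"
    by (rule O.radd_copy_right[OF radd_trans[OF radd_dual[OF radd_copy(1)[OF assms(1)]] radd_dual[OF that]]])
  {
    case 0
    obtain N F :: "('a, nat \<Rightarrow> 'k) module" and i p where F: "radd A (copy A Q) F" "ses A N i F p M"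
      using 0 by (rule gen_res_SucE) (rule that)
    obtain i' p' where t: "ses (opp A) (copy (opp A) (dual K A M)) i' (copy (opp A) (dual K A F)) p' (copy (opp A) (dual K A N))"
      using O.ses_copy[OF dual_ses[OF F(2)]] by blast
    note s = sesD[OF t]
    let ?M = "copy (opp A) (dual K A M)"
    have "{y \<in> carrier ?M. restrict i' (carrier ?M) y = \<zero>\<^bsub>copy (opp A) (dual K A F)\<^esub>} = {\<zero>\<^bsub>?M\<^esub>}"
      by (rule kernel_restrict_inj[OF s(7,9,4,5)])
    then have x: "exact_mods_from (opp A) 0 ?M (restrict i' (carrier ?M)) (\<lambda>_. copy (opp A) (dual K A F)) (\<lambda>_ _. undefined)"
      using s(1,2) restrict_lhom[OF s(7,4)] unfolding exact_mods_from_def exact_from_def a_kernel_def' by simp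
    show ?case
      by (rule exI[of _ "\<lambda>_. copy (opp A) (dual K A F)"], rule exI[of _ "\<lambda>_ _. undefined"], rule exI[of _ "restrict i' (carrier ?M)"])
        (intro conjI allI impI x r[OF F(1)])
  next
    case (Suc m)
    obtain N F :: "('a, nat \<Rightarrow> 'k) module" and i p where F: "radd A (copy A Q) F" "ses A N i F p M" "gen_res A (copy A Q) (Suc m) N"
      using Suc.prems by (rule gen_res_SucE) (rule that)
    obtain C :: "nat \<Rightarrow> ('a, nat \<Rightarrow> 'k) module" and d e where C: "\<forall>i\<le>m. radd (opp A) (dual K A Q) (C i)"
        "exact_mods_from (opp A) m (copy (opp A) (dual K A N)) e C d"
      using Suc.IH[OF F(3)] by blast
    obtain i' p' where t: "ses (opp A) (copy (opp A) (dual K A M)) i' (copy (opp A) (dual K A F)) p' (copy (opp A) (dual K A N))"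
      using O.ses_copy[OF dual_ses[OF F(2)]] by blast
    let ?M = "copy (opp A) (dual K A M)" and ?F = "copy (opp A) (dual K A F)" and ?N = "copy (opp A) (dual K A N)"
    note s = sesD[OF t]
    note x = exact_mods_fromD[OF C(2)]
    let ?C = "case_nat ?F C" and ?f = "restrict (\<lambda>x. e (p' x)) (carrier ?F)" and ?e = "restrict i' (carrier ?M)"
    let ?d = "case_nat ?f d"
    have f: "?f \<in> lhom (opp A) ?F (C 0)" by (rule restrict_lhom[OF lin_comp[OF s(8) x(3)] s(5)])
    have ef: "?f ` carrier ?F = e ` carrier ?N"
    proof -
      have "?f ` carrier ?F = e ` p' ` carrier ?F" unfolding image_image by (rule image_cong) simp_all
      then show ?thesis using s(10) by simp
    qed
    have e1: "{y \<in> carrier ?M. ?e y = \<zero>\<^bsub>?F\<^esub>} = {\<zero>\<^bsub>?M\<^esub>}"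
      by (rule kernel_restrict_inj[OF s(7,9,4,5)])
    have fz: "?f y = \<zero>\<^bsub>C 0\<^esub> \<longleftrightarrow> p' y = \<zero>\<^bsub>?N\<^esub>" if y: "y \<in> carrier ?F" for y
    proof -
      have "p' y \<in> {z \<in> carrier ?N. e z = \<zero>\<^bsub>C 0\<^esub>} \<longleftrightarrow> p' y \<in> {\<zero>\<^bsub>?N\<^esub>}" by (simp only: x(4))
      then show ?thesis using lin_closed[OF s(8) y] y by simp
    qed
    have e2: "?e ` carrier ?M = {y \<in> carrier ?F. ?f y = \<zero>\<^bsub>C 0\<^esub>}"
    proof -
      have "?e ` carrier ?M = i' ` carrier ?M" by simp
      also have "\<dots> = {y \<in> carrier ?F. p' y = \<zero>\<^bsub>?N\<^esub>}" using t lin_closed[OF s(7)] unfolding ses_def by auto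
      also have "\<dots> = {y \<in> carrier ?F. ?f y = \<zero>\<^bsub>C 0\<^esub>}" using fz by blast
      finally show ?thesis .
    qed
    have e3: "?d j ` carrier (?C j) = {x \<in> carrier (C j). d j x = \<zero>\<^bsub>C (Suc j)\<^esub>}" if j: "j < m" for j
    proof (cases j)
      case 0
      then show ?thesis using x(6) ef j by (simp del: image_restrict_eq)
    next
      case (Suc j')
      then show ?thesis using x(7)[of j'] j by simp
    qed
    have c1: "\<forall>j\<le>Suc m. fg_module (opp A) (?C j)" using x(2) s(2) by (simp split: nat.splits)
    have c2: "\<forall>j<Suc m. ?d j \<in> lhom (opp A) (?C j) (?C (Suc j))"
      using f C(2) unfolding exact_mods_from_def by (simp split: nat.splits)
    have ex: "exact_from (Suc m) ?M ?e ?C ?d"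
      unfolding exact_from_def a_kernel_def' using e1 e2 e3 by simp
    have x: "exact_mods_from (opp A) (Suc m) ?M ?e ?C ?d"
      unfolding exact_mods_from_def using s(1) c1 c2 ex restrict_lhom[OF s(7,4)] by simp
    have y: "radd (opp A) (dual K A Q) (?C j)" if "j \<le> Suc m" for j
      using C(1) r[OF F(1)] that by (simp split: nat.splits)
    show ?case
      by (rule exI[of _ ?C], rule exI[of _ ?d], rule exI[of _ ?e]) (intro conjI allI impI x y)
  }
qed

lemma Hom_onto_injective:
  assumes "injective A I" "lin A N C e" "inj_on e (carrier N)" "fg_module A N" "fg_module A C"
  shows "(\<lambda>h. compose (carrier N) h e) ` carrier (Hom A C I) = carrier (Hom A N I)"
proof (intro equalityI subsetI)
  note lN = fg_moduleD[OF assms(4)]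
  fix f assume "f \<in> (\<lambda>h. compose (carrier N) h e) ` carrier (Hom A C I)"
  then obtain h where h: "h \<in> lhom A C I" "f = compose (carrier N) h e" by auto
  show "f \<in> carrier (Hom A N I)"
    unfolding h(2) compose_def using restrict_lhom[OF lin_comp[OF assms(2) lhom_lin[OF h(1)]] lN] by simp
next
  note lC = fg_moduleD[OF assms(5)]
  fix f assume "f \<in> carrier (Hom A N I)"
  then have f: "f \<in> lhom A N I" by simp
  obtain h where h: "lin A C I h" "\<And>x. x \<in> carrier N \<Longrightarrow> h (e x) = f x"
    by (rule injective_extend[OF assms(1,4,5,2,3) lhom_lin[OF f]]) (rule that)
  have hr: "restrict h (carrier C) \<in> lhom A C I" by (rule restrict_lhom[OF h(1) lC])
  have "compose (carrier N) (restrict h (carrier C)) e = f"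
    by (rule extensionalityI[of _ "carrier N"]) (use f h(2) lin_closed[OF assms(2)] in \<open>simp_all add: compose_def lhom_iff\<close>)
  then show "f \<in> (\<lambda>h. compose (carrier N) h e) ` carrier (Hom A C I)"
    using hr by (intro image_eqI[of _ _ "restrict h (carrier C)"]) auto
qed

text \<open>A map on \<open>Y\<close> that vanishes on the image of \<open>d\<close> factors over
  the image of \<open>e\<close>, and from this submodule of \<open>Z\<close> it extends by
  injectivity.\<close>

lemma Hom_exact_injective:
  assumes "injective A I" "lin A X Y d" "lin A Y Z e" "d ` carrier X = {y \<in> carrier Y. e y = \<zero>\<^bsub>Z\<^esub>}"
    and "fg_module A X" "fg_module A Y" "fg_module A Z"
  shows "(\<lambda>h. compose (carrier Y) h e) ` carrier (Hom A Z I) = a_kernel (Hom A Y I) (Hom A X I) (\<lambda>h. compose (carrier X) h d)"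
proof (intro equalityI subsetI)
  note lY = fg_moduleD[OF assms(6)] and lZ = fg_moduleD[OF assms(7)]
  have I: "left_module A I" using assms(1) by (auto simp: injective_def intro: fg_moduleD)
  fix f assume "f \<in> (\<lambda>h. compose (carrier Y) h e) ` carrier (Hom A Z I)"
  then obtain h where h: "h \<in> lhom A Z I" "f = compose (carrier Y) h e" by auto
  have f: "f \<in> lhom A Y I"
    unfolding h(2) compose_def by (rule restrict_lhom[OF lin_comp[OF assms(3) lhom_lin[OF h(1)]] lY])
  have "e (d x) = \<zero>\<^bsub>Z\<^esub>" if "x \<in> carrier X" for x using assms(4) that by blast
  then have "compose (carrier X) f d = \<zero>\<^bsub>Hom A X I\<^esub>"
    using lin_closed[OF assms(2)] lin_zero[OF lhom_lin[OF h(1)] lZ I] by (auto simp: h(2) compose_def fun_eq_iff)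
  then show "f \<in> a_kernel (Hom A Y I) (Hom A X I) (\<lambda>h. compose (carrier X) h d)" using f unfolding a_kernel_iff by simp
next
  note lY = fg_moduleD[OF assms(6)] and lZ = fg_moduleD[OF assms(7)]
  have I: "left_module A I" using assms(1) by (auto simp: injective_def intro: fg_moduleD)
  fix f assume "f \<in> a_kernel (Hom A Y I) (Hom A X I) (\<lambda>h. compose (carrier X) h d)"
  then have f: "f \<in> lhom A Y I" and z: "compose (carrier X) f d = \<zero>\<^bsub>Hom A X I\<^esub>" unfolding a_kernel_iff by auto
  let ?W = "e ` carrier Y"
  have W: "submod A Z ?W" by (rule submod_image[OF assms(3) lY lZ submod_carrier[OF lY]])
  have fW: "fg_module A (sub Z ?W)" by (rule fg_sub[OF assms(7) W])
  have l: "lin A Y (sub Z ?W) e" by (rule lin_sub_into[OF assms(3)]) simp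
  have s: "ses A (sub Y {x \<in> carrier Y. e x = \<zero>\<^bsub>sub Z ?W\<^esub>}) (\<lambda>x. x) Y e (sub Z ?W)"
    by (rule kernel_ses[OF l assms(6) fW]) simp
  have z': "f x = \<zero>\<^bsub>I\<^esub>" if x: "x \<in> carrier (sub Y {x \<in> carrier Y. e x = \<zero>\<^bsub>sub Z ?W\<^esub>})" for x
  proof -
    have "x \<in> d ` carrier X" using x unfolding assms(4) by simp
    then obtain y where "y \<in> carrier X" "x = d y" by (rule imageE)
    then show ?thesis using fun_cong[OF z, of y] by (simp add: compose_def)
  qed
  obtain g where g: "lin A (sub Z ?W) I g" "\<And>x. x \<in> carrier Y \<Longrightarrow> g (e x) = f x"
    by (rule ses_factor[OF s I lhom_lin[OF f] z'], assumption) (rule that)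
  have incl: "lin A (sub Z ?W) Z (\<lambda>x. x)" by (rule lin_sub_incl) (rule submodD(1)[OF W])
  obtain h where h: "lin A Z I h" "\<And>x. x \<in> carrier (sub Z ?W) \<Longrightarrow> h x = g x"
    by (rule injective_extend[OF assms(1) fW assms(7) incl _ g(1)], simp) (rule that)
  have hr: "restrict h (carrier Z) \<in> lhom A Z I" by (rule restrict_lhom[OF h(1) lZ])
  have "compose (carrier Y) (restrict h (carrier Z)) e = f"
    by (rule extensionalityI[of _ "carrier Y"])
      (use f h(2) g(2) lin_closed[OF assms(3)] in \<open>simp_all add: compose_def lhom_iff\<close>)
  then show "f \<in> (\<lambda>h. compose (carrier Y) h e) ` carrier (Hom A Z I)"
    using hr by (intro image_eqI[of _ _ "restrict h (carrier Z)"]) auto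
qed

text \<open>As the dual of a projective module, D Q is injective, so exactness under Hom(-,D Q)
  comes for free; what remains of \<open>cogen\<close> for \<open>N\<close> is a resolution of D N
  by add Q.\<close>

lemma cogen_iff:
  assumes "projective A Q"
  shows "N \<in> cogen (opp A) m (dual K A Q) \<longleftrightarrow>
    fg_module (opp A) N \<and> gen_res A (copy A Q) (Suc m) (copy A (dual K (opp A) N))"
proof -
  interpret O: fd_alg K "opp A" by (rule fd_alg_opp)
  have Q: "fg_module A Q" using assms by (simp add: projective_def)
  let ?I = "dual K A Q"
  note fI = fg_dual[OF Q] and I = dual_projective[OF assms]
  show ?thesis
  proof
    assume "N \<in> cogen (opp A) m ?I"
    then obtain C :: "nat \<Rightarrow> ('a, nat \<Rightarrow> 'k) module" and d e where
      C: "\<forall>i\<le>m. in_add (opp A) ?I (C i)" "exact_mods_from (opp A) m N e C d"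
      unfolding cogen_def by blast
    have N: "fg_module (opp A) N" by (rule exact_mods_fromD(1)[OF C(2)])
    note ex = O.exact_mods_from_iso[OF C(2) O.fg_copy[OF N] O.lin_copy_inv[OF N] O.bij_copy_inv[OF N]]
    have g: "gen_res A (copy A Q) (Suc m) (copy A (dual K (opp A) (copy (opp A) N)))"
      by (rule dual_exact_from_gen_res[OF Q ex]) (use C(1) O.in_add_iff[OF fI] in blast)
    let ?X = "dual K (opp A) (copy (opp A) N)" and ?Y = "dual K (opp A) N"
    have X: "fg_module A ?X" and Y: "fg_module A ?Y" using O.fg_dual[OF O.fg_copy[OF N]] O.fg_dual[OF N] by simp_all
    have l: "lin A ?X ?Y (dmap N (copy_map (opp A) N))" using O.lin_dmap[OF O.lin_copy_map[OF N] fg_moduleD[OF N]] by simp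
    note b = O.bij_dmap[OF O.lin_copy_map[OF N] O.bij_copy_map[OF N] fg_moduleD[OF N] O.fg_copy[OF N]]
    have "gen_res A (copy A Q) (Suc m) (copy A ?Y)"
      by (rule gen_res_iso[OF g fg_copy[OF Y] lin_comp[OF lin_comp[OF lin_copy_inv[OF X] l] lin_copy_map[OF Y]]
          bij_betw_comp[OF bij_betw_comp[OF bij_copy_inv[OF X] b] bij_copy_map[OF Y]]])
    then show "fg_module (opp A) N \<and> gen_res A (copy A Q) (Suc m) (copy A ?Y)" using N by simp
  next
    let ?Y = "dual K (opp A) N"
    assume h: "fg_module (opp A) N \<and> gen_res A (copy A Q) (Suc m) (copy A ?Y)"
    then have N: "fg_module (opp A) N" by simp
    have Y: "fg_module A ?Y" using O.fg_dual[OF N] by simp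
    obtain C :: "nat \<Rightarrow> ('a, nat \<Rightarrow> 'k) module" and d e0 where C: "\<forall>i\<le>m. radd (opp A) ?I (C i)"
        "exact_mods_from (opp A) m (copy (opp A) (dual K A (copy A ?Y))) e0 C d"
      using gen_res_dual_exact_from[OF Q] h by blast
    let ?Z = "dual K A (copy A ?Y)"
    have Z: "fg_module (opp A) ?Z" by (rule fg_dual[OF fg_copy[OF Y]])
    have d1: "lin (opp A) N (dual K A ?Y) (O.bidual N)" "bij_betw (O.bidual N) (carrier N) (carrier (dual K A ?Y))"
      using O.double_dual[OF N] unfolding opp_simps .
    note d2 = lin_dmap[OF lin_copy_inv[OF Y] fg_moduleD[OF fg_copy[OF Y]]]
      and d3 = bij_dmap[OF lin_copy_inv[OF Y] bij_copy_inv[OF Y] fg_moduleD[OF fg_copy[OF Y]] Y]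
    \<comment> \<open>The coresolution obtained starts at the dual of the copy of D N. It is carried
      to \<open>N\<close> along the double dual and the copy maps.\<close>
    obtain e where ex: "exact_mods_from (opp A) m N e C d"
      using O.exact_mods_from_iso[OF C(2) N lin_comp[OF lin_comp[OF d1(1) d2] O.lin_copy_map[OF Z]]
          bij_betw_comp[OF bij_betw_comp[OF d1(2) d3] O.bij_copy_map[OF Z]]] by blast
    note x = exact_mods_fromD[OF ex]
    have inj: "inj_on e (carrier N)"
      unfolding lin_inj_iff[OF x(3) fg_moduleD[OF N] fg_moduleD[OF x(2)[OF le0]]] using x(4) by blast
    have "exact_to m (\<lambda>i. Hom (opp A) (C i) ?I) (\<lambda>i h. compose (carrier (C i)) h (d i)) (\<lambda>h. compose (carrier N) h e) (Hom (opp A) N ?I)"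
      unfolding exact_to_def
    proof (intro conjI allI impI)
      show "(\<lambda>h. compose (carrier N) h e) ` carrier (Hom (opp A) (C 0) ?I) = carrier (Hom (opp A) N ?I)"
        by (rule O.Hom_onto_injective[OF I x(3) inj N x(2)[OF le0]])
    next
      assume m: "0 < m"
      show "(\<lambda>h. compose (carrier (C 0)) h (d 0)) ` carrier (Hom (opp A) (C 1) ?I) =
          a_kernel (Hom (opp A) (C 0) ?I) (Hom (opp A) N ?I) (\<lambda>h. compose (carrier N) h e)"
        unfolding One_nat_def
        by (rule O.Hom_exact_injective[OF I x(3) x(5)[OF m] x(6)[OF m] N x(2)[OF le0] x(2)]) (use m in simp)
    next
      fix i assume i: "Suc i < m"
      then show "(\<lambda>h. compose (carrier (C (Suc i))) h (d (Suc i))) ` carrier (Hom (opp A) (C (Suc (Suc i))) ?I) =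
          a_kernel (Hom (opp A) (C (Suc i)) ?I) (Hom (opp A) (C i) ?I) (\<lambda>h. compose (carrier (C i)) h (d i))"
        by (intro O.Hom_exact_injective[OF I x(5) x(5) x(7)] x(2)) simp_all
    qed
    moreover have "\<forall>i\<le>m. in_add (opp A) ?I (C i)" using C(1) O.in_add_iff[OF fI] by blast
    ultimately show "N \<in> cogen (opp A) m ?I"
      unfolding cogen_def using ex by blast
  qed
qed

section \<open>Membership in the tilting subcategories in terms of \<open>ext_zero\<close>\<close>

lemma tilting_T_iff:
  assumes "fg_module A T"
  shows "M \<in> tilting_T A T j \<longleftrightarrow> fg_module A M \<and> (j \<noteq> 0 \<longrightarrow> hom_zero A (copy A T) (copy A M)) \<and> (\<forall>n. Suc n \<noteq> j \<longrightarrow> ext_zero A n (copy A T) (copy A M))"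
proof (cases "fg_module A M")
  case True
  have "Ext_vanishes A 0 T M \<longleftrightarrow> hom_zero A (copy A T) (copy A M)"
    using Hom_vanishes_iff[OF fg_moduleD[OF assms] fg_moduleD[OF True]] hom_zero_copy[OF assms True] by (simp add: Ext_vanishes_def)
  moreover have "(\<forall>i. i \<noteq> j \<longrightarrow> Ext_vanishes A i T M) \<longleftrightarrow>
      (j \<noteq> 0 \<longrightarrow> Ext_vanishes A 0 T M) \<and> (\<forall>n. Suc n \<noteq> j \<longrightarrow> Ext_vanishes A (Suc n) T M)"
    by (metis not0_implies_Suc)
  ultimately show ?thesis
    unfolding tilting_T_def using True Ext_vanishes_iff[OF assms True] by simp
qed (simp add: tilting_T_def)

text \<open>Ext of N into D T over the opposite algebra vanishes exactly when Ext of T into D N does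
  over the algebra, so N belongs to C_j(DT) if and only if D N belongs to T_j(T).\<close>

lemma tilting_C_iff:
  assumes "fg_module A T"
  shows "N \<in> tilting_C (opp A) (dual K A T) j \<longleftrightarrow> fg_module (opp A) N \<and>
    (j \<noteq> 0 \<longrightarrow> hom_zero A (copy A T) (copy A (dual K (opp A) N))) \<and> (\<forall>n. Suc n \<noteq> j \<longrightarrow> ext_zero A n (copy A T) (copy A (dual K (opp A) N)))"
proof (cases "fg_module (opp A) N")
  case True
  interpret O: fd_alg K "opp A" by (rule fd_alg_opp)
  let ?B = "opp A" and ?D = "dual K A T" and ?DN = "dual K (opp A) N"
  note D = fg_dual[OF assms]
  have DN: "fg_module A ?DN" using O.fg_dual[OF True] by simp
  have "Ext_vanishes ?B 0 N ?D \<longleftrightarrow> hom_zero A (copy A T) (copy A ?DN)"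
    using O.Hom_vanishes_iff[OF fg_moduleD[OF True] fg_moduleD[OF D]] hom_zero_dual[OF fg_moduleD[OF assms] fg_moduleD[OF True]]
      hom_zero_copy[OF assms DN] by (simp add: Ext_vanishes_def)
  moreover have "Ext_vanishes ?B (Suc n) N ?D \<longleftrightarrow> ext_zero A n (copy A T) (copy A ?DN)" for n
  proof -
    let ?N = "copy ?B N" and ?T = "copy A T"
    note cN = O.fg_copy[OF True] and cT = fg_copy[OF assms]
    \<comment> \<open>Dualizing and copying in either order gives isomorphic modules; the four
      \<open>radd\<close> facts let \<open>ext_zero\<close> pass between these
      representatives.\<close>
    have D1: "radd ?B (copy ?B ?D) (copy ?B (dual K A ?T))"
      by (rule O.radd_copy_left[OF O.radd_copy_right[OF radd_dual[OF radd_copy(1)[OF assms]]]])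
    have D2: "radd ?B (copy ?B (dual K A ?T)) (copy ?B ?D)"
      by (rule O.radd_copy_left[OF O.radd_copy_right[OF radd_dual[OF radd_copy(2)[OF assms]]]])
    have "radd A (dual K (opp A) ?N) ?DN" using O.radd_dual[OF O.radd_copy(2)[OF True]] by simp
    then have N1: "radd A (copy A (dual K (opp A) ?N)) (copy A ?DN)" by (rule radd_copy_left[OF radd_copy_right])
    have "radd A ?DN (dual K (opp A) ?N)" using O.radd_dual[OF O.radd_copy(1)[OF True]] by simp
    then have N2: "radd A (copy A ?DN) (copy A (dual K (opp A) ?N))" by (rule radd_copy_left[OF radd_copy_right])
    have "Ext_vanishes ?B (Suc n) N ?D \<longleftrightarrow> ext_zero ?B n ?N (copy ?B ?D)" by (rule O.Ext_vanishes_iff[OF True D])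
    also have "\<dots> \<longleftrightarrow> ext_zero ?B n ?N (copy ?B (dual K A ?T))"
      using O.ext_zero_radd_right[OF D1 cN] O.ext_zero_radd_right[OF D2 cN] by blast
    also have "\<dots> \<longleftrightarrow> ext_zero A n ?T (copy A (dual K (opp A) ?N))" by (rule ext_zero_dual[OF cN cT])
    also have "\<dots> \<longleftrightarrow> ext_zero A n ?T (copy A ?DN)"
      using ext_zero_radd_right[OF N1 cT] ext_zero_radd_right[OF N2 cT] by blast
    finally show ?thesis .
  qed
  moreover have "(\<forall>i. i \<noteq> j \<longrightarrow> Ext_vanishes ?B i N ?D) \<longleftrightarrow>
      (j \<noteq> 0 \<longrightarrow> Ext_vanishes ?B 0 N ?D) \<and> (\<forall>n. Suc n \<noteq> j \<longrightarrow> Ext_vanishes ?B (Suc n) N ?D)"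
    by (metis not0_implies_Suc)
  ultimately show ?thesis
    unfolding tilting_C_def using True by simp
qed (simp add: tilting_C_def)

lemma zero_copy:
  assumes "fg_module A M"
  shows "carrier (copy A M) = {\<zero>\<^bsub>copy A M\<^esub>} \<longleftrightarrow> zero_module M"
proof -
  note l = fg_moduleD[OF assms] and lc = fg_moduleD[OF fg_copy[OF assms]]
  show ?thesis
  proof
    assume z: "carrier (copy A M) = {\<zero>\<^bsub>copy A M\<^esub>}"
    show "zero_module M"
      unfolding zero_module_def
    proof (intro equalityI subsetI)
      fix m assume m: "m \<in> carrier M"
      have "copy_map A M m = \<zero>\<^bsub>copy A M\<^esub>" using copy_map_closed[OF assms m] unfolding z by simp
      then show "m \<in> {\<zero>\<^bsub>M\<^esub>}" using copy_inv_copy_map[OF assms m] lin_zero[OF lin_copy_inv[OF assms] lc l] by simp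
    qed (simp add: zero_in[OF l])
  next
    assume z: "zero_module M"
    show "carrier (copy A M) = {\<zero>\<^bsub>copy A M\<^esub>}"
    proof (intro equalityI subsetI)
      fix m assume m: "m \<in> carrier (copy A M)"
      have "copy_inv A M m = \<zero>\<^bsub>M\<^esub>" using copy_inv_closed[OF assms m] z unfolding zero_module_def by simp
      then show "m \<in> {\<zero>\<^bsub>copy A M\<^esub>}" using copy_map_copy_inv[OF assms m] lin_zero[OF lin_copy_map[OF assms] l lc] by simp
    qed (simp add: zero_in[OF lc])
  qed
qed

text \<open>If every functional is zero, all elements have the same double dual, and
  \<open>double_dual\<close> is injective.\<close>

lemma zero_dual:
  assumes "fg_module A M"
  shows "zero_module (dual K A M) \<longleftrightarrow> zero_module M"
proof
  assume z: "zero_module (dual K A M)"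
  interpret O: fd_alg K "opp A" by (rule fd_alg_opp)
  note l = fg_moduleD[OF assms]
  note D = double_dual[OF assms]
  note lD = left_module_dual[OF l]
  show "zero_module M"
    unfolding zero_module_def
  proof (intro equalityI subsetI)
    fix m assume m: "m \<in> carrier M"
    have "bidual M m = bidual M \<zero>\<^bsub>M\<^esub>"
    proof (rule O.dual_eqI[OF lin_closed[OF D(1) m] lin_closed[OF D(1) zero_in[OF l]]])
      fix f assume f: "f \<in> carrier (dual K A M)"
      then have "f = \<zero>\<^bsub>dual K A M\<^esub>" using z unfolding zero_module_def by blast
      then have "f m = f \<zero>\<^bsub>M\<^esub>" using m zero_in[OF l] by simp
      then show "bidual M m f = bidual M \<zero>\<^bsub>M\<^esub> f" using f by (simp add: bidual_def del: dual_simps)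
    qed
    then show "m \<in> {\<zero>\<^bsub>M\<^esub>}" using D(2) m zero_in[OF l] by (auto simp: bij_betw_def dest: inj_onD simp del: dual_simps)
  qed (simp add: zero_in[OF l])
next
  assume z: "zero_module M"
  note l = fg_moduleD[OF assms]
  show "zero_module (dual K A M)"
    unfolding zero_module_def
  proof (intro equalityI subsetI)
    fix f assume f: "f \<in> carrier (dual K A M)"
    have "f = \<zero>\<^bsub>dual K A M\<^esub>"
    proof (rule dual_eqI[OF f zero_in[OF left_module_dual[OF l]]])
      fix x assume x: "x \<in> carrier M"
      then have "x = \<zero>\<^bsub>M\<^esub>" using z unfolding zero_module_def by blast
      then show "f x = \<zero>\<^bsub>dual K A M\<^esub> x" using dual_zero[OF l f] x by simp
    qed
    then show "f \<in> {\<zero>\<^bsub>dual K A M\<^esub>}" by simp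
  qed (simp add: zero_in[OF left_module_dual[OF l]] del: dual_simps)
qed

lemma gen_res_mono:
  assumes "gen_res A P m M" "radd A P' P"
  shows "gen_res A P' m M"
  using assms(1)
proof (induction m arbitrary: M)
  case (Suc m)
  obtain N F :: "('a, nat \<Rightarrow> 'k) module" and i p where F: "radd A P F" "ses A N i F p M" "gen_res A P m N"
    using Suc.prems by (rule gen_res_SucE) (rule that)
  show ?case by (rule gen_res_SucI[OF radd_trans[OF assms(2) F(1)] F(2) Suc.IH[OF F(3)]])
qed simp

text \<open>The data of the definition, moved to copies: the projective resolution enters as
  vanishing above its length, and the long coresolution as iterated short exact sequences.\<close>

lemma special_tilting_special_tilt:
  assumes "special_tilting A P k T"
  shows "special_tilt K A (copy A P) (copy A T) k"
proof -
  have t: "tilting A k T" "projective A P" "in_add A T P" using assms by (auto simp: special_tilting_def)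
  have T: "fg_module A T" using t(1) by (simp add: tilting_def)
  have P: "fg_module A P" using t(2) by (simp add: projective_def)
  obtain t' :: "nat \<Rightarrow> ('a, nat \<Rightarrow> 'k) module" where c: "tilting_coresolution A k T t'" "\<forall>j<k. in_add A P (t' j)"
    using assms unfolding special_tilting_def by blast
  obtain e d where ex: "exact_mods_from A (Suc k) (regular A) e t' d" using c(1) unfolding tilting_coresolution_def by blast
  note R = fg_regular
  show ?thesis
  proof (unfold_locales)
    show "projective A (copy A P)" by (rule projective_radd[OF t(2) radd_copy(1)[OF P]])
    show "radd A (copy A T) (copy A P)" by (intro radd_copy_left radd_copy_right iffD1[OF in_add_iff[OF T] t(3)])
    show "ext_zero A n (copy A T) N" if "k \<le> n" "fg_module A N" for n N
      by (rule pdim_ext_zero[OF _ that]) (use t(1) in \<open>simp add: tilting_def\<close>)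
    show "ext_zero A n (copy A T) (copy A T)" for n
      using Ext_vanishes_iff[OF T T, of n] t(1) by (simp add: tilting_def)
    show "cores A (copy A P) (copy A T) k (copy A (regular A))"
    proof (rule coresolution_cores[OF exact_mods_from_iso[OF ex fg_copy[OF R] lin_copy_inv[OF R] bij_copy_inv[OF R]]])
      fix j assume "j < k"
      then have "radd A P (t' j)" using c(2) by (intro iffD1[OF in_add_iff[OF P]]) simp
      then show "radd A (copy A P) (t' j)" by (rule radd_copy_left)
    next
      have "radd A T (t' k)" using c(1) unfolding tilting_coresolution_def by (intro iffD1[OF in_add_iff[OF T]]) simp
      then show "radd A (copy A T) (t' k)" by (rule radd_copy_left)
      show "zero_module (t' (Suc k))" using c(1) unfolding tilting_coresolution_def by blast
    qed
  qed
qed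

end

lemma (in special_tilt) tilting_class_cases:
  assumes "fg_module A M" "0 < k"
  shows "(j \<noteq> 0 \<longrightarrow> hom_zero A T M) \<and> (\<forall>n. Suc n \<noteq> j \<longrightarrow> ext_zero A n T M) \<longleftrightarrow>
    (if j = 0 then gen_res A P k M else if j = k then hom_zero A P M else carrier M = {\<zero>\<^bsub>M\<^esub>})"
  using tilting_class_zero[OF assms(1)] tilting_class_k[OF assms] tilting_class_other[OF assms, of j] by simp

theorem theorem5p6:
  fixes K :: "'k ring"
    and A :: "('k, 'a) module"
    and P :: "('a, 'p) module"
    and T :: "('a, 't) module"
    and d k :: nat
    and B :: "('k, 't \<Rightarrow> 't) module"
    and DT :: "('t \<Rightarrow> 't, 't \<Rightarrow> 'k) module"
    and I :: "('t \<Rightarrow> 't, ('p \<Rightarrow> 't) \<Rightarrow> 'k) module"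
  assumes "fd_algebra K A" and "basic_algebra A"
    and "domdim_eq A (d + 1)"
    and "maximal_proj_inj_summand A P"
    and "1 \<le> k" and "k \<le> d + 1"
    and "shifted_module A P k T"
    and "B = opp (End A T)"
    and "DT = dual K (End A T) (End_module T)"
    and "I = dual K (End A T) (Hom_End_module A P T)"
  shows "injective B I \<and> summand B I DT \<and>
    (\<forall>j. (tilting_T A T j :: ('a, 'm) module set) =
       (if j = 0 then gen A (k - 1) P
        else if j = k then ker_Hom_from A P
        else zero_mods A)) \<and>
    (\<forall>j. (tilting_C B DT j :: ('t \<Rightarrow> 't, 'n) module set) =
       (if j = 0 then cogen B (k - 1) I
        else if j = k then ker_Hom_into B I
        else zero_mods B))"
proof -
  interpret A: fd_alg K A by unfold_locales (rule assms(1))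
  have sp: "special_tilting A P k T" using assms(7) by (simp add: shifted_module_def)
  have proj: "projective A P" and T: "fg_module A T"
    using sp by (auto simp: special_tilting_def tilting_def)
  have P: "fg_module A P" using proj by (simp add: projective_def)
  interpret X: end_tilt K A T P k
    by (intro end_tilt.intro end_algebra.intro end_algebra_axioms.intro end_tilt_axioms.intro
        A.fd_alg_axioms T P A.special_tilting_special_tilt[OF sp])
  let ?E = "End A T" and ?G = "Hom_End_module A P T" and ?ET = "End_module T"
  \<comment> \<open>The second instance of the tilting locale, over E with Hom(P,T) in the role of
    P. It describes T_j of T over E, from which the C_j are read off by duality.\<close>
  interpret Y: special_tilt K ?E "copy ?E ?G" "copy ?E ?ET" k by (rule X.special_tilt_E)
  interpret O: fd_alg K "opp ?E" by (rule X.E.fd_alg_opp)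
  \<comment> \<open>\<open>gen (k - 1)\<close> and \<open>cogen (k - 1)\<close> have k terms; this
    equation matches them with \<open>gen_res\<close> of index k and is where k must be
    positive.\<close>
  have k: "0 < k" "Suc (k - 1) = k" using assms(5) by auto
  note G = X.fg_G[OF P] and ET = X.fg_ET
  have projG: "projective ?E ?G" by (rule X.E.projective_radd[OF Y.proj_P X.E.radd_copy(2)[OF G]])
  note dG = X.E.fg_dual[OF G]
  have inj: "injective B I" unfolding assms(8,10) by (rule X.E.dual_projective[OF projG])
  \<comment> \<open>As \<open>P\<close> is a retract of the algebra, Hom(P,T) is a retract of
    Hom(A,T) = T over E; duality makes \<open>I\<close> a retract of \<open>DT\<close>, and
    \<open>retract_summand\<close> supplies a complement.\<close>
  have summ: "summand B I DT"
  proof -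
    have "summand A P (regular A)" using assms(4) by (simp add: maximal_proj_inj_summand_def)
    then obtain s r where sr: "lin A P (regular A) s" "lin A (regular A) P r" "\<And>x. x \<in> carrier P \<Longrightarrow> r (s x) = x"
      by (rule summand_retract) (rule that)
    note lP = fg_moduleD[OF P] and lR = fg_moduleD[OF A.fg_regular]
    let ?s = "\<lambda>f. dmap (regular A) r f \<one>\<^bsub>A\<^esub>" and ?r = "\<lambda>t. dmap P s (\<lambda>a\<in>carrier A. a \<odot>\<^bsub>T\<^esub> t)"
    have s: "lin ?E ?G ?ET ?s" by (rule lin_comp[OF X.lin_G[OF sr(2) lR] X.G_regular(1)])
    have r: "lin ?E ?ET ?G ?r" by (rule lin_comp[OF X.G_regular(2) X.lin_G[OF sr(1) lP]])
    have rs: "?r (?s f) = f" if f: "f \<in> carrier ?G" for f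
    proof -
      have f': "f \<in> lhom A P T" using f by simp
      have rf: "dmap (regular A) r f \<in> lhom A (regular A) T" by (rule X.dmap_lhom[OF sr(2) lR f'])
      have "(\<lambda>a\<in>carrier A. a \<odot>\<^bsub>T\<^esub> dmap (regular A) r f \<one>\<^bsub>A\<^esub>) = dmap (regular A) r f"
        by (rule X.G_regular(4)) (use rf in simp)
      moreover have "dmap P s (dmap (regular A) r f) = f"
        by (rule lhom_eqI[OF X.dmap_lhom[OF sr(1) lP rf] f'])
          (use lin_closed[OF sr(1)] sr(3) in \<open>simp add: dmap_def\<close>)
      ultimately show ?thesis by (simp only:)
    qed
    have lG: "left_module ?E ?G" and lET: "left_module ?E ?ET" using fg_moduleD G ET by auto
    have s': "lin (opp ?E) I DT (dmap ?ET ?r)" unfolding assms(9,10) by (rule X.E.lin_dmap[OF r lET])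
    have r': "lin (opp ?E) DT I (dmap ?G ?s)" unfolding assms(9,10) by (rule X.E.lin_dmap[OF s lG])
    show ?thesis
      unfolding assms(8)
    proof (rule O.retract_summand[OF _ _ s' r'])
      show "fg_module (opp ?E) I" "fg_module (opp ?E) DT" unfolding assms(9,10) using dG X.E.fg_dual[OF ET] .
      fix f assume "f \<in> carrier I"
      then have f: "f \<in> carrier (dual K ?E ?G)" by (simp only: assms(10))
      show "dmap ?G ?s (dmap ?ET ?r f) = f"
        by (rule X.E.dual_eqI[OF X.E.dmap_closed[OF s lG X.E.dmap_closed[OF r lET f]] f])
          (simp only: dmap_apply[where M = ?G] dmap_apply[where M = ?ET] lin_closed[OF s] rs)
    qed
  qed
  have T_part: "(tilting_T A T j :: ('a, 'm) module set) =
       (if j = 0 then gen A (k - 1) P else if j = k then ker_Hom_from A P else zero_mods A)" for j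
  proof (rule Set.set_eqI)
    fix M :: "('a, 'm) module"
    show "M \<in> tilting_T A T j \<longleftrightarrow>
      M \<in> (if j = 0 then gen A (k - 1) P else if j = k then ker_Hom_from A P else zero_mods A)"
    proof (cases "fg_module A M")
      case True
      \<comment> \<open>The tilting locale speaks about the copy of \<open>P\<close>; isomorphic
        modules have the same additive closure.\<close>
      have "gen_res A P k (copy A M) \<longleftrightarrow> gen_res A (copy A P) k (copy A M)"
        using A.gen_res_mono[OF _ A.radd_copy(1)[OF P]] A.gen_res_mono[OF _ A.radd_copy(2)[OF P]] by blast
      then have "M \<in> gen A (k - 1) P \<longleftrightarrow> gen_res A (copy A P) k (copy A M)"
        unfolding A.gen_iff[OF proj] k(2) using True by simp
      moreover have "M \<in> ker_Hom_from A P \<longleftrightarrow> hom_zero A (copy A P) (copy A M)"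
        using A.Hom_vanishes_iff[OF fg_moduleD[OF P] fg_moduleD[OF True]] A.hom_zero_copy[OF P True] True
        by (simp add: ker_Hom_from_def)
      moreover have "M \<in> zero_mods A \<longleftrightarrow> carrier (copy A M) = {\<zero>\<^bsub>copy A M\<^esub>}"
        using A.zero_copy[OF True] True by (simp add: zero_mods_def)
      ultimately show ?thesis
        unfolding A.tilting_T_iff[OF T] X.S.tilting_class_cases[OF A.fg_copy[OF True] k(1)] using True by simp
    next
      case False
      then show ?thesis
        unfolding A.tilting_T_iff[OF T] A.gen_iff[OF proj]
        by (simp add: A.gen_iff[OF proj] ker_Hom_from_def zero_mods_def)
    qed
  qed
  \<comment> \<open>The case distinction over E is applied to D N, and every class on either side is
    rewritten as a condition on D N.\<close>
  have C_part: "(tilting_C B DT j :: ('t \<Rightarrow> 't, 'n) module set) =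
       (if j = 0 then cogen B (k - 1) I else if j = k then ker_Hom_into B I else zero_mods B)" for j
    unfolding assms(8,9,10)
  proof (rule Set.set_eqI)
    fix N :: "('t \<Rightarrow> 't, 'n) module"
    let ?B = "opp ?E" and ?I = "dual K ?E ?G"
    show "N \<in> tilting_C ?B (dual K ?E ?ET) j \<longleftrightarrow>
      N \<in> (if j = 0 then cogen ?B (k - 1) ?I else if j = k then ker_Hom_into ?B ?I else zero_mods ?B)"
    proof (cases "fg_module ?B N")
      case True
      have DN: "fg_module ?E (dual K ?B N)" using O.fg_dual[OF True] by simp
      have "N \<in> cogen ?B (k - 1) ?I \<longleftrightarrow> gen_res ?E (copy ?E ?G) k (copy ?E (dual K ?B N))"
        unfolding X.E.cogen_iff[OF projG] k(2) using True by simp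
      moreover have "N \<in> ker_Hom_into ?B ?I \<longleftrightarrow> hom_zero ?E (copy ?E ?G) (copy ?E (dual K ?B N))"
        using O.Hom_vanishes_iff[OF fg_moduleD[OF True] fg_moduleD[OF dG]] X.E.hom_zero_dual[OF fg_moduleD[OF G] fg_moduleD[OF True]]
          X.E.hom_zero_copy[OF G DN] True
        by (simp add: ker_Hom_into_def)
      moreover have "N \<in> zero_mods ?B \<longleftrightarrow> carrier (copy ?E (dual K ?B N)) = {\<zero>\<^bsub>copy ?E (dual K ?B N)\<^esub>}"
        using X.E.zero_copy[OF DN] O.zero_dual[OF True] True by (simp add: zero_mods_def)
      ultimately show ?thesis
        unfolding X.E.tilting_C_iff[OF ET] Y.tilting_class_cases[OF X.E.fg_copy[OF DN] k(1)] using True by simp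
    next
      case False
      then show ?thesis
        unfolding X.E.tilting_C_iff[OF ET]
        by (simp add: X.E.cogen_iff[OF projG] ker_Hom_into_def zero_mods_def)
    qed
  qed
  show ?thesis using inj summ T_part C_part by blast
qed

end
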